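(* Let $G$ be a graph. The cycle ideal of the cographic matroid $\mathcal{M}_G^*$ of $G$ is $\mathrm{TH}_1$-exact if and only if $\mathcal{M}_G^*$ has no minor isomorphic to $\mathcal{M}_{K_5}^*$ and no chordless cocircuit of length (cardinality) at least $5$.
   Context: Graphs are finite and simple. A binary matroid is a pair $\mathcal{M}=(E,\mathcal{C})$ with $E$ a finite set and $\mathcal{C}$ a (nonempty) collection of subsets of $E$ closed under symmetric difference $\Delta$; members of $\mathcal{C}$ are the cycles. The cocycles are the members of $\mathcal{C}^*=\{D\subseteq E : |D\cap C| \text{ even for all } C\in\mathcal{C}\}$; cocircuits are the inclusion-minimal nonempty cocycles. For a cocircuit $D$, an element $e\in E\setminus D$ is a chord of $D$ if there are $D_1,D_2\in\mathcal{C}^*$ with $D_1\cap D_2=\{e\}$ and $D=D_1\Delta D_2$; $D$ is chordless if it has no chord. For $e\in E$, the deletion $\mathcal{M}\backslash e$ has ground set $E\setminus\{e\}$ and cycles $\{C\in\mathcal{C} : e\notin C\}$; the contraction $\mathcal{M}/e$ has ground set $E\setminus\{e\}$ and cycles $\{C\setminus\{e\} : C\in\mathcal{C}\}$. A minor is obtained by a sequence of deletions and contractions. For a graph $G=(V,E)$, the cographic matroid $\mathcal{M}_G^*$ has ground set $E$ and cycles the cuts of $G$, where the cut corresponding to $S\subseteq V$ is the set of edges with exactly one endpoint in $S$; its cocycles are the sets $C\subseteq E$ such that every vertex is incident to an even number of edges of $C$. $K_5$ is the complete graph on 5 vertices. For a cycle $C$ of $\mathcal{M}$, $\chi^C\in\{\pm1\}^E$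 has $\chi^C_e=-1$ if $e\in C$ and $1$ otherwise. The cycle ideal $I\mathcal{M}\subseteq\mathbb{R}[x_e:e\in E]$ is the ideal of all polynomials vanishing at all $\chi^C$, $C\in\mathcal{C}$. For an ideal $I$ of a real polynomial ring in finitely many variables, with real variety $V_{\mathbb{R}}(I)$, a polynomial $f$ is $k$-sos modulo $I$ if $f=\sum_{i=1}^t g_i^2+h$ with $h\in I$ and polynomials $g_i$ of degree at most $k$. The $k$-th theta body $\mathrm{TH}_k(I)$ is the set of real points $\mathbf{x}$ with $f(\mathbf{x})\ge0$ for every polynomial $f$ of degree at most $1$ that is $k$-sos modulo $I$. The ideal $I$ is $\mathrm{TH}_k$-exact if $\overline{\mathrm{conv}(V_{\mathbb{R}}(I))}=\mathrm{TH}_k(I)$. *)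

theory Defs
  imports "HOL-Analysis.Analysis" "HOL-Analysis.Finite_Function_Topology"
begin

type_synonym 'e bmat = "'e set \<times> 'e set set"

abbreviation ground :: "'e bmat \<Rightarrow> 'e set" where "ground M \<equiv> fst M"
abbreviation cycles :: "'e bmat \<Rightarrow> 'e set set" where "cycles M \<equiv> snd M"

definition binary_matroid :: "'e bmat \<Rightarrow> bool" where
  "binary_matroid M \<longleftrightarrow>
     finite (ground M) \<and> cycles M \<subseteq> Pow (ground M) \<and> cycles M \<noteq> {} \<and>
     (\<forall>C\<in>cycles M. \<forall>D\<in>cycles M. sym_diff C D \<in> cycles M)"

definition cocycles :: "'e bmat \<Rightarrow> 'e set set" where
  "cocycles M = {D. D \<subseteq> ground M \<and> (\<forall>C\<in>cycles M. even (card (D \<inter> C)))}"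

definition cocircuit :: "'e bmat \<Rightarrow> 'e set \<Rightarrow> bool" where
  "cocircuit M D \<longleftrightarrow> D \<in> cocycles M \<and> D \<noteq> {} \<and>
     (\<forall>D'\<in>cocycles M. D' \<noteq> {} \<and> D' \<subseteq> D \<longrightarrow> D' = D)"

definition chord :: "'e bmat \<Rightarrow> 'e set \<Rightarrow> 'e \<Rightarrow> bool" where
  "chord M D e \<longleftrightarrow> e \<in> ground M - D \<and>
     (\<exists>D1\<in>cocycles M. \<exists>D2\<in>cocycles M. D1 \<inter> D2 = {e} \<and> D = sym_diff D1 D2)"

definition chordless :: "'e bmat \<Rightarrow> 'e set \<Rightarrow> bool" where
  "chordless M D \<longleftrightarrow> \<not> (\<exists>e. chord M D e)"

definition deletion :: "'e bmat \<Rightarrow> 'e \<Rightarrow> 'e bmat" where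
  "deletion M e = (ground M - {e}, {C \<in> cycles M. e \<notin> C})"

definition contraction :: "'e bmat \<Rightarrow> 'e \<Rightarrow> 'e bmat" where
  "contraction M e = (ground M - {e}, (\<lambda>C. C - {e}) ` cycles M)"

inductive minor :: "'e bmat \<Rightarrow> 'e bmat \<Rightarrow> bool" for M :: "'e bmat" where
  refl: "minor M M"
| delete: "minor M N \<Longrightarrow> e \<in> ground N \<Longrightarrow> minor M (deletion N e)"
| contract: "minor M N \<Longrightarrow> e \<in> ground N \<Longrightarrow> minor M (contraction N e)"

definition bmat_iso :: "'e bmat \<Rightarrow> 'f bmat \<Rightarrow> bool" where
  "bmat_iso M N \<longleftrightarrow>
     (\<exists>\<phi>. bij_betw \<phi> (ground M) (ground N) \<and> (\<lambda>C. \<phi> ` C) ` cycles M = cycles N)"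

lemma binary_matroid_deletion:
  assumes "binary_matroid M"
  shows "binary_matroid (deletion M e)"
proof -
  have "{} \<in> cycles M"
    using assms unfolding binary_matroid_def by (metis Diff_cancel Un_absorb ex_in_conv)
  with assms show ?thesis
    unfolding binary_matroid_def deletion_def by auto
qed

lemma binary_matroid_contraction:
  assumes "binary_matroid M"
  shows "binary_matroid (contraction M e)"
proof -
  have "sym_diff (C - {e}) (D - {e}) = sym_diff C D - {e}" for C D :: "'a set"
    by auto
  with assms show ?thesis
    unfolding binary_matroid_def contraction_def by auto
qed

definition simple_graph :: "'v set \<Rightarrow> 'v set set \<Rightarrow> bool" where
  "simple_graph V E \<longleftrightarrow> finite V \<and> E \<subseteq> {e. e \<subseteq> V \<and> card e = 2}"

definition cut :: "'v set set \<Rightarrow> 'v set \<Rightarrow> 'v set set" where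
  "cut E S = {e \<in> E. card (e \<inter> S) = 1}"

definition cographic :: "'v set \<Rightarrow> 'v set set \<Rightarrow> 'v set bmat" where
  "cographic V E = (E, cut E ` Pow V)"

definition K5_vertices :: "nat set" where "K5_vertices = {..<5}"

definition K5_edges :: "nat set set" where
  "K5_edges = {e. e \<subseteq> K5_vertices \<and> card e = 2}"

lemma binary_matroid_cographic:
  assumes "simple_graph V E"
  shows "binary_matroid (cographic V E)"
proof -
  have "sym_diff (cut E S) (cut E T) = cut E (sym_diff S T)" for S T
  proof -
    have "(card (e \<inter> S) = 1) \<noteq> (card (e \<inter> T) = 1) \<longleftrightarrow> card (e \<inter> sym_diff S T) = 1"
      if "e \<in> E" for e
    proof -
      from that assms have "card e = 2" by (auto simp: simple_graph_def)
      then obtain u v where "e = {u, v}" "u \<noteq> v" by (auto simp: card_2_iff)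
      then show ?thesis
        by (cases "u \<in> S"; cases "v \<in> S"; cases "u \<in> T"; cases "v \<in> T")
          (auto simp: Int_insert_left)
    qed
    then show ?thesis unfolding cut_def by blast
  qed
  moreover have "finite E"
    using assms unfolding simple_graph_def
    by (metis (no_types, lifting) finite_Pow_iff finite_subset mem_Collect_eq PowI subset_iff)
  ultimately show ?thesis
    unfolding binary_matroid_def cographic_def by (auto simp: cut_def)
qed

text \<open>
  A monomial is its exponent vector and a polynomial is its coefficient function, both
  finitely supported. The elements of \<open>\<real>[x\<^sub>e : e \<in> E]\<close> are the polynomials whose
  variables lie in \<open>E\<close>, and \<open>\<real>\<^sup>E\<close> consists of the finitely supported
  functions that vanish outside \<open>E\<close>, with the vector space structure and norm (the sum of
  the absolute values of the entries) from \<^theory>\<open>HOL-Analysis.Finite_Function_Topology\<close>.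
  For finite \<open>E\<close>, \<open>\<real>\<^sup>E\<close> is a closed subspace carrying the usual topology, so taking
  closures in the whole type is the same as taking them in \<open>\<real>\<^sup>E\<close>.
\<close>

type_synonym 'e mpoly = "('e \<Rightarrow>\<^sub>0 nat) \<Rightarrow>\<^sub>0 real"
type_synonym 'e point = "'e \<Rightarrow>\<^sub>0 real"

definition vars :: "'e mpoly \<Rightarrow> 'e set" where
  "vars p = (\<Union>m\<in>Poly_Mapping.keys p. Poly_Mapping.keys m)"

definition poly_ring :: "'e set \<Rightarrow> 'e mpoly set" where
  "poly_ring E = {p. vars p \<subseteq> E}"

definition real_space :: "'e set \<Rightarrow> 'e point set" where
  "real_space E = {x. Poly_Mapping.keys x \<subseteq> E}"

definition peval :: "'e point \<Rightarrow> 'e mpoly \<Rightarrow> real" where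
  "peval x p = (\<Sum>m\<in>Poly_Mapping.keys p. Poly_Mapping.lookup p m *
     (\<Prod>e\<in>Poly_Mapping.keys m. Poly_Mapping.lookup x e ^ Poly_Mapping.lookup m e))"

definition degree_le :: "'e mpoly \<Rightarrow> nat \<Rightarrow> bool" where
  "degree_le p k \<longleftrightarrow>
     (\<forall>m\<in>Poly_Mapping.keys p. (\<Sum>e\<in>Poly_Mapping.keys m. Poly_Mapping.lookup m e) \<le> k)"

definition real_variety :: "'e set \<Rightarrow> 'e mpoly set \<Rightarrow> 'e point set" where
  "real_variety E I = {x \<in> real_space E. \<forall>p\<in>I. peval x p = 0}"

definition sos_mod :: "'e set \<Rightarrow> nat \<Rightarrow> 'e mpoly set \<Rightarrow> 'e mpoly \<Rightarrow> bool" where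
  "sos_mod E k I f \<longleftrightarrow>
     (\<exists>(t::nat) g h. (\<forall>i<t. g i \<in> poly_ring E \<and> degree_le (g i) k) \<and> h \<in> I \<and>
        f = (\<Sum>i<t. (g i)\<^sup>2) + h)"

definition theta_body :: "'e set \<Rightarrow> nat \<Rightarrow> 'e mpoly set \<Rightarrow> 'e point set" where
  "theta_body E k I = {x \<in> real_space E.
     \<forall>f\<in>poly_ring E. degree_le f 1 \<and> sos_mod E k I f \<longrightarrow> peval x f \<ge> 0}"

definition theta_exact :: "'e set \<Rightarrow> nat \<Rightarrow> 'e mpoly set \<Rightarrow> bool" where
  "theta_exact E k I \<longleftrightarrow> closure (convex hull (real_variety E I)) = theta_body E k I"

definition sign_vector :: "'e set \<Rightarrow> 'e set \<Rightarrow> 'e point" where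
  "sign_vector E C = (\<Sum>e\<in>E. Poly_Mapping.single e (if e \<in> C then - 1 else 1))"

lemma lookup_sign_vector:
  assumes "finite E"
  shows "Poly_Mapping.lookup (sign_vector E C) e = (if e \<in> E then if e \<in> C then - 1 else 1 else 0)"
  using assms by (simp add: sign_vector_def lookup_sum lookup_single when_def)

definition cycle_ideal :: "'e bmat \<Rightarrow> 'e mpoly set" where
  "cycle_ideal M = {p \<in> poly_ring (ground M).
     \<forall>C\<in>cycles M. peval (sign_vector (ground M) C) p = 0}"

end

theory Submission
  imports Defs "HOL-Probability.Probability_Mass_Function"
begin

text \<open>
  In the cographic matroid, a minor isomorphic to that of \<open>K\<^sub>5\<close> amounts to five disjoint connected vertex
  sets that touch pairwise, and a chordless cocircuit of length at least 5 to five such sets that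
  touch in the pattern of a pentagon. Given such blocks, the points of a facet of the cut polytope
  of \<open>K\<^sub>5\<close> or of the pentagon lift to cuts of the graph, and a functional that is nonnegative on
  squares of affine functions but violates the facet inequality shows that the first theta body is
  too large.

  Conversely, let \<open>x\<close> be in the theta body and \<open>d\<^sub>e = (1 - x\<^sub>e) / 2\<close>. The inequalities
  \<open>d(D - F) + (1 - d)(F) \<ge> 1\<close> for cocycles \<open>D\<close> and odd \<open>F \<subseteq> D\<close> take only two values on
  cuts if \<open>D\<close> has at most 4 elements, hence are 1-sos, and splitting along chords gives them for all
  \<open>D\<close>. By a shortest path argument on signed vertices, \<open>d\<close> extends to a function on all pairs of
  vertices that satisfies every triangle inequality. It remains to write such functions as mixtures
  of cut metrics on the edges. This is stable under sums over cliques of size at most 3, and a graph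
  without the two block patterns on more than 4 vertices is the octahedron or has a
  separator of size at most 3 that can be made a clique without creating one of the patterns.
\<close>

section \<open>Connected blocks\<close>

text \<open>The bound 3 on separators comes from probability. The cut that a random vertex set
  induces on three vertices is determined in law by the three separation probabilities, so two cut
  mixtures that agree on a triangle can be coupled; on four vertices there are seven nontrivial cuts
  for six pairs, and this fails. Gluing needs values on pairs of the separator that are not edges,
  which is why \<open>d\<close> is first extended to all pairs and only then restricted to edges
  again. The obstacle is that the class is closed only under deleting vertices and contracting
  connected sets: adding or removing an edge may create one of the patterns. Hence each missing edge
  of a separator has to be produced by contracting a part on the far side into a separator vertex,
  and most of the graph theory looks for separators with enough room for that. The octahedron has no
  separator of size at most 3; its 8 triangles and 3 four-cycles are fewer than its 12 edges, so
  every extreme point of the relaxation has a coordinate 0 or 1, which allows a contraction.\<close>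

definition conn :: "('a \<Rightarrow> 'a \<Rightarrow> bool) \<Rightarrow> 'a set \<Rightarrow> bool" where
  "conn adj X \<longleftrightarrow> X \<noteq> {} \<and> (\<forall>Y. Y \<subseteq> X \<longrightarrow> Y \<noteq> {} \<longrightarrow> Y \<noteq> X \<longrightarrow> (\<exists>y\<in>Y. \<exists>z\<in>X - Y. adj y z))"

definition touch :: "('a \<Rightarrow> 'a \<Rightarrow> bool) \<Rightarrow> 'a set \<Rightarrow> 'a set \<Rightarrow> bool" where
  "touch adj X Y \<longleftrightarrow> (\<exists>x\<in>X. \<exists>y\<in>Y. adj x y)"

definition K5_model :: "'a set \<Rightarrow> ('a \<Rightarrow> 'a \<Rightarrow> bool) \<Rightarrow> (nat \<Rightarrow> 'a set) \<Rightarrow> bool" where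
  "K5_model V adj X \<longleftrightarrow> (\<forall>i<5. conn adj (X i) \<and> X i \<subseteq> V) \<and>
     (\<forall>i<5. \<forall>j<5. i \<noteq> j \<longrightarrow> X i \<inter> X j = {} \<and> touch adj (X i) (X j))"

text \<open>A pentagon as an induced minor: nonconsecutive blocks must not touch, while the vertices
  outside all blocks count as deleted.\<close>

definition C5_model :: "'a set \<Rightarrow> ('a \<Rightarrow> 'a \<Rightarrow> bool) \<Rightarrow> (nat \<Rightarrow> 'a set) \<Rightarrow> bool" where
  "C5_model V adj X \<longleftrightarrow> (\<forall>i<5. conn adj (X i) \<and> X i \<subseteq> V) \<and>
     (\<forall>i<5. \<forall>j<5. i \<noteq> j \<longrightarrow> X i \<inter> X j = {} \<and>
        (touch adj (X i) (X j) \<longleftrightarrow> j = (i + 1) mod 5 \<or> i = (j + 1) mod 5))"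

definition no_C5 :: "'a set \<Rightarrow> ('a \<Rightarrow> 'a \<Rightarrow> bool) \<Rightarrow> bool" where
  "no_C5 V adj \<longleftrightarrow> \<not> (\<exists>X. C5_model V adj X)"

definition no_K5 :: "'a set \<Rightarrow> ('a \<Rightarrow> 'a \<Rightarrow> bool) \<Rightarrow> bool" where
  "no_K5 V adj \<longleftrightarrow> \<not> (\<exists>X. K5_model V adj X)"

lemma touch_sym: "symp adj \<Longrightarrow> touch adj X Y \<longleftrightarrow> touch adj Y X"
  unfolding touch_def by (metis sympD)

lemma touch_simps [simp]:
  "touch adj (X \<union> Y) Z \<longleftrightarrow> touch adj X Z \<or> touch adj Y Z"
  "touch adj Z (X \<union> Y) \<longleftrightarrow> touch adj Z X \<or> touch adj Z Y"
  "touch adj (insert x Y) Z \<longleftrightarrow> (\<exists>z\<in>Z. adj x z) \<or> touch adj Y Z"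
  "touch adj Z (insert y Y) \<longleftrightarrow> (\<exists>z\<in>Z. adj z y) \<or> touch adj Z Y"
  "\<not> touch adj {} Z" "\<not> touch adj Z {}"
  unfolding touch_def by auto

lemma touchI: "x \<in> X \<Longrightarrow> y \<in> Y \<Longrightarrow> adj x y \<Longrightarrow> touch adj X Y"
  by (auto simp: touch_def)

lemma conn_ne: "conn adj X \<Longrightarrow> X \<noteq> {}"
  by (simp add: conn_def)

lemma conn_sing [simp]: "conn adj {x}"
  by (auto simp: conn_def)

lemma connD:
  "conn adj X \<Longrightarrow> Y \<subseteq> X \<Longrightarrow> Y \<noteq> {} \<Longrightarrow> Y \<noteq> X \<Longrightarrow> \<exists>y\<in>Y. \<exists>z\<in>X - Y. adj y z"
  by (simp add: conn_def)

text \<open>Connectivity is defined by subsets without leaving edges, so this plays the role of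
  induction along a path everywhere below.\<close>

lemma conn_closed:
  assumes "conn adj X" "X \<inter> D \<noteq> {}" "\<And>x y. x \<in> D \<inter> X \<Longrightarrow> y \<in> X - D \<Longrightarrow> \<not> adj x y"
  shows "X \<subseteq> D"
  using connD[OF assms(1), of "X \<inter> D"] assms(2,3) by blast

text \<open>For a symmetric relation the complement of a set without leaving edges has none either,
  so only sets through a chosen base point are tested.\<close>

lemma connI_closed:
  assumes "x0 \<in> X" "symp adj"
    and "\<And>Y. Y \<subseteq> X \<Longrightarrow> x0 \<in> Y \<Longrightarrow> (\<And>y z. y \<in> Y \<Longrightarrow> z \<in> X - Y \<Longrightarrow> \<not> adj y z) \<Longrightarrow> Y = X"
  shows "conn adj X"
proof -
  have "\<exists>y\<in>Y. \<exists>z\<in>X - Y. adj y z" if Y: "Y \<subseteq> X" "Y \<noteq> {}" "Y \<noteq> X" for Y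
  proof (rule ccontr)
    assume n: "\<not> ?thesis"
    show False
    proof (cases "x0 \<in> Y")
      case True
      then show False using assms(3)[of Y] n Y by blast
    next
      case False
      have "X - Y = X"
        by (rule assms(3)) (use n False assms(1) sympD[OF assms(2)] in blast)+
      then show False using Y by blast
    qed
  qed
  then show ?thesis using assms(1) by (auto simp: conn_def)
qed

lemma conn_Un:
  assumes "symp adj" "conn adj X" "conn adj Y" "X \<inter> Y \<noteq> {} \<or> touch adj X Y"
  shows "conn adj (X \<union> Y)"
proof -
  obtain x0 where x0: "x0 \<in> X" using conn_ne[OF assms(2)] by blast
  show ?thesis
  proof (rule connI_closed[of x0])
    fix Z assume Z: "Z \<subseteq> X \<union> Y" "x0 \<in> Z" "\<And>y z. y \<in> Z \<Longrightarrow> z \<in> X \<union> Y - Z \<Longrightarrow> \<not> adj y z"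
    have X: "X \<subseteq> Z" using conn_closed[OF assms(2), of Z] Z x0 by blast
    have "Y \<inter> Z \<noteq> {}" using assms(4) X Z(3) unfolding touch_def by blast
    then have "Y \<subseteq> Z" using conn_closed[OF assms(3), of Z] Z by blast
    then show "Z = X \<union> Y" using X Z by blast
  qed (use x0 assms in auto)
qed

lemma conn_insert:
  assumes "symp adj" "conn adj X" "touch adj {x} X \<or> touch adj X {x} \<or> x \<in> X"
  shows "conn adj (insert x X)"
  using conn_Un[OF assms(1) conn_sing assms(2), of x] assms(3) sympD[OF assms(1)] by (auto simp: touch_def)

lemma conn_edge:
  assumes "symp adj" "adj x y"
  shows "conn adj {x, y}"
  using conn_insert[OF assms(1) conn_sing[of adj y], of x] assms(2) by simp

lemma conn_UN:
  assumes "symp adj" "conn adj' X" "\<And>v. v \<in> X \<Longrightarrow> conn adj (\<phi> v)"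
    and "\<And>u v. u \<in> X \<Longrightarrow> v \<in> X \<Longrightarrow> u \<noteq> v \<Longrightarrow> adj' u v \<Longrightarrow> touch adj (\<phi> u) (\<phi> v)"
  shows "conn adj (\<Union>v\<in>X. \<phi> v)"
proof -
  obtain v0 where v0: "v0 \<in> X" using conn_ne[OF assms(2)] by blast
  obtain x0 where x0: "x0 \<in> \<phi> v0" using conn_ne[OF assms(3)[OF v0]] by blast
  show ?thesis
  proof (rule connI_closed[of x0])
    fix Z assume Z: "Z \<subseteq> \<Union> (\<phi> ` X)" "x0 \<in> Z"
      "\<And>y z. y \<in> Z \<Longrightarrow> z \<in> \<Union> (\<phi> ` X) - Z \<Longrightarrow> \<not> adj y z"
    have full: "\<phi> v \<subseteq> Z" if "v \<in> X" "\<phi> v \<inter> Z \<noteq> {}" for v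
      using conn_closed[OF assms(3)[OF that(1)], of Z] that Z(3) by blast
    have "X \<subseteq> {v\<in>X. \<phi> v \<subseteq> Z}"
    proof (rule conn_closed[OF assms(2)])
      show "X \<inter> {v \<in> X. \<phi> v \<subseteq> Z} \<noteq> {}" using full[OF v0] v0 x0 Z by blast
      fix u v assume u: "u \<in> {v \<in> X. \<phi> v \<subseteq> Z} \<inter> X" and v: "v \<in> X - {v \<in> X. \<phi> v \<subseteq> Z}"
      show "\<not> adj' u v"
      proof
        assume "adj' u v"
        then have "touch adj (\<phi> u) (\<phi> v)" using assms(4) u v by blast
        then obtain x y where xy: "x \<in> \<phi> u" "y \<in> \<phi> v" "adj x y" by (auto simp: touch_def)
        have "y \<in> Z" using Z(3)[of x y] xy u v by blast
        then show False using full[of v] v xy by blast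
      qed
    qed
    then show "Z = \<Union> (\<phi> ` X)" using Z(1) by blast
  qed (use v0 x0 assms in auto)
qed

definition component :: "('a \<Rightarrow> 'a \<Rightarrow> bool) \<Rightarrow> 'a set \<Rightarrow> 'a \<Rightarrow> 'a set" where
  "component adj W x = \<Union> {X. conn adj X \<and> X \<subseteq> W \<and> x \<in> X}"

lemma component:
  assumes "symp adj" "x \<in> W"
  shows "x \<in> component adj W x" "component adj W x \<subseteq> W" "conn adj (component adj W x)"
    "\<And>y z. y \<in> component adj W x \<Longrightarrow> z \<in> W - component adj W x \<Longrightarrow> \<not> adj y z"
proof -
  let ?C = "component adj W x"
  show x: "x \<in> ?C" unfolding component_def using assms(2) by (intro UnionI[of "{x}"]) auto
  show sub: "?C \<subseteq> W" by (auto simp: component_def)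
  show con: "conn adj ?C"
  proof (rule connI_closed[of x])
    fix Y assume Y: "Y \<subseteq> ?C" "x \<in> Y" "\<And>y z. y \<in> Y \<Longrightarrow> z \<in> ?C - Y \<Longrightarrow> \<not> adj y z"
    have "X \<subseteq> Y" if X: "conn adj X" "X \<subseteq> W" "x \<in> X" for X
    proof -
      have "X \<subseteq> ?C" using X by (auto simp: component_def)
      then show ?thesis using conn_closed[OF X(1), of Y] X Y by blast
    qed
    then have "?C \<subseteq> Y" by (auto simp: component_def)
    then show "Y = ?C" using Y(1) by blast
  qed (use x assms in auto)
  fix y z assume yz: "y \<in> ?C" "z \<in> W - ?C"
  show "\<not> adj y z"
  proof
    assume "adj y z"
    then have "conn adj (insert z ?C)"
      using conn_insert[OF assms(1) con, of z] yz by (auto simp: touch_def)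
    then have "insert z ?C \<subseteq> ?C" using yz sub x unfolding component_def by blast
    then show False using yz by blast
  qed
qed

text \<open>A largest connected proper subset containing \<open>x\<close> has a neighbour in
  \<open>X\<close>. Adding that neighbour must give all of \<open>X\<close>, so it is a removable
  vertex. Minimality arguments below peel off such vertices.\<close>

lemma exists_noncut:
  assumes "symp adj" "finite X" "conn adj X" "x \<in> X" "X \<noteq> {x}"
  obtains z where "z \<in> X" "z \<noteq> x" "conn adj (X - {z})"
proof -
  let ?P = "\<lambda>Y. conn adj Y \<and> x \<in> Y \<and> Y \<subset> X"
  have "?P {x}" using assms by auto
  moreover have "\<forall>Y. ?P Y \<longrightarrow> card Y < card X"
    using assms(2) by (auto intro: psubset_card_mono)
  ultimately obtain Y where Y: "?P Y" and mx: "\<And>Z. ?P Z \<Longrightarrow> card Z \<le> card Y"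
    using ex_has_greatest_nat[of ?P "{x}" card "card X"] by blast
  obtain y z where yz: "y \<in> Y" "z \<in> X - Y" "adj y z"
    using connD[OF assms(3), of Y] Y by blast
  have c: "conn adj (insert z Y)"
    using conn_insert[OF assms(1), of Y z] Y yz by (auto simp: touch_def)
  have "finite Y" using Y assms(2) finite_subset by blast
  have "insert z Y = X"
  proof (rule ccontr)
    assume "insert z Y \<noteq> X"
    then have "card (insert z Y) \<le> card Y" using mx[of "insert z Y"] c Y yz by blast
    then show False using \<open>finite Y\<close> yz by simp
  qed
  then have "X - {z} = Y" using yz by blast
  then show ?thesis using that[of z] yz Y by blast
qed

lemma link:
  assumes "symp adj" "conn adj X" "s \<in> X" "t \<in> X" "s \<noteq> t" "\<not> adj s t"
  obtains C where "conn adj C" "C \<subseteq> X - {s, t}" "touch adj {s} C" "touch adj {t} C"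
proof -
  let ?W = "X - {s, t}"
  \<comment> \<open>If no component of the rest touches both ends, then \<open>s\<close> with the
    components touching it has no edge leaving it inside \<open>X\<close>, yet it misses
    \<open>t\<close>.\<close>
  define Y where "Y = insert s {x\<in>?W. touch adj {s} (component adj ?W x)}"
  have "\<exists>x\<in>?W. touch adj {s} (component adj ?W x) \<and> touch adj {t} (component adj ?W x)"
  proof (rule ccontr)
    assume n: "\<not> ?thesis"
    have "Y \<subseteq> X" "Y \<noteq> {}" "t \<notin> Y" using assms by (auto simp: Y_def)
    then obtain y z where yz: "y \<in> Y" "z \<in> X - Y" "adj y z"
      using connD[OF assms(2), of Y] assms(4) by blast
    show False
    proof (cases "y = s")
      case True
      then have "z \<in> ?W" using yz assms(6) by (auto simp: Y_def)
      then have "z \<in> Y" using component(1)[OF assms(1), of z ?W] yz(3) True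
        by (auto simp: Y_def touch_def)
      then show False using yz by blast
    next
      case False
      then have y: "y \<in> ?W" "touch adj {s} (component adj ?W y)" using yz by (auto simp: Y_def)
      show False
      proof (cases "z = t")
        case True
        have "touch adj {t} (component adj ?W y)"
          using component(1)[OF assms(1) y(1)] yz(3) True sympD[OF assms(1)] by (auto simp: touch_def)
        then show False using n y by blast
      next
        case False
        have z: "z \<in> ?W" using yz False by (auto simp: Y_def)
        then have zc: "z \<in> component adj ?W y"
          using component(4)[OF assms(1) y(1) component(1)[OF assms(1) y(1)], of z] yz(3) by blast
        have "component adj ?W y \<subseteq> component adj ?W z"
          using component(2,3)[OF assms(1) y(1)] zc unfolding component_def[of adj ?W z] by blast
        then have "touch adj {s} (component adj ?W z)" using y by (auto simp: touch_def)
        then show False using z yz(2) by (auto simp: Y_def)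
      qed
    qed
  qed
  then obtain x where x: "x \<in> ?W" "touch adj {s} (component adj ?W x)" "touch adj {t} (component adj ?W x)"
    by blast
  show ?thesis
    using that[OF component(3)[OF assms(1) x(1)] component(2)[OF assms(1) x(1)]] x(2,3) by blast
qed

lemma split_conn:
  assumes "symp adj" "conn adj X" "s \<in> X" "t \<in> X" "s \<noteq> t"
  obtains A B where "conn adj A" "conn adj B" "A \<inter> B = {}" "A \<union> B \<subseteq> X" "s \<in> A" "t \<in> B" "touch adj A B"
proof (cases "adj s t")
  case True
  then show ?thesis using that[of "{s}" "{t}"] assms by auto
next
  case False
  then obtain C where C: "conn adj C" "C \<subseteq> X - {s, t}" "touch adj {s} C" "touch adj {t} C"
    using link[OF assms] by blast
  show ?thesis
    using that[of "{s}" "insert t C"] C assms conn_insert[OF assms(1) C(1), of t]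
    by (auto simp: touch_def)
qed

text \<open>In a smallest connected set with two vertices of \<open>N\<close>, the link between
  these avoids \<open>N\<close>: a further vertex of \<open>N\<close> on the link would, together
  with \<open>s\<close> and the link, give a smaller such set.\<close>

lemma link_independent:
  assumes "symp adj" "finite X" "conn adj X" "s \<in> X \<inter> N" "t \<in> X \<inter> N" "s \<noteq> t"
    and ind: "\<And>x y. x \<in> N \<Longrightarrow> y \<in> N \<Longrightarrow> \<not> adj x y"
  obtains s t C where "s \<in> X \<inter> N" "t \<in> X \<inter> N" "s \<noteq> t" "conn adj C" "C \<subseteq> X - N"
    "touch adj {s} C" "touch adj {t} C"
proof -
  let ?P = "\<lambda>Y. conn adj Y \<and> Y \<subseteq> X \<and> (\<exists>s t. s \<in> Y \<inter> N \<and> t \<in> Y \<inter> N \<and> s \<noteq> t)"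
  have "?P X" using assms by blast
  then obtain Y where Y: "?P Y" and mn: "\<And>Z. ?P Z \<Longrightarrow> card Y \<le> card Z"
    using ex_has_least_nat[of ?P X card] by blast
  then obtain s t where st: "s \<in> Y \<inter> N" "t \<in> Y \<inter> N" "s \<noteq> t" by blast
  obtain C where C: "conn adj C" "C \<subseteq> Y - {s, t}" "touch adj {s} C" "touch adj {t} C"
    using link[OF assms(1), of Y s t] Y st ind by blast
  have "C \<inter> N = {}"
  proof (rule ccontr)
    assume "C \<inter> N \<noteq> {}"
    then obtain n where n: "n \<in> C" "n \<in> N" by blast
    have "?P (insert s C)"
      using conn_insert[OF assms(1) C(1), of s] C n st Y by blast
    then have "card Y \<le> card (insert s C)" by (rule mn)
    moreover have "insert s C \<subset> Y" using C st by blast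
    ultimately show False
      using psubset_card_mono[of Y "insert s C"] finite_subset[OF _ assms(2)] Y by (meson leD)
  qed
  then show ?thesis using that[of s t C] C st Y by blast
qed

lemma all_less_5: "(\<forall>i<5::nat. P i) \<longleftrightarrow> P 0 \<and> P 1 \<and> P 2 \<and> P 3 \<and> P 4"
  by (simp add: eval_nat_numeral All_less_Suc conj_ac)

lemma K5_False:
  assumes "no_K5 V adj" "symp adj"
    and "conn adj A" "conn adj B" "conn adj C" "conn adj D" "conn adj E"
    and "A \<union> B \<union> C \<union> D \<union> E \<subseteq> V"
    and "A \<inter> (B \<union> C \<union> D \<union> E) = {}" "B \<inter> (C \<union> D \<union> E) = {}" "C \<inter> (D \<union> E) = {}" "D \<inter> E = {}"
    and "touch adj A B" "touch adj A C" "touch adj A D" "touch adj A E"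
    and "touch adj B C" "touch adj B D" "touch adj B E"
    and "touch adj C D" "touch adj C E" "touch adj D E"
  shows False
proof -
  have "K5_model V adj (\<lambda>i. [A, B, C, D, E] ! i)"
    unfolding K5_model_def all_less_5 using assms(3-) touch_sym[OF assms(2)] by auto
  then show False using assms(1) by (auto simp: no_K5_def)
qed

lemma C5_False:
  assumes "no_C5 V adj" "symp adj"
    and "conn adj A" "conn adj B" "conn adj C" "conn adj D" "conn adj E"
    and "A \<union> B \<union> C \<union> D \<union> E \<subseteq> V"
    and "A \<inter> (B \<union> C \<union> D \<union> E) = {}" "B \<inter> (C \<union> D \<union> E) = {}" "C \<inter> (D \<union> E) = {}" "D \<inter> E = {}"
    and "touch adj A B" "\<not> touch adj A C" "\<not> touch adj A D" "touch adj A E"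
    and "touch adj B C" "\<not> touch adj B D" "\<not> touch adj B E"
    and "touch adj C D" "\<not> touch adj C E" "touch adj D E"
  shows False
proof -
  have "C5_model V adj (\<lambda>i. [A, B, C, D, E] ! i)"
    unfolding C5_model_def all_less_5 using assms(3-) touch_sym[OF assms(2)] by auto
  then show False using assms(1) by (auto simp: no_C5_def)
qed

text \<open>Take a smallest connected subset of \<open>X\<close> touching \<open>s\<close> and
  \<open>t\<close>. Without a common neighbour it has more than one vertex, and peeling off a vertex
  \<open>z\<close> leaves a rest that \<open>t\<close> no longer touches. Then \<open>A\<close>,
  \<open>s\<close>, the rest, \<open>z\<close>, \<open>t\<close> form a pentagon.\<close>

lemma common_neighbour:
  assumes "no_C5 V adj" "symp adj" "finite X" "conn adj X" "conn adj A"
    and "A \<union> X \<union> {s, t} \<subseteq> V" "A \<inter> X = {}" "{s, t} \<inter> (A \<union> X) = {}" "s \<noteq> t"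
    and "\<not> touch adj A X" "\<not> adj s t"
    and "touch adj {s} A" "touch adj {t} A" "touch adj {s} X" "touch adj {t} X"
  shows "\<exists>x\<in>X. adj s x \<and> adj t x"
proof (rule ccontr)
  assume "\<not> ?thesis"
  then have nc: "\<not> (adj s x \<and> adj t x)" if "x \<in> X" for x using that by blast
  let ?P = "\<lambda>Y. conn adj Y \<and> Y \<subseteq> X \<and> touch adj {s} Y \<and> touch adj {t} Y"
  have "?P X" using assms by blast
  then obtain Y where Y: "?P Y" and mn: "\<And>Z. ?P Z \<Longrightarrow> card Y \<le> card Z"
    using ex_has_least_nat[of ?P X card] by blast
  have fY: "finite Y" using Y assms(3) finite_subset by blast
  obtain p where p: "p \<in> Y" "adj s p" using Y by (auto simp: touch_def)
  have "Y \<noteq> {p}" using Y nc p by (auto simp: touch_def)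
  then obtain z where z: "z \<in> Y" "z \<noteq> p" "conn adj (Y - {z})"
    using exists_noncut[OF assms(2) fY, of p] Y p by blast
  have "\<not> ?P (Y - {z})"
  proof
    assume "?P (Y - {z})"
    then have "card Y \<le> card (Y - {z})" by (rule mn)
    then show False using fY z by (metis card_Diff1_less leD)
  qed
  then have tz: "\<not> touch adj {t} (Y - {z})" using z p Y by (auto simp: touch_def)
  then have tz': "adj t z" using Y by (auto simp: touch_def)
  have sz: "\<not> adj s z" using nc z Y tz' by blast
  have sYz: "touch adj {s} (Y - {z})" using p z by (auto simp: touch_def)
  have "\<exists>y\<in>Y - {z}. \<exists>w\<in>Y - (Y - {z}). adj y w" using connD[of adj Y "Y - {z}"] Y p z by blast
  then have Yz: "touch adj (Y - {z}) {z}" by (auto simp: touch_def)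
  have sub: "Y - {z} \<subseteq> X" "z \<in> X" using Y z by auto
  note sy = touch_sym[OF assms(2)]
  show False
  proof (rule C5_False[OF assms(1,2), of A "{s}" "Y - {z}" "{z}" "{t}"])
    show "\<not> touch adj A (Y - {z})" "\<not> touch adj A {z}"
      using assms(10) sub by (auto simp: touch_def)
    show "\<not> touch adj (Y - {z}) {t}" using tz sy by blast
    show "touch adj A {s}" "touch adj A {t}" "touch adj {s} (Y - {z})" using assms sYz sy by blast+
    show "\<not> touch adj {s} {z}" "\<not> touch adj {s} {t}" "touch adj {z} {t}"
      using sz assms tz' sympD[OF assms(2)] by auto
    show "A \<union> {s} \<union> (Y - {z}) \<union> {z} \<union> {t} \<subseteq> V" using assms(6) sub by auto
    show "A \<inter> ({s} \<union> (Y - {z}) \<union> {z} \<union> {t}) = {}" using assms(7,8) sub by auto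
    show "{s} \<inter> (Y - {z} \<union> {z} \<union> {t}) = {}" using assms(8,9) sub by auto
    show "(Y - {z}) \<inter> ({z} \<union> {t}) = {}" using assms(8) sub by auto
    show "{z} \<inter> {t} = {}" using assms(8) sub by auto
  qed (use assms z Yz in auto)
qed

section \<open>Cut mixtures and clique sums\<close>

definition cls :: "'a set \<Rightarrow> ('a \<Rightarrow> 'a \<Rightarrow> bool) \<Rightarrow> bool" where
  "cls V adj \<longleftrightarrow> no_K5 V adj \<and> no_C5 V adj"

text \<open>Both patterns pull back along a contraction: replacing each vertex by its connected set
  keeps blocks connected and disjoint and preserves touching in both directions.\<close>

lemma cls_minor:
  assumes "cls V adj" "symp adj"
    and \<phi>: "\<And>v. v \<in> V' \<Longrightarrow> conn adj (\<phi> v)" "\<And>v. v \<in> V' \<Longrightarrow> \<phi> v \<subseteq> V"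
    and dis: "\<And>u v. u \<in> V' \<Longrightarrow> v \<in> V' \<Longrightarrow> u \<noteq> v \<Longrightarrow> \<phi> u \<inter> \<phi> v = {}"
    and adj': "\<And>u v. u \<in> V' \<Longrightarrow> v \<in> V' \<Longrightarrow> u \<noteq> v \<Longrightarrow> adj' u v \<longleftrightarrow> touch adj (\<phi> u) (\<phi> v)"
  shows "cls V' adj'"
proof -
  define \<Phi> where "\<Phi> X = (\<Union>v\<in>X. \<phi> v)" for X
  have con: "conn adj (\<Phi> X)" if "conn adj' X" "X \<subseteq> V'" for X
    unfolding \<Phi>_def using conn_UN[OF assms(2) that(1), of \<phi>] \<phi> adj' that by (metis subsetD)
  have sub: "\<Phi> X \<subseteq> V" if "X \<subseteq> V'" for X using that \<phi> by (force simp: \<Phi>_def)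
  have disj: "\<Phi> X \<inter> \<Phi> Y = {}" if "X \<subseteq> V'" "Y \<subseteq> V'" "X \<inter> Y = {}" for X Y
  proof -
    have "\<phi> u \<inter> \<phi> v = {}" if "u \<in> X" "v \<in> Y" for u v
      using dis[of u v] that \<open>X \<subseteq> V'\<close> \<open>Y \<subseteq> V'\<close> \<open>X \<inter> Y = {}\<close> by blast
    then show ?thesis by (auto simp: \<Phi>_def)
  qed
  have tou: "touch adj (\<Phi> X) (\<Phi> Y) \<longleftrightarrow> touch adj' X Y" if "X \<subseteq> V'" "Y \<subseteq> V'" "X \<inter> Y = {}" for X Y
  proof -
    have "adj' u v \<longleftrightarrow> touch adj (\<phi> u) (\<phi> v)" if "u \<in> X" "v \<in> Y" for u v
      using adj'[of u v] that \<open>X \<subseteq> V'\<close> \<open>Y \<subseteq> V'\<close> \<open>X \<inter> Y = {}\<close> by blast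
    then show ?thesis unfolding \<Phi>_def touch_def by blast
  qed
  have "K5_model V adj (\<lambda>i. \<Phi> (X i))" if "K5_model V' adj' X" for X
    using that unfolding K5_model_def by (auto simp: con sub disj tou)
  moreover have "C5_model V adj (\<lambda>i. \<Phi> (X i))" if "C5_model V' adj' X" for X
    using that unfolding C5_model_def by (auto simp: con sub disj tou)
  ultimately show ?thesis using assms(1) unfolding cls_def no_K5_def no_C5_def by blast
qed

lemma cls_induced:
  assumes "cls V adj" "symp adj" "V' \<subseteq> V"
    and "\<And>u v. u \<in> V' \<Longrightarrow> v \<in> V' \<Longrightarrow> u \<noteq> v \<Longrightarrow> adj' u v \<longleftrightarrow> adj u v"
  shows "cls V' adj'"
  by (rule cls_minor[OF assms(1,2), of V' "\<lambda>v. {v}"]) (use assms in auto)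

lemma cls_contract:
  assumes "cls V adj" "symp adj" "V' \<subseteq> V" "D \<subseteq> V - V'" "conn adj D" "s \<in> V'" "touch adj {s} D"
    and "\<And>u v. u \<in> V' \<Longrightarrow> v \<in> V' \<Longrightarrow> u \<noteq> v \<Longrightarrow>
      adj' u v \<longleftrightarrow> adj u v \<or> u = s \<and> touch adj {v} D \<or> v = s \<and> touch adj {u} D"
  shows "cls V' adj'"
proof (rule cls_minor[OF assms(1,2), of V' "\<lambda>v. {v} \<union> (if v = s then D else {})"])
  fix v assume v: "v \<in> V'"
  show "conn adj ({v} \<union> (if v = s then D else {}))"
    using conn_Un[OF assms(2) conn_sing assms(5), of s] assms(7) by auto
  show "{v} \<union> (if v = s then D else {}) \<subseteq> V" using v assms(3,4) by auto
  fix u assume u: "u \<in> V'" "u \<noteq> v"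
  show "({u} \<union> (if u = s then D else {})) \<inter> ({v} \<union> (if v = s then D else {})) = {}"
    using u v assms(4) by auto
  show "adj' u v \<longleftrightarrow> touch adj ({u} \<union> (if u = s then D else {})) ({v} \<union> (if v = s then D else {}))"
    unfolding assms(8)[OF u(1) v u(2)] using u(2) touch_sym[OF assms(2), of D "{v}"] by (cases "u = s"; cases "v = s") auto
qed

definition add_clique :: "'a set \<Rightarrow> ('a \<Rightarrow> 'a \<Rightarrow> bool) \<Rightarrow> 'a \<Rightarrow> 'a \<Rightarrow> bool" where
  "add_clique S adj u v \<longleftrightarrow> adj u v \<or> u \<in> S \<and> v \<in> S \<and> u \<noteq> v"

lemma symp_add_clique: "symp adj \<Longrightarrow> symp (add_clique S adj)"
  unfolding add_clique_def symp_def by blast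

text \<open>Contracting \<open>X\<close> into \<open>s\<close> creates exactly the edges from
  \<open>s\<close> to \<open>t\<close> and \<open>u\<close>. The third pair is an edge or
  degenerate, and \<open>D\<close> gains nothing because it does not touch \<open>X\<close>.\<close>

lemma cls_add_clique1:
  assumes "cls V adj" "symp adj" "insert s (insert t (insert u D)) \<subseteq> V" "s \<notin> {t, u}" "t = u \<or> adj t u"
    and "conn adj X" "X \<subseteq> V" "X \<inter> D = {}" "X \<inter> {s, t, u} = {}" "\<not> touch adj D X"
    and "touch adj {s} X" "touch adj {t} X" "touch adj {u} X"
  shows "cls (D \<union> {s, t, u}) (add_clique {s, t, u} adj)"
proof (rule cls_contract[OF assms(1,2), of _ X s])
  have n: "\<not> touch adj {v} X" if "v \<in> D" for v using assms(10) that by (auto simp: touch_def)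
  fix a b assume ab: "a \<in> D \<union> {s, t, u}" "b \<in> D \<union> {s, t, u}" "a \<noteq> b"
  show "add_clique {s, t, u} adj a b \<longleftrightarrow> adj a b \<or> a = s \<and> touch adj {b} X \<or> b = s \<and> touch adj {a} X"
    using ab n[of a] n[of b] assms(4,5,11,12,13) sympD[OF assms(2)] unfolding add_clique_def by blast
qed (use assms in auto)

text \<open>Three missing edges take two contractions: \<open>X\<close> into \<open>s\<close>
  supplies the two edges at \<open>s\<close>, and \<open>Y\<close> into \<open>t\<close> supplies
  the remaining one.\<close>

lemma cls_add_clique2:
  assumes "cls V adj" "symp adj" "{s, t, u} \<union> D \<subseteq> V" "card {s, t, u} = 3" "D \<inter> {s, t, u} = {}"
    and "conn adj X" "X \<subseteq> V" "X \<inter> D = {}" "X \<inter> {s, t, u} = {}" "\<not> touch adj D X"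
    and "touch adj {s} X" "touch adj {t} X" "touch adj {u} X"
    and "conn adj Y" "Y \<subseteq> V" "Y \<inter> D = {}" "Y \<inter> {s, t, u} = {}" "\<not> touch adj D Y" "X \<inter> Y = {}"
    and "touch adj {s} Y" "touch adj {t} Y" "touch adj {u} Y"
  shows "cls (D \<union> {s, t, u}) (add_clique {s, t, u} adj)"
proof -
  have dis: "s \<noteq> t" "s \<noteq> u" "t \<noteq> u" using assms(4) by (auto simp: card_insert_if split: if_splits)
  define adj1 where "adj1 a b \<longleftrightarrow> adj a b \<or> a = s \<and> touch adj {b} X \<or> b = s \<and> touch adj {a} X" for a b
  have sy1: "symp adj1" using sympD[OF assms(2)] unfolding adj1_def symp_def by blast
  have le: "touch adj1 A B" if "touch adj A B" for A B using that by (auto simp: adj1_def touch_def)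
  have 1: "cls (D \<union> {s, t, u} \<union> Y) adj1"
    by (rule cls_contract[OF assms(1,2), of _ X s]) (use assms adj1_def in auto)
  have cY: "conn adj1 Y" using assms(14) unfolding conn_def adj1_def by blast
  have n: "\<not> touch adj {v} X" if "v \<in> D" for v using assms(10) that by (auto simp: touch_def)
  have nY: "\<not> touch adj1 {v} Y" if "v \<in> D" for v
    using assms(5,17,18) that n[OF that] by (auto simp: touch_def adj1_def)
  show ?thesis
  proof (rule cls_contract[OF 1 sy1, of _ Y t])
    fix a b assume ab: "a \<in> D \<union> {s, t, u}" "b \<in> D \<union> {s, t, u}" "a \<noteq> b"
    have tY: "touch adj1 {v} Y \<longleftrightarrow> v \<in> {s, t, u}" if "v \<in> D \<union> {s, t, u}" for v
      using that nY le assms(5,20,21,22) by blast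
    have tX: "touch adj {v} X \<longleftrightarrow> v \<in> {s, t, u}" if "v \<in> D \<union> {s, t, u}" for v
      using that n assms(5,11,12,13) by blast
    show "add_clique {s, t, u} adj a b \<longleftrightarrow> adj1 a b \<or> a = t \<and> touch adj1 {b} Y \<or> b = t \<and> touch adj1 {a} Y"
      unfolding tY[OF ab(1)] tY[OF ab(2)] add_clique_def adj1_def tX[OF ab(1)] tX[OF ab(2)]
      using ab(3) by blast
  qed (use assms(3,5,15,16,17,19) cY le[OF assms(21)] in blast)+
qed

text \<open>The metric polytope of the complete graph. The perimeter bound is the triangle
  inequality after both distances at \<open>v\<close> are replaced by their complements to
  1.\<close>

definition full_metric :: "'a set \<Rightarrow> ('a \<Rightarrow> 'a \<Rightarrow> real) \<Rightarrow> bool" where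
  "full_metric V d \<longleftrightarrow> (\<forall>u\<in>V. d u u = 0) \<and> (\<forall>u\<in>V. \<forall>v\<in>V. d u v = d v u) \<and>
     (\<forall>u\<in>V. \<forall>v\<in>V. \<forall>w\<in>V. d u w \<le> d u v + d v w \<and> d u v + d v w + d u w \<le> 2)"

definition sep :: "'a \<Rightarrow> 'a \<Rightarrow> 'a set set" where
  "sep u v = {A. (u \<in> A) \<noteq> (v \<in> A)}"

text \<open>Membership in the cut polytope, projected to the pairs in \<open>R\<close>. The convex
  combination of cuts is encoded as a random vertex set, so that gluing becomes a coupling.\<close>

definition cut_repr :: "'a set \<Rightarrow> ('a \<Rightarrow> 'a \<Rightarrow> bool) \<Rightarrow> ('a \<Rightarrow> 'a \<Rightarrow> real) \<Rightarrow> bool" where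
  "cut_repr V R d \<longleftrightarrow>
     (\<exists>p. \<forall>u\<in>V. \<forall>v\<in>V. R u v \<longrightarrow> measure_pmf.prob p (sep u v) = d u v)"

text \<open>The metric lives on all pairs, but only its values on \<open>R\<close> are to be
  realised; this gives added edges a value and lets them be dropped again.\<close>

definition good :: "'a set \<Rightarrow> ('a \<Rightarrow> 'a \<Rightarrow> bool) \<Rightarrow> bool" where
  "good V R \<longleftrightarrow> (\<forall>d. full_metric V d \<longrightarrow> cut_repr V R d)"

lemma sep_refl [simp]: "sep u u = {}"
  by (auto simp: sep_def)

lemma full_metric_subset: "full_metric V d \<Longrightarrow> W \<subseteq> V \<Longrightarrow> full_metric W d"
  unfolding full_metric_def by blast

lemma cut_repr_mono:
  assumes "cut_repr V R d" "\<And>u v. u \<in> V' \<Longrightarrow> v \<in> V' \<Longrightarrow> R' u v \<Longrightarrow> R u v" "V' \<subseteq> V"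
  shows "cut_repr V' R' d"
  using assms unfolding cut_repr_def by (meson subsetD)

lemma cut_repr_pullback:
  assumes "cut_repr U R d'" "\<And>v. v \<in> V \<Longrightarrow> g v \<in> U"
    and "\<And>u v. u \<in> V \<Longrightarrow> v \<in> V \<Longrightarrow> R' u v \<Longrightarrow> R (g u) (g v) \<and> d u v = d' (g u) (g v)"
  shows "cut_repr V R' d"
proof -
  obtain p where p: "\<And>u v. u \<in> U \<Longrightarrow> v \<in> U \<Longrightarrow> R u v \<Longrightarrow> measure_pmf.prob p (sep u v) = d' u v"
    using assms(1) unfolding cut_repr_def by blast
  have "measure_pmf.prob (map_pmf (\<lambda>A. g -` A) p) (sep u v) = d u v"
    if "u \<in> V" "v \<in> V" "R' u v" for u v
  proof -
    have "(\<lambda>A. g -` A) -` sep u v = sep (g u) (g v)" by (auto simp: sep_def)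
    then show ?thesis using p[of "g u" "g v"] assms(2,3) that by simp
  qed
  then show ?thesis unfolding cut_repr_def by blast
qed

text \<open>The four atoms satisfy four independent linear equations. The two bits will say whether
  \<open>t\<close> and \<open>u\<close> are separated from \<open>s\<close>, and their disagreement
  is the separation of \<open>t\<close> from \<open>u\<close>.\<close>

lemma pmf_bool_pair_eqI:
  fixes p q :: "(bool \<times> bool) pmf"
  assumes "measure_pmf.prob p {x. fst x} = measure_pmf.prob q {x. fst x}"
    and "measure_pmf.prob p {x. snd x} = measure_pmf.prob q {x. snd x}"
    and "measure_pmf.prob p {x. fst x \<noteq> snd x} = measure_pmf.prob q {x. fst x \<noteq> snd x}"
  shows "p = q"
proof -
  have s: "measure_pmf.prob r {x. fst x} = pmf r (True, True) + pmf r (True, False)"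
    "measure_pmf.prob r {x. snd x} = pmf r (True, True) + pmf r (False, True)"
    "measure_pmf.prob r {x. fst x \<noteq> snd x} = pmf r (True, False) + pmf r (False, True)"
    "1 = pmf r (True, True) + pmf r (True, False) + pmf r (False, True) + pmf r (False, False)"
    for r :: "(bool \<times> bool) pmf"
  proof -
    have 1: "{x::bool \<times> bool. fst x} = {(True, True), (True, False)}" by auto
    have 2: "{x::bool \<times> bool. snd x} = {(True, True), (False, True)}" by auto
    have 3: "{x::bool \<times> bool. fst x \<noteq> snd x} = {(True, False), (False, True)}" by auto
    have 4: "(UNIV::(bool \<times> bool) set) = {(True, True), (True, False), (False, True), (False, False)}"
      by auto
    show "measure_pmf.prob r {x. fst x} = pmf r (True, True) + pmf r (True, False)"
      unfolding 1 by (simp add: measure_measure_pmf_finite)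
    show "measure_pmf.prob r {x. snd x} = pmf r (True, True) + pmf r (False, True)"
      unfolding 2 by (simp add: measure_measure_pmf_finite)
    show "measure_pmf.prob r {x. fst x \<noteq> snd x} = pmf r (True, False) + pmf r (False, True)"
      unfolding 3 by (simp add: measure_measure_pmf_finite)
    have "measure_pmf.prob r UNIV = 1" using measure_pmf.prob_space[of r] by simp
    then show "1 = pmf r (True, True) + pmf r (True, False) + pmf r (False, True) + pmf r (False, False)"
      unfolding 4 by (simp add: measure_measure_pmf_finite)
  qed
  show ?thesis
  proof (rule pmf_eqI)
    fix x :: "bool \<times> bool"
    show "pmf p x = pmf q x"
      using s[of p] s[of q] assms by (cases x; cases "fst x"; cases "snd x") auto
  qed
qed

lemma cut_repr_glue:
  assumes r: "cut_repr V1 R d" "cut_repr V2 R d"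
    and S: "V1 \<inter> V2 = {} \<or> V1 \<inter> V2 = {s, t, u}"
    and cl: "\<And>x y. x \<in> V1 \<inter> V2 \<Longrightarrow> y \<in> V1 \<inter> V2 \<Longrightarrow> x \<noteq> y \<Longrightarrow> R x y"
    and no: "\<And>x y. x \<in> V1 - V2 \<Longrightarrow> y \<in> V2 - V1 \<Longrightarrow> \<not> R x y \<and> \<not> R y x"
  shows "cut_repr (V1 \<union> V2) R d"
proof -
  obtain p1 p2 where
    p1: "\<And>u v. u \<in> V1 \<Longrightarrow> v \<in> V1 \<Longrightarrow> R u v \<Longrightarrow> measure_pmf.prob p1 (sep u v) = d u v" and
    p2: "\<And>u v. u \<in> V2 \<Longrightarrow> v \<in> V2 \<Longrightarrow> R u v \<Longrightarrow> measure_pmf.prob p2 (sep u v) = d u v"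
    using r unfolding cut_repr_def by metis
  \<comment> \<open>The cut induced on the common vertices, read relative to \<open>s\<close> so
    that a set and its complement give the same value.\<close>
  define f where "f A = (if V1 \<inter> V2 = {} then (False, False) else (A \<in> sep s t, A \<in> sep s u))"
    for A :: "'a set"
  have eq: "measure_pmf.prob p1 (sep x y) = measure_pmf.prob p2 (sep x y)"
    if "x \<in> V1 \<inter> V2" "y \<in> V1 \<inter> V2" for x y
    using p1[of x y] p2[of x y] cl[of x y] that by (cases "x = y") auto
  have "map_pmf f p1 = map_pmf f p2"
  proof (cases "V1 \<inter> V2 = {}")
    case True
    then have "f = (\<lambda>_. (False, False))" by (simp add: f_def fun_eq_iff)
    then show ?thesis by simp
  next
    case False
    then have SS: "V1 \<inter> V2 = {s, t, u}" using S by blast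
    have f: "f -` {x. fst x} = sep s t" "f -` {x. snd x} = sep s u" "f -` {x. fst x \<noteq> snd x} = sep t u"
      using False by (auto simp: f_def sep_def)
    show ?thesis
      by (rule pmf_bool_pair_eqI) (simp_all only: measure_map_pmf f, simp_all add: eq SS)
  qed
  \<comment> \<open>Equal laws of the induced cut yield a joint distribution of the two random sets
    under which their induced cuts always agree.\<close>
  then have "rel_pmf (=) (map_pmf f p1) (map_pmf f p2)" by (simp add: pmf.rel_eq)
  then have "rel_pmf (\<lambda>A B. f A = f B) p1 p2" by (simp add: pmf.rel_map)
  then obtain pq where pq: "\<And>A B. (A, B) \<in> set_pmf pq \<Longrightarrow> f A = f B"
    and m1: "map_pmf fst pq = p1" and m2: "map_pmf snd pq = p2"
    by (auto elim!: rel_pmf.cases)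
  \<comment> \<open>The second set is complemented when it disagrees with the first about
    \<open>s\<close>. This does not change which pairs it separates, and it makes the two sets agree
    on the common vertices.\<close>
  define g where "g AB = {v. if v \<in> V1 then v \<in> fst AB else (v \<in> snd AB) = ((s \<in> fst AB) = (s \<in> snd AB))}"
    for AB :: "'a set \<times> 'a set"
  have "measure_pmf.prob (map_pmf g pq) (sep x y) = d x y"
    if xy: "x \<in> V1 \<union> V2" "y \<in> V1 \<union> V2" "R x y" for x y
  proof (cases "x \<in> V1 \<and> y \<in> V1")
    case True
    then have "g -` sep x y = fst -` sep x y" by (auto simp: g_def sep_def)
    then show ?thesis using p1[of x y] True xy unfolding m1[symmetric] by simp
  next
    case False
    then have in2: "x \<in> V2" "y \<in> V2" using xy no[of x y] no[of y x] by auto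
    have S2: "V1 \<inter> V2 = {s, t, u}" if "V1 \<inter> V2 \<noteq> {}" using S that by blast
    have "AB \<in> g -` sep x y \<longleftrightarrow> AB \<in> snd -` sep x y" if AB: "AB \<in> set_pmf pq" for AB
    proof -
      have "f (fst AB) = f (snd AB)" using pq[of "fst AB" "snd AB"] AB by simp
      then have key: "(v \<in> fst AB) = ((v \<in> snd AB) = ((s \<in> fst AB) = (s \<in> snd AB)))"
        if "v \<in> V1 \<inter> V2" for v
        using S2 that unfolding f_def sep_def by (auto split: if_splits)
      have gv: "v \<in> g AB \<longleftrightarrow> (v \<in> snd AB) = ((s \<in> fst AB) = (s \<in> snd AB))" if "v \<in> V2" for v
        using key[of v] that by (auto simp: g_def)
      show ?thesis using gv[OF in2(1)] gv[OF in2(2)] by (auto simp: sep_def)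
    qed
    then have "AE AB in measure_pmf pq. AB \<in> g -` sep x y \<longleftrightarrow> AB \<in> snd -` sep x y"
      by (simp add: AE_measure_pmf_iff)
    then have "measure_pmf.prob pq (g -` sep x y) = measure_pmf.prob pq (snd -` sep x y)"
      by (intro measure_pmf.finite_measure_eq_AE) auto
    then show ?thesis using p2[of x y] in2 xy unfolding m2[symmetric] by simp
  qed
  then show ?thesis unfolding cut_repr_def by blast
qed

text \<open>Up to complement four points have eight cuts; six distances and the total mass fix all
  but one parameter \<open>t\<close>, the mass of the empty cut. A triangle omitting the point
  \<open>i\<close> is left unseparated by the empty cut and the cut isolating \<open>i\<close> only,
  whose joint mass is one minus half the perimeter of that triangle.\<close>

lemma cut_repr_K4:
  assumes "full_metric {..<4::nat} d"
  shows "cut_repr {..<4} (\<lambda>_ _. True) d"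
proof -
  have le: "(0::nat) \<in> {..<4}" "(1::nat) \<in> {..<4}" "(2::nat) \<in> {..<4}" "(3::nat) \<in> {..<4}" by auto
  note D = assms[unfolded full_metric_def]
  have T: "d i k \<le> d i j + d j k \<and> d i j + d j k + d i k \<le> 2" if "i \<in> {..<4}" "j \<in> {..<4}" "k \<in> {..<4}" for i j k
    using D that by blast
  have sy: "d 1 0 = d 0 1" "d 2 0 = d 0 2" "d 3 0 = d 0 3" "d 2 1 = d 1 2" "d 3 1 = d 1 3" "d 3 2 = d 2 3"
    "d 0 0 = 0" "d 1 1 = 0" "d 2 2 = 0" "d 3 3 = 0"
    using D le by blast+
  note tr = T[OF le(1,2,3)] T[OF le(2,1,3)] T[OF le(1,3,2)] T[OF le(1,2,4)] T[OF le(2,1,4)] T[OF le(1,4,2)]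
    T[OF le(1,3,4)] T[OF le(3,1,4)] T[OF le(1,4,3)] T[OF le(2,3,4)] T[OF le(3,2,4)] T[OF le(2,4,3)]
  define \<pi>0 where "\<pi>0 = 1 - (d 1 2 + d 1 3 + d 2 3) / 2"
  define \<pi>1 where "\<pi>1 = 1 - (d 0 2 + d 0 3 + d 2 3) / 2"
  define \<pi>2 where "\<pi>2 = 1 - (d 0 1 + d 0 3 + d 1 3) / 2"
  define \<pi>3 where "\<pi>3 = 1 - (d 0 1 + d 0 2 + d 1 2) / 2"
  \<comment> \<open>The singletons need \<open>t\<close> below each of \<open>\<pi>0\<close> to
    \<open>\<pi>3\<close>, while the masses \<open>a\<close>, \<open>b\<close>, \<open>c\<close> of
    the two-point cuts grow with \<open>t\<close>; so the largest admissible value is taken.\<close>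
  obtain t where t: "t \<le> \<pi>0" "t \<le> \<pi>1" "t \<le> \<pi>2" "t \<le> \<pi>3" "t = \<pi>0 \<or> t = \<pi>1 \<or> t = \<pi>2 \<or> t = \<pi>3"
    using that[of "min (min \<pi>0 \<pi>1) (min \<pi>2 \<pi>3)"] by (auto simp: min_def)
  define a where "a = (d 0 2 + d 0 3 - d 2 3) / 2 - \<pi>0 + t"
  define b where "b = (d 0 1 + d 0 3 - d 1 3) / 2 - \<pi>0 + t"
  define c where "c = (d 0 1 + d 0 2 - d 1 2) / 2 - \<pi>0 + t"
  note defs = \<pi>0_def \<pi>1_def \<pi>2_def \<pi>3_def a_def b_def c_def
  have nn: "t \<ge> 0" "a \<ge> 0" "b \<ge> 0" "c \<ge> 0"
    using t(5) t(1-4) tr unfolding defs sy by argo+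
  define L where "L = [({}::nat set, t), ({0}, \<pi>0 - t), ({1}, \<pi>1 - t), ({2}, \<pi>2 - t), ({3}, \<pi>3 - t),
     ({0, 1}, a), ({0, 2}, b), ({0, 3}, c)]"
  have wf: "pmf_of_list_wf L"
    by (rule pmf_of_list_wfI) (use nn t in \<open>auto simp: L_def defs field_simps\<close>)
  have pr: "measure_pmf.prob (pmf_of_list L) X = sum_list (map snd (filter (\<lambda>z. fst z \<in> X) L))" for X
    by (rule measure_pmf_of_list[OF wf])
  have n01: "measure_pmf.prob (pmf_of_list L) (sep 0 1) = d 0 1"
    "measure_pmf.prob (pmf_of_list L) (sep 0 2) = d 0 2"
    "measure_pmf.prob (pmf_of_list L) (sep 0 3) = d 0 3"
    "measure_pmf.prob (pmf_of_list L) (sep 1 2) = d 1 2"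
    "measure_pmf.prob (pmf_of_list L) (sep 1 3) = d 1 3"
    "measure_pmf.prob (pmf_of_list L) (sep 2 3) = d 2 3"
    unfolding pr unfolding L_def by (simp_all add: sep_def defs field_simps)
  have sc: "sep x y = sep y x" for x y :: nat by (auto simp: sep_def)
  have "measure_pmf.prob (pmf_of_list L) (sep u v) = d u v" if "u \<in> {..<4}" "v \<in> {..<4}" for u v
  proof -
    have "u = 0 \<or> u = 1 \<or> u = 2 \<or> u = 3" "v = 0 \<or> v = 1 \<or> v = 2 \<or> v = 3" using that by auto
    then show ?thesis
      by (elim disjE) (simp_all only: n01 sy sep_refl measure_empty sc[of 1 0] sc[of 2 0] sc[of 3 0]
        sc[of 2 1] sc[of 3 1] sc[of 3 2])
  qed
  then show ?thesis unfolding cut_repr_def by blast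
qed

lemma good_small:
  assumes "finite V" "card V \<le> 4"
  shows "good V R"
  unfolding good_def
proof (intro allI impI)
  fix d assume d: "full_metric V d"
  show "cut_repr V R d"
  proof (cases "V = {}")
    case True
    then show ?thesis by (simp add: cut_repr_def)
  next
    case False
    obtain g where g: "inj_on g V" "g ` V \<subseteq> {..<4::nat}"
      using card_le_inj[OF assms(1), of "{..<4::nat}"] assms(2) by auto
    obtain v0 where v0: "v0 \<in> V" using False by blast
    define h where "h i = (if i \<in> g ` V then inv_into V g i else v0)" for i
    have h: "h i \<in> V" for i using v0 by (auto simp: h_def inv_into_into)
    have hg: "h (g v) = v" if "v \<in> V" for v using that g by (simp add: h_def)
    have "full_metric {..<4} (\<lambda>i j. d (h i) (h j))" using d h unfolding full_metric_def by blast
    from cut_repr_K4[OF this] show ?thesis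
      by (rule cut_repr_pullback[where g = g]) (use g hg in auto)
  qed
qed

text \<open>A set without edges to the rest of \<open>V - S\<close> is split until it is connected.
  The two parts of a split meet in \<open>S\<close>, where all pairs are represented, so their
  mixtures can be glued.\<close>

lemma good_clique_sum:
  assumes "finite V" "symp R" "S \<subseteq> V" "card S \<le> 3"
    and cl: "\<And>x y. x \<in> S \<Longrightarrow> y \<in> S \<Longrightarrow> x \<noteq> y \<Longrightarrow> R x y"
    and D: "\<And>D. conn R D \<Longrightarrow> D \<subseteq> V - S \<Longrightarrow> (\<And>x y. x \<in> D \<Longrightarrow> y \<in> V - S - D \<Longrightarrow> \<not> R x y) \<Longrightarrow> good (D \<union> S) R"
  shows "good V R"
  unfolding good_def
proof (intro allI impI)
  fix d assume d: "full_metric V d"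
  have fS: "finite S" by (rule finite_subset[OF assms(3,1)])
  \<comment> \<open>Smaller cliques are written with repeated vertices, so that one gluing lemma
    serves all sizes.\<close>
  have S3: "S = {} \<or> (\<exists>s t u. S = {s, t, u})"
  proof -
    have "card S = 0 \<or> card S = 1 \<or> card S = 2 \<or> card S = 3" using assms(4) by linarith
    then show ?thesis
    proof (elim disjE)
      assume "card S = 0"
      then show ?thesis using fS by simp
    next
      assume "card S = 1"
      then obtain x where "S = {x}" by (rule card_1_singletonE)
      then have "S = {x, x, x}" by simp
      then show ?thesis by (intro disjI2 exI)
    next
      assume "card S = 2"
      then obtain x y where "S = {x, y}" unfolding card_2_iff by blast
      then have "S = {x, y, y}" by simp
      then show ?thesis by (intro disjI2 exI)
    next
      assume "card S = 3"
      then obtain x y z where "S = {x, y, z}" unfolding card_3_iff by blast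
      then show ?thesis by (intro disjI2 exI)
    qed
  qed
  have main: "cut_repr (X \<union> S) R d"
    if "X \<subseteq> V - S" "\<And>x y. x \<in> X \<Longrightarrow> y \<in> V - S - X \<Longrightarrow> \<not> R x y" for X
    using that
  proof (induction "card X" arbitrary: X rule: less_induct)
    case less
    have fX: "finite X" by (rule finite_subset[OF less.prems(1)]) (use assms(1) in simp)
    have fm: "full_metric (X \<union> S) d" using less.prems(1) assms(3) by (intro full_metric_subset[OF d]) blast
    show ?case
    proof (cases "X = {}")
      case True
      then show ?thesis using good_small[OF fS, of R] assms(4) fm by (auto simp: good_def)
    next
      case ne: False
      show ?thesis
      proof (cases "conn R X")
        case True
        then show ?thesis using D[of X] less.prems fm by (auto simp: good_def)
      next
        case False
        then obtain Y where Y: "Y \<subseteq> X" "Y \<noteq> {}" "Y \<noteq> X" "\<And>y z. y \<in> Y \<Longrightarrow> z \<in> X - Y \<Longrightarrow> \<not> R y z"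
          using ne unfolding conn_def by blast
        have Y': "\<And>y z. y \<in> X - Y \<Longrightarrow> z \<in> Y \<Longrightarrow> \<not> R y z" using Y(4) sympD[OF assms(2)] by blast
        have "card Y < card X" using Y fX by (simp add: psubsetI psubset_card_mono)
        then have 1: "cut_repr (Y \<union> S) R d"
          by (rule less.hyps) (use Y less.prems in blast)+
        have "card (X - Y) < card X" using Y fX by (intro psubset_card_mono) auto
        then have 2: "cut_repr (X - Y \<union> S) R d"
          by (rule less.hyps) (use Y Y' less.prems in blast)+
        have int: "(Y \<union> S) \<inter> (X - Y \<union> S) = S" by blast
        obtain s t u where stu: "S = {} \<or> S = {s, t, u}" using S3 by blast
        have "cut_repr ((Y \<union> S) \<union> (X - Y \<union> S)) R d"
        proof (rule cut_repr_glue[OF 1 2, of s t u])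
          show "(Y \<union> S) \<inter> (X - Y \<union> S) = {} \<or> (Y \<union> S) \<inter> (X - Y \<union> S) = {s, t, u}"
            unfolding int by (rule stu)
          show "R x y" if "x \<in> (Y \<union> S) \<inter> (X - Y \<union> S)" "y \<in> (Y \<union> S) \<inter> (X - Y \<union> S)" "x \<noteq> y" for x y
            using that unfolding int by (rule cl)
          fix x y assume xy: "x \<in> Y \<union> S - (X - Y \<union> S)" "y \<in> X - Y \<union> S - (Y \<union> S)"
          show "\<not> R x y \<and> \<not> R y x" using Y(4)[of x y] Y'[of y x] xy by auto
        qed
        moreover have "(Y \<union> S) \<union> (X - Y \<union> S) = X \<union> S" using Y by blast
        ultimately show ?thesis by simp
      qed
    qed
  qed
  have "cut_repr (V - S \<union> S) R d" by (rule main) auto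
  then show "cut_repr V R d" using assms(3) by (simp add: Un_absorb2)
qed

section \<open>The octahedron\<close>

definition cyc_weight :: "'e set \<Rightarrow> 'e set \<Rightarrow> ('e \<Rightarrow> real) \<Rightarrow> real" where
  "cyc_weight C F x = (\<Sum>e\<in>C. if e \<in> F then 1 - x e else x e)"

definition cycle_polytope :: "'e::finite set set \<Rightarrow> (real ^ 'e) set" where
  "cycle_polytope \<C> = {x. (\<forall>e. 0 \<le> x $ e \<and> x $ e \<le> 1) \<and>
     (\<forall>C\<in>\<C>. \<forall>F. F \<subseteq> C \<longrightarrow> odd (card F) \<longrightarrow> 1 \<le> cyc_weight C F (($) x))}"

lemma cyc_weight_line:
  "cyc_weight C F (($) (x + t *\<^sub>R y)) = cyc_weight C F (($) x) + t * (\<Sum>e\<in>C. if e \<in> F then - (y $ e) else y $ e)"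
  unfolding cyc_weight_def sum_distrib_left sum.distrib[symmetric]
  by (rule sum.cong) (auto simp: algebra_simps)

lemma compact_convex_cycle_polytope:
  fixes \<C> :: "'e::finite set set"
  shows "compact (cycle_polytope \<C>)" "convex (cycle_polytope \<C>)"
proof -
  let ?H = "\<lambda>C F. {x::real^'e. 1 \<le> cyc_weight C F (($) x)}"
  have eq: "cycle_polytope \<C> = cbox 0 1 \<inter> (\<Inter>C\<in>\<C>. \<Inter>F\<in>{F. F \<subseteq> C \<and> odd (card F)}. ?H C F)"
    unfolding cycle_polytope_def by (auto simp: mem_box_cart)
  have cl: "closed (?H C F)" for C F
    proof -
    have "continuous_on UNIV (\<lambda>x::real^'e. if e \<in> F then 1 - x $ e else x $ e)" for e
      by (cases "e \<in> F") (auto intro!: continuous_intros)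
    then show ?thesis unfolding cyc_weight_def by (intro closed_Collect_le continuous_on_const continuous_on_sum)
  qed
  have cv: "convex (?H C F)" for C F
  proof (rule convexI)
    fix x y :: "real^'e" and u v :: real
    assume h: "x \<in> ?H C F" "y \<in> ?H C F" "0 \<le> u" "0 \<le> v" "u + v = 1"
    have "u * (1 - a) + v * (1 - b) = 1 - (u * a + v * b)" for a b
      using h(5) by (simp add: algebra_simps)
    then have "cyc_weight C F (($) (u *\<^sub>R x + v *\<^sub>R y)) = u * cyc_weight C F (($) x) + v * cyc_weight C F (($) y)"
      unfolding cyc_weight_def sum_distrib_left sum.distrib[symmetric] by (intro sum.cong) auto
    moreover have "u * 1 + v * 1 \<le> u * cyc_weight C F (($) x) + v * cyc_weight C F (($) y)"
      using h by (intro add_mono mult_left_mono) auto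
    ultimately show "u *\<^sub>R x + v *\<^sub>R y \<in> ?H C F" using h(5) by simp
  qed
  show "compact (cycle_polytope \<C>)" unfolding eq
    by (intro compact_Int_closed compact_cbox closed_INT ballI cl)
  show "convex (cycle_polytope \<C>)" unfolding eq
    by (intro convex_Int convex_box(1) convex_INT cv)
qed

text \<open>Add the two tight inequalities: the total is 2. Each element of the symmetric difference
  contributes 1, an even positive number of times, and every other element of \<open>C\<close>
  contributes a positive amount. So nothing else can be left, but then the symmetric difference is
  \<open>C\<close>, which has at least three elements.\<close>

lemma tight_unique:
  fixes x :: "'e \<Rightarrow> real"
  assumes "finite C" "3 \<le> card C" "\<And>e. 0 < x e \<and> x e < 1"
    and "F \<subseteq> C" "G \<subseteq> C" "odd (card F)" "odd (card G)" "cyc_weight C F x = 1" "cyc_weight C G x = 1"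
  shows "F = G"
proof (rule ccontr)
  assume ne: "F \<noteq> G"
  let ?f = "\<lambda>e. (if e \<in> F then 1 - x e else x e) + (if e \<in> G then 1 - x e else x e)"
  let ?D = "sym_diff F G"
  have fin: "finite F" "finite G" using finite_subset[OF assms(4,1)] finite_subset[OF assms(5,1)] by auto
  have D: "?D \<subseteq> C" using assms by blast
  have "card F + card G = card ?D + 2 * card (F \<inter> G)"
  proof -
    have "card F = card (F - G) + card (F \<inter> G)" using card_Diff_subset_Int[of F G] fin
      by (metis Int_Diff_disjoint Int_commute Un_Diff_Int card_Un_disjoint finite_Diff finite_Int)
    moreover have "card G = card (G - F) + card (F \<inter> G)"
      by (metis Int_Diff_disjoint Int_commute Un_Diff_Int card_Un_disjoint fin(2) finite_Diff finite_Int)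
    moreover have "card ?D = card (F - G) + card (G - F)" using fin by (intro card_Un_disjoint) auto
    ultimately show ?thesis by simp
  qed
  then have ev: "even (card ?D)" using assms(6,7) by presburger
  have "card ?D \<noteq> 0" using ne fin by auto
  then have c2: "2 \<le> card ?D" using ev by (cases "card ?D = 1") auto
  have s: "(\<Sum>e\<in>C. ?f e) = 2" using assms(8,9) unfolding cyc_weight_def sum.distrib by simp
  have "(\<Sum>e\<in>C. ?f e) = (\<Sum>e\<in>C - ?D. ?f e) + (\<Sum>e\<in>?D. ?f e)"
    using sum.subset_diff[OF D assms(1)] by blast
  moreover have "(\<Sum>e\<in>?D. ?f e) = (\<Sum>e\<in>?D. 1)" by (intro sum.cong) auto
  ultimately have e: "(\<Sum>e\<in>C - ?D. ?f e) + real (card ?D) = 2" using s by simp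
  have pos: "0 < ?f e" for e using assms(3)[of e] by auto
  show False
  proof (cases "C - ?D = {}")
    case True
    then have "?D = C" using D by blast
    then have "3 \<le> card ?D" using assms(2) by metis
    then show False using e True by (simp only: sum.empty)
  next
    case False
    then have "0 < (\<Sum>e\<in>C - ?D. ?f e)" using assms(1) pos by (intro sum_pos) auto
    then show False using e c2 by linarith
  qed
qed

text \<open>At a fractional point every \<open>C\<close> has at most one tight inequality, so there
  are fewer tight normals than coordinates. Some direction is orthogonal to all of them, and small
  moves along it in both senses stay in the polytope.\<close>

lemma extreme_point_integral:
  fixes \<C> :: "'e::finite set set"
  assumes ex: "x extreme_point_of cycle_polytope \<C>" and c: "card \<C> < CARD('e)" and c3: "\<And>C. C \<in> \<C> \<Longrightarrow> 3 \<le> card C"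
  shows "\<exists>e. x $ e = 0 \<or> x $ e = 1"
proof (rule ccontr)
  assume n: "\<not> ?thesis"
  have xP: "x \<in> cycle_polytope \<C>" using ex by (simp add: extreme_point_of_def)
  have fr: "0 < x $ e \<and> x $ e < 1" for e using n xP by (auto simp: cycle_polytope_def order_less_le)
  define tight where "tight C F \<longleftrightarrow> F \<subseteq> C \<and> odd (card F) \<and> cyc_weight C F (($) x) = 1" for C F
  \<comment> \<open>\<open>v C\<close> is the normal of the tight inequality of \<open>C\<close> if
    there is one, and otherwise some vector; in either case there is one per cycle for the dimension
    count.\<close>
  define v :: "'e set \<Rightarrow> real ^ 'e" where
    "v C = (\<chi> e. if e \<in> C then if e \<in> (SOME F. tight C F) then -1 else 1 else 0)" for C
  have "dim (v ` \<C>) \<le> card (v ` \<C>)" by (rule dim_le_card') simp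
  also have "\<dots> \<le> card \<C>" by (rule card_image_le) simp
  also have "\<dots> < DIM(real ^ 'e)" using c by simp
  finally have "dim (v ` \<C>) < DIM(real ^ 'e)" .
  then obtain y where y: "y \<noteq> 0" "\<And>z. z \<in> span (v ` \<C>) \<Longrightarrow> orthogonal y z"
    using orthogonal_to_subspace_exists by metis
  have zero: "(\<Sum>e\<in>C. if e \<in> F then - (y $ e) else y $ e) = 0" if C: "C \<in> \<C>" and F: "tight C F" for C F
  proof -
    have "(SOME F. tight C F) = F"
    proof (rule tight_unique[of C "($) x"])
      have "tight C (SOME F. tight C F)" using F by (rule someI)
      then show "(SOME F. tight C F) \<subseteq> C" "odd (card (SOME F. tight C F))" "cyc_weight C (SOME F. tight C F) (($) x) = 1"
        by (auto simp: tight_def)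
    qed (use F c3[OF C] fr in \<open>auto simp: tight_def\<close>)
    then have "y \<bullet> v C = (\<Sum>e\<in>UNIV. if e \<in> C then if e \<in> F then - (y $ e) else y $ e else 0)"
      unfolding inner_vec_def v_def by (intro sum.cong) auto
    also have "\<dots> = (\<Sum>e\<in>C. if e \<in> F then - (y $ e) else y $ e)" by (simp add: sum.inter_restrict[symmetric])
    finally show ?thesis using y(2)[of "v C"] C by (simp add: orthogonal_def span_base)
  qed
  define ok where "ok t \<longleftrightarrow> x + t *\<^sub>R y \<in> cycle_polytope \<C>" for t
  have lim: "((\<lambda>t. a + t * b) \<longlongrightarrow> a) (at 0)" for a b :: real
    by (auto intro!: tendsto_eq_intros)
  have "eventually ok (at 0)"
  proof -
    have 1: "eventually (\<lambda>t. 0 \<le> x $ e + t * y $ e \<and> x $ e + t * y $ e \<le> 1) (at 0)" for e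
    proof -
      have "eventually (\<lambda>t. 0 < x $ e + t * y $ e) (at 0)" "eventually (\<lambda>t. x $ e + t * y $ e < 1) (at 0)"
        using order_tendstoD[OF lim[of "x $ e" "y $ e"]] fr[of e] by blast+
      from eventually_conj[OF this] show ?thesis by (rule eventually_mono) auto
    qed
    have 2: "eventually (\<lambda>t. 1 \<le> cyc_weight C F (($) (x + t *\<^sub>R y))) (at 0)"
      if "C \<in> \<C>" "F \<subseteq> C" "odd (card F)" for C F
    proof (cases "tight C F")
      case True
      then show ?thesis using zero[OF that(1) True] by (simp add: cyc_weight_line tight_def)
    next
      case False
      then have "1 < cyc_weight C F (($) x)" using xP that by (auto simp: cycle_polytope_def tight_def order_less_le)
      from order_tendstoD(1)[OF lim this] show ?thesis
        unfolding cyc_weight_line by (rule eventually_mono) (rule less_imp_le)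
    qed
    have A: "eventually (\<lambda>t. \<forall>e. 0 \<le> x $ e + t * y $ e \<and> x $ e + t * y $ e \<le> 1) (at 0)"
      by (rule eventually_all_finite[OF 1])
    have B: "eventually (\<lambda>t. \<forall>C\<in>\<C>. \<forall>F\<in>{F. F \<subseteq> C \<and> odd (card F)}. 1 \<le> cyc_weight C F (($) (x + t *\<^sub>R y))) (at 0)"
      by (rule eventually_ball_finite, simp, rule ballI, rule eventually_ball_finite, simp, rule ballI, rule 2) auto
    from eventually_conj[OF A B]
    show ?thesis by (rule eventually_mono) (auto simp: ok_def cycle_polytope_def)
  qed
  then obtain \<delta> where \<delta>: "\<delta> > 0" "\<And>t. t \<noteq> 0 \<Longrightarrow> dist t 0 < \<delta> \<Longrightarrow> ok t" unfolding eventually_at by auto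
  define t where "t = \<delta> / 2"
  have t: "ok t" "ok (- t)" "t > 0" using \<delta> by (auto simp: t_def dist_real_def)
  obtain e where e: "y $ e \<noteq> 0" using y(1) by (auto simp: vec_eq_iff)
  have "x \<in> open_segment (x + t *\<^sub>R y) (x + (- t) *\<^sub>R y)"
    unfolding in_segment
  proof (intro conjI exI[of _ "1/2"])
    have "(x + t *\<^sub>R y) $ e \<noteq> (x + (- t) *\<^sub>R y) $ e" using e t(3) by simp
    then show "x + t *\<^sub>R y \<noteq> x + (- t) *\<^sub>R y" by metis
    show "x = (1 - 1 / 2) *\<^sub>R (x + t *\<^sub>R y) + (1 / 2) *\<^sub>R (x + - t *\<^sub>R y)"
      by (simp add: vec_eq_iff field_simps)
  qed auto
  then show False using ex t unfolding extreme_point_of_def ok_def by blast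
qed

section \<open>Edge coordinates of the octahedron\<close>

definition nx :: "bool option \<Rightarrow> bool option" where
  "nx k = (if k = None then Some False else if k = Some False then Some True else None)"

lemma nx3: "nx (nx (nx k)) = k" "nx k \<noteq> k" "nx (nx k) \<noteq> k" "nx (nx k) \<noteq> nx k"
  by (cases k; auto simp: nx_def)+

lemma nx_cases: "l = k \<or> l = nx k \<or> l = nx (nx k)"
  by (cases k; cases l; auto simp: nx_def)

text \<open>The vertices are \<open>(k, a)\<close>, where \<open>k\<close> is one of three antipodal
  pairs in the cyclic order \<open>nx\<close>, and \<open>(k, a, b)\<close> is the edge from
  \<open>(k, a)\<close> to \<open>(nx k, b)\<close>. Each of the 12 edges has exactly one such
  name.\<close>

type_synonym oedge = "bool option \<times> bool \<times> bool"

definition oct_tri :: "bool option \<Rightarrow> bool \<Rightarrow> bool \<Rightarrow> bool \<Rightarrow> oedge set" where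
  "oct_tri k a b c = {(k, a, b), (nx k, b, c), (nx (nx k), c, a)}"

definition oct_quad :: "bool option \<Rightarrow> oedge set" where
  "oct_quad k = {(k, True, True), (k, True, False), (k, False, True), (k, False, False)}"

text \<open>These are the chordless cycles of the octahedron: eight triangles and one four-cycle for
  every two antipodal pairs.\<close>

definition oct_cycles :: "oedge set set" where
  "oct_cycles = (\<lambda>(a, b, c). oct_tri None a b c) ` UNIV \<union> range oct_quad"

lemma oct_tri_rotate: "oct_tri k a b c \<in> oct_cycles"
proof -
  have "oct_tri k a b c = oct_tri None a b c \<or> oct_tri k a b c = oct_tri None c a b \<or>
     oct_tri k a b c = oct_tri None b c a"
    by (cases k) (auto simp: oct_tri_def nx_def)
  then show ?thesis unfolding oct_cycles_def by (elim disjE) (auto simp: image_iff)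
qed

text \<open>8 + 3 = 11 cycles against 12 edges: the count on which the octahedron case
  rests.\<close>

lemma card_oct_cycles: "card oct_cycles < CARD(oedge)"
proof -
  have "card oct_cycles \<le> card ((\<lambda>(a, b, c). oct_tri None a b c) ` UNIV) + card (range oct_quad)"
    unfolding oct_cycles_def by (rule card_Un_le)
  also have "\<dots> \<le> CARD(bool \<times> bool \<times> bool) + CARD(bool option)"
    by (intro add_mono card_image_le) auto
  also have "\<dots> < CARD(oedge)" by (simp add: card_UNIV_option)
  finally show ?thesis .
qed

lemma card_oct_cycle: "C \<in> oct_cycles \<Longrightarrow> 3 \<le> card C"
  unfolding oct_cycles_def oct_tri_def oct_quad_def nx_def by auto

lemma odd_subset_3:
  assumes "e1 \<noteq> e2" "e1 \<noteq> e3" "e2 \<noteq> e3" "F \<subseteq> {e1, e2, e3}" "odd (card F)"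
  shows "F = {e1} \<or> F = {e2} \<or> F = {e3} \<or> F = {e1, e2, e3}"
proof -
  obtain p q r where eq: "F = (if p then {e1} else {}) \<union> (if q then {e2} else {}) \<union> (if r then {e3} else {})"
  proof
    show "F = (if e1 \<in> F then {e1} else {}) \<union> (if e2 \<in> F then {e2} else {}) \<union> (if e3 \<in> F then {e3} else {})"
      using assms(4) by auto
  qed
  show ?thesis using assms(1-3,5) unfolding eq by (cases p; cases q; cases r) (simp_all add: insert_commute)
qed

lemma odd_subset_4:
  assumes "e1 \<noteq> e2" "e1 \<noteq> e3" "e1 \<noteq> e4" "e2 \<noteq> e3" "e2 \<noteq> e4" "e3 \<noteq> e4" "F \<subseteq> {e1, e2, e3, e4}" "odd (card F)"
  shows "F = {e1} \<or> F = {e2} \<or> F = {e3} \<or> F = {e4} \<or>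
    F = {e1, e2, e3} \<or> F = {e1, e2, e4} \<or> F = {e1, e3, e4} \<or> F = {e2, e3, e4}"
proof -
  obtain p q r s where eq: "F = (if p then {e1} else {}) \<union> (if q then {e2} else {}) \<union> (if r then {e3} else {}) \<union>
    (if s then {e4} else {})"
  proof
    show "F = (if e1 \<in> F then {e1} else {}) \<union> (if e2 \<in> F then {e2} else {}) \<union> (if e3 \<in> F then {e3} else {}) \<union>
      (if e4 \<in> F then {e4} else {})"
      using assms(7) by auto
  qed
  show ?thesis using assms(1-6,8) unfolding eq
    by (cases p; cases q; cases r; cases s) (simp_all add: insert_commute)
qed

definition tri_ineq :: "real \<Rightarrow> real \<Rightarrow> real \<Rightarrow> bool" where
  "tri_ineq a b c \<longleftrightarrow> a \<le> b + c \<and> b \<le> a + c \<and> c \<le> a + b \<and> a + b + c \<le> 2"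

lemma tri_ineqD:
  assumes "tri_ineq a b c"
  shows "a \<le> b + c" "b \<le> a + c" "c \<le> a + b" "a + b + c \<le> 2" "0 \<le> a" "0 \<le> b" "0 \<le> c" "a \<le> 1" "b \<le> 1" "c \<le> 1"
  using assms unfolding tri_ineq_def by linarith+

lemma tri_ineq_perm: "tri_ineq a b c = tri_ineq b a c" "tri_ineq a b c = tri_ineq a c b"
  by (auto simp: tri_ineq_def)

lemma tri_ineq_0: "tri_ineq 0 x x \<longleftrightarrow> 0 \<le> x \<and> x \<le> 1" "tri_ineq x 0 x \<longleftrightarrow> 0 \<le> x \<and> x \<le> 1"
  "tri_ineq x x 0 \<longleftrightarrow> 0 \<le> x \<and> x \<le> 1"
  by (auto simp: tri_ineq_def)

lemma full_metricD:
  assumes "full_metric V d" "x \<in> V" "y \<in> V"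
  shows "d x x = 0" "d x y = d y x" "0 \<le> d x y" "d x y \<le> 1" "z \<in> V \<Longrightarrow> tri_ineq (d x y) (d y z) (d x z)"
proof -
  have T: "d u w \<le> d u v + d v w \<and> d u v + d v w + d u w \<le> 2" if "u \<in> V" "v \<in> V" "w \<in> V" for u v w
    using assms(1) that by (auto simp: full_metric_def)
  show s: "d x x = 0" "d x y = d y x" using assms by (auto simp: full_metric_def)
  show "0 \<le> d x y" "d x y \<le> 1" using T[of x y x] T[of x x y] assms s by auto
  assume z: "z \<in> V"
  have "d z x = d x z" "d z y = d y z" using assms z by (auto simp: full_metric_def)
  then show "tri_ineq (d x y) (d y z) (d x z)"
    using T[of x y z] T[of y x z] T[of x z y] assms(2,3) z s by (auto simp: tri_ineq_def)
qed

lemma full_metric_4I: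
  assumes "d a a = 0" "d b b = 0" "d c c = 0" "d e e = 0"
    and "d b a = d a b" "d c a = d a c" "d e a = d a e" "d c b = d b c" "d e b = d b e" "d e c = d c e"
    and "tri_ineq (d a b) (d b c) (d a c)" "tri_ineq (d a b) (d b e) (d a e)"
      "tri_ineq (d a c) (d c e) (d a e)" "tri_ineq (d b c) (d c e) (d b e)"
  shows "full_metric {a, b, c, e} d"
  unfolding full_metric_def
proof (intro conjI ballI)
  fix u v w assume uvw: "u \<in> {a, b, c, e}" "v \<in> {a, b, c, e}" "w \<in> {a, b, c, e}"
  have eqs: "u = a \<or> u = b \<or> u = c \<or> u = e" "v = a \<or> v = b \<or> v = c \<or> v = e" "w = a \<or> w = b \<or> w = c \<or> w = e"
    using uvw by auto
  note as = assms(11-14)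
  note nn = as[THEN tri_ineqD(5)] as[THEN tri_ineqD(6)] as[THEN tri_ineqD(7)]
    as[THEN tri_ineqD(8)] as[THEN tri_ineqD(9)] as[THEN tri_ineqD(10)]
  have "tri_ineq (d u w) (d u v) (d v w)"
    using eqs as by (elim disjE) (simp_all add: assms(1-10) nn tri_ineq_0 tri_ineq_perm)
  from tri_ineqD[OF this] show "d u w \<le> d u v + d v w" "d u v + d v w + d u w \<le> 2" by auto
qed (use assms(1-10) in auto)

definition quad_ineq :: "real \<Rightarrow> real \<Rightarrow> real \<Rightarrow> real \<Rightarrow> bool" where
  "quad_ineq p q r s \<longleftrightarrow> p \<le> q + r + s \<and> q \<le> p + r + s \<and> r \<le> p + q + s \<and> s \<le> p + q + r \<and>
     p + q + r \<le> 2 + s \<and> p + q + s \<le> 2 + r \<and> p + r + s \<le> 2 + q \<and> q + r + s \<le> 2 + p"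

definition oct_metric :: "(oedge \<Rightarrow> real) \<Rightarrow> bool" where
  "oct_metric x \<longleftrightarrow>
     (\<forall>k a b c. tri_ineq (x (k, a, b)) (x (nx k, b, c)) (x (nx (nx k), c, a))) \<and>
     (\<forall>k. quad_ineq (x (k, True, True)) (x (k, True, False)) (x (k, False, True)) (x (k, False, False)))"

definition oval :: "(oedge \<Rightarrow> real) \<Rightarrow> bool option \<times> bool \<Rightarrow> bool option \<times> bool \<Rightarrow> real" where
  "oval x p q = (if fst q = nx (fst p) then x (fst p, snd p, snd q)
     else if fst p = nx (fst q) then x (fst q, snd q, snd p) else 0)"

definition oadj :: "bool option \<times> bool \<Rightarrow> bool option \<times> bool \<Rightarrow> bool" where
  "oadj p q \<longleftrightarrow> fst p \<noteq> fst q"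

lemma nx_eq: "nx k = nx l \<longleftrightarrow> k = l" "k = nx l \<longleftrightarrow> nx (nx k) = l" "nx (nx k) = nx l \<longleftrightarrow> nx k = l"
  "k \<noteq> nx k" "k \<noteq> nx (nx k)" "nx k \<noteq> nx (nx k)"
  by (cases k; cases l; auto simp: nx_def)+

lemma oct_metric_iff:
  "x \<in> cycle_polytope oct_cycles \<longleftrightarrow> oct_metric (($) x)"
proof -
  have tw: "cyc_weight (oct_tri k a b c) F z =
      (if (k, a, b) \<in> F then 1 - z (k, a, b) else z (k, a, b)) +
      (if (nx k, b, c) \<in> F then 1 - z (nx k, b, c) else z (nx k, b, c)) +
      (if (nx (nx k), c, a) \<in> F then 1 - z (nx (nx k), c, a) else z (nx (nx k), c, a))"
    for k :: "bool option" and a b c F z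
    by (simp add: cyc_weight_def oct_tri_def nx3 nx_eq)
  have qw: "cyc_weight (oct_quad k) F z =
      (if (k, True, True) \<in> F then 1 - z (k, True, True) else z (k, True, True)) +
      (if (k, True, False) \<in> F then 1 - z (k, True, False) else z (k, True, False)) +
      (if (k, False, True) \<in> F then 1 - z (k, False, True) else z (k, False, True)) +
      (if (k, False, False) \<in> F then 1 - z (k, False, False) else z (k, False, False))"
    for k :: "bool option" and F z
    by (simp add: cyc_weight_def oct_quad_def)
  show ?thesis
  proof
    assume x: "x \<in> cycle_polytope oct_cycles"
    then have W: "1 \<le> cyc_weight C F (($) x)" if "C \<in> oct_cycles" "F \<subseteq> C" "odd (card F)" for C F
      using that by (auto simp: cycle_polytope_def)
    show "oct_metric (($) x)"
      unfolding oct_metric_def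
    proof (intro conjI allI)
      fix k a b c
      let ?C = "oct_tri k a b c"
      have "1 \<le> cyc_weight ?C {(k, a, b)} (($) x)" "1 \<le> cyc_weight ?C {(nx k, b, c)} (($) x)"
        "1 \<le> cyc_weight ?C {(nx (nx k), c, a)} (($) x)"
        "1 \<le> cyc_weight ?C {(k, a, b), (nx k, b, c), (nx (nx k), c, a)} (($) x)"
        by (intro W[OF oct_tri_rotate]; simp add: oct_tri_def nx3 nx_eq)+
      then show "tri_ineq (x $ (k, a, b)) (x $ (nx k, b, c)) (x $ (nx (nx k), c, a))"
        unfolding tw by (simp add: tri_ineq_def nx3 nx_eq)
    next
      fix k :: "bool option"
      let ?a = "(k, True, True)" and ?b = "(k, True, False)" and ?c = "(k, False, True)" and ?d = "(k, False, False)"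
      have C: "oct_quad k \<in> oct_cycles" by (simp add: oct_cycles_def)
      have "1 \<le> cyc_weight (oct_quad k) {?a} (($) x)" "1 \<le> cyc_weight (oct_quad k) {?b} (($) x)"
        "1 \<le> cyc_weight (oct_quad k) {?c} (($) x)" "1 \<le> cyc_weight (oct_quad k) {?d} (($) x)"
        "1 \<le> cyc_weight (oct_quad k) {?a, ?b, ?c} (($) x)" "1 \<le> cyc_weight (oct_quad k) {?a, ?b, ?d} (($) x)"
        "1 \<le> cyc_weight (oct_quad k) {?a, ?c, ?d} (($) x)" "1 \<le> cyc_weight (oct_quad k) {?b, ?c, ?d} (($) x)"
        by (intro W[OF C]; simp add: oct_quad_def)+
      then show "quad_ineq (x $ ?a) (x $ ?b) (x $ ?c) (x $ ?d)"
        unfolding qw by (simp add: quad_ineq_def)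
    qed
  next
    assume m: "oct_metric (($) x)"
    have t: "tri_ineq (x $ (k, a, b)) (x $ (nx k, b, c)) (x $ (nx (nx k), c, a))" for k a b c
      using m by (simp add: oct_metric_def)
    have q: "quad_ineq (x $ (k, True, True)) (x $ (k, True, False)) (x $ (k, False, True)) (x $ (k, False, False))" for k
      using m by (simp add: oct_metric_def)
    have T: "1 \<le> cyc_weight (oct_tri k a b c) F (($) x)"
      if "F \<subseteq> oct_tri k a b c" "odd (card F)" for k a b c F
    proof -
      have "F = {(k, a, b)} \<or> F = {(nx k, b, c)} \<or> F = {(nx (nx k), c, a)} \<or> F = oct_tri k a b c"
        unfolding oct_tri_def by (rule odd_subset_3) (use that in \<open>auto simp: oct_tri_def nx3 nx_eq\<close>)
      then show ?thesis
        using t[of k a b c] unfolding tw tri_ineq_def by (elim disjE) (simp_all add: oct_tri_def nx3 nx_eq)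
    qed
    have Q: "1 \<le> cyc_weight (oct_quad k) F (($) x)" if "F \<subseteq> oct_quad k" "odd (card F)" for k F
    proof -
      have "F = {(k, True, True)} \<or> F = {(k, True, False)} \<or> F = {(k, False, True)} \<or> F = {(k, False, False)} \<or>
        F = {(k, True, True), (k, True, False), (k, False, True)} \<or>
        F = {(k, True, True), (k, True, False), (k, False, False)} \<or>
        F = {(k, True, True), (k, False, True), (k, False, False)} \<or>
        F = {(k, True, False), (k, False, True), (k, False, False)}"
        by (rule odd_subset_4) (use that in \<open>auto simp: oct_quad_def\<close>)
      then show ?thesis
        using q[of k] unfolding qw quad_ineq_def by (elim disjE) simp_all
    qed
    have "0 \<le> x $ e \<and> x $ e \<le> 1" for e
      by (cases e) (use tri_ineqD(5,8)[OF t] in auto)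
    then show "x \<in> cycle_polytope oct_cycles"
      unfolding cycle_polytope_def oct_cycles_def using T Q by auto
  qed
qed

text \<open>Toggling \<open>s\<close> in the random set complements exactly the separations of pairs
  with one end \<open>s\<close>. It serves to turn a coordinate 1 into a coordinate 0.\<close>

lemma cut_repr_switch:
  assumes "cut_repr V R (\<lambda>p q. if (p = s) \<noteq> (q = s) then 1 - d p q else d p q)"
  shows "cut_repr V R d"
proof -
  obtain r where r: "\<And>p q. p \<in> V \<Longrightarrow> q \<in> V \<Longrightarrow> R p q \<Longrightarrow>
      measure_pmf.prob r (sep p q) = (if (p = s) \<noteq> (q = s) then 1 - d p q else d p q)"
    using assms unfolding cut_repr_def by blast
  have "measure_pmf.prob (map_pmf (\<lambda>A. sym_diff A {s}) r) (sep p q) = d p q"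
    if "p \<in> V" "q \<in> V" "R p q" for p q
  proof -
    have "(\<lambda>A. sym_diff A {s}) -` sep p q = (if (p = s) \<noteq> (q = s) then - sep p q else sep p q)"
      by (auto simp: sep_def)
    moreover have "measure_pmf.prob r (- sep p q) = 1 - measure_pmf.prob r (sep p q)"
      using measure_pmf.prob_compl[of "sep p q" r] by (simp add: Compl_eq_Diff_UNIV)
    ultimately show ?thesis using r[OF that] by (auto split: if_splits)
  qed
  then show ?thesis unfolding cut_repr_def by blast
qed

text \<open>An edge of length 0 can be contracted by identifying \<open>v\<close> with
  \<open>u\<close>. The five remaining vertices form the complete graph without the pair
  \<open>w\<close>, \<open>w'\<close>: two complete graphs on four vertices glued along the triangle
  \<open>u\<close>, \<open>u'\<close>, \<open>v'\<close>.\<close>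

lemma oct_zero:
  assumes m: "oct_metric x" and z: "x (k, a, b) = 0"
  shows "cut_repr UNIV oadj (oval x)"
proof -
  define u u' v v' w w' where p: "u = (k, a)" "u' = (k, \<not> a)" "v = (nx k, b)" "v' = (nx k, \<not> b)"
    "w = (nx (nx k), True)" "w' = (nx (nx k), False)"
  have T: "tri_ineq (x (k, a, b)) (x (nx k, b, c)) (x (nx (nx k), c, a))" for k a b c
    using m by (simp add: oct_metric_def)
  have Q: "quad_ineq (x (k, True, True)) (x (k, True, False)) (x (k, False, True)) (x (k, False, False))" for k
    using m by (simp add: oct_metric_def)
  have eq: "x (nx k, b, c) = x (nx (nx k), c, a)" for c
    using T[of k a b c] z by (simp add: tri_ineq_def)
  have q3: "tri_ineq (x (k, a, \<not> b)) (x (k, \<not> a, b)) (x (k, \<not> a, \<not> b))"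
    using Q[of k] z by (cases a; cases b) (simp_all add: tri_ineq_def quad_ineq_def)
  \<comment> \<open>After the contraction \<open>u\<close> and \<open>u'\<close> are joined by the
    former edge between \<open>u'\<close> and \<open>v\<close>, whose length is used for this
    pair.\<close>
  define d where "d p q = (if p = u \<and> q = u' \<or> p = u' \<and> q = u then x (k, \<not> a, b) else oval x p q)" for p q
  have cov: "y \<in> {u, u', v, v', w, w'}" for y
    using nx_cases[of "fst y" k] unfolding p by (cases y) auto
  have F: "full_metric {u, u', v', y} d" if "y = (nx (nx k), c)" for y c
  proof (rule full_metric_4I)
    show "tri_ineq (d u u') (d u' v') (d u v')"
      using q3 by (simp add: d_def oval_def p nx3 nx_eq tri_ineq_perm)
    show "tri_ineq (d u u') (d u' y) (d u y)"
      using T[of k "\<not> a" b c] eq[of c] by (simp add: d_def oval_def p that nx3 nx_eq tri_ineq_perm)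
    show "tri_ineq (d u v') (d v' y) (d u y)" "tri_ineq (d u' v') (d v' y) (d u' y)"
      using T[of k a "\<not> b" c] T[of k "\<not> a" "\<not> b" c]
      by (simp_all add: d_def oval_def p that nx3 nx_eq tri_ineq_perm)
  qed (simp_all add: d_def oval_def p that nx3 nx_eq)
  define R where "R p q \<longleftrightarrow> {p, q} \<noteq> {w, w'}" for p q
  have "cut_repr {u, u', v', w} R d" "cut_repr {u, u', v', w'} R d"
    using good_small[of "{u, u', v', w}" R] good_small[of "{u, u', v', w'}" R] F[of w True] F[of w' False]
    unfolding good_def p by (simp_all add: card_insert_if nx_eq nx3)
  note AB = this
  have I: "{u, u', v', w} \<inter> {u, u', v', w'} = {u, u', v'}" unfolding p by (auto simp: nx_eq nx3)
  have "cut_repr ({u, u', v', w} \<union> {u, u', v', w'}) R d"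
  proof (rule cut_repr_glue[OF AB, of u u' v'])
    show "{u, u', v', w} \<inter> {u, u', v', w'} = {} \<or> {u, u', v', w} \<inter> {u, u', v', w'} = {u, u', v'}"
      using I by blast
    show "R y y'" if "y \<in> {u, u', v', w} \<inter> {u, u', v', w'}" "y' \<in> {u, u', v', w} \<inter> {u, u', v', w'}" for y y'
      using that unfolding I unfolding R_def p by (auto simp: nx_eq nx3 doubleton_eq_iff)
    show "\<not> R y y' \<and> \<not> R y' y" if "y \<in> {u, u', v', w} - {u, u', v', w'}" "y' \<in> {u, u', v', w'} - {u, u', v', w}" for y y'
      using that unfolding R_def by auto
  qed
  then show ?thesis
  proof (rule cut_repr_pullback[where g = "\<lambda>y. if y = v then u else y"])
    show "(if y = v then u else y) \<in> {u, u', v', w} \<union> {u, u', v', w'}" for y using cov[of y] by auto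
    fix y y' assume "oadj y y'"
    then show "R (if y = v then u else y) (if y' = v then u else y') \<and>
        oval x y y' = d (if y = v then u else y) (if y' = v then u else y')"
      using cov[of y] cov[of y'] z eq[of True] eq[of False]
      unfolding insert_iff empty_iff
      by (elim disjE) (simp_all add: R_def d_def oval_def oadj_def p nx3 nx_eq doubleton_eq_iff)
  qed
qed

text \<open>Switching at the end \<open>(k, a)\<close> of the edge permutes the odd-set inequalities
  and sends the value 1 to 0.\<close>

lemma oct_one:
  assumes m: "oct_metric x" and z: "x (k, a, b) = 1"
  shows "cut_repr UNIV oadj (oval x)"
proof -
  define y where "y e = (case e of (l, c, f) \<Rightarrow>
    if l = k \<and> c = a \<or> nx l = k \<and> f = a then 1 - x (l, c, f) else x (l, c, f))" for e
  have T: "tri_ineq (x (k, a, b)) (x (nx k, b, c)) (x (nx (nx k), c, a))" for k a b c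
    using m by (simp add: oct_metric_def)
  have Q: "quad_ineq (x (k, True, True)) (x (k, True, False)) (x (k, False, True)) (x (k, False, False))" for k
    using m by (simp add: oct_metric_def)
  have tf: "tri_ineq (1 - p) (1 - q) r = tri_ineq p q r" "tri_ineq (1 - p) q (1 - r) = tri_ineq p q r"
    "tri_ineq p (1 - q) (1 - r) = tri_ineq p q r" for p q r
    by (auto simp: tri_ineq_def)
  have qf: "quad_ineq (1 - p) (1 - q) r s = quad_ineq p q r s" "quad_ineq p q (1 - r) (1 - s) = quad_ineq p q r s"
    "quad_ineq (1 - p) q (1 - r) s = quad_ineq p q r s" "quad_ineq p (1 - q) r (1 - s) = quad_ineq p q r s"
    for p q r s
    by (auto simp: quad_ineq_def)
  have "oct_metric y"
    unfolding oct_metric_def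
  proof (intro conjI allI)
    fix l c f g
    consider (1) "l = k" | (2) "l = nx k" | (3) "l = nx (nx k)" using nx_cases by blast
    then show "tri_ineq (y (l, c, f)) (y (nx l, f, g)) (y (nx (nx l), g, c))"
    proof cases
      case 1
      show ?thesis unfolding 1 using T[of k c f g] by (cases "c = a") (simp_all add: y_def nx3 nx_eq tf)
    next
      case 2
      show ?thesis unfolding 2 using T[of "nx k" c f g] by (cases "g = a") (simp_all add: y_def nx3 nx_eq tf)
    next
      case 3
      show ?thesis unfolding 3 using T[of "nx (nx k)" c f g] by (cases "f = a") (simp_all add: y_def nx3 nx_eq tf)
    qed
  next
    fix l
    consider (1) "l = k" | (2) "l = nx k" | (3) "l = nx (nx k)" using nx_cases by blast
    then show "quad_ineq (y (l, True, True)) (y (l, True, False)) (y (l, False, True)) (y (l, False, False))"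
    proof cases
      case 1
      show ?thesis unfolding 1 using Q[of k] by (cases a) (simp_all add: y_def nx3 nx_eq qf)
    next
      case 2
      show ?thesis unfolding 2 using Q[of "nx k"] by (simp add: y_def nx3 nx_eq)
    next
      case 3
      show ?thesis unfolding 3 using Q[of "nx (nx k)"] by (cases a) (simp_all add: y_def nx3 nx_eq qf)
    qed
  qed
  moreover have "y (k, a, b) = 0" using z by (simp add: y_def)
  ultimately have "cut_repr UNIV oadj (oval y)" by (rule oct_zero)
  moreover have "(if (p = (k, a)) \<noteq> (q = (k, a)) then 1 - oval x p q else oval x p q) = oval y p q"
    if "oadj p q" for p q
  proof -
    obtain l c m f where pq: "p = (l, c)" "q = (m, f)" by fastforce
    have "m = nx l \<or> m = nx (nx l)" using that nx_cases[of m l] by (auto simp: oadj_def pq)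
    then show ?thesis
    proof
      assume m: "m = nx l"
      have "oval z p q = z (l, c, f)" for z by (simp add: oval_def pq m)
      moreover have "\<not> (l = k \<and> nx l = k)" using nx3(2)[of l] by metis
      ultimately show ?thesis by (auto simp: y_def pq m)
    next
      assume m: "m = nx (nx l)"
      have "nx m = l" "m \<noteq> nx l" unfolding m by (simp_all add: nx3)
      then have "oval z p q = z (m, f, c)" for z by (auto simp: oval_def pq)
      moreover have "\<not> (m = k \<and> nx m = k)" using nx3(2)[of m] by metis
      ultimately show ?thesis using \<open>nx m = l\<close> by (auto simp: y_def pq)
    qed
  qed
  ultimately have "cut_repr UNIV oadj (\<lambda>p q. if (p = (k, a)) \<noteq> (q = (k, a)) then 1 - oval x p q else oval x p q)"
    unfolding cut_repr_def by simp
  then show ?thesis by (rule cut_repr_switch)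
qed

lemma convex_cut_repr: "convex {x. cut_repr UNIV oadj (oval (($) (x :: real ^ oedge)))}"
proof (rule convexI)
  fix x y :: "real ^ oedge" and s t :: real
  assume h: "x \<in> {x. cut_repr UNIV oadj (oval (($) x))}" "y \<in> {x. cut_repr UNIV oadj (oval (($) x))}"
    "0 \<le> s" "0 \<le> t" "s + t = 1"
  obtain p q where p: "\<And>u v. oadj u v \<Longrightarrow> measure_pmf.prob p (sep u v) = oval (($) x) u v"
    and q: "\<And>u v. oadj u v \<Longrightarrow> measure_pmf.prob q (sep u v) = oval (($) y) u v"
    using h(1,2) unfolding cut_repr_def by auto
  define r where "r = bernoulli_pmf s \<bind> (\<lambda>c. if c then p else q)"
  have t: "t = 1 - s" using h by simp
  have "measure_pmf.prob r A = s * measure_pmf.prob p A + t * measure_pmf.prob q A" for A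
  proof -
    have m: "measure_pmf.prob r' A = pmf (map_pmf (\<lambda>x. x \<in> A) r') True" for r' :: "(bool option \<times> bool) set pmf"
      by (simp add: pmf_map vimage_def)
    show ?thesis
      unfolding m unfolding r_def map_bind_pmf pmf_bind using h by (simp add: t)
  qed
  then have "measure_pmf.prob r (sep u v) = oval (($) (s *\<^sub>R x + t *\<^sub>R y)) u v" if "oadj u v" for u v
    using p[OF that] q[OF that] by (simp add: oval_def)
  then show "s *\<^sub>R x + t *\<^sub>R y \<in> {x. cut_repr UNIV oadj (oval (($) x))}"
    unfolding cut_repr_def by blast
qed

text \<open>The edge values of a metric lie in the cycle polytope, which is the hull of its extreme
  points. Each of these has a coordinate 0 or 1, hence is a cut mixture by contraction or switching,
  and cut mixtures form a convex set.\<close>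

lemma good_octahedron:
  assumes V: "V = {u, u', v, v', w, w'}" and c6: "card V = 6"
    and R: "\<not> R u u'" "\<not> R u' u" "\<not> R v v'" "\<not> R v' v" "\<not> R w w'" "\<not> R w' w" "\<And>x. \<not> R x x"
  shows "good V R"
  unfolding good_def
proof (intro allI impI)
  fix d assume d: "full_metric V d"
  define pt where "pt y = (case y of (None, a) \<Rightarrow> if a then u else u' | (Some False, a) \<Rightarrow> if a then v else v'
    | (Some True, a) \<Rightarrow> if a then w else w')" for y :: "bool option \<times> bool"
  have ptV: "pt y \<in> V" for y unfolding V pt_def by (auto split: option.splits bool.splits prod.splits)
  define x :: "real ^ oedge" where "x = (\<chi> e. case e of (k, a, b) \<Rightarrow> d (pt (k, a)) (pt (nx k, b)))"
  have xe: "x $ (k, a, b) = d (pt (k, a)) (pt (nx k, b))" for k a b by (simp add: x_def)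
  note D = full_metricD[OF d ptV ptV]
  have "oct_metric (($) x)"
    unfolding oct_metric_def
  proof (intro conjI allI)
    fix k a b c
    have "d (pt (k, a)) (pt (nx (nx k), c)) = d (pt (nx (nx k), c)) (pt (k, a))" by (rule D(2))
    then show "tri_ineq (x $ (k, a, b)) (x $ (nx k, b, c)) (x $ (nx (nx k), c, a))"
      using D(5)[OF ptV, of "(k, a)" "(nx k, b)" "(nx (nx k), c)"] by (simp add: xe nx3)
  next
    fix k
    let ?p = "pt (k, True)" and ?p' = "pt (k, False)" and ?q = "pt (nx k, True)" and ?q' = "pt (nx k, False)"
    \<comment> \<open>The four-cycle inequalities follow from the two triangles on the diagonal
      between \<open>?p\<close> and \<open>?p'\<close>, a pair that has a distance without being an
      edge.\<close>
    have "tri_ineq (d ?p ?q) (d ?q ?p') (d ?p ?p')" "tri_ineq (d ?p ?q') (d ?q' ?p') (d ?p ?p')"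
      by (rule D(5)[OF ptV])+
    moreover have "d ?q ?p' = d ?p' ?q" "d ?q' ?p' = d ?p' ?q'" by (rule D(2))+
    ultimately show "quad_ineq (x $ (k, True, True)) (x $ (k, True, False)) (x $ (k, False, True)) (x $ (k, False, False))"
      by (simp add: xe quad_ineq_def tri_ineq_def)
  qed
  then have "x \<in> cycle_polytope oct_cycles" by (simp add: oct_metric_iff)
  also have "cycle_polytope oct_cycles = convex hull {x. x extreme_point_of cycle_polytope oct_cycles}"
    by (intro Krein_Milman_Minkowski compact_convex_cycle_polytope)
  also have "\<dots> \<subseteq> {x. cut_repr UNIV oadj (oval (($) x))}"
  proof (rule hull_minimal[where S = convex, OF _ convex_cut_repr], rule subsetI)
    fix y assume "y \<in> {x. x extreme_point_of cycle_polytope oct_cycles}"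
    then have y: "y extreme_point_of cycle_polytope oct_cycles" by simp
    then have "oct_metric (($) y)" unfolding oct_metric_iff[symmetric] by (simp add: extreme_point_of_def)
    moreover obtain e where "y $ e = 0 \<or> y $ e = 1"
      using extreme_point_integral[OF y card_oct_cycles card_oct_cycle] by blast
    ultimately show "y \<in> {x. cut_repr UNIV oadj (oval (($) x))}"
      using oct_zero[of "($) y"] oct_one[of "($) y"] by (cases e) auto
  qed
  finally have x: "cut_repr UNIV oadj (oval (($) x))" by simp
  have dis: "distinct [u, u', v, v', w, w']" using c6 unfolding V
    by (simp add: card_insert_if split: if_splits)
  define g where "g z = (if z = u then (None, True) else if z = u' then (None, False)
    else if z = v then (Some False, True) else if z = v' then (Some False, False)
    else if z = w then (Some True, True) else (Some True, False))" for z
  show "cut_repr V R d"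
  proof (rule cut_repr_pullback[OF x, of _ g])
    fix y z assume yz: "y \<in> V" "z \<in> V" "R y z"
    have pg: "pt (g q) = q" if "q \<in> V" for q using that dis unfolding V by (auto simp: g_def pt_def)
    have adj: "oadj (g y) (g z)" using yz R dis unfolding V oadj_def g_def by (auto split: if_splits)
    have dyz: "d y z = d z y" using full_metricD(2)[OF d yz(1,2)] .
    obtain k a l b where gk: "g y = (k, a)" "g z = (l, b)" by fastforce
    have y': "y = pt (k, a)" "z = pt (l, b)" using pg[OF yz(1)] pg[OF yz(2)] gk by auto
    have "l = nx k \<or> l = nx (nx k)" using adj nx_cases[of l k] gk by (auto simp: oadj_def)
    then have "oval (($) x) (g y) (g z) = d y z"
    proof
      assume "l = nx k"
      then have "z = pt (nx k, b)" using y' by simp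
      then show ?thesis using \<open>l = nx k\<close> y'(1) unfolding gk by (simp add: oval_def xe)
    next
      assume "l = nx (nx k)"
      then have "nx l = k" "z = pt (l, b)" "l \<noteq> nx k" using y' by (simp_all add: nx3)
      then show ?thesis using y'(1) unfolding gk dyz by (auto simp: oval_def xe)
    qed
    then show "oadj (g y) (g z) \<and> d y z = oval (($) x) (g y) (g z)" using adj by simp
  qed simp
qed

section \<open>Graphs without the two block patterns\<close>

lemma component_mono_eq:
  assumes "symp adj" "x \<in> W" "y \<in> component adj W x"
  shows "component adj W x \<subseteq> component adj W y"
  using component[OF assms(1,2)] assms(3) unfolding component_def[of adj W y] by blast

lemma two_elements:
  assumes "2 \<le> card X"
  obtains x y where "x \<in> X" "y \<in> X" "x \<noteq> y"
proof -
  have "finite X" using assms card.infinite by fastforce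
  then show ?thesis using assms that card_le_Suc0_iff_eq[of X] by fastforce
qed

lemma card_Diff_ge: "finite T \<Longrightarrow> card T \<le> k \<Longrightarrow> m + k \<le> card X \<Longrightarrow> m \<le> card (X - T)"
  using diff_card_le_card_Diff[of T X] by linarith

text \<open>Every other component of \<open>D\<close> without \<open>d\<close> remains attached to
  \<open>d\<close>.\<close>

lemma conn_minus_component:
  assumes "symp adj" "conn adj D" "d \<in> D" "x \<in> D - {d}"
  shows "conn adj (D - component adj (D - {d}) x)"
proof -
  let ?E = "component adj (D - {d}) x"
  note E = component[OF assms(1) assms(4)]
  show ?thesis
  proof (rule connI_closed[of d, OF _ assms(1)])
    show "d \<in> D - ?E" using assms(3) E(2) by blast
    fix Y assume Y: "Y \<subseteq> D - ?E" "d \<in> Y" "\<And>y z. y \<in> Y \<Longrightarrow> z \<in> D - ?E - Y \<Longrightarrow> \<not> adj y z"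
    have "D \<subseteq> Y \<union> ?E"
    proof (rule conn_closed[OF assms(2)])
      show "D \<inter> (Y \<union> ?E) \<noteq> {}" using Y(2) assms(3) by blast
      fix y z assume yz: "y \<in> (Y \<union> ?E) \<inter> D" "z \<in> D - (Y \<union> ?E)"
      then have "z \<noteq> d" using Y(2) by blast
      then show "\<not> adj y z" using yz Y(3)[of y z] E(4)[of y z] by blast
    qed
    then show "Y = D - ?E" using Y(1) by blast
  qed
qed

locale cgraph =
  fixes V :: "'a set" and adj :: "'a \<Rightarrow> 'a \<Rightarrow> bool"
  assumes fin: "finite V" and sy: "symp adj" and irr: "\<not> adj x x" and cls: "cls V adj"
begin

lemma adj_sym: "adj x y \<Longrightarrow> adj y x"
  using sy by (rule sympD)

lemmas K5F = K5_False[OF conjunct1[OF cls[unfolded cls_def]] sy]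
lemmas C5F = C5_False[OF conjunct2[OF cls[unfolded cls_def]] sy]
lemmas common = common_neighbour[OF conjunct2[OF cls[unfolded cls_def]] sy]

definition nb :: "'a set \<Rightarrow> 'a set" where
  "nb X = {v \<in> V - X. \<exists>x\<in>X. adj x v}"

text \<open>Shrink \<open>B\<close> to a smallest connected \<open>Z\<close> touching all of
  \<open>S\<close>; nonadjacent vertices of \<open>S\<close> have a common neighbour in
  \<open>Z\<close>. If \<open>Z\<close> is no singleton, two removable vertices \<open>z1\<close>,
  \<open>z2\<close> have private neighbours \<open>s1\<close>, \<open>s2\<close>. These are adjacent
  because they have no common neighbour in \<open>Z\<close>, and \<open>z1\<close>,
  \<open>z2\<close> are adjacent because a longer link would close to a pentagon.\<close>

lemma dominate:
  assumes "conn adj B" "B \<subseteq> V" "conn adj A" "A \<subseteq> V" "A \<inter> B = {}" "\<not> touch adj A B"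
    and "S \<subseteq> V" "S \<inter> (A \<union> B) = {}" "\<And>s. s \<in> S \<Longrightarrow> touch adj {s} A" "\<And>s. s \<in> S \<Longrightarrow> touch adj {s} B"
  obtains b where "b \<in> B" "\<And>s. s \<in> S \<Longrightarrow> adj s b"
  | z1 z2 s1 s2 where "z1 \<in> B" "z2 \<in> B" "s1 \<in> S" "s2 \<in> S" "z1 \<noteq> z2" "s1 \<noteq> s2"
      "adj s1 s2" "adj z1 z2" "adj s1 z1" "adj s2 z2" "\<not> adj s1 z2" "\<not> adj s2 z1"
      "\<And>w. w \<in> S - {s1, s2} \<Longrightarrow> (adj w s1 \<or> adj w z1) \<and> (adj w s2 \<or> adj w z2)"
proof -
  let ?P = "\<lambda>Z. conn adj Z \<and> Z \<subseteq> B \<and> (\<forall>s\<in>S. touch adj {s} Z)"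
  have "?P B" using assms by blast
  then obtain Z where Z: "?P Z" and mn: "\<And>Y. ?P Y \<Longrightarrow> card Z \<le> card Y"
    using ex_has_least_nat[of ?P B card] by blast
  have fZ: "finite Z" using Z assms(2) fin finite_subset by (metis (no_types))
  have com: "\<exists>x\<in>Z. adj s x \<and> adj t x" if "s \<in> S" "t \<in> S" "s \<noteq> t" "\<not> adj s t" for s t
  proof (rule common[OF fZ])
    show "\<not> touch adj A Z" using assms(6) Z by (auto simp: touch_def)
  qed (use Z assms that in auto)
  show ?thesis
  proof (cases "\<exists>b. Z = {b}")
    case True
    then show ?thesis using that(1) Z by auto
  next
    case False
    have priv: "\<exists>s\<in>S. adj s z \<and> \<not> touch adj {s} (Z - {z})" if z: "z \<in> Z" "conn adj (Z - {z})" for z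
    proof (rule ccontr)
      assume n: "\<not> ?thesis"
      have "touch adj {s} (Z - {z})" if "s \<in> S" for s
        using Z that n by (cases "adj s z") (auto simp: touch_def)
      then have "?P (Z - {z})" using z Z by blast
      then have "card Z \<le> card (Z - {z})" by (rule mn)
      then show False using fZ z by (metis card_Diff1_less leD)
    qed
    obtain z0 where z0: "z0 \<in> Z" using Z conn_ne by blast
    obtain z1 where z1: "z1 \<in> Z" "conn adj (Z - {z1})"
      using exists_noncut[OF sy fZ _ z0] Z False by metis
    obtain z2 where z2: "z2 \<in> Z" "z2 \<noteq> z1" "conn adj (Z - {z2})"
      using exists_noncut[OF sy fZ _ z1(1)] Z False by metis
    obtain s1 where s1: "s1 \<in> S" "adj s1 z1" "\<not> touch adj {s1} (Z - {z1})" using priv[OF z1] by blast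
    obtain s2 where s2: "s2 \<in> S" "adj s2 z2" "\<not> touch adj {s2} (Z - {z2})" using priv[OF z2(1,3)] by blast
    have p1: "\<not> adj s1 z" if "z \<in> Z" "z \<noteq> z1" for z using s1(3) that by (auto simp: touch_def)
    have p2: "\<not> adj s2 z" if "z \<in> Z" "z \<noteq> z2" for z using s2(3) that by (auto simp: touch_def)
    have ne: "s1 \<noteq> s2" using p1[of z2] z2 s2 by auto
    have ss: "adj s1 s2"
    proof (rule ccontr)
      assume "\<not> adj s1 s2"
      then obtain x where "x \<in> Z" "adj s1 x" "adj s2 x" using com[OF s1(1) s2(1) ne] by blast
      then show False using p1[of x] p2[of x] z2(2) by auto
    qed
    have zz: "adj z1 z2"
    proof (rule ccontr)
      assume n: "\<not> adj z1 z2"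
      obtain C where C: "conn adj C" "C \<subseteq> Z - {z1, z2}" "touch adj {z1} C" "touch adj {z2} C"
        using link[OF sy _ z1(1) z2(1) z2(2)[symmetric] n] Z by blast
      have 1: "\<not> touch adj {s1} C" using p1 C(2) by (auto simp: touch_def)
      have "\<not> touch adj {s2} C" using p2 C(2) by (auto simp: touch_def)
      then have 2: "\<not> touch adj C {s2}" using touch_sym[OF sy] by blast
      have 3: "touch adj C {z2}" using C(4) touch_sym[OF sy] by blast
      have sub: "C \<subseteq> V" "z1 \<in> V" "z2 \<in> V" "s1 \<in> V" "s2 \<in> V" "s1 \<notin> Z" "s2 \<notin> Z"
        using C(2) Z assms(2,7,8) z1 z2 s1 s2 by auto
      have q: "\<not> adj z1 s2" using p2[OF z1(1)] z2(2) adj_sym[of z1 s2] by auto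
      show False
        by (rule C5F[of "{s1}" "{z1}" C "{z2}" "{s2}"])
          (use C 1 2 3 sub n ss s1(2) adj_sym[OF s2(2)] z1(1) z2(1,2) ne p1[of z2] q in auto)
    qed
    have w: "(adj w s1 \<or> adj w z1) \<and> (adj w s2 \<or> adj w z2)" if w: "w \<in> S - {s1, s2}" for w
    proof (intro conjI disjCI)
      assume "\<not> adj w z1"
      show "adj w s1"
      proof (rule ccontr)
        assume "\<not> adj w s1"
        then obtain x where "x \<in> Z" "adj w x" "adj s1 x" using com[of w s1] w s1 by blast
        then show False using p1[of x] \<open>\<not> adj w z1\<close> by auto
      qed
    next
      assume "\<not> adj w z2"
      show "adj w s2"
      proof (rule ccontr)
        assume "\<not> adj w s2"
        then obtain x where "x \<in> Z" "adj w x" "adj s2 x" using com[of w s2] w s2 by blast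
        then show False using p2[of x] \<open>\<not> adj w z2\<close> by auto
      qed
    qed
    have "\<not> adj s1 z2" "\<not> adj s2 z1" using p1[of z2] p2[of z1] z1 z2 by auto
    then show ?thesis using that(2)[of z1 z2 s1 s2] Z z1 z2 s1 s2 ne ss zz w by blast
  qed
qed

lemma dominate_independent:
  assumes "conn adj B" "B \<subseteq> V" "conn adj A" "A \<subseteq> V" "A \<inter> B = {}" "\<not> touch adj A B"
    and "S \<subseteq> V" "S \<inter> (A \<union> B) = {}" "\<And>s. s \<in> S \<Longrightarrow> touch adj {s} A" "\<And>s. s \<in> S \<Longrightarrow> touch adj {s} B"
    and "\<And>s t. s \<in> S \<Longrightarrow> t \<in> S \<Longrightarrow> \<not> adj s t"
  obtains b where "b \<in> B" "\<And>s. s \<in> S \<Longrightarrow> adj s b"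
proof (rule dominate[OF assms(1-10)])
  show thesis if "b \<in> B" "\<And>s. s \<in> S \<Longrightarrow> adj s b" for b
    by (rule \<open>\<And>b. b \<in> B \<Longrightarrow> (\<And>s. s \<in> S \<Longrightarrow> adj s b) \<Longrightarrow> thesis\<close>) (fact that)+
  show thesis if "s1 \<in> S" "s2 \<in> S" "adj s1 s2" for s1 s2
    using assms(11)[OF that(1,2)] that(3) by contradiction
qed

text \<open>Four pairwise linked pieces around the cycle \<open>s1, z1, z2, s2\<close> together with the apex \<open>a\<close>:
  every vertex of \<open>S\<close> off the cycle lies in its own component of the rest, and two such
  components provide the missing diagonals.\<close>

lemma dominating_pair_False:
  assumes four: "\<And>X. X \<subseteq> V \<Longrightarrow> X \<noteq> {} \<Longrightarrow> V - X - nb X \<noteq> {} \<Longrightarrow> 4 \<le> card (nb X)"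
    and S: "S \<subseteq> V" "4 \<le> card S" "a \<in> V" "a \<notin> S" "\<And>s. s \<in> S \<Longrightarrow> adj a s"
    and z: "z1 \<in> V - S - {a}" "z2 \<in> V - S - {a}" "s1 \<in> S" "s2 \<in> S" "z1 \<noteq> z2" "s1 \<noteq> s2"
      "adj s1 s2" "adj z1 z2" "adj s1 z1" "adj s2 z2"
    and w: "\<And>w. w \<in> S - {s1, s2} \<Longrightarrow> (adj w s1 \<or> adj w z1) \<and> (adj w s2 \<or> adj w z2)"
  shows False
proof -
  define U where "U = V - {a, s1, s2, z1, z2}"
  have V: "s1 \<in> V" "s2 \<in> V" "z1 \<in> V" "z2 \<in> V" "a \<in> V" using S z by auto
  have dis: "a \<noteq> s1" "a \<noteq> s2" "a \<noteq> z1" "a \<noteq> z2" "s1 \<noteq> z1" "s1 \<noteq> z2" "s2 \<noteq> z1" "s2 \<noteq> z2"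
    "s1 \<noteq> s2" "z1 \<noteq> z2" using S z by auto
  have E: "adj a s1" "adj a s2" "adj s1 s2" "adj z1 z2" "adj s1 z1" "adj s2 z2"
    "adj s1 a" "adj s2 a" "adj s2 s1" "adj z2 z1" "adj z1 s1" "adj z2 s2"
    using S z adj_sym by blast+
  have cS: "conn adj {s1, z1}" "conn adj {s2, z2}" "conn adj {z1, z2}" using conn_edge[OF sy] E by auto
  have patA: False
    if "conn adj C" "conn adj C'" "C \<subseteq> U" "C' \<subseteq> U" "C \<inter> C' = {}" "touch adj {a} C" "touch adj {a} C'"
      "touch adj {s2} C" "touch adj {z2} C" "touch adj {s1} C \<or> touch adj {z1} C" "touch adj {z2} C'" for C C'
  proof (rule K5F[of "{s1, z1}" "{s2}" "{z2}" "insert a C'" C])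
    show "conn adj (insert a C')" using conn_insert[OF sy that(2)] that(7) by blast
    show "touch adj (insert a C') C" using that by (auto simp: touch_def)
  qed (use that V dis E cS in \<open>auto simp: U_def\<close>)
  have patB: False
    if "conn adj C" "conn adj C'" "C \<subseteq> U" "C' \<subseteq> U" "C \<inter> C' = {}" "touch adj {a} C" "touch adj {a} C'"
      "touch adj {s1} C" "touch adj {z1} C" "touch adj {s2} C \<or> touch adj {z2} C" "touch adj {z1} C'" for C C'
  proof (rule K5F[of "{s2, z2}" "{s1}" "{z1}" "insert a C'" C])
    show "conn adj (insert a C')" using conn_insert[OF sy that(2)] that(7) by blast
    show "touch adj (insert a C') C" using that by (auto simp: touch_def)
  qed (use that V dis E cS in \<open>auto simp: U_def\<close>)
  have patC: False
    if "conn adj C" "conn adj C'" "C \<subseteq> U" "C' \<subseteq> U" "C \<inter> C' = {}" "touch adj {a} C" "touch adj {a} C'"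
      "touch adj {s1} C" "touch adj {s2} C" "touch adj {z2} C"
      "touch adj {s1} C'" "touch adj {s2} C'" "touch adj {z1} C'" for C C'
  proof (rule K5F[of "{a}" "{s1}" "{s2}" C "{z1, z2} \<union> C'"])
    show "conn adj ({z1, z2} \<union> C')" using conn_Un[OF sy cS(3) that(2)] that(13) by auto
    show "touch adj C ({z1, z2} \<union> C')" using that(10) adj_sym by (auto simp: touch_def)
  qed (use that V dis E cS in \<open>auto simp: U_def\<close>)
  have "2 \<le> card (S - {s1, s2})" by (rule card_Diff_ge[where k = 2]) (use S(2) in \<open>auto simp: card_insert_if\<close>)
  then obtain w w' where ww: "w \<in> S - {s1, s2}" "w' \<in> S - {s1, s2}" "w \<noteq> w'" by (rule two_elements)
  have U: "w \<in> U" "w' \<in> U" using ww S z by (auto simp: U_def)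
  define C where "C = component adj U w"
  define C' where "C' = component adj U w'"
  note c = component[OF sy U(1), folded C_def] and c' = component[OF sy U(2), folded C'_def]
  have aC: "touch adj {a} C" "touch adj {a} C'" using c(1) c'(1) S(5) ww by auto
  show False
  proof (cases "w' \<in> C")
    case True
    obtain P Q where PQ: "conn adj P" "conn adj Q" "P \<inter> Q = {}" "P \<union> Q \<subseteq> C" "w \<in> P" "w' \<in> Q" "touch adj P Q"
      using split_conn[OF sy c(3) c(1) True ww(3)] by blast
    have W: "adj s1 w \<or> adj z1 w" "adj s2 w \<or> adj z2 w" "adj s1 w' \<or> adj z1 w'" "adj s2 w' \<or> adj z2 w'"
      using w[OF ww(1)] w[OF ww(2)] adj_sym by blast+
    have aw: "adj a w" "adj a w'" using S(5) ww by auto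
    show False
    proof (rule K5F[of "{a}" "{s1, z1}" "{s2, z2}" P Q])
      show "touch adj {s1, z1} P" "touch adj {s2, z2} P" "touch adj {s1, z1} Q" "touch adj {s2, z2} Q"
        "touch adj {a} P" "touch adj {a} Q"
        using W PQ(5,6) aw by (auto simp: touch_def)
      show "{a} \<union> {s1, z1} \<union> {s2, z2} \<union> P \<union> Q \<subseteq> V" "{a} \<inter> ({s1, z1} \<union> {s2, z2} \<union> P \<union> Q) = {}"
        "{s1, z1} \<inter> ({s2, z2} \<union> P \<union> Q) = {}" "{s2, z2} \<inter> (P \<union> Q) = {}"
        using V dis PQ(4) c(2) unfolding U_def by auto
    qed (use PQ cS E in auto)
  next
    case False
    have dC: "C \<inter> C' = {}"
    proof (rule ccontr)
      assume "C \<inter> C' \<noteq> {}"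
      then have "C' \<subseteq> C" using conn_closed[OF c'(3), of C] c(4) c'(2) by blast
      then show False using False c'(1) by blast
    qed
    \<comment> \<open>All neighbours of such a component are among the apex and the four cycle
      vertices, and there are at least four of them, so at most one cycle vertex is missed.\<close>
    have key: "touch adj {x} D \<or> touch adj {y} D"
      if D: "conn adj D" "D \<subseteq> U" "\<And>p q. p \<in> D \<Longrightarrow> q \<in> U - D \<Longrightarrow> \<not> adj p q" "v \<in> U - D"
        and xy: "x \<in> {s1, s2, z1, z2}" "y \<in> {s1, s2, z1, z2}" "x \<noteq> y" for D v x y
    proof (rule ccontr)
      assume n: "\<not> ?thesis"
      have "\<not> adj p x" "\<not> adj p y" if "p \<in> D" for p using n that adj_sym by auto
      then have "nb D \<subseteq> {a, s1, s2, z1, z2} - {x, y}" using D(2,3) unfolding nb_def U_def by blast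
      then have "card (nb D) \<le> card ({a, s1, s2, z1, z2} - {x, y})" by (intro card_mono) auto
      also have "\<dots> = 3" using xy dis by auto
      finally have "card (nb D) \<le> 3" .
      moreover have "v \<in> V - D - nb D" using D(3,4) unfolding U_def nb_def by blast
      ultimately show False using four[of D] conn_ne[OF D(1)] D(2) unfolding U_def by fastforce
    qed
    have wC: "w \<in> U - C'" "w' \<in> U - C" using dC c(1) c'(1) U by auto
    note k = key[OF c(3,2,4) wC(2)] and k' = key[OF c'(3,2,4) wC(1)]
    have k1: "touch adj {s1} C \<or> touch adj {s2} C" "touch adj {s1} C \<or> touch adj {z1} C"
      "touch adj {s1} C \<or> touch adj {z2} C" "touch adj {s2} C \<or> touch adj {z1} C"
      "touch adj {s2} C \<or> touch adj {z2} C" "touch adj {z1} C \<or> touch adj {z2} C"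
      using k dis by blast+
    have k2: "touch adj {s1} C' \<or> touch adj {s2} C'" "touch adj {s1} C' \<or> touch adj {z1} C'"
      "touch adj {s1} C' \<or> touch adj {z2} C'" "touch adj {s2} C' \<or> touch adj {z1} C'"
      "touch adj {s2} C' \<or> touch adj {z2} C'" "touch adj {z1} C' \<or> touch adj {z2} C'"
      using k' dis by blast+
    have dC': "C' \<inter> C = {}" using dC by blast
    note A = patA[OF c(3) c'(3) c(2) c'(2) dC aC] patA[OF c'(3) c(3) c'(2) c(2) dC' aC(2,1)]
    note B = patB[OF c(3) c'(3) c(2) c'(2) dC aC] patB[OF c'(3) c(3) c'(2) c(2) dC' aC(2,1)]
    note C = patC[OF c(3) c'(3) c(2) c'(2) dC aC] patC[OF c'(3) c(3) c'(2) c(2) dC' aC(2,1)]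
    \<comment> \<open>The first two patterns leave only the case that one component misses exactly
      \<open>z1\<close> and the other exactly \<open>z2\<close>; this is the third pattern.\<close>
    show False using A B C k1 k2 by argo
  qed
qed

end

section \<open>Graphs whose separators all have at least four vertices\<close>

context cgraph begin

text \<open>Choose a connected \<open>B\<close> as large as possible among those that contain
  neither some vertex \<open>a\<close> nor a neighbour of it. Maximality makes everything outside
  \<open>B\<close> and its boundary \<open>S\<close> complete to \<open>S\<close>. Every further
  vertex then produces a forbidden pattern, until two poles \<open>a\<close>, \<open>b\<close> over
  a four-cycle remain.\<close>

lemma four_connected_cases:
  assumes four: "\<And>X. X \<subseteq> V \<Longrightarrow> X \<noteq> {} \<Longrightarrow> V - X - nb X \<noteq> {} \<Longrightarrow> 4 \<le> card (nb X)"
    and nc: "u0 \<in> V" "v0 \<in> V" "u0 \<noteq> v0" "\<not> adj u0 v0"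
  obtains u u' v v' w w' where "V = {u, u', v, v', w, w'}" "card V = 6"
    "\<not> adj u u'" "\<not> adj v v'" "\<not> adj w w'"
proof -
  \<comment> \<open>The boundary bound as a statement on deletions: this supplies the connected sets
    in which links are found below.\<close>
  have conn_rest: "conn adj (V - T)" if T: "finite T" "card T \<le> 3" "V - T \<noteq> {}" for T
  proof (rule ccontr)
    assume "\<not> conn adj (V - T)"
    then obtain Y where Y: "Y \<subseteq> V - T" "Y \<noteq> {}" "Y \<noteq> V - T" "\<And>y z. y \<in> Y \<Longrightarrow> z \<in> V - T - Y \<Longrightarrow> \<not> adj y z"
      using T(3) unfolding conn_def by blast
    have "nb Y \<subseteq> T" using Y(4) by (auto simp: nb_def)
    then have "card (nb Y) \<le> 3" using card_mono[OF T(1), of "nb Y"] T(2) by linarith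
    moreover have "V - Y - nb Y \<noteq> {}" using Y \<open>nb Y \<subseteq> T\<close> by blast
    ultimately show False using four[of Y] Y by fastforce
  qed
  define P where "P n \<longleftrightarrow> (\<exists>a B. a \<in> V \<and> conn adj B \<and> B \<subseteq> V \<and> (\<forall>x\<in>B. x \<noteq> a \<and> \<not> adj a x) \<and> card B = n)" for n
  have "P (card {v0})" unfolding P_def using nc by (intro exI[of _ u0] exI[of _ "{v0}"]) auto
  moreover have "\<forall>n. P n \<longrightarrow> n \<le> card V" unfolding P_def using card_mono[OF fin] by blast
  ultimately obtain n where n: "P n" and mx: "\<And>m. P m \<Longrightarrow> m \<le> n"
    using Greatest_le_nat[of P _ "card V"] GreatestI_nat[of P _ "card V"] by metis
  obtain a B where a: "a \<in> V" and B: "conn adj B" "B \<subseteq> V" "\<And>x. x \<in> B \<Longrightarrow> x \<noteq> a \<and> \<not> adj a x" and cB: "card B = n"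
    using n unfolding P_def by metis
  have mxB: "card B' \<le> card B" if "a' \<in> V" "conn adj B'" "B' \<subseteq> V" "\<And>x. x \<in> B' \<Longrightarrow> x \<noteq> a' \<and> \<not> adj a' x" for a' B'
    using mx[of "card B'"] that unfolding P_def cB by blast
  define S where "S = nb B"
  have SV: "S \<subseteq> V" "S \<inter> B = {}" by (auto simp: S_def nb_def)
  have fS: "finite S" using SV(1) fin finite_subset by blast
  have fB: "finite B" using B(2) fin finite_subset by blast
  have SB: "touch adj {s} B" "touch adj B {s}" if "s \<in> S" for s
    using that adj_sym by (auto simp: S_def nb_def touch_def)
  have aS: "a \<notin> S" "a \<notin> B" using B(3) adj_sym by (auto simp: S_def nb_def)
  have cS: "4 \<le> card S" unfolding S_def
    by (rule four) (use B(2) conn_ne[OF B(1)] a aS in \<open>auto simp: S_def\<close>)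
  \<comment> \<open>Otherwise \<open>B\<close> extended by \<open>w\<close> would be a larger
    connected set avoiding \<open>u\<close> and its neighbours.\<close>
  have full: "adj u w" if u: "u \<in> V - B - S" and w: "w \<in> S" for u w
  proof (rule ccontr)
    assume n: "\<not> adj u w"
    have nB: "\<not> adj u x" if "x \<in> B" for x using u that adj_sym[of u x] by (auto simp: S_def nb_def)
    have "card (insert w B) \<le> card B"
    proof (rule mxB)
      show "conn adj (insert w B)" using conn_insert[OF sy B(1)] SB[OF w] by blast
      show "insert w B \<subseteq> V" using B SV w by blast
      show "x \<noteq> u \<and> \<not> adj u x" if "x \<in> insert w B" for x using that n nB u w by auto
    qed (use u in auto)
    then show False using fB w SV by (metis IntI card_insert_disjoint empty_iff Suc_n_not_le_n)
  qed
  have aS': "adj a s" "adj s a" if "s \<in> S" for s using full[of a s] that a aS adj_sym by auto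
  have pick2: "\<exists>s3 s4. s3 \<in> S - {x, y} \<and> s4 \<in> S - {x, y} \<and> s3 \<noteq> s4" for x y
  proof -
    have "2 \<le> card (S - {x, y})" by (rule card_Diff_ge[where k = 2]) (use cS in \<open>auto simp: card_insert_if\<close>)
    then show ?thesis by (metis two_elements)
  qed
  \<comment> \<open>A second pole \<open>a2\<close> would be complete to \<open>S\<close> as well.
    With \<open>a\<close>, \<open>a2\<close> and \<open>B\<close> over at least four vertices of
    \<open>S\<close>, an edge inside \<open>S\<close> gives \<open>K5\<close>; if \<open>S\<close>
    is independent, a link between two of its vertices does.\<close>
  have only_a: "V - B - S = {a}"
  proof (rule ccontr)
    assume "V - B - S \<noteq> {a}"
    then obtain a2 where a2: "a2 \<in> V - B - S" "a2 \<noteq> a" using a aS by blast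
    have f2: "adj a2 s" "adj s a2" if "s \<in> S" for s using full[OF a2(1) that] adj_sym by auto
    have ind: "\<not> adj s t" if st: "s \<in> S" "t \<in> S" for s t
    proof
      assume adj: "adj s t"
      obtain s3 s4 where s34: "s3 \<in> S - {s, t}" "s4 \<in> S - {s, t}" "s3 \<noteq> s4" using pick2 by blast
      have st': "s \<noteq> t" using adj irr by auto
      show False
      proof (rule K5F[of "{a}" "{a2, s3}" "{s}" "{t}" "insert s4 B"])
        show "conn adj {a2, s3}" "conn adj (insert s4 B)"
          using conn_edge[OF sy] f2 s34 conn_insert[OF sy B(1)] SB by auto
        show "touch adj {s} (insert s4 B)" "touch adj {t} (insert s4 B)" using SB st by (auto simp: touch_def)
        show "{a2, s3} \<inter> ({s} \<union> {t} \<union> insert s4 B) = {}" using a2 s34 st SV by auto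
      qed (use a2 s34 st st' SV a aS aS' f2 adj B in auto)
    qed
    obtain b where b: "b \<in> B" "\<And>s. s \<in> S \<Longrightarrow> adj s b"
    proof (rule dominate_independent[OF B(1,2), of "{a}" S])
      show "\<not> touch adj {a} B" using B(3) by (auto simp: touch_def)
    qed (use a aS SV SB aS' ind in auto)
    have bs: "adj b s" if "s \<in> S" for s using b(2)[OF that] adj_sym by auto
    define X where "X = V - {a, a2, b}"
    obtain x y where xy: "x \<in> S" "y \<in> S" "x \<noteq> y" using pick2 by blast
    have SX: "S \<subseteq> X" using SV aS a2 b(1) by (auto simp: X_def)
    have cX: "conn adj X" unfolding X_def
      by (rule conn_rest) (use xy SX in \<open>auto simp: X_def card_insert_if\<close>)
    have fX: "finite X" using fin by (simp add: X_def)
    obtain s t C where st: "s \<in> X \<inter> S" "t \<in> X \<inter> S" "s \<noteq> t" and C: "conn adj C" "C \<subseteq> X - S" "touch adj {s} C" "touch adj {t} C"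
      by (rule link_independent[OF sy fX cX, of x S y]) (use xy SX ind in auto)
    obtain s3 s4 where s34: "s3 \<in> S - {s, t}" "s4 \<in> S - {s, t}" "s3 \<noteq> s4" using pick2 by blast
    show False
    proof (rule K5F[of "{a}" "{a2, s3}" "{s}" "insert t C" "{b, s4}"])
      show "conn adj {a2, s3}" "conn adj {b, s4}" "conn adj (insert t C)"
        using conn_edge[OF sy] f2 bs s34 conn_insert[OF sy C(1)] C(4) by auto
      show "{a2, s3} \<inter> ({s} \<union> insert t C \<union> {b, s4}) = {}" using a2 s34 st SV b C(2) by (auto simp: X_def)
      show "insert t C \<inter> {b, s4} = {}" using st SV b C(2) s34 by (auto simp: X_def)
      show "touch adj {s} (insert t C)" using C(3) by (auto simp: touch_def)
      show "{a} \<union> {a2, s3} \<union> {s} \<union> insert t C \<union> {b, s4} \<subseteq> V"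
        using a a2 s34 st C(2) b(1) B(2) SV by (auto simp: X_def)
      show "{a} \<inter> ({a2, s3} \<union> {s} \<union> insert t C \<union> {b, s4}) = {}"
        using a2 s34 st C(2) b(1) aS by (auto simp: X_def)
      show "{s} \<inter> (insert t C \<union> {b, s4}) = {}" using st C(2) b(1) SV s34 by auto
    qed (use s34 st aS' f2 bs b(2) in auto)
  qed
  have Veq: "V = insert a (B \<union> S)" using only_a a B(2) SV by blast
  have tri: False if "s1 \<in> S" "s2 \<in> S" "s3 \<in> S" "adj s1 s2" "adj s1 s3" "adj s2 s3" for s1 s2 s3
  proof -
    have ne: "s1 \<noteq> s2" "s1 \<noteq> s3" "s2 \<noteq> s3" using that irr by auto
    obtain s4 where s4: "s4 \<in> S" "s4 \<notin> {s1, s2, s3}"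
      using cS card_mono[of "{s1, s2, s3}" S] ne by fastforce
    show False
    proof (rule K5F[of "{a}" "insert s4 B" "{s1}" "{s2}" "{s3}"])
      show "conn adj (insert s4 B)" using conn_insert[OF sy B(1)] SB s4 by auto
      show "touch adj (insert s4 B) {s1}" "touch adj (insert s4 B) {s2}" "touch adj (insert s4 B) {s3}"
        using SB that by (auto simp: touch_def)
      show "insert s4 B \<inter> ({s1} \<union> {s2} \<union> {s3}) = {}" using s4 that SV by auto
      show "{a} \<inter> (insert s4 B \<union> {s1} \<union> {s2} \<union> {s3}) = {}" using aS s4 that by auto
      show "{a} \<union> insert s4 B \<union> {s1} \<union> {s2} \<union> {s3} \<subseteq> V" using a B SV s4 that by auto
    qed (use that ne aS' s4 in auto)
  qed
  obtain b where b: "b \<in> B" "\<And>s. s \<in> S \<Longrightarrow> adj s b"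
  proof (rule dominate[OF B(1,2), of "{a}" S])
    show "\<not> touch adj {a} B" using B(3) by (auto simp: touch_def)
    show thesis if "z1 \<in> B" "z2 \<in> B" "s1 \<in> S" "s2 \<in> S" "z1 \<noteq> z2" "s1 \<noteq> s2"
      "adj s1 s2" "adj z1 z2" "adj s1 z1" "adj s2 z2"
      "\<And>w. w \<in> S - {s1, s2} \<Longrightarrow> (adj w s1 \<or> adj w z1) \<and> (adj w s2 \<or> adj w z2)" for z1 z2 s1 s2
    proof -
      have "z1 \<in> V - S - {a}" "z2 \<in> V - S - {a}" using that(1,2) B(2) SV(2) aS by blast+
      from dominating_pair_False[OF four SV(1) cS a aS(1) aS'(1) this that(3-10) that(11)]
      show thesis by blast
    qed
  qed (use a aS SV SB aS' in auto)
  have bs: "adj b s" if "s \<in> S" for s using b(2)[OF that] adj_sym by auto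
  have bV: "b \<in> V" "b \<notin> S" "b \<noteq> a" using b B SV aS by auto
  have ab: "\<not> adj a b" using B(3) b by auto
  define W0 where "W0 = V - S - {a, b}"
  \<comment> \<open>A component \<open>D\<close> of what is left has at least four neighbours among
    \<open>b\<close> and \<open>S\<close>, hence at least three in \<open>S\<close>. It acts as a
    third pole over these and again yields \<open>K5\<close>.\<close>
  have W0e: "W0 = {}"
  proof (rule ccontr)
    assume "W0 \<noteq> {}"
    then obtain x where x: "x \<in> W0" by blast
    define D where "D = component adj W0 x"
    note D = component[OF sy x, folded D_def]
    have DB: "D \<subseteq> B" "D \<subseteq> V" using D(2) Veq by (auto simp: W0_def)
    define N where "N = {s \<in> S. touch adj {s} D}"
    have N: "s \<in> S" "touch adj {s} D" "touch adj D {s}" if "s \<in> N" for s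
      using that adj_sym by (auto simp: N_def touch_def)
    have aD: "\<not> adj a y" "\<not> adj y a" if "y \<in> D" for y using B(3)[of y] DB that adj_sym by auto
    have nbD: "nb D \<subseteq> insert b N"
    proof
      fix v assume "v \<in> nb D"
      then obtain y where v: "v \<in> V - D" "y \<in> D" "adj y v" by (auto simp: nb_def)
      have "v \<notin> W0" using D(4)[of y v] v by blast
      then have "v \<in> S \<or> v = b" using v aD[of y] by (auto simp: W0_def)
      then show "v \<in> insert b N" using v adj_sym by (auto simp: N_def)
    qed
    have "a \<in> V - D - nb D" using a aS DB nbD bV(3) by (auto simp: N_def)
    then have "4 \<le> card (nb D)" using four[of D] DB(2) D(1) by blast
    also have "\<dots> \<le> card (insert b N)" using nbD fS by (intro card_mono) (auto simp: N_def)
    also have "\<dots> \<le> Suc (card N)" by (simp add: card_insert_le_m1 card_insert_if)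
    finally have cN: "3 \<le> card N" by simp
    have DS: "D \<inter> S = {}" "a \<notin> D" "b \<notin> D" using D(2) by (auto simp: W0_def)
    have pickN: "\<exists>n. n \<in> N - {x, y}" for x y
    proof -
      have "1 \<le> card (N - {x, y})" by (rule card_Diff_ge[where k = 2]) (use cN in \<open>auto simp: card_insert_if\<close>)
      then show ?thesis by (metis all_not_in_conv card.empty not_one_le_zero)
    qed
    have pickS: "\<exists>n. n \<in> S - {x, y, z}" for x y z
    proof -
      have "1 \<le> card (S - {x, y, z})" by (rule card_Diff_ge[where k = 3]) (use cS in \<open>auto simp: card_insert_if\<close>)
      then show ?thesis by (metis all_not_in_conv card.empty not_one_le_zero)
    qed
    have ind: "\<not> adj s t" if st: "s \<in> N" "t \<in> N" for s t
    proof
      assume adj: "adj s t"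
      have st': "s \<noteq> t" using adj irr by auto
      obtain s3 where s3: "s3 \<in> N - {s, t}" using pickN by blast
      obtain s4 where s4: "s4 \<in> S - {s, t, s3}" using pickS by blast
      show False
      proof (rule K5F[of "{a}" "{b, s4}" "{s}" "{t}" "insert s3 D"])
        show "conn adj {b, s4}" "conn adj (insert s3 D)"
          using conn_edge[OF sy] bs s4 conn_insert[OF sy D(3)] N s3 by auto
        show "touch adj {s} (insert s3 D)" "touch adj {t} (insert s3 D)" using N st by (auto simp: touch_def)
        show "{a} \<union> {b, s4} \<union> {s} \<union> {t} \<union> insert s3 D \<subseteq> V" using a bV s4 SV N st s3 DB by auto
        show "{b, s4} \<inter> ({s} \<union> {t} \<union> insert s3 D) = {}" using bV s4 N(1) st s3 DS by auto
        show "{a} \<inter> ({b, s4} \<union> {s} \<union> {t} \<union> insert s3 D) = {}" using bV s4 aS N(1) st s3 DS by auto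
        show "{s} \<inter> ({t} \<union> insert s3 D) = {}" "{t} \<inter> insert s3 D = {}" using st' N(1) st s3 DS by auto
      qed (use adj s4 s3 st N(1) aS' bs in auto)
    qed
    obtain d where d: "d \<in> D" "\<And>s. s \<in> N \<Longrightarrow> adj s d"
    proof (rule dominate_independent[OF D(3) DB(2), of "{a}" N])
      show "\<not> touch adj {a} D" using aD by (auto simp: touch_def)
      show "N \<subseteq> V" "N \<inter> ({a} \<union> D) = {}" using N(1) SV aS DS by auto
      show "touch adj {s} {a}" if "s \<in> N" for s using aS' N(1) that by auto
    qed (use a DS N ind in auto)
    have ds: "adj d s" if "s \<in> N" for s using d(2)[OF that] adj_sym by auto
    have dV: "d \<in> V" "d \<notin> S" "d \<noteq> a" "d \<noteq> b" using d DB DS by auto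
    define X where "X = V - {a, b, d}"
    have NX: "N \<subseteq> X" using N(1) SV aS bV dV by (auto simp: X_def)
    have "2 \<le> card N" using cN by simp
    then obtain x y where xy: "x \<in> N" "y \<in> N" "x \<noteq> y" by (rule two_elements)
    have cX: "conn adj X" unfolding X_def
      by (rule conn_rest) (use xy NX in \<open>auto simp: X_def card_insert_if\<close>)
    have fX: "finite X" using fin by (simp add: X_def)
    obtain s t C where st: "s \<in> X \<inter> N" "t \<in> X \<inter> N" "s \<noteq> t" and C: "conn adj C" "C \<subseteq> X - N" "touch adj {s} C" "touch adj {t} C"
      by (rule link_independent[OF sy fX cX, of x N y]) (use xy NX ind in auto)
    obtain r where r: "r \<in> N - {s, t}" using pickN by blast
    have S': "s \<in> S" "t \<in> S" "r \<in> S" using st r N(1) by auto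
    have C': "C \<subseteq> V" "a \<notin> C" "b \<notin> C" "d \<notin> C" "s \<notin> C" "t \<notin> C" "r \<notin> C"
      using C(2) st r by (auto simp: X_def)
    have in': "s \<in> V" "t \<in> V" "r \<in> V" "s \<noteq> a" "t \<noteq> a" "r \<noteq> a" "s \<noteq> b" "t \<noteq> b" "r \<noteq> b"
      "s \<noteq> d" "t \<noteq> d" "r \<noteq> d" "r \<noteq> s" "r \<noteq> t" "s \<noteq> t"
      using S' SV aS bV dV r st by auto
    have e: "adj d s" "adj d t" "adj d r" "adj s d" "adj t d" "adj r d" using st r ds d(2) by auto
    note e' = aS'[OF S'(1)] aS'[OF S'(2)] aS'[OF S'(3)] bs[OF S'(1)] bs[OF S'(2)] bs[OF S'(3)]
      b(2)[OF S'(1)] b(2)[OF S'(2)] b(2)[OF S'(3)]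
    have tC: "touch adj C {t}" "touch adj C {s}" using C(3,4) touch_sym[OF sy] by blast+
    show False
    proof (cases "\<exists>q. q \<in> S - C - {s, t, r}")
      case True
      then obtain q where q: "q \<in> S" "q \<notin> C" "q \<noteq> s" "q \<noteq> t" "q \<noteq> r" by blast
      have q': "q \<in> V" "q \<noteq> a" "q \<noteq> b" "q \<noteq> d" using q SV aS bV dV by auto
      show False
      proof (rule K5F[of "{a}" "{b, q}" "{s}" "insert t C" "{d, r}"])
        show "conn adj {b, q}" "conn adj {d, r}" "conn adj (insert t C)"
          using conn_edge[OF sy] bs[OF q(1)] e conn_insert[OF sy C(1)] C(4) by auto
        show "touch adj {s} (insert t C)" using C(3) by (auto simp: touch_def)
        show "{a} \<union> {b, q} \<union> {s} \<union> insert t C \<union> {d, r} \<subseteq> V" using a bV q' in' C' dV by auto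
        show "{a} \<inter> ({b, q} \<union> {s} \<union> insert t C \<union> {d, r}) = {}" using bV q' in' C' dV by auto
        show "{b, q} \<inter> ({s} \<union> insert t C \<union> {d, r}) = {}" using bV q q' in' C' dV by auto
        show "{s} \<inter> (insert t C \<union> {d, r}) = {}" "insert t C \<inter> {d, r} = {}" using in' C' by auto
      qed (use e e' aS'[OF q(1)] in auto)
    next
      case False
      obtain q where "q \<in> S - {s, t, r}" using pickS by blast
      then have q: "q \<in> S" "q \<in> C" using False by auto
      show False
      proof (rule K5F[of "{a}" "{b, r}" "{s}" C "{t, d}"])
        show "conn adj {b, r}" "conn adj {t, d}" using conn_edge[OF sy] e e' by auto
        show "touch adj {a} C" "touch adj {b, r} C" using q aS'[OF q(1)] bs[OF q(1)] by auto
        show "touch adj C {t, d}" using tC by (auto simp: touch_def)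
        show "{a} \<union> {b, r} \<union> {s} \<union> C \<union> {t, d} \<subseteq> V" using a bV in' C' dV by auto
        show "{a} \<inter> ({b, r} \<union> {s} \<union> C \<union> {t, d}) = {}" "{b, r} \<inter> ({s} \<union> C \<union> {t, d}) = {}"
          "{s} \<inter> (C \<union> {t, d}) = {}" "C \<inter> {t, d} = {}" using bV in' C' dV by auto
      qed (use e e' C in auto)
    qed
  qed
  have Veq2: "V = {a, b} \<union> S" using W0e a bV SV by (auto simp: W0_def)
  obtain s1 where s1: "s1 \<in> S" using pick2 by blast
  define N where "N = {x \<in> S. adj s1 x}"
  have fN: "finite N" using fS by (simp add: N_def)
  \<comment> \<open>With at most one neighbour in \<open>S\<close>, deleting that neighbour and the
    two poles would isolate \<open>s1\<close>.\<close>
  have "2 \<le> card N"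
  proof (rule ccontr)
    assume "\<not> 2 \<le> card N"
    then have cN: "card N \<le> 1" by simp
    have sN: "s1 \<notin> N" using irr by (simp add: N_def)
    have c3: "card (insert s1 N) \<le> 2" using cN sN fN by simp
    have "2 \<le> card (S - insert s1 N)" by (rule card_Diff_ge[where k = 2]) (use cS c3 fN in auto)
    then obtain y where y: "y \<in> S - insert s1 N" by (metis two_elements)
    have "card ({a, b} \<union> N) \<le> card {a, b} + card N" by (rule card_Un_le)
    then have c: "card ({a, b} \<union> N) \<le> 3" using cN bV by simp
    have "conn adj (V - ({a, b} \<union> N))"
      by (rule conn_rest) (use fN c s1 SV aS bV sN in auto)
    moreover have "{s1} \<subseteq> V - ({a, b} \<union> N)" "{s1} \<noteq> V - ({a, b} \<union> N)"
      using s1 y SV aS bV sN by auto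
    ultimately obtain z where "z \<in> V - ({a, b} \<union> N) - {s1}" "adj s1 z"
      using connD[of adj "V - ({a, b} \<union> N)" "{s1}"] by blast
    then show False using Veq2 by (auto simp: N_def)
  qed
  then obtain p q where pq: "p \<in> N" "q \<in> N" "p \<noteq> q" by (rule two_elements)
  have ind: "\<not> adj x y" if "x \<in> N" "y \<in> N" for x y
    using tri[of s1 x y] that s1 by (auto simp: N_def)
  define X where "X = V - {a, b, s1}"
  have NX: "N \<subseteq> X" using SV aS bV irr by (auto simp: X_def N_def)
  have cX: "conn adj X" unfolding X_def
    by (rule conn_rest) (use pq NX in \<open>auto simp: X_def card_insert_if\<close>)
  have fX: "finite X" using fin by (simp add: X_def)
  obtain x y C where xy: "x \<in> X \<inter> N" "y \<in> X \<inter> N" "x \<noteq> y" and C: "conn adj C" "C \<subseteq> X - N" "touch adj {x} C" "touch adj {y} C"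
    by (rule link_independent[OF sy fX cX, of p N q]) (use pq NX ind in auto)
  have CS: "C \<subseteq> S" using C(2) Veq2 by (auto simp: X_def)
  have sx: "adj s1 x" "adj s1 y" "adj x s1" "adj y s1" "x \<in> S" "y \<in> S" using xy adj_sym by (auto simp: N_def)
  \<comment> \<open>Here \<open>{s1}\<close> is the opposite side: a missing common neighbour would
    give a pentagon inside \<open>S\<close>. The vertices \<open>s1\<close>, \<open>x\<close>,
    \<open>c\<close>, \<open>y\<close> then form a four-cycle, and a fifth vertex of
    \<open>S\<close> would complete \<open>K5\<close> with the poles.\<close>
  have "\<exists>c\<in>C. adj x c \<and> adj y c"
  proof (rule common[of C "{s1}" x y])
    show "finite C" using CS fS finite_subset by blast
    show "\<not> touch adj {s1} C" using C(2) CS by (auto simp: touch_def N_def)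
    show "{s1} \<inter> C = {}" "{s1} \<union> C \<union> {x, y} \<subseteq> V" "{x, y} \<inter> ({s1} \<union> C) = {}"
      using C(2) CS s1 SV sx xy irr by (auto simp: X_def)
  qed (use C xy ind sx in auto)
  then obtain c where c: "c \<in> C" "adj x c" "adj y c" by blast
  have c': "c \<in> S" "\<not> adj s1 c" "c \<noteq> s1" "c \<noteq> x" "c \<noteq> y" using c CS C(2) xy by (auto simp: N_def X_def)
  have Seq: "S = {s1, x, y, c}"
  proof (rule ccontr)
    assume "S \<noteq> {s1, x, y, c}"
    then obtain t where t: "t \<in> S" "t \<notin> {s1, x, y, c}" using s1 sx c' by blast
    have V': "s1 \<in> V" "x \<in> V" "y \<in> V" "c \<in> V" "t \<in> V" using s1 sx c' t SV by auto
    have nS: "z \<noteq> a \<and> z \<noteq> b" if "z \<in> S" for z using aS bV that by auto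
    note nn = nS[OF s1] nS[OF sx(5)] nS[OF sx(6)] nS[OF c'(1)] nS[OF t(1)]
    show False
    proof (rule K5F[of "{a}" "{b, t}" "{s1}" "{x}" "{y, c}"])
      show "conn adj {b, t}" "conn adj {y, c}" using conn_edge[OF sy] bs[OF t(1)] c(3) by auto
      show "{a} \<union> {b, t} \<union> {s1} \<union> {x} \<union> {y, c} \<subseteq> V" using V' a bV by auto
      show "{a} \<inter> ({b, t} \<union> {s1} \<union> {x} \<union> {y, c}) = {}" "{b, t} \<inter> ({s1} \<union> {x} \<union> {y, c}) = {}"
        "{s1} \<inter> ({x} \<union> {y, c}) = {}" "{x} \<inter> {y, c} = {}" using nn t bV c' xy(3) sx irr by auto
    qed (use aS' bs s1 sx c t c' in auto)
  qed
  show ?thesis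
  proof (rule that[of a b x y s1 c])
    show V: "V = {a, b, x, y, s1, c}" using Veq2 Seq by auto
    have "x \<noteq> s1" "y \<noteq> s1" using sx irr by auto
    then show "card V = 6" unfolding V using aS bV s1 sx c' xy(3) by (auto simp: card_insert_if)
  qed (use ab c' ind xy in auto)
qed

end

section \<open>Separators with at most three vertices\<close>

context cgraph begin

definition separators_ge :: "nat \<Rightarrow> bool" where
  "separators_ge k \<longleftrightarrow> (\<forall>X. X \<subseteq> V \<longrightarrow> X \<noteq> {} \<longrightarrow> V - X - nb X \<noteq> {} \<longrightarrow> k \<le> card (nb X))"

definition closed_in :: "'a set \<Rightarrow> 'a set \<Rightarrow> bool" where
  "closed_in W D \<longleftrightarrow> conn adj D \<and> D \<subseteq> W \<and> (\<forall>x\<in>D. \<forall>y\<in>W - D. \<not> adj x y)"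

text \<open>\<open>S\<close> may be turned into a clique without leaving the class. The condition
  \<open>D \<noteq> V - S\<close> makes \<open>S\<close> separate, so that the pieces of the clique
  sum are smaller than the graph.\<close>

definition fillable :: "'a set \<Rightarrow> bool" where
  "fillable S \<longleftrightarrow> S \<subseteq> V \<and> card S \<le> 3 \<and>
     (\<forall>D. closed_in (V - S) D \<longrightarrow> D \<noteq> V - S \<and> cls (D \<union> S) (add_clique S adj))"

lemma closed_in_component: "x \<in> W \<Longrightarrow> closed_in W (component adj W x)"
  using component[OF sy, of x W] unfolding closed_in_def by blast

lemma closed_in_disjoint:
  assumes "closed_in W D" "closed_in W D'" "x \<in> D'" "x \<notin> D"
  shows "D \<inter> D' = {}"
proof (rule ccontr)
  assume "D \<inter> D' \<noteq> {}"
  then have "D' \<subseteq> D" using conn_closed[of adj D' D] assms unfolding closed_in_def by blast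
  then show False using assms by blast
qed

lemma closed_in_no_touch:
  assumes "closed_in W D" "X \<subseteq> W" "X \<inter> D = {}"
  shows "\<not> touch adj D X"
  using assms unfolding closed_in_def touch_def by blast

text \<open>If a component missed a vertex of \<open>S\<close>, its boundary would be a smaller
  separator.\<close>

lemma full_component:
  assumes mn: "separators_ge (card S)"
    and S: "S \<subseteq> V" and D: "closed_in (V - S) D" "D \<noteq> V - S" and s: "s \<in> S"
  shows "touch adj {s} D" "touch adj D {s}"
proof -
  have fS: "finite S" using S fin finite_subset by blast
  have sub: "nb D \<subseteq> S" using D(1) by (auto simp: nb_def closed_in_def)
  have "D \<subseteq> V - S" "D \<noteq> {}" using D(1) conn_ne by (auto simp: closed_in_def)
  moreover have "V - D - nb D \<noteq> {}" using sub calculation D(2) by blast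
  ultimately have "card S \<le> card (nb D)" using mn unfolding separators_ge_def by blast
  then have "nb D = S" using sub fS by (simp add: card_seteq)
  then obtain x where "x \<in> D" "adj x s" using s by (auto simp: nb_def)
  then show "touch adj {s} D" "touch adj D {s}" using adj_sym by (auto simp: touch_def)
qed

text \<open>A component other than the kept one, contracted into \<open>s\<close>, supplies the two
  edges at \<open>s\<close>. The case \<open>t = u\<close> covers separators with two
  vertices.\<close>

lemma fillable_edge:
  assumes mn: "separators_ge (card {s, t, u})"
    and S: "{s, t, u} \<subseteq> V" "s \<notin> {t, u}" "t = u \<or> adj t u" and nc: "\<not> conn adj (V - {s, t, u})"
  shows "fillable {s, t, u}"
  unfolding fillable_def
proof (intro conjI allI impI)
  show "card {s, t, u} \<le> 3" by (simp add: card_insert_if)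
  fix D assume D: "closed_in (V - {s, t, u}) D"
  show ne: "D \<noteq> V - {s, t, u}" using D nc by (auto simp: closed_in_def)
  then obtain x where x: "x \<in> V - {s, t, u}" "x \<notin> D" using D by (auto simp: closed_in_def)
  define X where "X = component adj (V - {s, t, u}) x"
  have X: "closed_in (V - {s, t, u}) X" "x \<in> X"
    unfolding X_def using closed_in_component[OF x(1)] component(1)[OF sy x(1)] by auto
  have dis: "D \<inter> X = {}" by (rule closed_in_disjoint[OF D X x(2)])
  have Dne: "D \<noteq> {}" using D conn_ne by (auto simp: closed_in_def)
  have Xne: "X \<noteq> V - {s, t, u}" using D dis Dne by (auto simp: closed_in_def)
  note T = full_component(1)[OF mn S(1) X(1) Xne]
  show "cls (D \<union> {s, t, u}) (add_clique {s, t, u} adj)"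
  proof (rule cls_add_clique1[OF cls sy])
    show "\<not> touch adj D X"
      by (rule closed_in_no_touch[OF D]) (use X dis in \<open>auto simp: closed_in_def\<close>)
    show "X \<inter> {s, t, u} = {}" "conn adj X" "X \<subseteq> V" "X \<inter> D = {}"
      using X(1) dis by (auto simp: closed_in_def)
    show "insert s (insert t (insert u D)) \<subseteq> V" using S D by (auto simp: closed_in_def)
  qed (use S T in auto)
qed (use S in auto)

text \<open>The two sets to be contracted may vary with the kept component \<open>D\<close> and may
  be proper parts of other components.\<close>

lemma fillable_three:
  assumes S: "{s, t, u} \<subseteq> V" "card {s, t, u} = 3"
    and D: "\<And>D. closed_in (V - {s, t, u}) D \<Longrightarrow> \<exists>X Y. conn adj X \<and> conn adj Y \<and> X \<union> Y \<subseteq> V - {s, t, u} - D \<and>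
      X \<inter> Y = {} \<and> (\<forall>v\<in>{s, t, u}. touch adj {v} X \<and> touch adj {v} Y)"
  shows "fillable {s, t, u}"
  unfolding fillable_def
proof (intro conjI allI impI)
  fix E assume E: "closed_in (V - {s, t, u}) E"
  obtain X Y where XY: "conn adj X" "conn adj Y" "X \<union> Y \<subseteq> V - {s, t, u} - E" "X \<inter> Y = {}"
     "\<And>v. v \<in> {s, t, u} \<Longrightarrow> touch adj {v} X \<and> touch adj {v} Y" using D[OF E] by blast
  show "E \<noteq> V - {s, t, u}" using XY(3) conn_ne[OF XY(1)] by blast
  have 1: "\<not> touch adj E X" "\<not> touch adj E Y"
    using XY(3) by (intro closed_in_no_touch[OF E]; blast)+
  have 2: "E \<subseteq> V - {s, t, u}" using E by (auto simp: closed_in_def)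
  show "cls (E \<union> {s, t, u}) (add_clique {s, t, u} adj)"
    by (rule cls_add_clique2[OF cls sy, of s t u E X Y])
      (use XY(1-4) XY(5)[of s] XY(5)[of t] XY(5)[of u] 1 2 S in blast)+
qed (use S in auto)

text \<open>Take \<open>a\<close>, \<open>D\<close>, \<open>s1\<close>, \<open>s2\<close> and the
  pair \<open>b\<close>, \<open>s3\<close> as blocks. Only the contact between \<open>s1\<close> and
  \<open>s2\<close> can be missing, and \<open>D'\<close> provides it when joined to
  \<open>s2\<close>.\<close>

lemma dominated_component_False:
  assumes "a \<in> V" "b \<in> V" "a \<noteq> b" "s1 \<in> V" "s2 \<in> V" "s3 \<in> V" "{a, b} \<inter> {s1, s2, s3} = {}" "card {s1, s2, s3} = 3"
    and "\<And>s. s \<in> {s1, s2, s3} \<Longrightarrow> adj a s \<and> adj b s"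
    and "conn adj D" "conn adj D'" "D \<union> D' \<subseteq> V - {a, b, s1, s2, s3}" "D \<inter> D' = {}" "touch adj {a} D"
    and "\<And>s. s \<in> {s1, s2, s3} \<Longrightarrow> touch adj {s} D" "touch adj {s1} D'" "touch adj {s2} D'"
  shows False
proof (rule K5F[of "{a}" D "{s1}" "insert s2 D'" "{b, s3}"])
  have d: "s1 \<noteq> s2" "s1 \<noteq> s3" "s2 \<noteq> s3" using assms(8) by (auto simp: card_insert_if split: if_splits)
  have e: "adj a s1" "adj a s2" "adj a s3" "adj b s1" "adj b s2" "adj b s3" "adj s1 b" "adj s2 b"
    using assms(9) adj_sym by auto
  have T: "touch adj D {s1}" "touch adj D {s2}" "touch adj D {s3}" using assms(15) touch_sym[OF sy] by blast+
  show "conn adj (insert s2 D')" using conn_insert[OF sy assms(11)] assms(17) by blast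
  show "conn adj {b, s3}" using conn_edge[OF sy] e by blast
  show "{a} \<union> D \<union> {s1} \<union> insert s2 D' \<union> {b, s3} \<subseteq> V" using assms by auto
  show "{a} \<inter> (D \<union> {s1} \<union> insert s2 D' \<union> {b, s3}) = {}" "D \<inter> ({s1} \<union> insert s2 D' \<union> {b, s3}) = {}"
    using assms(3,7,12,13) by auto
  show "{s1} \<inter> (insert s2 D' \<union> {b, s3}) = {}" "insert s2 D' \<inter> {b, s3} = {}" using d assms(7,12) by auto
  show "touch adj D {s1}" "touch adj D (insert s2 D')" "touch adj D {b, s3}" using T by (auto simp: touch_def)
  show "touch adj {s1} (insert s2 D')" using assms(16) by (auto simp: touch_def)
  show "touch adj {a} {s1}" "touch adj {a} (insert s2 D')" "touch adj {a} {b, s3}"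
    "touch adj {s1} {b, s3}" "touch adj (insert s2 D') {b, s3}" using e by auto
qed (use assms in auto)

text \<open>A vertex \<open>d\<close> of \<open>D\<close> adjacent to all three \<open>s\<close>
  makes \<open>a, b, d\<close> and \<open>s1, s2, s3\<close> the sides of a complete bipartite
  graph. The other side \<open>{a, b, d}\<close> is the separator to fill: no component of its
  complement contains two of the \<open>s\<close>, so for each component two of them remain as
  singletons to contract.\<close>

lemma separator_K33:
  assumes V: "V = {a, b, s1, s2, s3} \<union> D" and dis: "D \<inter> {a, b, s1, s2, s3} = {}" "card {a, b, s1, s2, s3} = 5"
    and ind: "\<And>s t. s \<in> {s1, s2, s3} \<Longrightarrow> t \<in> {s1, s2, s3} \<Longrightarrow> \<not> adj s t"
    and ab: "\<And>s. s \<in> {s1, s2, s3} \<Longrightarrow> adj a s \<and> adj b s"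
    and D: "conn adj D" "touch adj {a} D" "\<not> touch adj {b} D" "\<And>s. s \<in> {s1, s2, s3} \<Longrightarrow> touch adj {s} D"
  shows "\<exists>T. fillable T"
proof -
  let ?S = "{s1, s2, s3}"
  have ne: "a \<noteq> b" "a \<notin> ?S" "b \<notin> ?S" "s1 \<noteq> s2" "s1 \<noteq> s3" "s2 \<noteq> s3"
    using dis(2) by (auto simp: card_insert_if split: if_splits)
  have DV: "D \<subseteq> V" using V by blast
  obtain d where d: "d \<in> D" "\<And>s. s \<in> ?S \<Longrightarrow> adj s d"
  proof (rule dominate_independent[OF D(1) DV, of "{b}" ?S])
    show "touch adj {s} {b}" if "s \<in> ?S" for s using ab[OF that] adj_sym by auto
    show "{b} \<inter> D = {}" "?S \<inter> ({b} \<union> D) = {}" using dis(1) ne by auto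
  qed (use V D ind in auto)
  have ds: "adj d s" if "s \<in> ?S" for s using d(2)[OF that] adj_sym by auto
  have sab: "adj s a" "adj s b" if "s \<in> ?S" for s using ab[OF that] adj_sym by auto
  have dne: "d \<noteq> a" "d \<noteq> b" "d \<notin> ?S" using d(1) dis(1) by auto
  \<comment> \<open>A component of \<open>D\<close> without \<open>d\<close> that touches two of the
    \<open>s\<close> yields \<open>K5\<close>; the blocks depend on whether \<open>a\<close> reaches
    the rest of \<open>D\<close> or only this component.\<close>
  have one: False
    if pqr: "{p, q, r} = ?S" "p \<noteq> q" "p \<noteq> r" "q \<noteq> r"
      and x: "x \<in> D - {d}" "touch adj {p} (component adj (D - {d}) x)" "touch adj {q} (component adj (D - {d}) x)"
    for p q r x
  proof -
    define E where "E = component adj (D - {d}) x"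
    note E = component[OF sy x(1), folded E_def] and tE = x(2,3)[folded E_def]
    have cDE: "conn adj (D - E)" unfolding E_def by (rule conn_minus_component[OF sy D(1) d(1) x(1)])
    have S: "p \<in> ?S" "q \<in> ?S" "r \<in> ?S" using pqr(1) by blast+
    have pV: "p \<in> V" "q \<in> V" "r \<in> V" "p \<notin> D" "q \<notin> D" "r \<notin> D" "a \<notin> D" "b \<notin> D" "a \<in> V" "b \<in> V"
      using S V dis(1) by blast+
    have pn: "p \<noteq> a" "q \<noteq> a" "r \<noteq> a" "p \<noteq> b" "q \<noteq> b" "r \<noteq> b" using S ne by blast+
    note e = ab[OF S(1)] ab[OF S(2)] ab[OF S(3)] sab[OF S(1)] sab[OF S(2)] sab[OF S(3)]
      ds[OF S(1)] ds[OF S(2)] ds[OF S(3)] d(2)[OF S(1)] d(2)[OF S(2)] d(2)[OF S(3)]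
    have dE: "d \<in> D - E" using d(1) E(2) by blast
    have ED: "E \<subseteq> D" using E(2) by blast
    have tE': "touch adj E {p}" "touch adj E {q}" using tE touch_sym[OF sy] by blast+
    have Edt: "touch adj E {d}"
    proof -
      have "E \<noteq> {}" "E \<noteq> D" using E(1) dE by auto
      then obtain y z where "y \<in> E" "z \<in> D - E" "adj y z" using connD[OF D(1) ED] by blast
      then show ?thesis using E(4)[of y z] by (cases "z = d") auto
    qed
    show False
    proof (cases "touch adj {a} (D - E)")
      case True
      have DEq: "touch adj (D - E) (insert q E)" "touch adj (D - E) {p}" "touch adj (D - E) {r, b}"
        using dE e by (auto simp: touch_def)
      show False
      proof (rule K5F[of "{a}" "D - E" "{p}" "insert q E" "{r, b}"])
        show "conn adj (insert q E)" "conn adj {r, b}"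
          using conn_insert[OF sy E(3)] tE(2) conn_edge[OF sy] e by auto
        show "touch adj {p} (insert q E)" using tE(1) by (auto simp: touch_def)
        show "{a} \<union> (D - E) \<union> {p} \<union> insert q E \<union> {r, b} \<subseteq> V"
          "{a} \<inter> (D - E \<union> {p} \<union> insert q E \<union> {r, b}) = {}"
          "(D - E) \<inter> ({p} \<union> insert q E \<union> {r, b}) = {}" "{p} \<inter> (insert q E \<union> {r, b}) = {}"
          "insert q E \<inter> {r, b} = {}"
          using pV pn pqr(2-4) ED DV ne(1) by auto
      qed (use True DEq cDE e in auto)
    next
      case False
      then have aE: "touch adj {a} E" using D(2) by (auto simp: touch_def)
      then have Ea: "touch adj E {a}" using touch_sym[OF sy] by blast
      show False
      proof (rule K5F[of E "{p, b}" "{a}" "{q}" "{d, r}"])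
        show "conn adj {p, b}" "conn adj {d, r}" using conn_edge[OF sy] e by auto
        show "touch adj E {p, b}" "touch adj E {a}" "touch adj E {q}" "touch adj E {d, r}"
          using tE' Ea Edt by (auto simp: touch_def)
        show "E \<union> {p, b} \<union> {a} \<union> {q} \<union> {d, r} \<subseteq> V" "E \<inter> ({p, b} \<union> {a} \<union> {q} \<union> {d, r}) = {}"
          "{p, b} \<inter> ({a} \<union> {q} \<union> {d, r}) = {}" "{a} \<inter> ({q} \<union> {d, r}) = {}" "{q} \<inter> {d, r} = {}"
          using pV pn pqr(2-4) ED DV ne(1) dE by auto
      qed (use e E in auto)
    qed
  qed
  have oneT: False
    if "p \<in> ?S" "q \<in> ?S" "p \<noteq> q" "x \<in> D - {d}" "touch adj {p} (component adj (D - {d}) x)"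
      "touch adj {q} (component adj (D - {d}) x)" for p q x
  proof -
    have "p = s1 \<and> q = s2 \<or> p = s1 \<and> q = s3 \<or> p = s2 \<and> q = s1 \<or> p = s2 \<and> q = s3 \<or> p = s3 \<and> q = s1 \<or> p = s3 \<and> q = s2"
      using that(1-3) by blast
    then have "({p, q, s1} = ?S \<and> p \<noteq> s1 \<and> q \<noteq> s1) \<or> ({p, q, s2} = ?S \<and> p \<noteq> s2 \<and> q \<noteq> s2) \<or>
        ({p, q, s3} = ?S \<and> p \<noteq> s3 \<and> q \<noteq> s3)"
      using ne(4-6) by (elim disjE) (auto simp: insert_commute)
    then obtain r where "{p, q, r} = ?S" "p \<noteq> r" "q \<noteq> r" by blast
    then show False using one[of p q r x] that by blast
  qed
  let ?T = "{a, b, d}"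
  have VT: "V - ?T = ?S \<union> (D - {d})" using V dis(1) ne dne by auto
  have sep: False if F: "closed_in (V - ?T) F" "p \<in> ?S" "q \<in> ?S" "p \<noteq> q" "p \<in> F" "q \<in> F" for F p q
  proof -
    \<comment> \<open>This is all that \<open>p\<close> can reach off \<open>{a, b, d}\<close>: by
      the previous step the pieces attached to \<open>p\<close> are attached to no other
      \<open>s\<close>.\<close>
    define Q where "Q = insert p {x \<in> D - {d}. touch adj {p} (component adj (D - {d}) x)}"
    have FV: "F \<subseteq> ?S \<union> (D - {d})" "conn adj F" using F(1) VT by (auto simp: closed_in_def)
    have "F \<subseteq> Q"
    proof (rule conn_closed[OF FV(2)])
      show "F \<inter> Q \<noteq> {}" using F(5) by (auto simp: Q_def)
      fix x y assume x: "x \<in> Q \<inter> F" and y: "y \<in> F - Q"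
      show "\<not> adj x y"
      proof
        assume xy: "adj x y"
        show False
        proof (cases "x = p")
          case True
          then have yD: "y \<in> D - {d}" using y FV(1) ind[OF F(2), of y] xy by blast
          have "touch adj {p} (component adj (D - {d}) y)"
            using component(1)[OF sy yD] xy True by (auto simp: touch_def)
          then show False using y yD by (auto simp: Q_def)
        next
          case False
          then have xD: "x \<in> D - {d}" "touch adj {p} (component adj (D - {d}) x)" using x by (auto simp: Q_def)
          note xc = component[OF sy xD(1)]
          show False
          proof (cases "y \<in> ?S")
            case True
            have "y \<noteq> p" using y by (auto simp: Q_def)
            moreover have "touch adj {y} (component adj (D - {d}) x)"
              using xc(1) adj_sym[OF xy] by (auto simp: touch_def)
            ultimately show False using oneT[of p y x] True F(2) xD by blast
          next
            case False
            then have yD: "y \<in> D - {d}" using y FV(1) by blast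
            then have "y \<in> component adj (D - {d}) x" using xc(1,4) xy by blast
            then have "touch adj {p} (component adj (D - {d}) y)"
              using component_mono_eq[OF sy xD(1)] xD(2) by (auto simp: touch_def)
            then show False using y yD by (auto simp: Q_def)
          qed
        qed
      qed
    qed
    then have "q \<in> Q" using F(6) by blast
    then show False using F(3,4) dis(1) by (auto simp: Q_def)
  qed
  have "fillable ?T"
  proof (rule fillable_three)
    show "?T \<subseteq> V" "card ?T = 3" using V d(1) ne dne by (auto simp: card_insert_if)
    fix F assume F: "closed_in (V - ?T) F"
    have "\<exists>p q. p \<in> ?S \<and> q \<in> ?S \<and> p \<noteq> q \<and> p \<notin> F \<and> q \<notin> F"
      using sep[OF F, of s1 s2] sep[OF F, of s1 s3] sep[OF F, of s2 s3] ne(4-6) by blast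
    then obtain p q where pq: "p \<in> ?S" "q \<in> ?S" "p \<noteq> q" "p \<notin> F" "q \<notin> F" by blast
    have t: "touch adj {v} {p} \<and> touch adj {v} {q}" if "v \<in> ?T" for v
      using that ab[OF pq(1)] ab[OF pq(2)] ds[OF pq(1)] ds[OF pq(2)] by auto
    show "\<exists>X Y. conn adj X \<and> conn adj Y \<and> X \<union> Y \<subseteq> V - ?T - F \<and> X \<inter> Y = {} \<and>
      (\<forall>v\<in>?T. touch adj {v} X \<and> touch adj {v} Y)"
      by (rule exI[of _ "{p}"], rule exI[of _ "{q}"]) (use pq t VT in auto)
  qed
  then show ?thesis by blast
qed

text \<open>If nothing is fillable, every three-vertex separator is independent and \<open>S\<close>
  leaves exactly two components, since an edge or a third component would allow filling. Each side
  has a vertex adjacent to all of \<open>S\<close>, and the remaining vertices either form the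
  bipartite situation of \<open>separator_K33\<close> or complete a \<open>K5\<close>.\<close>

lemma three_separator_fillable:
  assumes mn': "separators_ge 3"
    and S: "S \<subseteq> V" "card S = 3" "\<not> conn adj (V - S)" "V - S \<noteq> {}"
  shows "\<exists>T. fillable T"
proof (rule ccontr)
  assume nf: "\<nexists>T. fillable T"
  have mn: "3 \<le> card (nb X)" if "X \<subseteq> V" "X \<noteq> {}" "V - X - nb X \<noteq> {}" for X
    using mn' that unfolding separators_ge_def by blast
  have indep: "\<not> adj x y" if T: "T \<subseteq> V" "card T = 3" "\<not> conn adj (V - T)" "x \<in> T" "y \<in> T" for T x y
  proof
    assume xy: "adj x y"
    then have ne: "x \<noteq> y" using irr by auto
    have fT: "finite T" using T(1) fin finite_subset by blast
    have "1 \<le> card (T - {x, y})" by (rule card_Diff_ge[where k = 2]) (use T(2) in \<open>auto simp: card_insert_if\<close>)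
    then obtain s where s: "s \<in> T" "s \<notin> {x, y}" by (metis DiffD1 DiffD2 all_not_in_conv card.empty not_one_le_zero)
    have "{s, x, y} \<subseteq> T" "card {s, x, y} = 3" using s T ne by auto
    then have eq: "{s, x, y} = T" using fT T(2) by (metis card_subset_eq)
    have "fillable {s, x, y}"
      by (rule fillable_edge) (use mn' T s xy eq in auto)
    then show False using nf by blast
  qed
  obtain s1 s2 s3 where Seq: "S = {s1, s2, s3}" and ne: "s1 \<noteq> s2" "s1 \<noteq> s3" "s2 \<noteq> s3"
    using S(2) unfolding card_3_iff by blast
  have ind: "\<not> adj x y" if "x \<in> S" "y \<in> S" for x y by (rule indep[OF S(1,2,3) that])
  obtain x where x: "x \<in> V - S" using S(4) by blast
  define D1 where "D1 = component adj (V - S) x"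
  have D1: "closed_in (V - S) D1" "x \<in> D1" unfolding D1_def using closed_in_component[OF x] component(1)[OF sy x] by auto
  have D1V: "D1 \<noteq> V - S" using D1 S(3) by (auto simp: closed_in_def)
  then obtain y where y: "y \<in> V - S" "y \<notin> D1" using D1 by (auto simp: closed_in_def)
  define D2 where "D2 = component adj (V - S) y"
  have D2: "closed_in (V - S) D2" "y \<in> D2" unfolding D2_def using closed_in_component[OF y(1)] component(1)[OF sy y(1)] by auto
  have D2V: "D2 \<noteq> V - S" using D2 S(3) by (auto simp: closed_in_def)
  have d12: "D1 \<inter> D2 = {}" by (rule closed_in_disjoint[OF D1(1) D2 y(2)])
  have mnS: "separators_ge (card S)" using mn' S(2) by simp
  note full = full_component[OF mnS S(1)]
  have two: "V - S = D1 \<union> D2"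
  proof (rule ccontr)
    assume "V - S \<noteq> D1 \<union> D2"
    then obtain z where z: "z \<in> V - S" "z \<notin> D1" "z \<notin> D2" using D1 D2 by (auto simp: closed_in_def)
    define D3 where "D3 = component adj (V - S) z"
    have D3: "closed_in (V - S) D3" "z \<in> D3" unfolding D3_def using closed_in_component[OF z(1)] component(1)[OF sy z(1)] by auto
    have D3V: "D3 \<noteq> V - S" using D3 S(3) by (auto simp: closed_in_def)
    have d3: "D1 \<inter> D3 = {}" "D2 \<inter> D3 = {}"
      using closed_in_disjoint[OF D1(1) D3 z(2)] closed_in_disjoint[OF D2(1) D3 z(3)] by auto
    have "fillable {s1, s2, s3}"
    proof (rule fillable_three)
      show "{s1, s2, s3} \<subseteq> V" "card {s1, s2, s3} = 3" using S Seq by auto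
      fix F assume "closed_in (V - {s1, s2, s3}) F"
      then have F: "closed_in (V - S) F" by (simp add: Seq)
      have sub: "F \<subseteq> D \<or> F \<inter> D = {}" if "closed_in (V - S) D" for D
        using conn_closed[of adj F D] F that unfolding closed_in_def by blast
      have t: "touch adj {v} D1" "touch adj {v} D2" "touch adj {v} D3" if "v \<in> S" for v
        using full(1)[OF D1(1) D1V that] full(1)[OF D2(1) D2V that] full(1)[OF D3(1) D3V that] by auto
      have c: "conn adj D1" "conn adj D2" "conn adj D3" "D1 \<subseteq> V - S" "D2 \<subseteq> V - S" "D3 \<subseteq> V - S"
        using D1 D2 D3 by (auto simp: closed_in_def)
      have "F \<inter> D1 = {} \<and> F \<inter> D2 = {} \<or> F \<inter> D1 = {} \<and> F \<inter> D3 = {} \<or> F \<inter> D2 = {} \<and> F \<inter> D3 = {}"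
        using sub[OF D1(1)] sub[OF D2(1)] sub[OF D3(1)] d12 d3 by blast
      moreover have "\<forall>v\<in>S. touch adj {v} D1 \<and> touch adj {v} D2 \<and> touch adj {v} D3" using t by blast
      ultimately obtain X Y where XY: "conn adj X" "conn adj Y" "X \<subseteq> V - S" "Y \<subseteq> V - S" "F \<inter> X = {}" "F \<inter> Y = {}"
        "X \<inter> Y = {}" "\<forall>v\<in>S. touch adj {v} X \<and> touch adj {v} Y"
        using c d12 d3 by metis
      show "\<exists>X Y. conn adj X \<and> conn adj Y \<and> X \<union> Y \<subseteq> V - {s1, s2, s3} - F \<and> X \<inter> Y = {} \<and>
        (\<forall>v\<in>{s1, s2, s3}. touch adj {v} X \<and> touch adj {v} Y)"
        unfolding Seq[symmetric] by (rule exI[of _ X], rule exI[of _ Y]) (use XY in blast)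
    qed
    then show False using nf by blast
  qed
  have c: "conn adj D1" "conn adj D2" "D1 \<subseteq> V" "D2 \<subseteq> V" "S \<inter> D1 = {}" "S \<inter> D2 = {}"
    using D1 D2 by (auto simp: closed_in_def)
  have nt: "\<not> touch adj D1 D2" by (rule closed_in_no_touch[OF D1(1)]) (use c d12 in auto)
  then have nt': "\<not> touch adj D2 D1" using touch_sym[OF sy] by blast
  note f1 = full[OF D1(1) D1V] and f2 = full[OF D2(1) D2V]
  obtain a where a: "a \<in> D1" "\<And>s. s \<in> S \<Longrightarrow> adj s a"
    by (rule dominate_independent[OF c(1,3) c(2,4) _ nt' S(1)]) (use d12 c f1 f2 ind in auto)
  obtain b where b: "b \<in> D2" "\<And>s. s \<in> S \<Longrightarrow> adj s b"
    by (rule dominate_independent[OF c(2,4) c(1,3) _ nt S(1)]) (use d12 c f1 f2 ind in auto)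
  \<comment> \<open>Stated for abstract sides \<open>P\<close> and \<open>Q\<close>, so that it
    applies with \<open>D1\<close> and \<open>D2\<close> in either role.\<close>
  have main: False
    if d: "closed_in (V - S - {a, b}) D" "D \<subseteq> P" "a \<in> P" "b \<in> Q" "conn adj P" "P \<inter> Q = {}" "V - S = P \<union> Q"
      "\<not> touch adj P Q" "\<And>s. s \<in> S \<Longrightarrow> adj s a" "\<And>s. s \<in> S \<Longrightarrow> adj s b" for a b P Q D
  proof -
    have D: "conn adj D" "D \<noteq> {}" "D \<subseteq> V - S - {a, b}" using d(1) conn_ne by (auto simp: closed_in_def)
    have av: "a \<in> V - S" "b \<in> V - S" "a \<noteq> b" using d(3,4,6,7) by blast+
    have nbD: "nb D \<subseteq> insert a S"
    proof
      fix v assume "v \<in> nb D"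
      then obtain z where v: "v \<in> V - D" "z \<in> D" "adj z v" by (auto simp: nb_def)
      have "v \<notin> V - S - {a, b}" using d(1) v by (auto simp: closed_in_def)
      moreover have "v \<noteq> b" using d(8) v d(2,4) by (auto simp: touch_def)
      ultimately show "v \<in> insert a S" using v by blast
    qed
    have fS: "finite S" using S(1) fin finite_subset by blast
    have bn: "b \<in> V - D - nb D" using av D nbD by blast
    have c3: "3 \<le> card (nb D)" by (rule mn) (use D bn in auto)
    \<comment> \<open>If \<open>D\<close> missed \<open>s\<close>, its boundary would be
      \<open>a\<close> with the other two vertices of \<open>S\<close>: a three-vertex separator
      that contains an edge at \<open>a\<close>.\<close>
    have fD: "touch adj {s} D" if s: "s \<in> S" for s
    proof (rule ccontr)
      assume "\<not> touch adj {s} D"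
      then have "s \<notin> nb D" using adj_sym by (auto simp: nb_def touch_def)
      then have sub: "nb D \<subseteq> insert a (S - {s})" using nbD by blast
      have "card (insert a (S - {s})) = 3" using fS s S(2) av by auto
      then have eq: "nb D = insert a (S - {s})" using sub c3 fS by (metis card_seteq finite_Diff finite_insert)
      obtain t where t: "t \<in> S" "t \<noteq> s" using Seq ne s by blast
      have nc: "\<not> conn adj (V - nb D)"
      proof
        assume "conn adj (V - nb D)"
        moreover have "D \<subseteq> V - nb D" using D by (auto simp: nb_def)
        moreover have "D \<noteq> V - nb D" using bn by blast
        ultimately obtain p q where "p \<in> D" "q \<in> V - nb D - D" "adj p q" using connD D(2) by metis
        then show False by (auto simp: nb_def)
      qed
      have "card (nb D) = 3" "nb D \<subseteq> V" using eq \<open>card (insert a (S - {s})) = 3\<close> by (auto simp: nb_def)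
      from indep[OF this(2,1) nc, of t a] show False using d(9)[OF t(1)] eq t by blast
    qed
    have aP: "touch adj {a} D"
    proof -
      have "D \<noteq> P" using D(3) d(3) by blast
      then obtain p q where pq: "p \<in> D" "q \<in> P - D" "adj p q" using connD[OF d(5) d(2) D(2)] by blast
      then have "q \<notin> V - S - {a, b}" using d(1) by (auto simp: closed_in_def)
      then have "q = a" using pq d(4,6,7) by blast
      then show ?thesis using pq adj_sym by (auto simp: touch_def)
    qed
    have abs: "adj a s \<and> adj b s" if "s \<in> {s1, s2, s3}" for s
      using that d(9,10)[of s] adj_sym unfolding Seq[symmetric] by blast
    show False
    proof (cases "V - S - {a, b} = D")
      case True
      have VV: "V = {a, b, s1, s2, s3} \<union> D" using True Seq av S(1) by blast
      have dd: "D \<inter> {a, b, s1, s2, s3} = {}" "card {a, b, s1, s2, s3} = 5"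
        using D(3) Seq av ne by (auto simp: card_insert_if)
      have nbt: "\<not> touch adj {b} D" using d(2,4,8) adj_sym unfolding touch_def by blast
      have "\<exists>T. fillable T"
        by (rule separator_K33[OF VV dd ind[unfolded Seq] abs D(1) aP nbt fD[unfolded Seq]])
      then show False using nf by blast
    next
      case False
      then obtain z where z: "z \<in> V - S - {a, b}" "z \<notin> D" using D(3) by blast
      define D' where "D' = component adj (V - S - {a, b}) z"
      have D': "closed_in (V - S - {a, b}) D'" "z \<in> D'" unfolding D'_def
        using closed_in_component[OF z(1)] component(1)[OF sy z(1)] by auto
      have dis: "D \<inter> D' = {}" by (rule closed_in_disjoint[OF d(1) D' z(2)])
      have D'c: "conn adj D'" "D' \<subseteq> V - S - {a, b}" "D' \<noteq> {}" using D' by (auto simp: closed_in_def)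
      \<comment> \<open>Since \<open>D'\<close> lies on one side, at most one of \<open>a\<close>
        and \<open>b\<close> borders it; so two of its at least three boundary vertices are in
        \<open>S\<close>.\<close>
      have "\<exists>p q. p \<in> S \<and> q \<in> S \<and> p \<noteq> q \<and> touch adj {p} D' \<and> touch adj {q} D'"
      proof -
        have "nb D' \<subseteq> insert a (insert b (nb D' \<inter> S))" using D'(1) by (auto simp: nb_def closed_in_def)
        moreover have "a \<notin> nb D' \<or> b \<notin> nb D'"
        proof -
          have "D' \<subseteq> P \<or> D' \<subseteq> Q"
          proof -
            have "D' \<inter> P \<noteq> {} \<Longrightarrow> D' \<subseteq> P"
              by (rule conn_closed[OF D'c(1)]) (use d(7,8) D'c(2) in \<open>auto simp: touch_def\<close>)
            then show ?thesis using D'c(2) d(7) by blast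
          qed
          then show ?thesis using d(3,4,8) adj_sym unfolding nb_def touch_def by blast
        qed
        ultimately obtain g where g: "nb D' \<subseteq> insert g (nb D' \<inter> S)" "g \<notin> nb D' \<or> g \<in> {a, b}" by blast
        have "x \<in> V - D' - nb D'" if "x \<in> {a, b}" "x \<notin> nb D'" for x using that av D'c by blast
        then have "V - D' - nb D' \<noteq> {}" using \<open>a \<notin> nb D' \<or> b \<notin> nb D'\<close> by blast
        then have "3 \<le> card (nb D')" by (intro mn) (use D'c in auto)
        also have "\<dots> \<le> card (insert g (nb D' \<inter> S))" using g(1) fS by (intro card_mono) auto
        also have "\<dots> \<le> Suc (card (nb D' \<inter> S))" by (simp add: card_insert_le_m1 card_insert_if fS)
        finally have "2 \<le> card (nb D' \<inter> S)" by simp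
        then obtain p q where "p \<in> nb D' \<inter> S" "q \<in> nb D' \<inter> S" "p \<noteq> q" by (rule two_elements)
        moreover from this have "touch adj {p} D'" "touch adj {q} D'" using adj_sym by (auto simp: nb_def)
        ultimately show ?thesis by blast
      qed
      then obtain p q where pq: "p \<in> S" "q \<in> S" "p \<noteq> q" "touch adj {p} D'" "touch adj {q} D'" by blast
      have "1 \<le> card (S - {p, q})" by (rule card_Diff_ge[where k = 2]) (use S(2) in \<open>auto simp: card_insert_if\<close>)
      then obtain r where r: "r \<in> S" "r \<notin> {p, q}" by (metis DiffD1 DiffD2 all_not_in_conv card.empty not_one_le_zero)
      have abs': "adj a s \<and> adj b s" if "s \<in> {p, q, r}" for s using abs[of s] that pq r Seq by blast
      show False
      proof (rule dominated_component_False[of a b p q r D D'])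
        show "card {p, q, r} = 3" using pq r by auto
        show "{a, b} \<inter> {p, q, r} = {}" using av pq r by blast
        show "D \<union> D' \<subseteq> V - {a, b, p, q, r}" using D(3) D'c(2) pq r by blast
        show "touch adj {s} D" if "s \<in> {p, q, r}" for s using fD that pq r by blast
      qed (use av pq r S(1) abs' D(1) D'c(1) dis aP in auto)
    qed
  qed
  show False
  proof (cases "V - S - {a, b} = {}")
    case True
    have "nb {s1} \<subseteq> {a, b}" using True ind[of s1] Seq by (auto simp: nb_def)
    then have "card (nb {s1}) \<le> card {a, b}" by (intro card_mono) auto
    also have "\<dots> \<le> 2" by (simp add: card_insert_if)
    finally have "card (nb {s1}) \<le> 2" .
    moreover have "s2 \<in> V - {s1} - nb {s1}" using S(1) Seq ne ind[of s1 s2] by (auto simp: nb_def)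
    ultimately show False using mn[of "{s1}"] S(1) Seq by fastforce
  next
    case False
    then obtain z where z: "z \<in> V - S - {a, b}" by blast
    define D where "D = component adj (V - S - {a, b}) z"
    have D: "closed_in (V - S - {a, b}) D" "z \<in> D" unfolding D_def
      using closed_in_component[OF z] component(1)[OF sy z] by auto
    have D': "closed_in (V - S - {b, a}) D" using D(1) by (simp add: insert_commute)
    have "D \<inter> D1 \<noteq> {} \<Longrightarrow> D \<subseteq> D1"
      by (rule conn_closed[of adj]) (use D(1) two nt in \<open>auto simp: touch_def closed_in_def\<close>)
    then consider "D \<subseteq> D1" | "D \<subseteq> D2" using D two by (auto simp: closed_in_def)
    then show False
    proof cases
      case 1
      show False by (rule main[OF D(1) 1 a(1) b(1) c(1) d12 two nt a(2) b(2)])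
    next
      case 2
      have d21: "D2 \<inter> D1 = {}" "V - S = D2 \<union> D1" using d12 two by auto
      show False by (rule main[OF D' 2 b(1) a(1) c(2) d21 nt' b(2) a(2)])
    qed
  qed
qed

end

text \<open>A complete graph on more than four vertices contains \<open>K5\<close>, so separators
  exist, and the size of a smallest one decides. Size four or more leads to the octahedron, which is
  good; with at most one vertex the separator is already a clique.\<close>

lemma (in cgraph) exists_fillable:
  assumes big: "4 < card V" and ng: "\<not> good V adj"
  shows "\<exists>S. fillable S"
proof -
  have "\<exists>u\<in>V. \<exists>v\<in>V. u \<noteq> v \<and> \<not> adj u v"
  proof (rule ccontr)
    assume n: "\<not> ?thesis"
    have "5 \<le> card V" using big by simp
    then obtain T where T: "T \<subseteq> V" "card T = 5" "finite T" by (rule obtain_subset_with_card_n)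
    obtain h where h: "bij_betw h {0..<5::nat} T" using ex_bij_betw_nat_finite[OF T(3)] unfolding T(2) by blast
    have "K5_model V adj (\<lambda>i. {h i})"
      unfolding K5_model_def
    proof (intro conjI allI impI)
      fix i j :: nat assume "i < 5" "j < 5" "i \<noteq> j"
      then have "h i \<noteq> h j" "h i \<in> T" "h j \<in> T" using h by (auto simp: bij_betw_def inj_on_def)
      then show "{h i} \<inter> {h j} = {}" "touch adj {h i} {h j}" using n T(1) by auto
    next
      fix i :: nat assume "i < 5"
      then show "{h i} \<subseteq> V" using h T(1) by (auto simp: bij_betw_def)
    qed simp
    then show False using cls by (auto simp: cls_def no_K5_def)
  qed
  then obtain u v where uv: "u \<in> V" "v \<in> V" "u \<noteq> v" "\<not> adj u v" by blast
  let ?P = "\<lambda>X. X \<subseteq> V \<and> X \<noteq> {} \<and> V - X - nb X \<noteq> {}"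
  have "?P {u}" using uv by (auto simp: nb_def)
  then obtain X where X: "?P X" and mn: "\<And>Y. ?P Y \<Longrightarrow> card (nb X) \<le> card (nb Y)"
    using ex_has_least_nat[of ?P "{u}" "\<lambda>X. card (nb X)"] by blast
  define S where "S = nb X"
  have sg: "separators_ge (card S)" using mn by (auto simp: separators_ge_def S_def)
  have S: "S \<subseteq> V" "X \<inter> S = {}" by (auto simp: S_def nb_def)
  have fS: "finite S" using S(1) fin finite_subset by blast
  have ne: "V - S \<noteq> {}" using X S by blast
  have nc: "\<not> conn adj (V - S)"
  proof
    assume c: "conn adj (V - S)"
    have "V - S \<subseteq> X" by (rule conn_closed[OF c]) (use X S in \<open>auto simp: S_def nb_def\<close>)
    then show False using X by (auto simp: S_def)
  qed
  consider "4 \<le> card S" | "card S = 3" | "card S = 2" | "card S \<le> 1" by linarith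
  then show ?thesis
  proof cases
    case 1
    have four: "4 \<le> card (nb Y)" if "Y \<subseteq> V" "Y \<noteq> {}" "V - Y - nb Y \<noteq> {}" for Y
      using mn[of Y] that 1 by (simp add: S_def)
    obtain u u' v v' w w' where "V = {u, u', v, v', w, w'}" "card V = 6"
      "\<not> adj u u'" "\<not> adj v v'" "\<not> adj w w'"
      using four_connected_cases[OF four uv] by blast
    then have "good V adj" by (intro good_octahedron[of V u u' v v' w w' adj]) (use adj_sym irr in auto)
    then show ?thesis using ng by blast
  next
    case 2
    then show ?thesis using three_separator_fillable[OF _ S(1) _ nc ne] sg by simp
  next
    case 3
    then obtain s t where st: "S = {s, t}" "s \<noteq> t" unfolding card_2_iff by blast
    have "fillable {s, t, t}" by (rule fillable_edge) (use st S sg nc in auto)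
    then show ?thesis by blast
  next
    case 4
    have "fillable S"
      unfolding fillable_def
    proof (intro conjI allI impI)
      fix D assume D: "closed_in (V - S) D"
      show "D \<noteq> V - S" using D nc by (auto simp: closed_in_def)
      have eq: "x = y" if "x \<in> S" "y \<in> S" for x y using 4 that card_le_Suc0_iff_eq[OF fS] by auto
      show "cls (D \<union> S) (add_clique S adj)"
        by (rule cls_induced[OF cls sy]) (use D S eq in \<open>auto simp: closed_in_def add_clique_def\<close>)
    qed (use S 4 in auto)
    then show ?thesis by blast
  qed
qed

lemma good_mono: "good V R \<Longrightarrow> (\<And>u v. R' u v \<Longrightarrow> R u v) \<Longrightarrow> good V R'"
  unfolding good_def using cut_repr_mono by blast

text \<open>The induction generalises the adjacency because the pieces carry the added edges of the
  filled separator. Dropping these edges at the end only weakens the demand on the mixture.\<close>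

theorem cgraph_good: "cgraph V adj \<Longrightarrow> good V adj"
proof (induction "card V" arbitrary: V adj rule: less_induct)
  case less
  interpret cgraph V adj by fact
  show ?case
  proof (rule ccontr)
    assume ng: "\<not> good V adj"
    then have "4 < card V" using good_small[OF fin, of adj] by linarith
    then obtain S where S: "fillable S" using exists_fillable ng by blast
    have SV: "S \<subseteq> V" "card S \<le> 3" using S by (auto simp: fillable_def)
    let ?R = "add_clique S adj"
    have "good V ?R"
    proof (rule good_clique_sum[OF fin symp_add_clique[OF sy] SV])
      show "?R x y" if "x \<in> S" "y \<in> S" "x \<noteq> y" for x y using that by (simp add: add_clique_def)
      fix D assume D: "conn ?R D" "D \<subseteq> V - S" and cl: "\<And>x y. x \<in> D \<Longrightarrow> y \<in> V - S - D \<Longrightarrow> \<not> ?R x y"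
      have eq: "?R x y \<longleftrightarrow> adj x y" if "x \<in> D" for x y using that D(2) by (auto simp: add_clique_def)
      have "conn adj D"
        unfolding conn_def
      proof (intro conjI allI impI)
        show "D \<noteq> {}" using D(1) by (rule conn_ne)
        fix Y assume Y: "Y \<subseteq> D" "Y \<noteq> {}" "Y \<noteq> D"
        show "\<exists>y\<in>Y. \<exists>z\<in>D - Y. adj y z" using connD[OF D(1) Y] eq Y(1) by blast
      qed
      then have "closed_in (V - S) D" using D(2) cl eq unfolding closed_in_def by blast
      then have F: "D \<noteq> V - S" "cls (D \<union> S) ?R" using S by (auto simp: fillable_def)
      have "D \<union> S \<subset> V" using F(1) D(2) SV(1) by blast
      then have "card (D \<union> S) < card V" using fin by (rule psubset_card_mono[rotated])
      moreover have "cgraph (D \<union> S) ?R"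
      proof
        show "finite (D \<union> S)" using D(2) SV(1) fin by (meson Diff_subset finite_Un finite_subset)
        show "\<not> ?R x x" for x using irr by (auto simp: add_clique_def)
      qed (use symp_add_clique[OF sy] F in auto)
      ultimately show "good (D \<union> S) ?R" by (rule less.hyps)
    qed
    then have "good V adj" by (rule good_mono) (auto simp: add_clique_def)
    then show False using ng by blast
  qed
qed

section \<open>Theta bodies\<close>

abbreviation "lkp \<equiv> Poly_Mapping.lookup"

definition monom_eval :: "'e point \<Rightarrow> ('e \<Rightarrow>\<^sub>0 nat) \<Rightarrow> real" where
  "monom_eval x m = (\<Prod>e\<in>Poly_Mapping.keys m. lkp x e ^ lkp m e)"

lemma monom_eval_superset:
  "finite K \<Longrightarrow> Poly_Mapping.keys m \<subseteq> K \<Longrightarrow> monom_eval x m = (\<Prod>e\<in>K. lkp x e ^ lkp m e)"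
  unfolding monom_eval_def by (rule prod.mono_neutral_left) (auto simp: in_keys_iff)

lemma monom_eval_add: "monom_eval x (m + n) = monom_eval x m * monom_eval x n"
proof -
  let ?K = "Poly_Mapping.keys m \<union> Poly_Mapping.keys n"
  have "Poly_Mapping.keys (m + n) \<subseteq> ?K" by (rule Poly_Mapping.keys_add)
  then show ?thesis
    by (simp add: monom_eval_superset[of ?K] lookup_add power_add prod.distrib)
qed

lemma monom_eval_simps [simp]:
  "monom_eval x 0 = 1" "monom_eval x (Poly_Mapping.single e 1) = lkp x e"
  by (simp_all add: monom_eval_def)

lemma peval_superset:
  "finite K \<Longrightarrow> Poly_Mapping.keys p \<subseteq> K \<Longrightarrow> peval x p = (\<Sum>m\<in>K. lkp p m * monom_eval x m)"
  unfolding peval_def monom_eval_def by (rule sum.mono_neutral_left) (auto simp: in_keys_iff)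

lemma peval_add: "peval x (p + q) = peval x p + peval x q"
proof -
  let ?K = "Poly_Mapping.keys p \<union> Poly_Mapping.keys q"
  have "Poly_Mapping.keys (p + q) \<subseteq> ?K" by (rule Poly_Mapping.keys_add)
  then show ?thesis
    by (simp add: peval_superset[of ?K] lookup_add algebra_simps sum.distrib)
qed

lemma peval_0 [simp]: "peval x 0 = 0"
  by (simp add: peval_def)

lemma peval_single [simp]: "peval x (Poly_Mapping.single m a) = a * monom_eval x m"
  by (subst peval_superset[of "{m}"]) auto

lemma poly_sum_singles: "(\<Sum>m\<in>Poly_Mapping.keys p. Poly_Mapping.single m (lkp p m)) = p"
  by (rule poly_mapping_eqI) (simp add: lookup_sum lookup_single when_def in_keys_iff)

lemma peval_sum: "peval x (\<Sum>i\<in>I. f i) = (\<Sum>i\<in>I. peval x (f i))"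
  by (induction I rule: infinite_finite_induct) (auto simp: peval_add)

lemma peval_mult: "peval x (p * q) = peval x p * peval x q"
proof -
  have "p * q = (\<Sum>m\<in>Poly_Mapping.keys p. \<Sum>n\<in>Poly_Mapping.keys q.
      Poly_Mapping.single m (lkp p m) * Poly_Mapping.single n (lkp q n))"
    by (subst (1) poly_sum_singles[of p, symmetric], subst (1) poly_sum_singles[of q, symmetric])
      (rule sum_product)
  also have "peval x \<dots> = (\<Sum>m\<in>Poly_Mapping.keys p. \<Sum>n\<in>Poly_Mapping.keys q.
      (lkp p m * monom_eval x m) * (lkp q n * monom_eval x n))"
    by (simp add: peval_sum mult_single monom_eval_add algebra_simps)
  also have "\<dots> = peval x p * peval x q"
    unfolding sum_product[symmetric] by (simp add: peval_superset[of "Poly_Mapping.keys p"] peval_superset[of "Poly_Mapping.keys q"])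
  finally show ?thesis .
qed

lemma peval_power2: "peval x (p\<^sup>2) = (peval x p)\<^sup>2"
  by (simp add: power2_eq_square peval_mult)

lemma peval_1 [simp]: "peval x 1 = 1"
  using peval_single[of x 0 1] by simp

lemma peval_prod: "peval x (\<Prod>i\<in>I. f i) = (\<Prod>i\<in>I. peval x (f i))"
  by (induction I rule: infinite_finite_induct) (auto simp: peval_mult)

lemma peval_minus: "peval x (p - q) = peval x p - peval x q"
  using peval_add[of x "p - q" q] by simp

lemma poly_ring_single: "Poly_Mapping.keys m \<subseteq> E \<Longrightarrow> Poly_Mapping.single m a \<in> poly_ring E"
  by (auto simp: poly_ring_def vars_def)

lemma poly_ring_iff: "p \<in> poly_ring E \<longleftrightarrow> (\<forall>m\<in>Poly_Mapping.keys p. Poly_Mapping.keys m \<subseteq> E)"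
  by (auto simp: poly_ring_def vars_def)

lemma poly_ring_add: "p \<in> poly_ring E \<Longrightarrow> q \<in> poly_ring E \<Longrightarrow> p + q \<in> poly_ring E"
  unfolding poly_ring_iff using Poly_Mapping.keys_add[of p q] by blast

lemma poly_ring_minus: "p \<in> poly_ring E \<Longrightarrow> q \<in> poly_ring E \<Longrightarrow> p - q \<in> poly_ring E"
  unfolding poly_ring_iff using keys_diff[of p q] by blast

lemma poly_ring_mult: "p \<in> poly_ring E \<Longrightarrow> q \<in> poly_ring E \<Longrightarrow> p * q \<in> poly_ring E"
proof (unfold poly_ring_iff, intro ballI)
  fix m assume p: "\<forall>m\<in>Poly_Mapping.keys p. Poly_Mapping.keys m \<subseteq> E" "\<forall>m\<in>Poly_Mapping.keys q. Poly_Mapping.keys m \<subseteq> E"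
    and "m \<in> Poly_Mapping.keys (p * q)"
  then obtain a b where "m = a + b" "a \<in> Poly_Mapping.keys p" "b \<in> Poly_Mapping.keys q"
    using keys_mult[of p q] by blast
  then show "Poly_Mapping.keys m \<subseteq> E" using p Poly_Mapping.keys_add[of a b] by blast
qed

lemma poly_ring_1 [simp]: "1 \<in> poly_ring E" and poly_ring_0 [simp]: "0 \<in> poly_ring E"
  using poly_ring_single[of 0 E 1] by (simp_all add: poly_ring_iff)

lemma poly_ring_sum: "(\<And>i. i \<in> I \<Longrightarrow> f i \<in> poly_ring E) \<Longrightarrow> (\<Sum>i\<in>I. f i) \<in> poly_ring E"
  by (induction I rule: infinite_finite_induct) (auto intro: poly_ring_add)

lemma poly_ring_prod: "(\<And>i. i \<in> I \<Longrightarrow> f i \<in> poly_ring E) \<Longrightarrow> (\<Prod>i\<in>I. f i) \<in> poly_ring E"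
  by (induction I rule: infinite_finite_induct) (auto intro: poly_ring_mult)

section \<open>Affine functions and theta bodies\<close>

definition affine_poly :: "'e set \<Rightarrow> real \<Rightarrow> ('e \<Rightarrow> real) \<Rightarrow> 'e mpoly" where
  "affine_poly E c0 c = Poly_Mapping.single 0 c0 + (\<Sum>e\<in>E. Poly_Mapping.single (Poly_Mapping.single e 1) (c e))"

definition affine_eval :: "'e set \<Rightarrow> real \<Rightarrow> ('e \<Rightarrow> real) \<Rightarrow> 'e point \<Rightarrow> real" where
  "affine_eval E c0 c x = c0 + (\<Sum>e\<in>E. c e * lkp x e)"

lemma peval_affine_poly: "peval x (affine_poly E c0 c) = affine_eval E c0 c x"
  by (simp add: affine_poly_def affine_eval_def peval_add peval_sum del: One_nat_def)

lemma affine_poly_in_ring: "affine_poly E c0 c \<in> poly_ring E"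
  unfolding affine_poly_def by (intro poly_ring_add poly_ring_sum poly_ring_single) auto

lemma affine_poly_degree: "degree_le (affine_poly E c0 c) 1"
  unfolding degree_le_def
proof
  fix m assume "m \<in> Poly_Mapping.keys (affine_poly E c0 c)"
  moreover have "Poly_Mapping.keys (affine_poly E c0 c) \<subseteq> Poly_Mapping.keys (Poly_Mapping.single (0 :: 'a \<Rightarrow>\<^sub>0 nat) c0) \<union>
      Poly_Mapping.keys (\<Sum>e\<in>E. Poly_Mapping.single (Poly_Mapping.single e (1::nat)) (c e))"
    unfolding affine_poly_def by (rule Poly_Mapping.keys_add)
  moreover have "Poly_Mapping.keys (\<Sum>e\<in>E. Poly_Mapping.single (Poly_Mapping.single e (1::nat)) (c e)) \<subseteq>
      (\<Union>e\<in>E. Poly_Mapping.keys (Poly_Mapping.single (Poly_Mapping.single e (1::nat)) (c e)))"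
    by (rule keys_sum)
  ultimately have "m \<in> Poly_Mapping.keys (Poly_Mapping.single (0 :: 'a \<Rightarrow>\<^sub>0 nat) c0) \<union>
      (\<Union>e\<in>E. Poly_Mapping.keys (Poly_Mapping.single (Poly_Mapping.single e (1::nat)) (c e)))"
    by (meson Un_mono subset_iff subset_refl)
  then have "m = 0 \<or> (\<exists>e\<in>E. m = Poly_Mapping.single e 1)" by (auto split: if_splits)
  then show "(\<Sum>e\<in>Poly_Mapping.keys m. lkp m e) \<le> 1" by auto
qed

lemma degree_le_1_affine:
  assumes "finite E" "g \<in> poly_ring E" "degree_le g 1"
  shows "\<exists>c0 c. \<forall>x. peval x g = affine_eval E c0 c x"
proof -
  let ?s = "\<lambda>e :: 'a. Poly_Mapping.single e (1::nat)"
  have key: "m = 0 \<or> (\<exists>e\<in>E. m = ?s e)" if m: "m \<in> Poly_Mapping.keys g" for m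
  proof (rule ccontr)
    assume n: "\<not> ?thesis"
    have d: "(\<Sum>e\<in>Poly_Mapping.keys m. lkp m e) \<le> 1" using assms(3) m by (auto simp: degree_le_def)
    have kE: "Poly_Mapping.keys m \<subseteq> E" using assms(2) m by (auto simp: poly_ring_iff)
    have "Poly_Mapping.keys m \<noteq> {}" using n by auto
    then obtain e where e: "e \<in> Poly_Mapping.keys m" by blast
    have "(\<Sum>e\<in>Poly_Mapping.keys m. lkp m e) = lkp m e + (\<Sum>e\<in>Poly_Mapping.keys m - {e}. lkp m e)"
      using e by (simp add: sum.remove)
    moreover have "1 \<le> lkp m e" using e by (simp add: in_keys_iff)
    ultimately have l: "lkp m e = 1" and "(\<Sum>e\<in>Poly_Mapping.keys m - {e}. lkp m e) = 0" using d by linarith+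
    then have "\<forall>f\<in>Poly_Mapping.keys m - {e}. lkp m f = 0" by simp
    then have "lkp m f = 0" if "f \<noteq> e" for f using that by (metis DiffI in_keys_iff singletonD)
    then have "lkp m f = lkp (?s e) f" for f using l by (cases "f = e") (simp_all add: lookup_single when_def)
    then have "m = ?s e" by (rule poly_mapping_eqI)
    then show False using n e kE by blast
  qed
  have ks: "Poly_Mapping.keys (?s e) = {e}" for e :: 'a by simp
  have inj: "inj_on ?s E" by (rule inj_onI) (metis ks singleton_inject)
  have z: "0 \<notin> ?s ` E"
  proof
    assume "0 \<in> ?s ` E"
    then obtain e where e: "0 = ?s e" by (rule imageE) (rule that)
    from arg_cong[OF e, of Poly_Mapping.keys] show False unfolding ks keys_zero by simp
  qed
  have "peval x g = affine_eval E (lkp g 0) (\<lambda>e. lkp g (?s e)) x" for x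
  proof -
    have "peval x g = (\<Sum>m\<in>insert 0 (?s ` E). lkp g m * monom_eval x m)"
      by (rule peval_superset) (use assms(1) key in auto)
    also have "\<dots> = lkp g 0 + (\<Sum>m\<in>?s ` E. lkp g m * monom_eval x m)"
      using z assms(1) by (subst sum.insert) auto
    also have "(\<Sum>m\<in>?s ` E. lkp g m * monom_eval x m) = (\<Sum>e\<in>E. lkp g (?s e) * lkp x e)"
      by (subst sum.reindex[OF inj]) (simp add: comp_def del: One_nat_def)
    finally show ?thesis by (simp add: affine_eval_def)
  qed
  then show ?thesis by blast
qed

lemma lookup_scaleR [simp]: "lkp (r *\<^sub>R x) e = r * lkp (x :: 'e point) e"
proof -
  have "finite {i. r *\<^sub>R lkp x i \<noteq> 0}"
    by (rule finite_subset[OF _ finite_lookup[of x]]) auto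
  then show ?thesis by (simp add: scaleR_poly_mapping_def Abs_poly_mapping_inverse)
qed

lemma bounded_linear_lookup: "bounded_linear (\<lambda>x :: 'e point. lkp x e)"
proof (rule bounded_linear_intro[where K = 1])
  fix x :: "'e point"
  have "norm x = (\<Sum>n\<in>Poly_Mapping.keys x. \<bar>lkp x n\<bar>)"
    by (simp add: norm_poly_mapping_def dist_poly_mapping_def)
  moreover have "\<bar>lkp x e\<bar> \<le> (\<Sum>n\<in>Poly_Mapping.keys x. \<bar>lkp x n\<bar>)"
  proof (cases "e \<in> Poly_Mapping.keys x")
    case True
    then show ?thesis by (intro member_le_sum) auto
  next
    case False
    then show ?thesis by (simp add: in_keys_iff sum_nonneg)
  qed
  ultimately show "norm (lkp x e) \<le> norm x * 1" by simp
qed (auto simp: lookup_add)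

lemma affine_eval_combination:
  "(\<Sum>i\<in>I. w i) = 1 \<Longrightarrow> affine_eval E c0 c (\<Sum>i\<in>I. w i *\<^sub>R x i) = (\<Sum>i\<in>I. w i * affine_eval E c0 c (x i))"
proof -
  assume w: "(\<Sum>i\<in>I. w i) = 1"
  have "(\<Sum>i\<in>I. w i * c0) = c0" unfolding sum_distrib_right[symmetric] w by simp
  then show ?thesis
    unfolding affine_eval_def
    by (simp add: lookup_sum sum.distrib distrib_left sum_distrib_left sum.swap[of _ I E] mult.left_commute)
qed

lemma halfspace_affine_eval:
  "closed {x. 0 \<le> affine_eval E c0 c x}" "convex {x. 0 \<le> affine_eval E c0 c x}"
proof -
  have cont: "continuous_on UNIV (\<lambda>x. lkp (x :: 'a point) e)" for e
    by (rule linear_continuous_on[OF bounded_linear_lookup])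
  show "closed {x. 0 \<le> affine_eval E c0 c x}"
    unfolding affine_eval_def by (intro closed_Collect_le continuous_intros cont)
  show "convex {x. 0 \<le> affine_eval E c0 c x}"
  proof (rule convexI)
    fix x y :: "'a point" and u v :: real
    assume h: "x \<in> {x. 0 \<le> affine_eval E c0 c x}" "y \<in> {x. 0 \<le> affine_eval E c0 c x}" "0 \<le> u" "0 \<le> v" "u + v = 1"
    have "affine_eval E c0 c (u *\<^sub>R x + v *\<^sub>R y) = u * affine_eval E c0 c x + v * affine_eval E c0 c y"
      using affine_eval_combination[where I = "{True, False}" and w = "\<lambda>b. if b then u else v" and x = "\<lambda>b. if b then x else y"] h(5)
      by simp
    then show "u *\<^sub>R x + v *\<^sub>R y \<in> {x. 0 \<le> affine_eval E c0 c x}" using h by simp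
  qed
qed

lemma closed_convex_real_space: "closed (real_space E)" "convex (real_space E)"
proof -
  have eq: "real_space E = (\<Inter>e\<in>- E. {x. lkp x e = 0})"
    by (auto simp: real_space_def in_keys_iff subset_iff)
  have cont: "continuous_on UNIV (\<lambda>x. lkp (x :: 'a point) e)" for e
    by (rule linear_continuous_on[OF bounded_linear_lookup])
  show "closed (real_space E)" unfolding eq by (intro closed_INT ballI closed_Collect_eq cont continuous_on_const)
  show "convex (real_space E)" unfolding eq
    by (intro convex_INT) (auto simp: convex_def lookup_add)
qed

lemma variety_subset_theta:
  assumes "finite E"
  shows "closure (convex hull (real_variety E I)) \<subseteq> theta_body E k I"
proof -
  define \<F> where "\<F> = {f \<in> poly_ring E. degree_le f 1 \<and> sos_mod E k I f}"
  have eq: "theta_body E k I = real_space E \<inter> (\<Inter>f\<in>\<F>. {x. 0 \<le> peval x f})"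
    by (auto simp: theta_body_def \<F>_def)
  have half: "closed {x. 0 \<le> peval x f} \<and> convex {x. 0 \<le> peval x f}" if f: "f \<in> \<F>" for f
  proof -
    obtain c0 c where "\<forall>x. peval x f = affine_eval E c0 c x"
      using degree_le_1_affine[OF assms, of f] f unfolding \<F>_def by blast
    then show ?thesis by (simp add: halfspace_affine_eval)
  qed
  have "real_variety E I \<subseteq> theta_body E k I"
  proof
    fix x assume x: "x \<in> real_variety E I"
    have "0 \<le> peval x f" if "sos_mod E k I f" for f
    proof -
      from that obtain t :: nat and g h where "h \<in> I" "f = (\<Sum>i<t. (g i)\<^sup>2) + h"
        unfolding sos_mod_def by metis
      then show ?thesis using x by (auto simp: peval_add peval_sum peval_power2 real_variety_def intro!: sum_nonneg)
    qed
    then show "x \<in> theta_body E k I" using x by (auto simp: theta_body_def real_variety_def)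
  qed
  moreover have "convex (theta_body E k I)" "closed (theta_body E k I)"
    unfolding eq using half closed_convex_real_space by (auto intro!: convex_Int convex_INT closed_Int closed_INT)
  ultimately show ?thesis by (simp add: closure_minimal hull_minimal)
qed

lemma sign_vector_in_variety:
  assumes "C \<in> cycles M" "finite (ground M)"
  shows "sign_vector (ground M) C \<in> real_variety (ground M) (cycle_ideal M)"
  using assms by (auto simp: real_variety_def cycle_ideal_def real_space_def in_keys_iff lookup_sign_vector split: if_splits)

lemma theta_exactI:
  assumes "finite (ground M)"
    and "theta_body (ground M) 1 (cycle_ideal M) \<subseteq> convex hull (sign_vector (ground M) ` cycles M)"
  shows "theta_exact (ground M) 1 (cycle_ideal M)"
proof -
  have "convex hull (sign_vector (ground M) ` cycles M) \<subseteq> convex hull (real_variety (ground M) (cycle_ideal M))"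
    using sign_vector_in_variety[OF _ assms(1)] by (intro hull_mono) auto
  then show ?thesis
    unfolding theta_exact_def using variety_subset_theta[OF assms(1)] assms(2) closure_subset by blast
qed

text \<open>An affine function with values 0 and \<open>r\<close> on the cycles equals its own
  square divided by \<open>r\<close> there, so modulo the ideal it is a single square.\<close>

lemma theta_body_two_level:
  assumes fin: "finite (ground M)" and r: "0 < r"
    and two: "\<And>C. C \<in> cycles M \<Longrightarrow> affine_eval (ground M) c0 c (sign_vector (ground M) C) \<in> {0, r}"
    and x: "x \<in> theta_body (ground M) 1 (cycle_ideal M)"
  shows "0 \<le> affine_eval (ground M) c0 c x"
proof -
  let ?E = "ground M"
  let ?f = "affine_poly ?E c0 c"
  define g where "g = affine_poly ?E (c0 / sqrt r) (\<lambda>e. c e / sqrt r)"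
  have g: "affine_eval ?E (c0 / sqrt r) (\<lambda>e. c e / sqrt r) y = affine_eval ?E c0 c y / sqrt r" for y
    by (simp add: affine_eval_def add_divide_distrib sum_divide_distrib)
  have "peval (sign_vector ?E C) (?f - g\<^sup>2) = 0" if "C \<in> cycles M" for C
  proof -
    let ?a = "affine_eval ?E c0 c (sign_vector ?E C)"
    have "peval (sign_vector ?E C) (?f - g\<^sup>2) = ?a - ?a\<^sup>2 / r"
      using r by (simp add: peval_minus peval_power2 peval_affine_poly g_def g power_divide)
    then show ?thesis using two[OF that] r by (auto simp: power2_eq_square)
  qed
  moreover have "?f - g\<^sup>2 \<in> poly_ring ?E"
    unfolding power2_eq_square g_def by (intro poly_ring_minus poly_ring_mult affine_poly_in_ring)
  ultimately have I: "?f - g\<^sup>2 \<in> cycle_ideal M" by (simp add: cycle_ideal_def)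
  have "sos_mod ?E 1 (cycle_ideal M) ?f"
    unfolding sos_mod_def
  proof (intro exI conjI)
    show "\<forall>i<1::nat. g \<in> poly_ring ?E \<and> degree_le g 1"
      by (simp add: g_def affine_poly_in_ring affine_poly_degree del: One_nat_def)
    show "?f = (\<Sum>i<1::nat. g\<^sup>2) + (?f - g\<^sup>2)" by simp
  qed (rule I)
  then have "0 \<le> peval x ?f"
    using x affine_poly_in_ring affine_poly_degree unfolding theta_body_def by blast
  then show ?thesis by (simp add: peval_affine_poly)
qed

text \<open>If \<open>Q\<close> is an affine combination of \<open>P\<close> and roots \<open>S i\<close> of a valid inequality with coefficient
  \<open>\<beta> > 1\<close> at \<open>P\<close>, then giving \<open>P\<close> a negative weight, \<open>Q\<close> a weight strictly between
  \<open>1 / \<beta>\<^sup>2\<close> and \<open>1 / \<beta>\<close>, and the roots a large weight defines a functional that is nonnegative on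
  squares of affine functions although it violates the inequality.\<close>

lemma not_theta_exact:
  fixes M :: "'e bmat" and S :: "'i \<Rightarrow> 'e set"
  assumes fin: "finite (ground M)" and fI: "finite I"
    and cyc: "finite (cycles M)" "P \<in> cycles M" "Q \<in> cycles M" "\<And>i. i \<in> I \<Longrightarrow> S i \<in> cycles M"
    and \<beta>: "1 < \<beta>" "\<beta> + (\<Sum>i\<in>I. \<mu> i) = 1"
    and comb: "\<And>e. e \<in> ground M \<Longrightarrow> lkp (sign_vector (ground M) Q) e =
      \<beta> * lkp (sign_vector (ground M) P) e + (\<Sum>i\<in>I. \<mu> i * lkp (sign_vector (ground M) (S i)) e)"
    and root: "\<And>i. i \<in> I \<Longrightarrow> affine_eval (ground M) c0 c (sign_vector (ground M) (S i)) = 0"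
    and pos: "0 < affine_eval (ground M) c0 c (sign_vector (ground M) P)"
    and valid: "\<And>C. C \<in> cycles M \<Longrightarrow> 0 \<le> affine_eval (ground M) c0 c (sign_vector (ground M) C)"
  shows "\<not> theta_exact (ground M) 1 (cycle_ideal M)"
proof
  assume exact: "theta_exact (ground M) 1 (cycle_ideal M)"
  let ?E = "ground M"
  let ?sv = "sign_vector ?E"
  have affQ: "affine_eval ?E a0 a (?sv Q) = \<beta> * affine_eval ?E a0 a (?sv P) + (\<Sum>i\<in>I. \<mu> i * affine_eval ?E a0 a (?sv (S i)))" for a0 a
  proof -
    have "affine_eval ?E a0 a (?sv Q) = a0 * (\<beta> + (\<Sum>i\<in>I. \<mu> i)) +
        (\<Sum>e\<in>?E. a e * (\<beta> * lkp (?sv P) e + (\<Sum>i\<in>I. \<mu> i * lkp (?sv (S i)) e)))"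
      using comb \<beta>(2) by (simp add: affine_eval_def)
    also have "\<dots> = \<beta> * affine_eval ?E a0 a (?sv P) + (\<Sum>i\<in>I. \<mu> i * affine_eval ?E a0 a (?sv (S i)))"
      unfolding affine_eval_def
      by (simp add: algebra_simps sum.distrib sum_distrib_left sum.swap[of _ I ?E])
    finally show ?thesis .
  qed
  define v where "v = (1 / \<beta>\<^sup>2 + 1 / \<beta>) / 2"
  have b2: "1 / \<beta>\<^sup>2 < 1 / \<beta>" using \<beta>(1) by (simp add: field_simps power2_eq_square)
  have v: "0 < v" "v * \<beta> < 1" "1 < v * \<beta>\<^sup>2"
  proof -
    show "0 < v" using \<beta>(1) by (simp add: v_def add_pos_pos)
    have "v < 1 / \<beta>" "1 / \<beta>\<^sup>2 < v" using b2 by (simp_all add: v_def)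
    then show "v * \<beta> < 1" "1 < v * \<beta>\<^sup>2" using \<beta>(1) by (simp_all add: field_simps)
  qed
  \<comment> \<open>Completing the square in the value at \<open>P\<close> leaves an error of at
    most \<open>v\<^sup>2 * \<beta>\<^sup>2 / \<kappa>\<close> times the square of the root part,
    and Cauchy-Schwarz bounds that square by \<open>K\<close> times the sum of squares over the
    roots. The weight \<open>w\<close> dominates the product.\<close>
  define \<kappa> where "\<kappa> = v * \<beta>\<^sup>2 - 1"
  define K where "K = (\<Sum>i\<in>I. (\<mu> i)\<^sup>2)"
  define w where "w = v\<^sup>2 * \<beta>\<^sup>2 / \<kappa> * K + 1"
  have \<kappa>: "0 < \<kappa>" using v by (simp add: \<kappa>_def)
  have K: "0 \<le> K" by (simp add: K_def sum_nonneg)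
  have w1: "1 \<le> w" using K \<kappa> by (simp add: w_def)
  have "I \<noteq> {}" using \<beta> by auto
  then have cI: "1 \<le> real (card I)" using fI by (simp add: Suc_le_eq card_gt_0_iff)
  define W where "W = w * card I - 1 + v"
  have "1 * 1 \<le> w * real (card I)" using w1 cI by (intro mult_mono) auto
  then have W: "0 < W" using v by (simp add: W_def)
  define x where "x = (1 / W) *\<^sub>R (w *\<^sub>R (\<Sum>i\<in>I. ?sv (S i)) - ?sv P + v *\<^sub>R ?sv Q)"
  have xe: "affine_eval ?E a0 a x = (1 / W) * (w * (\<Sum>i\<in>I. affine_eval ?E a0 a (?sv (S i))) -
      affine_eval ?E a0 a (?sv P) + v * affine_eval ?E a0 a (?sv Q))" for a0 a
  proof -
    have "(\<Sum>e\<in>?E. a e * lkp x e) = (1 / W) * (w * (\<Sum>i\<in>I. \<Sum>e\<in>?E. a e * lkp (?sv (S i)) e) -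
        (\<Sum>e\<in>?E. a e * lkp (?sv P) e) + v * (\<Sum>e\<in>?E. a e * lkp (?sv Q) e))"
      unfolding x_def
      by (simp add: lookup_add lookup_minus lookup_sum algebra_simps sum.distrib sum_subtractf sum_distrib_left
        sum_distrib_right sum_divide_distrib sum.swap[of _ I ?E])
    moreover have "a0 = (1 / W) * (w * (card I * a0) - a0 + v * a0)"
      using W by (simp add: W_def field_simps)
    ultimately show ?thesis
      by (simp add: affine_eval_def sum.distrib algebra_simps)
  qed
  have xr: "x \<in> real_space ?E"
    by (auto simp: real_space_def in_keys_iff x_def lookup_add lookup_minus lookup_sum lookup_sign_vector[OF fin] split: if_splits)
  have sq: "0 \<le> w * (\<Sum>i\<in>I. (affine_eval ?E a0 a (?sv (S i)))\<^sup>2) - (affine_eval ?E a0 a (?sv P))\<^sup>2 +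
      v * (affine_eval ?E a0 a (?sv Q))\<^sup>2" for a0 a
  proof -
    define g where "g i = affine_eval ?E a0 a (?sv (S i))" for i
    define G where "G = affine_eval ?E a0 a (?sv P)"
    define T where "T = (\<Sum>i\<in>I. \<mu> i * g i)"
    have Q: "affine_eval ?E a0 a (?sv Q) = \<beta> * G + T" unfolding G_def T_def g_def by (rule affQ)
    have CS: "T\<^sup>2 \<le> K * (\<Sum>i\<in>I. (g i)\<^sup>2)" unfolding T_def K_def by (rule Cauchy_Schwarz_ineq_sum)
    define s where "s = v * \<beta> / \<kappa>"
    have ks: "\<kappa> * s = v * \<beta>" and ks2: "v\<^sup>2 * \<beta>\<^sup>2 / \<kappa> = \<kappa> * s\<^sup>2"
      using \<kappa> by (simp_all add: s_def power2_eq_square)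
    have "\<kappa> * (G + s * T)\<^sup>2 = \<kappa> * G\<^sup>2 + 2 * (\<kappa> * s) * (G * T) + \<kappa> * s\<^sup>2 * T\<^sup>2"
      by (simp add: power2_eq_square algebra_simps)
    moreover have "\<kappa> * G\<^sup>2 = v * \<beta>\<^sup>2 * G\<^sup>2 - G\<^sup>2" by (simp add: \<kappa>_def algebra_simps)
    moreover have "v * (\<beta> * G + T)\<^sup>2 = v * \<beta>\<^sup>2 * G\<^sup>2 + 2 * (v * \<beta>) * (G * T) + v * T\<^sup>2"
      by (simp add: power2_eq_square algebra_simps)
    moreover have "0 \<le> \<kappa> * (G + s * T)\<^sup>2" "0 \<le> v * T\<^sup>2" using \<kappa> v by auto
    ultimately have 1: "- (v\<^sup>2 * \<beta>\<^sup>2 / \<kappa> * T\<^sup>2) \<le> v * (\<beta> * G + T)\<^sup>2 - G\<^sup>2"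
      unfolding ks ks2 by linarith
    have "v\<^sup>2 * \<beta>\<^sup>2 / \<kappa> * T\<^sup>2 \<le> v\<^sup>2 * \<beta>\<^sup>2 / \<kappa> * (K * (\<Sum>i\<in>I. (g i)\<^sup>2))"
      using CS \<kappa> by (intro mult_left_mono) auto
    also have "\<dots> \<le> w * (\<Sum>i\<in>I. (g i)\<^sup>2)" unfolding w_def by (simp add: distrib_right sum_nonneg mult.assoc)
    finally show ?thesis using 1 unfolding Q unfolding g_def[symmetric] G_def[symmetric] by linarith
  qed
  have "x \<in> theta_body ?E 1 (cycle_ideal M)"
    unfolding theta_body_def
  proof (intro CollectI conjI xr ballI impI)
    fix f assume f: "f \<in> poly_ring ?E" "degree_le f 1 \<and> sos_mod ?E 1 (cycle_ideal M) f"
    obtain a0 a where fa: "\<And>x. peval x f = affine_eval ?E a0 a x"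
      using degree_le_1_affine[OF fin f(1) conjunct1[OF f(2)]] by blast
    obtain t :: nat and g h where gh: "\<forall>i<t. g i \<in> poly_ring ?E \<and> degree_le (g i) 1" "h \<in> cycle_ideal M"
      "f = (\<Sum>i<t. (g i)\<^sup>2) + h" using f(2) unfolding sos_mod_def by metis
    have "\<exists>b0 b. \<forall>x. peval x (g i) = affine_eval ?E b0 b x" if "i < t" for i
      using degree_le_1_affine[OF fin, of "g i"] gh(1) that by metis
    then obtain b0 b where ga: "\<And>i x. i < t \<Longrightarrow> peval x (g i) = affine_eval ?E (b0 i) (b i) x" by metis
    have fc: "affine_eval ?E a0 a (?sv C) = (\<Sum>i<t. (affine_eval ?E (b0 i) (b i) (?sv C))\<^sup>2)" if "C \<in> cycles M" for C
      unfolding fa[symmetric] gh(3) using gh(2) that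
      by (simp add: peval_add peval_sum peval_power2 ga cycle_ideal_def)
    have "peval x f = (1 / W) * (\<Sum>i<t. w * (\<Sum>j\<in>I. (affine_eval ?E (b0 i) (b i) (?sv (S j)))\<^sup>2) -
        (affine_eval ?E (b0 i) (b i) (?sv P))\<^sup>2 + v * (affine_eval ?E (b0 i) (b i) (?sv Q))\<^sup>2)"
      unfolding fa xe using cyc fc
      by (simp add: sum.distrib sum_subtractf sum_distrib_left sum.swap[of _ I "{..<t}"])
    also have "\<dots> \<ge> 0" using W sq by (intro mult_nonneg_nonneg sum_nonneg) auto
    finally show "0 \<le> peval x f" .
  qed
  then have "x \<in> closure (convex hull (real_variety ?E (cycle_ideal M)))"
    using exact unfolding theta_exact_def by simp
  also have "\<dots> \<subseteq> {x. 0 \<le> affine_eval ?E c0 c x}"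
  proof (intro closure_minimal hull_minimal halfspace_affine_eval subsetI CollectI)
    fix y assume y: "y \<in> real_variety ?E (cycle_ideal M)"
    \<comment> \<open>This product lies in the ideal, so on the whole real variety the affine
      function takes only values that it takes on cycles.\<close>
    define p where "p = (\<Prod>C\<in>cycles M. affine_poly ?E (c0 - affine_eval ?E c0 c (?sv C)) c)"
    have pe: "peval z p = (\<Prod>C\<in>cycles M. affine_eval ?E c0 c z - affine_eval ?E c0 c (?sv C))" for z
      by (simp add: p_def peval_prod peval_affine_poly affine_eval_def)
    have "peval (?sv C) p = 0" if "C \<in> cycles M" for C
      unfolding pe using cyc(1) that by (intro prod_zero) auto
    moreover have "p \<in> poly_ring ?E" unfolding p_def by (intro poly_ring_prod affine_poly_in_ring)
    ultimately have "p \<in> cycle_ideal M" by (simp add: cycle_ideal_def)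
    then have "peval y p = 0" using y by (simp add: real_variety_def)
    then obtain C where "C \<in> cycles M" "affine_eval ?E c0 c y = affine_eval ?E c0 c (?sv C)"
      unfolding pe using cyc(1) by auto
    then show "0 \<le> affine_eval ?E c0 c y" using valid by simp
  qed
  finally have "0 \<le> affine_eval ?E c0 c x" by simp
  moreover have "affine_eval ?E c0 c x = (1 / W) * (affine_eval ?E c0 c (?sv P) * (v * \<beta> - 1))"
    unfolding xe affQ using root by (simp add: algebra_simps)
  moreover have "(1 / W) * (affine_eval ?E c0 c (?sv P) * (v * \<beta> - 1)) < 0"
    using W pos v(2) by (intro mult_pos_neg) auto
  ultimately show False by linarith
qed

section \<open>Blocks that obstruct exactness\<close>

definition gadj :: "'v set set \<Rightarrow> 'v \<Rightarrow> 'v \<Rightarrow> bool" where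
  "gadj E u v \<longleftrightarrow> {u, v} \<in> E"

lemma symp_gadj: "symp (gadj E)"
  by (auto simp: symp_def gadj_def insert_commute)

lemma even_card_sym_diff:
  assumes "finite A" "finite B"
  shows "even (card (sym_diff A B)) \<longleftrightarrow> (even (card A) \<longleftrightarrow> even (card B))"
proof -
  have "card A = card (A - B) + card (A \<inter> B)" "card B = card (B - A) + card (A \<inter> B)"
    using card_Int_Diff[OF assms(1), of B] card_Int_Diff[OF assms(2), of A] by (simp_all add: Int_commute)
  moreover have "card (sym_diff A B) = card (A - B) + card (B - A)" using assms by (intro card_Un_disjoint) auto
  ultimately show ?thesis by presburger
qed

text \<open>The value \<open>n\<close> is reserved for elements outside all blocks, so that every
  edge has a pair of indices.\<close>

lemma block_index:
  assumes "\<And>i j. i < n \<Longrightarrow> j < n \<Longrightarrow> i \<noteq> j \<Longrightarrow> X i \<inter> X j = {}"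
  obtains blk :: "'v \<Rightarrow> nat" where "\<And>u i. i < n \<Longrightarrow> blk u = i \<longleftrightarrow> u \<in> X i" "\<And>u. blk u \<le> n"
proof -
  define blk where "blk u = (if \<exists>i<n. u \<in> X i then (SOME i. i < n \<and> u \<in> X i) else n)" for u
  have s: "(SOME i. i < n \<and> u \<in> X i) < n \<and> u \<in> X (SOME i. i < n \<and> u \<in> X i)" if "\<exists>i<n. u \<in> X i" for u
    using that by (rule someI_ex)
  have 1: "blk u = i \<longleftrightarrow> u \<in> X i" if i: "i < n" for u i
  proof
    assume u: "u \<in> X i"
    then have ex: "\<exists>i<n. u \<in> X i" using i by blast
    have "(SOME i. i < n \<and> u \<in> X i) = i" using assms[OF i] s[OF ex] u by blast
    then show "blk u = i" using ex by (simp add: blk_def)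
  next
    assume b: "blk u = i"
    show "u \<in> X i"
    proof (cases "\<exists>i<n. u \<in> X i")
      case True
      then show ?thesis using s[OF True] b by (simp add: blk_def)
    next
      case False
      then show ?thesis using b i unfolding blk_def by (simp only: if_False)
    qed
  qed
  have 2: "blk u \<le> n" for u
  proof (cases "\<exists>i<n. u \<in> X i")
    case True
    then show ?thesis using s[OF True] by (simp add: blk_def)
  next
    case False
    then show ?thesis unfolding blk_def by (simp only: if_False)
  qed
  show ?thesis by (rule that[OF 1 2])
qed

locale sgraph =
  fixes V :: "'v set" and E :: "'v set set"
  assumes sg: "simple_graph V E"
begin

lemma finV: "finite V" and edgeD: "e \<in> E \<Longrightarrow> e \<subseteq> V \<and> card e = 2"
  using sg by (auto simp: simple_graph_def)

lemma finE: "finite E"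
  by (rule finite_subset[of _ "Pow V"]) (use edgeD finV in auto)

lemma edgeE:
  assumes "e \<in> E"
  obtains u v where "e = {u, v}" "u \<noteq> v" "u \<in> V" "v \<in> V" "gadj E u v"
proof -
  obtain u v where "e = {u, v}" "u \<noteq> v" using edgeD[OF assms] by (auto simp: card_2_iff)
  then show ?thesis using that[of u v] edgeD[OF assms] assms by (auto simp: gadj_def)
qed

lemma gadjD: "gadj E u v \<Longrightarrow> u \<noteq> v \<and> u \<in> V \<and> v \<in> V"
  using edgeD[of "{u, v}"] by (auto simp: gadj_def card_insert_if split: if_splits)

lemma cut_iff: "gadj E u v \<Longrightarrow> {u, v} \<in> cut E S \<longleftrightarrow> (u \<in> S) \<noteq> (v \<in> S)"
  using gadjD[of u v] by (auto simp: cut_def gadj_def Int_insert_left)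

lemma cut_subset: "cut E S \<subseteq> E"
  by (auto simp: cut_def)

lemma cut_sym_diff: "cut E (sym_diff S T) = sym_diff (cut E S) (cut E T)"
proof (rule set_eqI)
  fix e
  show "e \<in> cut E (sym_diff S T) \<longleftrightarrow> e \<in> sym_diff (cut E S) (cut E T)"
  proof (cases "e \<in> E")
    case True
    then obtain u v where uv: "e = {u, v}" "gadj E u v" by (rule edgeE)
    show ?thesis unfolding uv(1) by (auto simp: cut_iff[OF uv(2)])
  qed (auto simp: cut_def)
qed

lemma cycles_cographic: "cycles (cographic V E) = cut E ` Pow V" "ground (cographic V E) = E"
  by (simp_all add: cographic_def)

lemma lookup_cut:
  "e \<in> E \<Longrightarrow> lkp (sign_vector E (cut E S)) e = 1 - 2 * of_bool (e \<in> cut E S)"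
  by (simp add: lookup_sign_vector[OF finE])

text \<open>The criterion in the 0/1 coordinates of cuts. Substituting \<open>1 - 2 * y\<close> for
  a sign produces the constant \<open>c0\<close> and the factor \<open>- 1 / 2\<close> on the
  coefficients.\<close>

lemma graph_not_exact:
  fixes b :: "'v set \<Rightarrow> real" and \<mu> :: "'i \<Rightarrow> real"
  assumes fI: "finite I" and sets: "P \<subseteq> V" "Q \<subseteq> V" "\<And>i. i \<in> I \<Longrightarrow> S i \<subseteq> V"
    and \<beta>: "1 < \<beta>" "\<beta> + (\<Sum>i\<in>I. \<mu> i) = 1"
    and comb: "\<And>e. e \<in> E \<Longrightarrow> of_bool (e \<in> cut E Q) =
      \<beta> * of_bool (e \<in> cut E P) + (\<Sum>i\<in>I. \<mu> i * of_bool (e \<in> cut E (S i)))"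
    and root: "\<And>i. i \<in> I \<Longrightarrow> b0 + (\<Sum>e\<in>E. b e * of_bool (e \<in> cut E (S i))) = 0"
    and pos: "0 < b0 + (\<Sum>e\<in>E. b e * of_bool (e \<in> cut E P))"
    and valid: "\<And>T. T \<subseteq> V \<Longrightarrow> 0 \<le> b0 + (\<Sum>e\<in>E. b e * of_bool (e \<in> cut E T))"
  shows "\<not> theta_exact E 1 (cycle_ideal (cographic V E))"
proof -
  define c0 where "c0 = b0 + (\<Sum>e\<in>E. b e / 2)"
  have ev: "affine_eval E c0 (\<lambda>e. - (b e / 2)) (sign_vector E (cut E T)) = b0 + (\<Sum>e\<in>E. b e * of_bool (e \<in> cut E T))" for T
  proof -
    have "(\<Sum>e\<in>E. - (b e / 2) * lkp (sign_vector E (cut E T)) e) = (\<Sum>e\<in>E. b e * of_bool (e \<in> cut E T) - b e / 2)"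
    proof (rule sum.cong[OF HOL.refl])
      fix e assume "e \<in> E"
      show "- (b e / 2) * lkp (sign_vector E (cut E T)) e = b e * of_bool (e \<in> cut E T) - b e / 2"
        unfolding lookup_cut[OF \<open>e \<in> E\<close>] by (simp add: algebra_simps)
    qed
    then show ?thesis by (simp add: affine_eval_def c0_def sum_subtractf)
  qed
  have "\<not> theta_exact (ground (cographic V E)) 1 (cycle_ideal (cographic V E))"
  proof (rule not_theta_exact[where I = I and P = "cut E P" and Q = "cut E Q" and S = "\<lambda>i. cut E (S i)" and \<mu> = \<mu> and \<beta> = \<beta>
        and ?c0.0 = c0 and c = "\<lambda>e. - (b e / 2)"])
    show "finite (ground (cographic V E))" "finite (cycles (cographic V E))"
      using finE finV by (auto simp: cycles_cographic)
    show "lkp (sign_vector (ground (cographic V E)) (cut E Q)) e =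
         \<beta> * lkp (sign_vector (ground (cographic V E)) (cut E P)) e +
         (\<Sum>i\<in>I. \<mu> i * lkp (sign_vector (ground (cographic V E)) (cut E (S i))) e)"
      if e: "e \<in> ground (cographic V E)" for e
    proof -
      have e: "e \<in> E" using e by (simp add: cycles_cographic)
      have "(\<Sum>i\<in>I. \<mu> i * (1 - 2 * of_bool (e \<in> cut E (S i)))) =
          (\<Sum>i\<in>I. \<mu> i) - 2 * (\<Sum>i\<in>I. \<mu> i * of_bool (e \<in> cut E (S i)))"
        by (simp add: algebra_simps sum_subtractf sum_distrib_left)
      then show ?thesis
        using comb[OF e] \<beta>(2) by (simp add: cycles_cographic lookup_cut[OF e] algebra_simps)
    qed
    show "cut E P \<in> cycles (cographic V E)" "cut E Q \<in> cycles (cographic V E)"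
      "\<And>i. i \<in> I \<Longrightarrow> cut E (S i) \<in> cycles (cographic V E)"
      using sets by (auto simp: cycles_cographic)
    show "0 \<le> affine_eval (ground (cographic V E)) c0 (\<lambda>e. - (b e / 2)) (sign_vector (ground (cographic V E)) C)"
      if "C \<in> cycles (cographic V E)" for C
      using that valid by (auto simp: cycles_cographic ev simp del: of_bool_eq)
  qed (use fI \<beta> root pos in \<open>simp_all add: cycles_cographic ev\<close>)
  then show ?thesis by (simp add: cycles_cographic)
qed

section \<open>Lifting inequalities from five blocks to the graph\<close>

definition block_val :: "real \<Rightarrow> (nat \<times> nat \<times> real) list \<Rightarrow> nat set \<Rightarrow> real" where
  "block_val b0 L T = b0 + (\<Sum>(i, j, b)\<leftarrow>L. b * of_bool ((i \<in> T) \<noteq> (j \<in> T)))"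

text \<open>In the hypothesis \<open>comb\<close> the index \<open>5\<close> stands for the vertices outside all blocks.\<close>

lemma block_not_exact:
  fixes R :: "(nat set \<times> real) list" and \<beta> :: real
  assumes con: "\<And>i. i < 5 \<Longrightarrow> conn (gadj E) (X i)" and sub: "\<And>i. i < 5 \<Longrightarrow> X i \<subseteq> V"
    and dis: "\<And>i j. i < 5 \<Longrightarrow> j < 5 \<Longrightarrow> i \<noteq> j \<Longrightarrow> X i \<inter> X j = {}"
    and L: "\<And>i j b. (i, j, b) \<in> set L \<Longrightarrow> i < 5 \<and> j < 5 \<and> i \<noteq> j \<and> touch (gadj E) (X i) (X j)"
    and valid: "\<And>T. T \<subseteq> {..<5} \<Longrightarrow> 0 \<le> block_val b0 L T"
    and R: "\<And>T m. (T, m) \<in> set R \<Longrightarrow> T \<subseteq> {..<5} \<and> block_val b0 L T = 0"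
    and PQ: "P \<subseteq> {..<5}" "Q \<subseteq> {..<5}" "0 < block_val b0 L P"
    and \<beta>: "1 < \<beta>" "\<beta> + (\<Sum>(T, m)\<leftarrow>R. m) = 1"
    and comb: "\<And>i j. i \<le> 5 \<Longrightarrow> j \<le> 5 \<Longrightarrow> i = 5 \<or> j = 5 \<or> i = j \<or> touch (gadj E) (X i) (X j) \<Longrightarrow>
      of_bool ((i \<in> Q) \<noteq> (j \<in> Q)) = \<beta> * of_bool ((i \<in> P) \<noteq> (j \<in> P)) + (\<Sum>(T, m)\<leftarrow>R. m * of_bool ((i \<in> T) \<noteq> (j \<in> T)))"
  shows "\<not> theta_exact E 1 (cycle_ideal (cographic V E))"
proof -
  define U where "U T = (\<Union>i\<in>T. X i)" for T
  obtain blk where blk: "\<And>u i. i < 5 \<Longrightarrow> blk u = i \<longleftrightarrow> u \<in> X i" and blk5: "\<And>u. blk u \<le> 5"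
    using block_index[of 5 X] dis by blast
  have inU: "u \<in> U T \<longleftrightarrow> blk u \<in> T" if T: "T \<subseteq> {..<5}" for u T
  proof -
    have "u \<in> X i \<longleftrightarrow> blk u = i" if "i \<in> T" for i using blk[of i u] that T by auto
    then show ?thesis by (auto simp: U_def)
  qed
  have UV: "U T \<subseteq> V" if T: "T \<subseteq> {..<5}" for T
    unfolding U_def by (rule UN_least, rule sub) (use T in auto)
  have cutU: "{u, v} \<in> cut E (U T) \<longleftrightarrow> (blk u \<in> T) \<noteq> (blk v \<in> T)" if "gadj E u v" "T \<subseteq> {..<5}" for u v T
    using cut_iff[OF that(1)] inU[OF that(2)] by simp
  \<comment> \<open>Edges inside a block will receive a penalty \<open>K\<close> large enough for
    the inequality to hold at every cut that splits a block.\<close>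
  define In where "In = {e \<in> E. \<exists>i<5. e \<subseteq> X i}"
  have finIn: "finite In" using finE by (simp add: In_def)
  have "\<exists>u v. u \<in> X i \<and> v \<in> X j \<and> gadj E u v" if "(i, j, b) \<in> set L" for i j b
    using L[OF that] by (auto simp: touch_def)
  \<comment> \<open>For each pair of blocks in \<open>L\<close> one representative edge carries the
    coefficient; all other edges between different blocks get 0.\<close>
  then obtain p q where pq: "\<And>i j b. (i, j, b) \<in> set L \<Longrightarrow> p i j \<in> X i \<and> q i j \<in> X j \<and> gadj E (p i j) (q i j)"
    by metis
  define \<epsilon> where "\<epsilon> i j = {p i j, q i j}" for i j
  have \<epsilon>E: "\<epsilon> i j \<in> E" if "(i, j, b) \<in> set L" for i j b using pq[OF that] by (simp add: \<epsilon>_def gadj_def)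
  define K where "K = (\<Sum>(i, j, b)\<leftarrow>L. \<bar>b\<bar>) + \<bar>b0\<bar>"
  define b where "b e = (\<Sum>(i, j, c)\<leftarrow>L. c * of_bool (\<epsilon> i j = e)) + K * of_bool (e \<in> In)" for e
  have val: "b0 + (\<Sum>e\<in>E. b e * of_bool (e \<in> cut E S)) =
      b0 + (\<Sum>(i, j, c)\<leftarrow>L. c * of_bool (\<epsilon> i j \<in> cut E S)) + K * real (card (In \<inter> cut E S))" for S
  proof -
    have "(\<Sum>e\<in>E. (\<Sum>(i, j, c)\<leftarrow>L'. c * of_bool (\<epsilon> i j = e)) * of_bool (e \<in> cut E S)) =
      (\<Sum>(i, j, c)\<leftarrow>L'. c * of_bool (\<epsilon> i j \<in> cut E S))" if "set L' \<subseteq> set L" for L'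
      using that
    proof (induction L')
      case (Cons x L')
      obtain i j c where x: "x = (i, j, c)" by (cases x)
      have e: "\<epsilon> i j \<in> E" using \<epsilon>E Cons.prems x by auto
      have "(\<Sum>e\<in>E. c * of_bool (\<epsilon> i j = e) * of_bool (e \<in> cut E S)) = (\<Sum>e\<in>E. if e = \<epsilon> i j then c * of_bool (\<epsilon> i j \<in> cut E S) else 0)"
        by (intro sum.cong) auto
      also have "\<dots> = c * of_bool (\<epsilon> i j \<in> cut E S)" using e finE by simp
      finally show ?case using Cons by (simp add: x distrib_right sum.distrib)
    qed simp
    from this[of L] have 1: "(\<Sum>e\<in>E. (\<Sum>(i, j, c)\<leftarrow>L. c * of_bool (\<epsilon> i j = e)) * of_bool (e \<in> cut E S)) =
      (\<Sum>(i, j, c)\<leftarrow>L. c * of_bool (\<epsilon> i j \<in> cut E S))" by simp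
    have "(\<Sum>e\<in>E. K * of_bool (e \<in> In) * of_bool (e \<in> cut E S)) = (\<Sum>e\<in>E. if e \<in> In \<inter> cut E S then K else 0)"
      by (intro sum.cong) auto
    also have "\<dots> = (\<Sum>e\<in>E \<inter> (In \<inter> cut E S). K)" by (rule sum.inter_restrict[OF finE, symmetric])
    also have "E \<inter> (In \<inter> cut E S) = In \<inter> cut E S" by (auto simp: In_def)
    finally have 2: "(\<Sum>e\<in>E. K * of_bool (e \<in> In) * of_bool (e \<in> cut E S)) = K * real (card (In \<inter> cut E S))"
      by simp
    show ?thesis unfolding b_def distrib_right sum.distrib 1 2 by simp
  qed
  have valU: "b0 + (\<Sum>e\<in>E. b e * of_bool (e \<in> cut E (U T))) = block_val b0 L T" if T: "T \<subseteq> {..<5}" for T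
  proof -
    have "In \<inter> cut E (U T) = {}"
    proof (rule ccontr)
      assume "In \<inter> cut E (U T) \<noteq> {}"
      then obtain e i where e: "e \<in> E" "i < 5" "e \<subseteq> X i" "e \<in> cut E (U T)" by (auto simp: In_def)
      obtain u v where uv: "e = {u, v}" "gadj E u v" using e(1) by (rule edgeE)
      then have "blk u = i" "blk v = i" using blk[OF e(2)] e(3) by auto
      then show False using e(4) cutU[OF uv(2) T] uv(1) by simp
    qed
    moreover have "\<epsilon> i j \<in> cut E (U T) \<longleftrightarrow> (i \<in> T) \<noteq> (j \<in> T)" if "(i, j, c) \<in> set L" for i j c
      using cutU[of "p i j" "q i j" T] pq[OF that] L[OF that] blk[of i "p i j"] blk[of j "q i j"] T
      by (simp add: \<epsilon>_def)
    ultimately show ?thesis unfolding val block_val_def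
      by (auto intro!: arg_cong[where f = sum_list] map_cong)
  qed
  have "0 \<le> b0 + (\<Sum>e\<in>E. b e * of_bool (e \<in> cut E S))" if S: "S \<subseteq> V" for S
  proof (cases "In \<inter> cut E S = {}")
    case False
    then have "1 \<le> real (card (In \<inter> cut E S))" using finIn by (simp add: Suc_le_eq card_gt_0_iff)
    moreover have "0 \<le> K" unfolding K_def by (intro add_nonneg_nonneg sum_list_nonneg) auto
    ultimately have "K * 1 \<le> K * real (card (In \<inter> cut E S))" by (intro mult_left_mono)
    moreover have neg: "- (\<Sum>(i, j, b)\<leftarrow>L'. \<bar>b\<bar>) \<le> (\<Sum>(i, j, c)\<leftarrow>L'. c * of_bool (\<epsilon> i j \<in> cut E S))" for L' :: "(nat \<times> nat \<times> real) list"
      by (induction L') (auto simp: of_bool_def)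
    moreover have "(\<Sum>(i, j, b)\<leftarrow>L. \<bar>b\<bar>) = K - \<bar>b0\<bar>" by (simp add: K_def)
    ultimately show ?thesis unfolding val using neg[of L] by linarith
  next
    case True
    define T where "T = {i. i < 5 \<and> X i \<subseteq> S}"
    have T: "T \<subseteq> {..<5}" by (auto simp: T_def)
    have un: "X i \<subseteq> S \<or> X i \<inter> S = {}" if i: "i < 5" for i
    proof (rule ccontr)
      assume n: "\<not> ?thesis"
      have "X i \<subseteq> S"
      proof (rule conn_closed[OF con[OF i]])
        show "X i \<inter> S \<noteq> {}" using n by blast
        fix x y assume xy: "x \<in> S \<inter> X i" "y \<in> X i - S"
        show "\<not> gadj E x y"
        proof
          assume a: "gadj E x y"
          have "{x, y} \<in> In \<inter> cut E S" using cut_iff[OF a] xy a i by (auto simp: In_def gadj_def)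
          then show False using True by blast
        qed
      qed
      then show False using n by blast
    qed
    have "\<epsilon> i j \<in> cut E S \<longleftrightarrow> \<epsilon> i j \<in> cut E (U T)" if l: "(i, j, c) \<in> set L" for i j c
    proof -
      have "(p i j \<in> S) = (i \<in> T)" "(q i j \<in> S) = (j \<in> T)"
        using pq[OF l] L[OF l] un[of i] un[of j] by (auto simp: T_def)
      moreover have "blk (p i j) = i" "blk (q i j) = j" using pq[OF l] L[OF l] blk by auto
      ultimately show ?thesis
        using cut_iff[of "p i j" "q i j" S] cutU[of "p i j" "q i j" T] pq[OF l] T by (simp add: \<epsilon>_def)
    qed
    then have "(\<Sum>(i, j, c)\<leftarrow>L. c * of_bool (\<epsilon> i j \<in> cut E S)) = (\<Sum>(i, j, c)\<leftarrow>L. c * of_bool (\<epsilon> i j \<in> cut E (U T)))"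
      by (auto intro!: arg_cong[where f = sum_list] map_cong)
    moreover have "0 \<le> K * real (card (In \<inter> cut E (U T)))" unfolding K_def
      by (intro mult_nonneg_nonneg add_nonneg_nonneg sum_list_nonneg) auto
    moreover have "In \<inter> cut E (U T) = {}"
    proof (rule ccontr)
      assume "In \<inter> cut E (U T) \<noteq> {}"
      then obtain e i where e: "e \<in> E" "i < 5" "e \<subseteq> X i" "e \<in> cut E (U T)" by (auto simp: In_def)
      obtain u v where uv: "e = {u, v}" "gadj E u v" using e(1) by (rule edgeE)
      then have "blk u = i" "blk v = i" using blk[OF e(2)] e(3) by auto
      then show False using e(4) cutU[OF uv(2) T] uv(1) by simp
    qed
    ultimately show ?thesis using valid[OF T] True unfolding valU[OF T, symmetric] unfolding val by simp
  qed
  note valid' = this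
  have Rn: "fst (R ! n) \<subseteq> {..<5} \<and> block_val b0 L (fst (R ! n)) = 0" if "n < length R" for n
    using R[of "fst (R ! n)" "snd (R ! n)"] that by (metis nth_mem prod.collapse)
  have sumR: "(\<Sum>n<length R. g (R ! n)) = (\<Sum>x\<leftarrow>R. g x)" for g :: "nat set \<times> real \<Rightarrow> real"
    by (simp add: sum_list_sum_nth atLeast0LessThan)
  show ?thesis
  proof (rule graph_not_exact[where I = "{..<length R}" and P = "U P" and Q = "U Q" and S = "\<lambda>n. U (fst (R ! n))"
        and \<mu> = "\<lambda>n. snd (R ! n)" and \<beta> = \<beta> and ?b0.0 = b0 and b = b])
    show "\<beta> + (\<Sum>i<length R. snd (R ! i)) = 1"
      using \<beta>(2) sumR[of snd] by (simp add: case_prod_unfold)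
    show "0 < b0 + (\<Sum>e\<in>E. b e * of_bool (e \<in> cut E (U P)))" unfolding valU[OF PQ(1)] by (rule PQ(3))
    show "b0 + (\<Sum>e\<in>E. b e * of_bool (e \<in> cut E (U (fst (R ! i))))) = 0" if "i \<in> {..<length R}" for i
      using valU[of "fst (R ! i)"] Rn[of i] that by simp
    fix e assume e: "e \<in> E"
    then obtain u v where uv: "e = {u, v}" "gadj E u v" by (rule edgeE)
    let ?i = "blk u" and ?j = "blk v"
    have cond: "?i = 5 \<or> ?j = 5 \<or> ?i = ?j \<or> touch (gadj E) (X ?i) (X ?j)"
    proof -
      have "?i < 5 \<Longrightarrow> ?j < 5 \<Longrightarrow> touch (gadj E) (X ?i) (X ?j)"
        using blk[of ?i u] blk[of ?j v] uv(2) by (auto intro: touchI)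
      then show ?thesis using blk5[of u] blk5[of v] by linarith
    qed
    have "(\<Sum>n<length R. snd (R ! n) * of_bool (e \<in> cut E (U (fst (R ! n))))) =
      (\<Sum>n<length R. (\<lambda>(T, m). m * of_bool ((?i \<in> T) \<noteq> (?j \<in> T))) (R ! n))"
      by (intro sum.cong HOL.refl) (use cutU[OF uv(2)] Rn uv(1) in \<open>simp add: case_prod_unfold\<close>)
    also have "\<dots> = (\<Sum>(T, m)\<leftarrow>R. m * of_bool ((?i \<in> T) \<noteq> (?j \<in> T)))" by (rule sumR)
    finally show "of_bool (e \<in> cut E (U Q)) = \<beta> * of_bool (e \<in> cut E (U P)) +
        (\<Sum>n<length R. snd (R ! n) * of_bool (e \<in> cut E (U (fst (R ! n)))))"
      using comb[OF blk5 blk5 cond] cutU[OF uv(2) PQ(1)] cutU[OF uv(2) PQ(2)] uv(1) by simp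
  qed (use UV PQ \<beta> Rn valid' in auto)
qed

lemma nat_le_5: "(i::nat) \<le> 5 \<longleftrightarrow> i = 0 \<or> i = 1 \<or> i = 2 \<or> i = 3 \<or> i = 4 \<or> i = 5"
  by auto

text \<open>The odd-set inequality of the pentagon with one odd edge has the three values 0, 2 and 4
  on cuts. \<open>P\<close> has value 2 and \<open>Q\<close> has value 4, whence the coefficient
  2.\<close>

lemma C5_not_exact:
  assumes "C5_model V (gadj E) X"
  shows "\<not> theta_exact E 1 (cycle_ideal (cographic V E))"
proof -
  have X: "conn (gadj E) (X i)" "X i \<subseteq> V" if "i < 5" for i
    using assms that unfolding C5_model_def by blast+
  have T: "X i \<inter> X j = {}" "touch (gadj E) (X i) (X j) \<longleftrightarrow> j = (i + 1) mod 5 \<or> i = (j + 1) mod 5"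
    if "i < 5" "j < 5" "i \<noteq> j" for i j
    using assms that unfolding C5_model_def by blast+
  show ?thesis
  \<comment> \<open>Each nonempty root cuts the edge between 4 and 0 and one further edge. Which
    side of a root is listed matters on edges to outside vertices, where the identity has to hold
    too.\<close>
  proof (rule block_not_exact[where X = X and L = "[(0, 1, 1), (1, 2, 1), (2, 3, 1), (3, 4, 1), (4, 0, -1)]" and ?b0.0 = 0
        and R = "[({0, 1, 2, 3}, 1), ({0, 1}, -1), ({3, 4}, 1), ({1, 2, 3, 4}, -1), ({}, -1)]"
        and P = "{1}" and Q = "{1, 3}" and \<beta> = 2])
    show "i < 5 \<and> j < 5 \<and> i \<noteq> j \<and> touch (gadj E) (X i) (X j)"
      if "(i, j, b) \<in> set [(0, 1, 1), (1, 2, 1), (2, 3, 1), (3, 4, 1), (4, 0, -1)]" for i j and b :: real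
      using that T(2)[of 0 1] T(2)[of 1 2] T(2)[of 2 3] T(2)[of 3 4] T(2)[of 4 0] by auto
    show "0 \<le> block_val 0 [(0, 1, 1), (1, 2, 1), (2, 3, 1), (3, 4, 1), (4, 0, -1)] T" for T
      by (simp add: block_val_def)
    fix i j :: nat assume ij: "i \<le> 5" "j \<le> 5" "i = 5 \<or> j = 5 \<or> i = j \<or> touch (gadj E) (X i) (X j)"
    then have "i = 5 \<or> j = 5 \<or> i = j \<or> j = (i + 1) mod 5 \<or> i = (j + 1) mod 5"
      using T(2)[of i j] by linarith
    with ij(1,2) show "of_bool ((i \<in> {1, 3}) \<noteq> (j \<in> {1, 3})) = 2 * of_bool ((i \<in> {1}) \<noteq> (j \<in> {1})) +
      (\<Sum>(T, m)\<leftarrow>[({0, 1, 2, 3}, 1), ({0, 1}, -1), ({3, 4}, 1), ({1, 2, 3, 4}, -1), ({}, -1)].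
        m * of_bool ((i \<in> T) \<noteq> (j \<in> T)) :: real)"
      unfolding nat_le_5 by (elim disjE) simp_all
  next
    show "T \<subseteq> {..<5} \<and> block_val 0 [(0, 1, 1), (1, 2, 1), (2, 3, 1), (3, 4, 1), (4, 0, -1)] T = 0"
      if "(T, m) \<in> set [({0, 1, 2, 3}, 1), ({0, 1}, -1), ({3, 4}, 1), ({1, 2, 3, 4}, -1), ({}, -1)]"
      for T :: "nat set" and m :: real
    proof -
      have "list_all (\<lambda>(T, m). T \<subseteq> {..<5} \<and> block_val 0 [(0, 1, 1), (1, 2, 1), (2, 3, 1), (3, 4, 1), (4, 0, -1)] T = 0)
         [({0, 1, 2, 3}, 1), ({0, 1}, -1), ({3, 4}, 1), ({1, 2, 3, 4}, -1), ({}, -1 :: real)]"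
        by (simp add: block_val_def)
      then show ?thesis using that unfolding list_all_iff by blast
    qed
  qed (simp_all add: X T(1) block_val_def)
qed

text \<open>Cuts of the complete graph on five vertices have 0, 4 or 6 edges. The roots are the ten
  cuts with 6 edges; \<open>P\<close> has slack 2 and the empty cut \<open>Q\<close> has slack 6,
  whence the coefficient 3.\<close>

lemma K5_not_exact:
  assumes "K5_model V (gadj E) X"
  shows "\<not> theta_exact E 1 (cycle_ideal (cographic V E))"
proof -
  have X: "conn (gadj E) (X i)" "X i \<subseteq> V" if "i < 5" for i
    using assms that unfolding K5_model_def by blast+
  have T: "X i \<inter> X j = {}" "touch (gadj E) (X i) (X j)" if "i < 5" "j < 5" "i \<noteq> j" for i j
    using assms that unfolding K5_model_def by blast+
  define L :: "(nat \<times> nat \<times> real) list" where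
    "L = [(0, 1, -1), (0, 2, -1), (0, 3, -1), (0, 4, -1), (1, 2, -1), (1, 3, -1), (1, 4, -1), (2, 3, -1), (2, 4, -1), (3, 4, -1)]"
  \<comment> \<open>Every root occurs with both of its sides. Between blocks only the total counts:
    -2 for the cuts pairing 0 with another vertex and 1 for the other six. The division between the
    two sides makes edges to outside vertices balance as well.\<close>
  define R :: "(nat set \<times> real) list" where
    "R = [({0, 1}, -3/2), ({0, 2}, -3/2), ({0, 3}, -3/2), ({0, 4}, -3/2),
      ({2, 3, 4}, -1/2), ({1, 3, 4}, -1/2), ({1, 2, 4}, -1/2), ({1, 2, 3}, -1/2),
      ({1, 2}, 1/2), ({1, 3}, 1/2), ({1, 4}, 1/2), ({2, 3}, 1/2), ({2, 4}, 1/2), ({3, 4}, 1/2),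
      ({0, 3, 4}, 1/2), ({0, 2, 4}, 1/2), ({0, 2, 3}, 1/2), ({0, 1, 4}, 1/2), ({0, 1, 3}, 1/2), ({0, 1, 2}, 1/2)]"
  have Rm: "T \<subseteq> {..<5} \<and> block_val 6 L T = 0" if "(T, m) \<in> set R" for T m
  proof -
    have "list_all (\<lambda>(T, m). T \<subseteq> {..<5} \<and> block_val 6 L T = 0) R"
      unfolding R_def L_def by (simp add: block_val_def)
    then show ?thesis using that unfolding list_all_iff by blast
  qed
  show ?thesis
  proof (rule block_not_exact[where X = X and L = L and ?b0.0 = 6 and R = R and P = "{0}" and Q = "{}" and \<beta> = 3])
    show "i < 5 \<and> j < 5 \<and> i \<noteq> j \<and> touch (gadj E) (X i) (X j)" if "(i, j, b) \<in> set L" for i j b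
    proof -
      have "list_all (\<lambda>(i, j, b). i < 5 \<and> j < 5 \<and> i \<noteq> j) L" by (simp add: L_def)
      then have "i < 5 \<and> j < 5 \<and> i \<noteq> j" using that by (auto simp: list_all_iff)
      then show ?thesis using T(2) by blast
    qed
    show "0 \<le> block_val 6 L T" for T
      unfolding L_def block_val_def
      by (cases "0 \<in> T"; cases "1 \<in> T"; cases "2 \<in> T"; cases "3 \<in> T"; cases "4 \<in> T") simp_all
    show "0 < block_val 6 L {0}" by (simp add: L_def block_val_def)
    show "3 + (\<Sum>(T, m)\<leftarrow>R. m) = 1" by (simp add: R_def)
    fix i j :: nat assume ij: "i \<le> 5" "j \<le> 5"
    have R': "(\<Sum>(T, m)\<leftarrow>R. m * of_bool ((i \<in> T) \<noteq> (j \<in> T))) = - 3 * of_bool ((i = 0) \<noteq> (j = 0))"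
      using ij unfolding nat_le_5 R_def by (elim disjE) simp_all
    show "of_bool ((i \<in> {}) \<noteq> (j \<in> {})) = 3 * of_bool ((i \<in> {0}) \<noteq> (j \<in> {0})) + (\<Sum>(T, m)\<leftarrow>R. m * of_bool ((i \<in> T) \<noteq> (j \<in> T)))"
      unfolding R' by simp
  next
    show "T \<subseteq> {..<5} \<and> block_val 6 L T = 0" if "(T, m) \<in> set R" for T m using that by (rule Rm)
  qed (simp_all add: X T(1))
qed

end

section \<open>Chordless cocircuits\<close>

text \<open>The boundary over the field with two elements. Cocycles of the cographic matroid are the
  edge sets with empty boundary.\<close>

definition bd :: "'v set set \<Rightarrow> 'v set" where
  "bd D = {v. odd (card {e \<in> D. v \<in> e})}"

lemma bd_sym_diff:
  assumes "finite A" "finite B"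
  shows "bd (sym_diff A B) = sym_diff (bd A) (bd B)"
proof -
  have "{e \<in> sym_diff A B. v \<in> e} = sym_diff {e \<in> A. v \<in> e} {e \<in> B. v \<in> e}" for v by auto
  then show ?thesis using assms by (auto simp: bd_def even_card_sym_diff)
qed

lemma bd_empty [simp]: "bd {} = {}"
  by (simp add: bd_def)

lemma bd_single [simp]: "bd {e} = e"
proof -
  have "{f \<in> {e}. v \<in> f} = (if v \<in> e then {e} else {})" for v by auto
  then show ?thesis by (auto simp: bd_def)
qed

lemma mod5_inj: "a < 5 \<Longrightarrow> i < 5 \<Longrightarrow> (a + 1) mod 5 = (i + 1) mod 5 \<longleftrightarrow> a = (i :: nat)"
  by (auto simp: mod_Suc split: if_splits)

lemma sym_diff_4: "sym_diff (sym_diff {a} {b}) (sym_diff {c} {d}) \<subseteq> {a, b, c, d}"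
  by auto

lemma card_4: "card {a, b, c, d} \<le> 4"
  by (simp add: card_insert_if)

lemma card_3: "card {a, b, c} \<le> 4"
  by (simp add: card_insert_if)

context sgraph begin

lemma edge_ends: "e \<in> E \<Longrightarrow> \<exists>u v. e = {u, v} \<and> u \<noteq> v \<and> gadj E u v"
  by (erule edgeE) blast

lemma finite_sub: "D \<subseteq> E \<Longrightarrow> finite D"
  using finE finite_subset by blast

text \<open>Both parities are additive in \<open>S\<close>, so a single vertex decides, and its cut
  is its star.\<close>

lemma parity_cut:
  assumes "D \<subseteq> E" "S \<subseteq> V"
  shows "even (card (D \<inter> cut E S)) \<longleftrightarrow> even (card (bd D \<inter> S))"
proof -
  have "finite S" using assms(2) finV finite_subset by blast
  then show ?thesis using assms(2)
  proof (induction S)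
    case empty
    then show ?case by (simp add: cut_def)
  next
    case (insert v S)
    have "insert v S = sym_diff S {v}" using insert by auto
    then have c: "D \<inter> cut E (insert v S) = sym_diff (D \<inter> cut E S) (D \<inter> cut E {v})"
      using cut_sym_diff[of S "{v}"] by auto
    have d: "D \<inter> cut E {v} = {e \<in> D. v \<in> e}"
      using assms(1) by (auto simp: cut_def card_1_singleton_iff)
    have b: "bd D \<inter> insert v S = sym_diff (bd D \<inter> S) (if v \<in> bd D then {v} else {})" using insert by auto
    show ?case
      unfolding c b using insert finite_sub[OF assms(1)]
      by (subst even_card_sym_diff; simp add: d even_card_sym_diff bd_def)
  qed
qed

lemma bd_subset: "D \<subseteq> E \<Longrightarrow> bd D \<subseteq> V"
proof
  fix v assume D: "D \<subseteq> E" and v: "v \<in> bd D"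
  then have "{e \<in> D. v \<in> e} \<noteq> {}" unfolding bd_def by (metis (mono_tags, lifting) card.empty even_zero mem_Collect_eq)
  then show "v \<in> V" using D edgeD by blast
qed

lemma cocycles_iff: "D \<in> cocycles (cographic V E) \<longleftrightarrow> D \<subseteq> E \<and> bd D = {}"
proof
  assume "D \<in> cocycles (cographic V E)"
  then have D: "D \<subseteq> E" "\<And>S. S \<subseteq> V \<Longrightarrow> even (card (D \<inter> cut E S))"
    by (auto simp: cocycles_def cycles_cographic)
  have "v \<notin> bd D" for v
  proof
    assume v: "v \<in> bd D"
    then have "{v} \<subseteq> V" "bd D \<inter> {v} = {v}" using bd_subset[OF D(1)] by auto
    then show False using D(2) parity_cut[OF D(1), of "{v}"] by simp
  qed
  then show "D \<subseteq> E \<and> bd D = {}" using D(1) by blast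
next
  assume D: "D \<subseteq> E \<and> bd D = {}"
  then show "D \<in> cocycles (cographic V E)"
    using parity_cut[of D] by (auto simp: cocycles_def cycles_cographic)
qed

text \<open>Edge sets with boundary at \<open>u\<close> and \<open>v\<close> stand in for paths, so
  that no walk has to be constructed.\<close>

lemma conn_bd:
  assumes "conn (gadj E) X" "u \<in> X" "v \<in> X"
  shows "\<exists>D. D \<subseteq> {e \<in> E. e \<subseteq> X} \<and> bd D = sym_diff {u} {v}"
proof -
  let ?R = "{y. \<exists>D. D \<subseteq> {e \<in> E. e \<subseteq> X} \<and> bd D = sym_diff {u} {y}}"
  have "X \<subseteq> ?R"
  proof (rule conn_closed[OF assms(1)])
    have "u \<in> ?R" by (intro CollectI exI[of _ "{}"]) auto
    then show "X \<inter> ?R \<noteq> {}" using assms(2) by blast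
    fix y z assume y: "y \<in> ?R \<inter> X" and z: "z \<in> X - ?R"
    show "\<not> gadj E y z"
    proof
      assume a: "gadj E y z"
      obtain D where D: "D \<subseteq> {e \<in> E. e \<subseteq> X}" "bd D = sym_diff {u} {y}" using y by blast
      have fD: "finite D" using D(1) by (intro finite_sub) blast
      have "sym_diff D {{y, z}} \<subseteq> {e \<in> E. e \<subseteq> X}" using D(1) a y z by (auto simp: gadj_def)
      moreover have "bd (sym_diff D {{y, z}}) = sym_diff {u} {z}"
        using bd_sym_diff[OF fD, of "{{y, z}}"] D(2) gadjD[OF a] by auto
      ultimately show False using z by blast
    qed
  qed
  then show ?thesis using assms(3) by blast
qed

lemma even_degree:
  assumes "D \<subseteq> E" "bd D = {}" "e \<in> D" "v \<in> e"
  shows "\<exists>e'\<in>D. v \<in> e' \<and> e' \<noteq> e"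
proof -
  have "even (card {e \<in> D. v \<in> e})" using assms(2) by (auto simp: bd_def)
  then have "{e \<in> D. v \<in> e} \<noteq> {e}" by (metis card_1_singleton_iff One_nat_def odd_one)
  then show ?thesis using assms(3,4) by blast
qed

lemma card_even_ge_3:
  assumes "D \<subseteq> E" "bd D = {}" "D \<noteq> {}"
  shows "3 \<le> card D"
proof -
  obtain e where e: "e \<in> D" using assms(3) by blast
  then have "e \<in> E" using assms(1) by blast
  then obtain u v where uv: "e = {u, v}" "u \<noteq> v" by (rule edgeE)
  obtain e1 where e1: "e1 \<in> D" "u \<in> e1" "e1 \<noteq> e" using even_degree[OF assms(1,2) e, of u] uv by blast
  obtain e2 where e2: "e2 \<in> D" "v \<in> e2" "e2 \<noteq> e" using even_degree[OF assms(1,2) e, of v] uv by blast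
  have "e1 \<noteq> e2"
  proof
    assume eq: "e1 = e2"
    obtain p q where "e1 = {p, q}" using edgeE[of e1] e1(1) assms(1) by blast
    then show False using e1 e2 uv eq by auto
  qed
  then have "card {e, e1, e2} = 3" using e1 e2 by auto
  moreover have "{e, e1, e2} \<subseteq> D" using e e1 e2 by blast
  ultimately show ?thesis using card_mono[OF finite_sub[OF assms(1)]] by metis
qed

text \<open>Among the edge sets with empty boundary inside the blocks, take a smallest one that
  winds around the pentagon an odd number of times, measured by its crossings between the blocks 4
  and 0. If it split off a smaller cocycle or had a chord, one of the two parts would again be odd,
  against minimality.\<close>

lemma C5_chordless_cocircuit:
  assumes "C5_model V (gadj E) X"
  shows "\<exists>D. cocircuit (cographic V E) D \<and> chordless (cographic V E) D \<and> 5 \<le> card D"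
proof -
  have X: "conn (gadj E) (X i)" "X i \<subseteq> V" if "i < 5" for i
    using assms that unfolding C5_model_def by blast+
  have T: "X i \<inter> X j = {}" "touch (gadj E) (X i) (X j) \<longleftrightarrow> j = (i + 1) mod 5 \<or> i = (j + 1) mod 5"
    if "i < 5" "j < 5" "i \<noteq> j" for i j
    using assms that unfolding C5_model_def by blast+
  obtain blk where blk: "\<And>u i. i < 5 \<Longrightarrow> blk u = i \<longleftrightarrow> u \<in> X i" and blk5: "\<And>u. blk u \<le> 5"
    using block_index[of 5 X] T(1) by blast
  define W where "W = {u. blk u < 5}"
  define EW where "EW = {e \<in> E. e \<subseteq> W}"
  have XW: "X i \<subseteq> W" if i: "i < 5" for i
  proof
    fix u assume "u \<in> X i"
    then have "blk u = i" using blk[OF i] by blast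
    then show "u \<in> W" using i by (simp add: W_def)
  qed
  have EWE: "EW \<subseteq> E" by (auto simp: EW_def)
  have adjW: "blk u = blk v \<or> blk v = (blk u + 1) mod 5 \<or> blk u = (blk v + 1) mod 5"
    if "gadj E u v" "u \<in> W" "v \<in> W" for u v
  proof -
    have "u \<in> X (blk u)" "v \<in> X (blk v)" "blk u < 5" "blk v < 5" using blk that by (auto simp: W_def)
    then show ?thesis using T(2)[of "blk u" "blk v"] that(1) by (auto intro: touchI)
  qed
  define cr where "cr i D = {e \<in> D. \<exists>x y. e = {x, y} \<and> blk x = i \<and> blk y = (i + 1) mod 5}" for i :: nat and D :: "'v set set"
  have cr_sd: "cr i (sym_diff A B) = sym_diff (cr i A) (cr i B)" for i A B by (auto simp: cr_def)
  \<comment> \<open>\<open>k\<close> is the parity of crossings between the blocks 4 and 0; it adds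
    up under concatenation.\<close>
  define pth where "pth k a b \<longleftrightarrow> (\<exists>D. D \<subseteq> EW \<and> bd D = sym_diff {a} {b} \<and> odd (card (cr 4 D)) = k)" for k a b
  have fEW: "finite D" if "D \<subseteq> EW" for D using that EWE by (intro finite_sub) blast
  have fcr: "finite (cr i D)" if "D \<subseteq> EW" for i D using fEW[OF that] by (simp add: cr_def)
  have trans: "pth (k \<noteq> l) a c" if kl: "pth k a b" "pth l b c" for k l a b c
  proof -
    obtain A where A: "A \<subseteq> EW" "bd A = sym_diff {a} {b}" "odd (card (cr 4 A)) = k" using kl(1) unfolding pth_def by blast
    obtain B where B: "B \<subseteq> EW" "bd B = sym_diff {b} {c}" "odd (card (cr 4 B)) = l" using kl(2) unfolding pth_def by blast
    have 1: "sym_diff A B \<subseteq> EW" using A(1) B(1) by blast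
    have 2: "bd (sym_diff A B) = sym_diff {a} {c}" unfolding bd_sym_diff[OF fEW[OF A(1)] fEW[OF B(1)]] A(2) B(2) by auto
    have 3: "odd (card (cr 4 (sym_diff A B))) = (k \<noteq> l)"
      unfolding cr_sd using even_card_sym_diff[OF fcr[OF A(1), of 4] fcr[OF B(1), of 4]] A(3) B(3) by blast
    show ?thesis unfolding pth_def by (intro exI[of _ "sym_diff A B"] conjI 1 2 3)
  qed
  have inner: "pth False a b" if i: "i < 5" "a \<in> X i" "b \<in> X i" for i a b
  proof -
    obtain D where D: "D \<subseteq> {e \<in> E. e \<subseteq> X i}" "bd D = sym_diff {a} {b}" using conn_bd[OF X(1)[OF i(1)] i(2,3)] by blast
    have "cr 4 D = {}"
    proof (rule ccontr)
      assume "cr 4 D \<noteq> {}"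
      then obtain x y where xy: "{x, y} \<in> D" "blk x = 4" "blk y = 0" by (auto simp: cr_def)
      have "x \<in> X i" "y \<in> X i" using D(1) xy(1) by auto
      then have "blk x = i" "blk y = i" using blk[OF i(1)] by blast+
      then show False using xy by simp
    qed
    moreover have "D \<subseteq> EW" using D(1) XW[OF i(1)] by (auto simp: EW_def)
    ultimately show ?thesis unfolding pth_def using D(2) by (intro exI[of _ D]) simp
  qed
  have outer: "\<exists>x\<in>X i. \<exists>y\<in>X ((i + 1) mod 5). pth (i = 4) x y" if i: "i < 5" for i
  proof -
    have j: "(i + 1) mod 5 < 5" "i \<noteq> (i + 1) mod 5" using i by presburger+
    then obtain x y where xy: "x \<in> X i" "y \<in> X ((i + 1) mod 5)" "gadj E x y"
      using T(2)[OF i j] unfolding touch_def by blast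
    have b: "blk x = i" "blk y = (i + 1) mod 5" using blk[OF i] blk[OF j(1)] xy by auto
    have "{{x, y}} \<subseteq> EW" using xy XW[OF i] XW[OF j(1)] by (auto simp: EW_def gadj_def)
    moreover have "bd {{x, y}} = sym_diff {x} {y}" using gadjD[OF xy(3)] by auto
    moreover have "cr 4 {{x, y}} = (if i = 4 then {{x, y}} else {})"
    proof (cases "i = 4")
      case True
      then show ?thesis using b by (auto simp: cr_def)
    next
      case False
      have "\<not> ({x, y} = {x', y'} \<and> blk x' = 4 \<and> blk y' = 0)" for x' y'
        using False b i by (auto simp: doubleton_eq_iff)
      then show ?thesis using False by (auto simp: cr_def)
    qed
    ultimately have "pth (i = 4) x y" unfolding pth_def by (intro exI[of _ "{{x, y}}"]) auto
    then show ?thesis using xy by blast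
  qed
  obtain x0 y0 where p0: "x0 \<in> X 0" "y0 \<in> X 1" "pth False x0 y0" using outer[of 0] by auto
  obtain x1 y1 where p1: "x1 \<in> X 1" "y1 \<in> X 2" "pth False x1 y1" using outer[of 1] by (auto simp: numeral_2_eq_2)
  obtain x2 y2 where p2: "x2 \<in> X 2" "y2 \<in> X 3" "pth False x2 y2" using outer[of 2] by auto
  obtain x3 y3 where p3: "x3 \<in> X 3" "y3 \<in> X 4" "pth False x3 y3" using outer[of 3] by auto
  obtain x4 y4 where p4: "x4 \<in> X 4" "y4 \<in> X 0" "pth True x4 y4" using outer[of 4] by auto
  have q: "pth False y0 x1" "pth False y1 x2" "pth False y2 x3" "pth False y3 x4" "pth False y4 x0"
    using inner[of 1] inner[of 2] inner[of 3] inner[of 4] inner[of 0] p0 p1 p2 p3 p4 by auto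
  have "pth True x0 x0"
    using trans[OF trans[OF trans[OF trans[OF p0(3) q(1)] trans[OF p1(3) q(2)]] trans[OF p2(3) q(3)]]
        trans[OF trans[OF p3(3) q(4)] trans[OF p4(3) q(5)]]] by simp
  then obtain D0 where D0: "D0 \<subseteq> EW" "bd D0 = {}" "odd (card (cr 4 D0))" unfolding pth_def by auto
  let ?Q = "\<lambda>D. D \<subseteq> EW \<and> bd D = {} \<and> odd (card (cr 4 D))"
  have "?Q D0" using D0 by blast
  then obtain D where D: "?Q D" and mn: "\<And>D'. ?Q D' \<Longrightarrow> card D \<le> card D'"
    using ex_has_least_nat[of ?Q D0 card] by blast
  have DE: "D \<subseteq> E" using D EWE by blast
  have fD: "finite D" using D fEW by blast
  have D0: "D \<noteq> {}" using D by (auto simp: cr_def)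
  \<comment> \<open>The cut around one block consists of the crossings on its two sides and meets
    \<open>D\<close> evenly. So all five crossing parities agree; they are odd, which yields five
    distinct edges.\<close>
  have step: "odd (card (cr i D)) = odd (card (cr ((i + 1) mod 5) D))" if i: "i < 5" for i
  proof -
    let ?j = "(i + 1) mod 5"
    have j: "?j < 5" "i \<noteq> ?j" "(?j + 1) mod 5 \<noteq> ?j" "(?j + 1) mod 5 \<noteq> i" using i by presburger+
    have "D \<inter> cut E (X ?j) = sym_diff (cr i D) (cr ?j D)"
    proof (rule set_eqI)
      fix e
      show "e \<in> D \<inter> cut E (X ?j) \<longleftrightarrow> e \<in> sym_diff (cr i D) (cr ?j D)"
      proof (cases "e \<in> D")
        case True
        then have "e \<in> E" "e \<subseteq> W" using D by (auto simp: EW_def)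
        then obtain u v where uv: "e = {u, v}" "gadj E u v" using edge_ends by blast
        have uW: "u \<in> W" "v \<in> W" using \<open>e \<subseteq> W\<close> uv by auto
        have c: "e \<in> cr k D \<longleftrightarrow> (blk u = k \<and> blk v = (k + 1) mod 5 \<or> blk v = k \<and> blk u = (k + 1) mod 5)" for k
          using True unfolding cr_def uv(1) by (auto simp: doubleton_eq_iff)
        have "e \<in> cut E (X ?j) \<longleftrightarrow> (blk u = ?j) \<noteq> (blk v = ?j)"
          unfolding uv(1) cut_iff[OF uv(2)] blk[OF j(1)] ..
        moreover have "(blk u + 1) mod 5 = ?j \<longleftrightarrow> blk u = i" "(blk v + 1) mod 5 = ?j \<longleftrightarrow> blk v = i"
        proof -
          have "blk u < 5" "blk v < 5" using uW by (auto simp: W_def)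
          then show "(blk u + 1) mod 5 = ?j \<longleftrightarrow> blk u = i" "(blk v + 1) mod 5 = ?j \<longleftrightarrow> blk v = i" using mod5_inj i by blast+
        qed
        moreover have "(i + 1) mod 5 = (blk v + 1) mod 5 \<longleftrightarrow> blk v = i" "(i + 1) mod 5 = (blk u + 1) mod 5 \<longleftrightarrow> blk u = i"
          using calculation(2,3) by metis+
        ultimately show ?thesis
          unfolding Int_iff Un_iff Diff_iff c[of i] c[of ?j] using True adjW[OF uv(2) uW] j by metis
      qed (auto simp: cr_def)
    qed
    moreover have "even (card (D \<inter> cut E (X ?j)))" using parity_cut[OF DE X(2)[OF j(1)]] D by simp
    ultimately show ?thesis using even_card_sym_diff[of "cr i D" "cr ?j D"] D fcr by metis
  qed
  have odd: "odd (card (cr 4 D))" using D by blast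
  then have "odd (card (cr 0 D))" using step[of 4] by simp
  moreover from this have "odd (card (cr 1 D))" using step[of 0] by simp
  moreover from this have "odd (card (cr 2 D))" using step[of 1] by (simp add: numeral_2_eq_2)
  moreover from this have "odd (card (cr 3 D))" using step[of 2] by simp
  ultimately have "cr 0 D \<noteq> {}" "cr 1 D \<noteq> {}" "cr 2 D \<noteq> {}" "cr 3 D \<noteq> {}" "cr 4 D \<noteq> {}"
    using odd by (metis card.empty even_zero)+
  then obtain e0 e1 e2 e3 e4 where e: "e0 \<in> cr 0 D" "e1 \<in> cr 1 D" "e2 \<in> cr 2 D" "e3 \<in> cr 3 D" "e4 \<in> cr 4 D" by blast
  have crd: "e \<noteq> f" if ei: "e \<in> cr i D" "f \<in> cr j D" and ij: "i < 5" "j < 5" "i \<noteq> j" for e f i j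
  proof
    assume ef: "e = f"
    obtain x y x' y' where b: "e = {x, y}" "blk x = i" "blk y = (i + 1) mod 5" "f = {x', y'}" "blk x' = j" "blk y' = (j + 1) mod 5"
      using ei unfolding cr_def by blast
    have "x = x' \<and> y = y' \<or> x = y' \<and> y = x'" using ef unfolding b(1,4) doubleton_eq_iff .
    then show False
    proof
      assume "x = x' \<and> y = y'"
      then show False using b(2,5) ij(3) by simp
    next
      assume "x = y' \<and> y = x'"
      then have 1: "i = (j + 1) mod 5" "j = (i + 1) mod 5" using b(2,3,5,6) by simp_all
      have "j = 0 \<or> j = 1 \<or> j = 2 \<or> j = 3 \<or> j = 4" using ij(2) by linarith
      moreover have "i = 0 \<or> i = 1 \<or> i = 2 \<or> i = 3 \<or> i = 4" using ij(1) by linarith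
      ultimately show False using 1 by (elim disjE) simp_all
    qed
  qed
  have "card {e0, e1, e2, e3, e4} = 5"
    using crd[OF e(1) e(2)] crd[OF e(1) e(3)] crd[OF e(1) e(4)] crd[OF e(1) e(5)] crd[OF e(2) e(3)] crd[OF e(2) e(4)]
      crd[OF e(2) e(5)] crd[OF e(3) e(4)] crd[OF e(3) e(5)] crd[OF e(4) e(5)] by (simp add: card_insert_if)
  moreover have "{e0, e1, e2, e3, e4} \<subseteq> D" using e by (auto simp: cr_def)
  ultimately have c5: "5 \<le> card D" using card_mono[OF fD] by metis
  have "cocircuit (cographic V E) D"
    unfolding cocircuit_def cocycles_iff
  proof (intro conjI ballI impI)
    fix D' assume "D' \<in> cocycles (cographic V E)" "D' \<noteq> {} \<and> D' \<subseteq> D"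
    then have D': "D' \<subseteq> E" "bd D' = {}" "D' \<noteq> {}" "D' \<subseteq> D" using cocycles_iff by auto
    have D'EW: "D' \<subseteq> EW" using D' D by blast
    show "D' = D"
    proof (cases "odd (card (cr 4 D'))")
      case True
      then have "card D \<le> card D'" using mn D' D'EW by blast
      then show ?thesis using D'(4) fD by (simp add: card_seteq)
    next
      case False
      have eq: "sym_diff D D' = D - D'" using D'(4) by blast
      have "bd (sym_diff D D') = {}" using bd_sym_diff[OF fD fEW[OF D'EW]] D D'(2) by simp
      moreover have "odd (card (cr 4 (sym_diff D D')))"
        unfolding cr_sd using even_card_sym_diff[OF fcr fcr[OF D'EW]] D False by blast
      ultimately have "card D \<le> card (D - D')" using mn[of "D - D'"] D unfolding eq by blast
      then show ?thesis using D'(3,4) fD by (metis Diff_subset card_seteq Diff_disjoint inf.absorb_iff2 inf_commute)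
    qed
  qed (use DE D D0 in auto)
  moreover have "chordless (cographic V E) D"
    unfolding chordless_def
  proof
    assume "\<exists>e. chord (cographic V E) D e"
    then obtain e D1 D2 where e: "e \<notin> D" "D1 \<inter> D2 = {e}" "D = sym_diff D1 D2"
      and c: "D1 \<subseteq> E" "bd D1 = {}" "D2 \<subseteq> E" "bd D2 = {}"
      unfolding chord_def Bex_def cocycles_iff by blast
    have eW: "v \<in> W" if ve: "v \<in> e" for v
    proof -
      have "e \<in> D1" using e by blast
      then obtain e' where e': "e' \<in> D1" "v \<in> e'" "e' \<noteq> e" using even_degree[OF c(1,2) _ ve] by blast
      then have "e' \<in> D" using e by blast
      then show ?thesis using D e' by (auto simp: EW_def)
    qed
    have sub: "D1 \<subseteq> EW" "D2 \<subseteq> EW"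
    proof -
      have "D1 \<subseteq> insert e D" "D2 \<subseteq> insert e D" "e \<in> E" using e c by auto
      moreover have "insert e D \<subseteq> EW" using \<open>e \<in> E\<close> eW D by (auto simp: EW_def)
      ultimately show "D1 \<subseteq> EW" "D2 \<subseteq> EW" by auto
    qed
    \<comment> \<open>The chord is counted twice and each part has at least 3 edges, so both parts
      are smaller than \<open>D\<close>.\<close>
    have "card D1 + card D2 = card D + 2"
    proof -
      have "card D1 = card (D1 - D2) + card (D1 \<inter> D2)" "card D2 = card (D2 - D1) + card (D1 \<inter> D2)"
        using card_Int_Diff[OF fEW[OF sub(1)], of D2] card_Int_Diff[OF fEW[OF sub(2)], of D1] by (simp_all add: Int_commute)
      moreover have "card D = card (D1 - D2) + card (D2 - D1)" unfolding e(3)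
        using fEW[OF sub(1)] fEW[OF sub(2)] by (intro card_Un_disjoint) auto
      ultimately show ?thesis using e(2) by simp
    qed
    moreover have "3 \<le> card D1" "3 \<le> card D2" using card_even_ge_3 c e(2) by auto
    moreover have "odd (card (cr 4 D1)) \<or> odd (card (cr 4 D2))"
      using odd even_card_sym_diff[OF fcr[OF sub(1)] fcr[OF sub(2)]] unfolding e(3) cr_sd by blast
    ultimately show False using mn[of D1] mn[of D2] sub c by force
  qed
  ultimately show ?thesis using c5 by blast
qed

text \<open>No cyclic order of \<open>D\<close> is constructed. Without a pentagon, \<open>D\<close>
  is the induced subgraph on its vertices because it has no chord, some vertex \<open>x\<close> has
  two neighbours in one component of the rest, and a common neighbour of two such vertices closes a
  four-cycle in \<open>D\<close>. Minimality then makes \<open>D\<close> too short.\<close>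

lemma chordless_cocircuit_C5:
  assumes cc: "cocircuit (cographic V E) D" and cl: "chordless (cographic V E) D" and c5: "5 \<le> card D"
  shows "\<exists>X. C5_model V (gadj E) X"
proof (rule ccontr)
  assume n: "\<not> ?thesis"
  then have noC5: "no_C5 V (gadj E)" by (simp add: no_C5_def)
  have D: "D \<subseteq> E" "bd D = {}" "D \<noteq> {}"
    and mn: "\<And>D'. D' \<subseteq> D \<Longrightarrow> bd D' = {} \<Longrightarrow> D' \<noteq> {} \<Longrightarrow> D' = D"
  proof -
    have "D \<in> cocycles (cographic V E)" and ne: "D \<noteq> {}"
      and m: "\<forall>D'\<in>cocycles (cographic V E). D' \<noteq> {} \<and> D' \<subseteq> D \<longrightarrow> D' = D"
      using cc unfolding cocircuit_def by auto
    then show D: "D \<subseteq> E" "bd D = {}" "D \<noteq> {}" unfolding cocycles_iff by auto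
    show "D' = D" if "D' \<subseteq> D" "bd D' = {}" "D' \<noteq> {}" for D'
    proof -
      have "D' \<in> cocycles (cographic V E)" unfolding cocycles_iff using that(1,2) D(1) by auto
      then show ?thesis using m that(1,3) by blast
    qed
  qed
  have fD: "finite D" using finite_sub D by blast
  define W where "W = \<Union>D"
  have WV: "W \<subseteq> V" using D(1) edgeD by (auto simp: W_def)
  have fW: "finite W" using WV finV finite_subset by blast
  interpret G: sgraph V D
    by unfold_locales (use sg D(1) in \<open>auto simp: simple_graph_def\<close>)
  obtain e where e: "e \<in> D" using D(3) by blast
  then obtain x y where xy: "e = {x, y}" "x \<noteq> y" using G.edge_ends by blast
  have xW: "x \<in> W" "y \<in> W" using e xy by (auto simp: W_def)
  have connD: "conn (gadj D) W"
  proof -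
    define R where "R = component (gadj D) W x"
    note R = component[OF symp_gadj[of D] xW(1), folded R_def]
    have "bd {e \<in> D. e \<subseteq> R} = {}"
    proof -
      have "v \<notin> bd {e \<in> D. e \<subseteq> R}" for v
      proof (cases "v \<in> R")
        case True
        have "f \<subseteq> R" if fD': "f \<in> D" "v \<in> f" for f
        proof -
          obtain p q where pq: "f = {p, q}" "gadj D p q" using G.edge_ends[OF fD'(1)] by blast
          have "p \<in> W" "q \<in> W" using fD'(1) pq by (auto simp: W_def)
          moreover have "gadj D q p" using pq(2) by (simp add: gadj_def insert_commute)
          moreover have "v = p \<or> v = q" using fD'(2) pq(1) by blast
          ultimately show ?thesis using R(4)[OF True, of p] R(4)[OF True, of q] True pq by blast
        qed
        then have "{f \<in> {e \<in> D. e \<subseteq> R}. v \<in> f} = {f \<in> D. v \<in> f}" by blast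
        then show ?thesis using D(2) by (simp add: bd_def)
      next
        case False
        then have "{f \<in> {e \<in> D. e \<subseteq> R}. v \<in> f} = {}" by blast
        then show ?thesis unfolding bd_def by (simp only: mem_Collect_eq card.empty even_zero) simp
      qed
      then show ?thesis by blast
    qed
    moreover have "e \<in> {e \<in> D. e \<subseteq> R}"
    proof -
      have "gadj D x y" using e xy by (simp add: gadj_def)
      then have "y \<in> R" using R(4)[OF R(1), of y] xW by blast
      then show ?thesis using e xy R(1) by simp
    qed
    ultimately have "{e \<in> D. e \<subseteq> R} = D" using mn[of "{e \<in> D. e \<subseteq> R}"] by blast
    then have "W \<subseteq> R" unfolding W_def by blast
    then show ?thesis using R(2,3) by (metis subset_antisym)
  qed
  \<comment> \<open>A part of \<open>D\<close> with boundary at \<open>u\<close> and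
    \<open>v\<close>, closed by the edge \<open>{u, v}\<close>, and its symmetric difference with
    \<open>D\<close> would exhibit that edge as a chord.\<close>
  have induced: "{u, v} \<in> D" if uv: "gadj E u v" "u \<in> W" "v \<in> W" for u v
  proof (rule ccontr)
    assume nD: "{u, v} \<notin> D"
    obtain D' where D': "D' \<subseteq> D" "bd D' = sym_diff {u} {v}" using G.conn_bd[OF connD uv(2,3)] by blast
    have uv': "u \<noteq> v" "{u, v} \<in> E" using gadjD[OF uv(1)] uv(1) by (auto simp: gadj_def)
    have fD': "finite D'" using D'(1) fD finite_subset by blast
    define D1 where "D1 = sym_diff D' {{u, v}}"
    define D2 where "D2 = sym_diff D D1"
    have b1: "bd D1 = {}" unfolding D1_def using bd_sym_diff[OF fD', of "{{u, v}}"] D'(2) uv' by auto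
    have fD1: "finite D1" using fD' by (simp add: D1_def)
    have b2: "bd D2 = {}" unfolding D2_def using bd_sym_diff[OF fD fD1] D(2) b1 by simp
    have "D1 \<inter> D2 = {{u, v}}" "D = sym_diff D1 D2" "D1 \<subseteq> E" "D2 \<subseteq> E"
      unfolding D2_def D1_def using nD D'(1) D(1) uv' by auto
    moreover from this b1 b2 have "D1 \<in> cocycles (cographic V E)" "D2 \<in> cocycles (cographic V E)"
      unfolding cocycles_iff by blast+
    ultimately have "chord (cographic V E) D {u, v}"
      unfolding chord_def cycles_cographic using nD uv' by blast
    then show False using cl by (auto simp: chordless_def)
  qed
  have gD: "{u, v} \<in> D \<Longrightarrow> gadj E u v" for u v using D(1) by (auto simp: gadj_def)
  have xyD: "{x, y} \<in> D" using e xy by simp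
  have yW: "y \<in> W - {x}" using xW xy by blast
  define R where "R = component (gadj E) (W - {x}) y"
  note R = component[OF symp_gadj[of E] yW, folded R_def]
  have RV: "R \<subseteq> V" using R(2) WV by blast
  \<comment> \<open>By parity a second edge of \<open>D\<close> besides \<open>{x, y}\<close> leaves
    \<open>R\<close>. Since \<open>R\<close> is a component of \<open>W - {x}\<close>, that edge
    ends in \<open>x\<close> too.\<close>
  have "even (card (D \<inter> cut E R))" using parity_cut[OF D(1) RV] D(2) by simp
  moreover have "{x, y} \<in> D \<inter> cut E R"
    using cut_iff[OF gD[OF xyD], of R] R(1,2) xyD by auto
  ultimately have "D \<inter> cut E R \<noteq> {{x, y}}" by auto
  then obtain f where f: "f \<in> D" "f \<in> cut E R" "f \<noteq> {x, y}" using \<open>{x, y} \<in> D \<inter> cut E R\<close> by blast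
  obtain p q where pq: "f = {p, q}" "gadj E p q" using edge_ends[of f] f(1) D(1) by blast
  have "(p \<in> R) \<noteq> (q \<in> R)" using f(2) cut_iff[OF pq(2)] pq(1) by simp
  then obtain z w where zw: "f = {z, w}" "z \<in> R" "w \<notin> R" "gadj E z w"
    using pq symp_gadj[of E] by (metis insert_commute sympD)
  have "w \<in> W" using f(1) zw(1) by (auto simp: W_def)
  then have wx: "w = x" using R(4)[OF zw(2), of w] zw(3,4) by blast
  have zy: "z \<noteq> y" using f(3) zw(1) wx by (auto simp: insert_commute)
  define N where "N = {z \<in> W. gadj E x z}"
  have sN: "gadj E u v \<Longrightarrow> gadj E v u" for u v using symp_gadj[of E] by (rule sympD)
  have small: False if "D' \<subseteq> D" "bd D' = {}" "D' \<noteq> {}" "card D' \<le> 4" for D'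
    using mn[OF that(1-3)] that(4) c5 by simp
  have ind: "\<not> gadj E u v" if uv: "u \<in> N" "v \<in> N" for u v
  proof
    assume a: "gadj E u v"
    have i: "{x, u} \<in> D" "{x, v} \<in> D" "{u, v} \<in> D" using induced uv a xW(1) by (auto simp: N_def)
    have ne: "u \<noteq> v" "x \<noteq> u" "x \<noteq> v" using gadjD a uv by (auto simp: N_def)
    let ?D' = "sym_diff (sym_diff {{x, u}} {{x, v}}) {{u, v}}"
    have "bd ?D' = {}" using ne by (auto simp: bd_sym_diff)
    moreover have "?D' \<noteq> {}" using ne by (auto simp: doubleton_eq_iff)
    moreover have sub: "?D' \<subseteq> {{x, u}, {x, v}, {u, v}}" by blast
    moreover have "card ?D' \<le> 4" by (rule order_trans[OF card_mono[OF _ sub] card_3]) simp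
    ultimately show False using small[of ?D'] i by blast
  qed
  have fR: "finite R" using R(2) fW finite_subset by (metis finite_Diff)
  have "y \<in> R \<inter> N" "z \<in> R \<inter> N" using R(1,2) zw wx gD[OF xyD] sN by (auto simp: N_def)
  then obtain s t C where st: "s \<in> R \<inter> N" "t \<in> R \<inter> N" "s \<noteq> t" and C: "conn (gadj E) C" "C \<subseteq> R - N"
    "touch (gadj E) {s} C" "touch (gadj E) {t} C"
    using link_independent[OF symp_gadj fR R(3), of y N z] ind zy by metis
  have xs: "gadj E x s" "gadj E x t" "gadj E s x" "gadj E t x" "s \<in> W" "t \<in> W" using st sN by (auto simp: N_def)
  have "\<exists>c\<in>C. gadj E s c \<and> gadj E t c"
  proof (rule common_neighbour[OF noC5 symp_gadj, of C "{x}"])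
    show "finite C" using C(2) fR finite_subset by blast
    show "\<not> touch (gadj E) {x} C" using C(2) R(2) by (auto simp: touch_def N_def)
    show "{x} \<union> C \<union> {s, t} \<subseteq> V" using xW xs WV C(2) R(2) by blast
    show "{x} \<inter> C = {}" "{s, t} \<inter> ({x} \<union> C) = {}" using C(2) R(2) st by auto
  qed (use C st xs ind in auto)
  then obtain c where c: "c \<in> C" "gadj E s c" "gadj E t c" by blast
  have cW: "c \<in> W" "c \<noteq> x" using c(1) C(2) R(2) by auto
  have i: "{x, s} \<in> D" "{x, t} \<in> D" "{s, c} \<in> D" "{t, c} \<in> D" using induced xs c cW xW(1) by auto
  have ne: "x \<noteq> s" "x \<noteq> t" "s \<noteq> c" "t \<noteq> c" using gadjD xs c by blast+
  let ?D' = "sym_diff (sym_diff {{x, s}} {{x, t}}) (sym_diff {{s, c}} {{t, c}})"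
  have b: "bd ?D' = {}" using ne st(3) cW by (auto simp: bd_sym_diff)
  have n: "?D' \<noteq> {}" using ne st(3) cW by (auto simp: doubleton_eq_iff)
  have sub: "?D' \<subseteq> {{x, s}, {x, t}, {s, c}, {t, c}}" by (rule sym_diff_4)
  have c4: "card ?D' \<le> 4" by (rule order_trans[OF card_mono[OF _ sub] card_4]) simp
  have "?D' \<subseteq> D" by (rule subset_trans[OF sub]) (simp add: i)
  then show False by (rule small[OF _ b n c4])
qed

end

section \<open>The minor of the complete graph\<close>

text \<open>Deletions and contractions commute, so a minor is described by one deleted set
  \<open>A\<close> and one contracted set \<open>B\<close>.\<close>

lemma minor_sets:
  assumes "minor M N" "cycles M \<subseteq> Pow (ground M)"
  shows "\<exists>A B. A \<union> B \<subseteq> ground M \<and> A \<inter> B = {} \<and> ground N = ground M - A - B \<and>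
    cycles N = (\<lambda>C. C - B) ` {C \<in> cycles M. C \<inter> A = {}}"
  using assms(1)
proof induction
  case refl
  show ?case by (intro exI[of _ "{}"]) auto
next
  case (delete N e)
  then obtain A B where AB: "A \<union> B \<subseteq> ground M" "A \<inter> B = {}" "ground N = ground M - A - B"
    "cycles N = (\<lambda>C. C - B) ` {C \<in> cycles M. C \<inter> A = {}}" by blast
  have e: "e \<in> ground M" "e \<notin> A" "e \<notin> B" using delete(2) AB(3) by auto
  have "cycles (deletion N e) = (\<lambda>C. C - B) ` {C \<in> cycles M. C \<inter> insert e A = {}}"
    unfolding deletion_def snd_conv AB(4) using e(3) by auto
  moreover have "ground (deletion N e) = ground M - insert e A - B" unfolding deletion_def fst_conv AB(3) by auto
  ultimately show ?case using AB(1,2) e by (intro exI[of _ "insert e A"] exI[of _ B]) auto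
next
  case (contract N e)
  then obtain A B where AB: "A \<union> B \<subseteq> ground M" "A \<inter> B = {}" "ground N = ground M - A - B"
    "cycles N = (\<lambda>C. C - B) ` {C \<in> cycles M. C \<inter> A = {}}" by blast
  have e: "e \<in> ground M" "e \<notin> A" "e \<notin> B" using contract(2) AB(3) by auto
  have eq: "C - B - {e} = C - insert e B" for C by blast
  have "cycles (contraction N e) = (\<lambda>C. C - insert e B) ` {C \<in> cycles M. C \<inter> A = {}}"
    unfolding contraction_def snd_conv AB(4) image_image eq ..
  moreover have "ground (contraction N e) = ground M - A - insert e B" unfolding contraction_def fst_conv AB(3) by auto
  moreover have "A \<union> insert e B \<subseteq> ground M" "A \<inter> insert e B = {}" using AB(1,2) e by auto
  ultimately show ?case by (intro exI[of _ A] exI[of _ "insert e B"] conjI)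
qed

lemma minor_of_sets:
  assumes "finite A" "finite B" "A \<union> B \<subseteq> ground M" "A \<inter> B = {}"
  shows "minor M (ground M - A - B, (\<lambda>C. C - B) ` {C \<in> cycles M. C \<inter> A = {}})"
  using assms(2,1,3,4)
proof (induction B)
  case empty
  from empty(1,2) show ?case
  proof (induction A)
    case empty
    have "(ground M - {} - {}, (\<lambda>C. C - {}) ` {C \<in> cycles M. C \<inter> {} = {}}) = M" by simp
    then show ?case using minor.refl by metis
  next
    case (insert e A)
    have "deletion (ground M - A - {}, (\<lambda>C. C - {}) ` {C \<in> cycles M. C \<inter> A = {}}) e =
      (ground M - insert e A - {}, (\<lambda>C. C - {}) ` {C \<in> cycles M. C \<inter> insert e A = {}})"
      unfolding deletion_def fst_conv snd_conv by (intro arg_cong2[where f = Pair]) auto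
    moreover have "minor M (deletion (ground M - A - {}, (\<lambda>C. C - {}) ` {C \<in> cycles M. C \<inter> A = {}}) e)"
      by (rule minor.delete) (use insert in auto)
    ultimately show ?case by simp
  qed
next
  case (insert e B)
  have "contraction (ground M - A - B, (\<lambda>C. C - B) ` {C \<in> cycles M. C \<inter> A = {}}) e =
    (ground M - A - insert e B, (\<lambda>C. C - insert e B) ` {C \<in> cycles M. C \<inter> A = {}})"
    unfolding contraction_def fst_conv snd_conv image_image by (intro arg_cong2[where f = Pair] image_cong HOL.refl) auto
  moreover have "minor M (contraction (ground M - A - B, (\<lambda>C. C - B) ` {C \<in> cycles M. C \<inter> A = {}}) e)"
    by (rule minor.contract) (use insert in auto)
  ultimately show ?case by simp
qed

lemma conn_mono:
  assumes "conn adj X" "\<And>x y. adj x y \<Longrightarrow> adj' x y"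
  shows "conn adj' X"
  unfolding conn_def
proof (intro conjI allI impI)
  show "X \<noteq> {}" using assms(1) by (rule conn_ne)
  fix Y assume "Y \<subseteq> X" "Y \<noteq> {}" "Y \<noteq> X"
  from connD[OF assms(1) this] show "\<exists>y\<in>Y. \<exists>z\<in>X - Y. adj' y z" using assms(2) by blast
qed

lemma component_eq:
  assumes "symp adj" "x \<in> W" "y \<in> component adj W x"
  shows "component adj W y = component adj W x"
proof -
  have y: "y \<in> W" using assms(3) component(2)[OF assms(1,2)] by blast
  have 1: "component adj W x \<subseteq> component adj W y"
    using component(2,3)[OF assms(1,2)] assms(3) unfolding component_def[of adj W y] by blast
  then have "x \<in> component adj W y" using component(1)[OF assms(1,2)] by blast
  then have "component adj W y \<subseteq> component adj W x"
    using component(2,3)[OF assms(1) y] unfolding component_def[of adj W x] by blast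
  then show ?thesis using 1 by blast
qed

lemma sgraph_K5: "sgraph K5_vertices K5_edges"
  by unfold_locales (auto simp: simple_graph_def K5_vertices_def K5_edges_def)

lemma K5_edge: "i < 5 \<Longrightarrow> j < 5 \<Longrightarrow> i \<noteq> j \<Longrightarrow> {i, j} \<in> K5_edges"
  by (auto simp: K5_edges_def K5_vertices_def)

lemma K5_cut: "i < 5 \<Longrightarrow> j < 5 \<Longrightarrow> i \<noteq> j \<Longrightarrow> {i, j} \<in> cut K5_edges T \<longleftrightarrow> (i \<in> T) \<noteq> (j \<in> T)"
  using sgraph.cut_iff[OF sgraph_K5, of i j T] K5_edge by (auto simp: gadj_def)

lemma sym_diff_pairs: "a \<noteq> c \<Longrightarrow> b \<noteq> c \<Longrightarrow> a \<noteq> b \<Longrightarrow> sym_diff {c, a} {c, b} = {a, b}"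
  by auto

text \<open>Distinct pairs that meet pairwise form a star or a triangle, and a triangle has room for
  only three of them.\<close>

lemma four_pairs:
  assumes Q: "\<And>i. i \<in> {1..4::nat} \<Longrightarrow> card (Q i) = 2"
    and QQ: "\<And>i j. i \<in> {1..4} \<Longrightarrow> j \<in> {1..4} \<Longrightarrow> i \<noteq> j \<Longrightarrow> card (Q i \<inter> Q j) = 1"
  shows "\<exists>c. \<forall>i\<in>{1..4}. c \<in> Q i"
proof -
  have fin: "finite (Q i)" if "i \<in> {1..4}" for i using Q[OF that] card.infinite by fastforce
  have eqI: "Q i = {a, b}" if i: "i \<in> {1..4}" and ab: "a \<in> Q i" "b \<in> Q i" "a \<noteq> b" for i a b
    by (rule card_subset_eq[symmetric]) (use fin[OF i] Q[OF i] ab in auto)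
  have QQ_ne: "Q i \<noteq> Q j" if ij: "i \<in> {1..4}" "j \<in> {1..4}" "i \<noteq> j" for i j
    using QQ[OF ij] Q[OF ij(1)] by auto
  have "card (Q 1 \<inter> Q 2) = 1" by (rule QQ) auto
  then obtain c where c: "Q 1 \<inter> Q 2 = {c}" by (auto simp: card_1_singleton_iff)
  have "Q 1 \<noteq> {c}" "Q 2 \<noteq> {c}" using Q[of 1] Q[of 2] by auto
  then obtain a b where ab: "a \<in> Q 1" "b \<in> Q 2" "a \<noteq> c" "b \<noteq> c" using c by blast
  have ab': "a \<noteq> b" using ab c by blast
  have Q12: "Q 1 = {c, a}" "Q 2 = {c, b}"
    using eqI[of 1 c a] eqI[of 2 c b] ab c by auto
  have no: "Q k = {a, b}" if k: "k = 3 \<or> k = 4" "c \<notin> Q k" for k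
  proof -
    have "card (Q 1 \<inter> Q k) = 1" "card (Q 2 \<inter> Q k) = 1" using QQ[of 1 k] QQ[of 2 k] k(1) by auto
    then have "Q 1 \<inter> Q k \<noteq> {}" "Q 2 \<inter> Q k \<noteq> {}" by force+
    then have "a \<in> Q k" "b \<in> Q k" using k(2) Q12 by auto
    then show ?thesis using eqI[of k a b] ab' k(1) by auto
  qed
  have bad: False if kl: "k = 3 \<and> l = 4 \<or> k = 4 \<and> l = 3" "c \<notin> Q k" for k l :: nat
  proof (cases "c \<in> Q l")
    case True
    have k: "Q k = {a, b}" using no[of k] kl by blast
    have "card (Q l \<inter> Q k) = 1" using QQ[of l k] kl(1) by auto
    then have "Q l \<inter> Q k \<noteq> {}" by force
    then have "a \<in> Q l \<or> b \<in> Q l" using k by auto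
    moreover have l: "l \<in> {1..4}" "l \<noteq> 1" "l \<noteq> 2" using kl(1) by auto
    ultimately have "Q l = {c, a} \<or> Q l = {c, b}" using eqI[OF l(1) True] ab(3,4) by metis
    moreover have "Q l \<noteq> Q 1" "Q l \<noteq> Q 2" using QQ_ne[OF l(1), of 1] QQ_ne[OF l(1), of 2] l by simp_all
    ultimately show False unfolding Q12 by blast
  next
    case False
    then have "Q k = Q l" using no[of k] no[of l] kl by metis
    moreover have "k \<in> {1..4}" "l \<in> {1..4}" "k \<noteq> l" using kl(1) by auto
    ultimately show False using QQ_ne by blast
  qed
  have "c \<in> Q 3" "c \<in> Q 4" using bad[of 3 4] bad[of 4 3] by blast+
  moreover have "{1..4::nat} = {1, 2, 3, 4}" by auto
  ultimately show ?thesis using Q12 by auto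
qed

section \<open>Five blocks as a minor of the cographic matroid\<close>

context sgraph begin

text \<open>Deleting \<open>A\<close> from the cographic matroid contracts it in the graph, so the
  blocks are sought among the components of the graph with edge set \<open>A\<close>. The
  isomorphism matches only edges; the vertices are recovered because the four edges matched with
  those at 0 have end components that pairwise share exactly one, hence all share one.\<close>

lemma K5_minor_model:
  assumes mi: "minor (cographic V E) N" and iso: "bmat_iso N (cographic K5_vertices K5_edges)"
  shows "\<exists>X. K5_model V (gadj E) X"
proof -
  have "cycles (cographic V E) \<subseteq> Pow (ground (cographic V E))"
    unfolding cycles_cographic using cut_subset by blast
  from minor_sets[OF mi this, unfolded cycles_cographic]
  obtain A B where AB: "A \<union> B \<subseteq> E" "A \<inter> B = {}" "ground N = E - A - B"
    and cyN: "cycles N = (\<lambda>C. C - B) ` {C \<in> cut E ` Pow V. C \<inter> A = {}}"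
    by blast
  obtain \<phi> where bij: "bij_betw \<phi> (ground N) K5_edges"
    and cyc: "(\<lambda>C. \<phi> ` C) ` cycles N = cut K5_edges ` Pow K5_vertices"
    using iso unfolding bmat_iso_def by (auto simp: cographic_def)
  define g where "g = inv_into (ground N) \<phi>"
  have g: "g k \<in> ground N" "\<phi> (g k) = k" if "k \<in> K5_edges" for k
    using bij that unfolding g_def bij_betw_def by (auto simp: inv_into_into f_inv_into_f)
  have gE: "g k \<in> E" "g k \<notin> A" "g k \<notin> B" if "k \<in> K5_edges" for k using g(1)[OF that] AB(3) by auto
  have mem: "k \<in> \<phi> ` (C - B) \<longleftrightarrow> g k \<in> C" if k: "k \<in> K5_edges" and C: "C \<subseteq> E" "C \<inter> A = {}" for k C
  proof
    assume "k \<in> \<phi> ` (C - B)"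
    then obtain e where e: "e \<in> C - B" "k = \<phi> e" by blast
    then have "e \<in> ground N" using C AB(3) by blast
    then have "g k = e" using bij e(2) unfolding g_def bij_betw_def by simp
    then show "g k \<in> C" using e by blast
  next
    assume "g k \<in> C"
    then show "k \<in> \<phi> ` (C - B)" using gE[OF k] g(2)[OF k] by force
  qed
  have c1: "\<exists>T. \<forall>i<5. \<forall>j<5. i \<noteq> j \<longrightarrow> (g {i, j} \<in> cut E R \<longleftrightarrow> (i \<in> T) \<noteq> (j \<in> T))"
    if R: "R \<subseteq> V" "cut E R \<inter> A = {}" for R
  proof -
    have "\<phi> ` (cut E R - B) \<in> cut K5_edges ` Pow K5_vertices"
      unfolding cyc[symmetric] cyN using R by blast
    then obtain T where T: "\<phi> ` (cut E R - B) = cut K5_edges T" by blast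
    show ?thesis
    proof (intro exI allI impI)
      fix i j :: nat assume ij: "i < 5" "j < 5" "i \<noteq> j"
      show "g {i, j} \<in> cut E R \<longleftrightarrow> (i \<in> T) \<noteq> (j \<in> T)"
        using mem[OF K5_edge[OF ij] cut_subset R(2)] K5_cut[OF ij, of T] unfolding T by blast
    qed
  qed
  have c2: "\<exists>R. R \<subseteq> V \<and> cut E R \<inter> A = {} \<and> g {i, j} \<in> cut E R" if ij: "i < 5" "j < 5" "i \<noteq> j" for i j :: nat
  proof -
    have "cut K5_edges {i} \<in> (\<lambda>C. \<phi> ` C) ` cycles N" unfolding cyc using ij(1) by (auto simp: K5_vertices_def)
    then obtain R where R: "R \<subseteq> V" "cut E R \<inter> A = {}" "cut K5_edges {i} = \<phi> ` (cut E R - B)" unfolding cyN by blast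
    have "{i, j} \<in> cut K5_edges {i}" using K5_cut[OF ij, of "{i}"] ij(3) by simp
    then have "g {i, j} \<in> cut E R" using mem[OF K5_edge[OF ij] cut_subset R(2)] unfolding R(3) by blast
    then show ?thesis using R by blast
  qed
  have AE: "gadj A x y \<Longrightarrow> gadj E x y" for x y using AB(1) by (auto simp: gadj_def)
  define cl where "cl = component (gadj A) V"
  note comp = component[OF symp_gadj[of A], where W = V, folded cl_def]
  have cl_eq: "cl y = cl x" if "x \<in> V" "y \<in> cl x" for x y
    using component_eq[OF symp_gadj that(1)] that(2) unfolding cl_def by blast
  have cutA: "cut E (cl x) \<inter> A = {}" if x: "x \<in> V" for x
  proof (rule ccontr)
    assume "cut E (cl x) \<inter> A \<noteq> {}"
    then obtain e where e: "e \<in> cut E (cl x)" "e \<in> A" by blast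
    have "e \<in> E" using e(2) AB(1) by blast
    then obtain u v where uv: "e = {u, v}" "u \<in> V" "v \<in> V" "gadj E u v" by (rule edgeE)
    have a: "gadj A u v" "gadj A v u" using e(2) uv(1) by (simp_all add: gadj_def insert_commute)
    have "(u \<in> cl x) \<noteq> (v \<in> cl x)" using e(1) cut_iff[OF uv(4)] uv(1) by blast
    then show False using comp(4)[OF x, of u v] comp(4)[OF x, of v u] a uv(2,3) by blast
  qed
  \<comment> \<open>The two components joined by the edge matched with \<open>{i, j}\<close>,
    expressed through the cuts around single components.\<close>
  define P where "P i j = {R \<in> cl ` V. g {i, j} \<in> cut E R}" for i j :: nat
  have Psym: "P i j = P j i" for i j by (simp add: P_def insert_commute)
  have P2: "\<exists>u v. u \<in> V \<and> v \<in> V \<and> gadj E u v \<and> cl u \<noteq> cl v \<and> P i j = {cl u, cl v}" if ij: "i < 5" "j < 5" "i \<noteq> j" for i j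
  proof -
    have gE': "g {i, j} \<in> E" using gE(1)[OF K5_edge[OF ij]] .
    obtain u v where uv: "g {i, j} = {u, v}" "u \<in> V" "v \<in> V" "gadj E u v" by (rule edgeE[OF gE'])
    have iff: "g {i, j} \<in> cut E R \<longleftrightarrow> (u \<in> R) \<noteq> (v \<in> R)" for R unfolding uv(1) by (rule cut_iff[OF uv(4)])
    have in_cl: "w \<in> cl x \<longleftrightarrow> cl w = cl x" if "w \<in> V" "x \<in> V" for w x
      using cl_eq[OF that(2), of w] comp(1)[OF that(1)] by blast
    \<comment> \<open>An edge within one component lies in no cut avoiding \<open>A\<close>, whereas
      every edge of the complete graph lies in some cut.\<close>
    have ne: "cl u \<noteq> cl v"
    proof
      assume eq: "cl u = cl v"
      obtain R where R: "R \<subseteq> V" "cut E R \<inter> A = {}" "g {i, j} \<in> cut E R" using c2[OF ij] by blast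
      have st: "x \<in> R \<longleftrightarrow> y \<in> R" if "gadj A x y" for x y
      proof -
        have "{x, y} \<notin> cut E R" using R(2) that by (auto simp: gadj_def)
        then show ?thesis using cut_iff[OF AE[OF that], of R] by blast
      qed
      have uu: "u \<in> cl u" "v \<in> cl u" using comp(1)[OF uv(2)] comp(1)[OF uv(3)] eq by blast+
      have "u \<in> R \<Longrightarrow> v \<in> R"
        using conn_closed[OF comp(3)[OF uv(2)], of R] st uu by blast
      moreover have "v \<in> R \<Longrightarrow> u \<in> R"
        using conn_closed[OF comp(3)[OF uv(2)], of R] st uu by blast
      ultimately show False using R(3) iff[of R] by blast
    qed
    have "P i j = {cl u, cl v}"
    proof (rule set_eqI)
      fix R
      show "R \<in> P i j \<longleftrightarrow> R \<in> {cl u, cl v}"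
      proof (cases "R \<in> cl ` V")
        case True
        then obtain r where r: "r \<in> V" "R = cl r" by blast
        show ?thesis using True ne unfolding P_def mem_Collect_eq iff unfolding r(2) in_cl[OF uv(2) r(1)] in_cl[OF uv(3) r(1)] by auto
      next
        case False
        then show ?thesis using uv(2,3) by (auto simp: P_def)
      qed
    qed
    then show ?thesis using uv ne by blast
  qed
  have card2: "card (P i j) = 2" if ij: "i < 5" "j < 5" "i \<noteq> j" for i j
  proof -
    obtain u v where "cl u \<noteq> cl v" "P i j = {cl u, cl v}" using P2[OF ij] by blast
    then show ?thesis by simp
  qed
  \<comment> \<open>A triangle of the complete graph meets every cut evenly, and the isomorphism
    transfers this to the cuts around components.\<close>
  have tri: "P i j = sym_diff (P 0 i) (P 0 j)" if ij: "i \<in> {1..4}" "j \<in> {1..4}" "i \<noteq> j" for i j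
  proof -
    have *: "g {i, j} \<in> cut E R \<longleftrightarrow> (g {0, i} \<in> cut E R) \<noteq> (g {0, j} \<in> cut E R)" if Rc: "R \<in> cl ` V" for R
    proof -
      obtain r where r: "r \<in> V" "R = cl r" using Rc by blast
      have RV: "R \<subseteq> V" using comp(2)[OF r(1)] r(2) by simp
      have RA: "cut E R \<inter> A = {}" using cutA[OF r(1)] r(2) by simp
      obtain T where T: "\<And>i j. i < 5 \<Longrightarrow> j < 5 \<Longrightarrow> i \<noteq> j \<Longrightarrow> (g {i, j} \<in> cut E R \<longleftrightarrow> (i \<in> T) \<noteq> (j \<in> T))"
        using c1[OF RV RA] by blast
      show ?thesis using T[of i j] T[of 0 i] T[of 0 j] ij by auto
    qed
    show ?thesis unfolding P_def using * by blast
  qed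
  have 4: "i < 5" "i \<noteq> 0" if "i \<in> {1..4}" for i :: nat using that by auto
  have finP: "finite (P i j)" if ij: "i < 5" "j < 5" "i \<noteq> j" for i j
    using card2[OF ij] card.infinite by fastforce
  have "\<exists>c. \<forall>i\<in>{1..4}. c \<in> P 0 i"
  proof (rule four_pairs)
    show "card (P 0 i) = 2" if "i \<in> {1..4}" for i using card2[of 0 i] 4[OF that] by simp
    fix i j :: nat assume ij: "i \<in> {1..4}" "j \<in> {1..4}" "i \<noteq> j"
    have f: "finite (P 0 i)" "finite (P 0 j)" using finP[of 0 i] finP[of 0 j] 4[OF ij(1)] 4[OF ij(2)] by auto
    have "card (P 0 i) = 2" "card (P 0 j) = 2" "card (sym_diff (P 0 i) (P 0 j)) = 2"
      using card2[of 0 i] card2[of 0 j] card2[of i j] 4[OF ij(1)] 4[OF ij(2)] ij(3) tri[OF ij] by auto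
    moreover have "card (P 0 i) = card (P 0 i - P 0 j) + card (P 0 i \<inter> P 0 j)" "card (P 0 j) = card (P 0 j - P 0 i) + card (P 0 i \<inter> P 0 j)"
      using card_Int_Diff[OF f(1), of "P 0 j"] card_Int_Diff[OF f(2), of "P 0 i"] by (simp_all add: Int_commute)
    moreover have "card (sym_diff (P 0 i) (P 0 j)) = card (P 0 i - P 0 j) + card (P 0 j - P 0 i)" using f by (intro card_Un_disjoint) auto
    ultimately show "card (P 0 i \<inter> P 0 j) = 1" by linarith
  qed
  then obtain c where c: "\<And>i. i \<in> {1..4} \<Longrightarrow> c \<in> P 0 i" by blast
  have "\<exists>w. w \<noteq> c \<and> P 0 i = {c, w}" if i: "i \<in> {1..4}" for i
  proof -
    have i': "0 < (5 :: nat)" "0 \<noteq> i" using 4[OF i] by auto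
    obtain u v where uv: "cl u \<noteq> cl v" "P 0 i = {cl u, cl v}" using P2[OF i'(1) 4(1)[OF i] i'(2)] by blast
    then have "c = cl u \<or> c = cl v" using c[OF i] by simp
    then show ?thesis
    proof
      assume "c = cl u"
      then show ?thesis using uv by (intro exI[of _ "cl v"]) simp
    next
      assume "c = cl v"
      then show ?thesis using uv by (intro exI[of _ "cl u"]) (simp add: insert_commute)
    qed
  qed
  then obtain w where w: "\<And>i. i \<in> {1..4} \<Longrightarrow> w i \<noteq> c \<and> P 0 i = {c, w i}" by metis
  define X where "X i = (if i = 0 then c else w i)" for i :: nat
  have PX: "P i j = {X i, X j}" if ij: "i < 5" "j < 5" "i \<noteq> j" for i j
  proof -
    have 0: "P 0 k = {X 0, X k}" if "k < 5" "k \<noteq> 0" for k using w[of k] that by (auto simp: X_def)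
    show ?thesis
    proof (cases "i = 0 \<or> j = 0")
      case True
      then show ?thesis using 0[of i] 0[of j] ij Psym[of i j] by auto
    next
      case False
      then have m: "i \<in> {1..4}" "j \<in> {1..4}" using ij by auto
      have eq: "P i j = sym_diff {c, w i} {c, w j}" using tri[OF m ij(3)] w[OF m(1)] w[OF m(2)] by simp
      have "w i \<noteq> w j"
      proof
        assume "w i = w j"
        then have "P i j = {}" unfolding eq by simp
        then show False using card2[OF ij] by simp
      qed
      then have "P i j = {w i, w j}"
        unfolding eq using w[OF m(1)] w[OF m(2)] by (intro sym_diff_pairs) simp_all
      then show ?thesis using False by (simp add: X_def)
    qed
  qed
  have XV: "X i \<in> cl ` V" if i: "i < 5" for i
  proof -
    define j :: nat where "j = (if i = 0 then 1 else 0)"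
    have j: "j < 5" "i \<noteq> j" by (auto simp: j_def)
    have "X i \<in> P i j" using PX[OF i j] by simp
    then show ?thesis by (simp add: P_def)
  qed
  have "K5_model V (gadj E) X"
    unfolding K5_model_def
  proof (intro conjI allI impI)
    fix i :: nat assume i: "i < 5"
    obtain x where x: "x \<in> V" "X i = cl x" using XV[OF i] by blast
    show "conn (gadj E) (X i)" unfolding x(2) by (rule conn_mono[OF comp(3)[OF x(1)] AE])
    show "X i \<subseteq> V" unfolding x(2) by (rule comp(2)[OF x(1)])
  next
    fix i j :: nat assume ij: "i < 5" "j < 5" "i \<noteq> j"
    obtain u v where uv: "u \<in> V" "v \<in> V" "gadj E u v" "cl u \<noteq> cl v" "{X i, X j} = {cl u, cl v}"
      using P2[OF ij] unfolding PX[OF ij] by blast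
    have s: "u \<in> cl u" "v \<in> cl v" "gadj E v u" using comp(1)[OF uv(1)] comp(1)[OF uv(2)] sympD[OF symp_gadj uv(3)] by auto
    have "touch (gadj E) (cl u) (cl v)" "touch (gadj E) (cl v) (cl u)" using s uv(3) unfolding touch_def by blast+
    moreover have d: "cl u \<inter> cl v = {}"
    proof (rule ccontr)
      assume "cl u \<inter> cl v \<noteq> {}"
      then obtain z where "z \<in> cl u" "z \<in> cl v" by blast
      then show False using cl_eq[OF uv(1)] cl_eq[OF uv(2)] uv(4) by metis
    qed
    moreover have "X i = cl u \<and> X j = cl v \<or> X i = cl v \<and> X j = cl u" using uv(5) unfolding doubleton_eq_iff .
    ultimately show "X i \<inter> X j = {}" "touch (gadj E) (X i) (X j)" by (metis Int_commute)+
  qed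
  then show ?thesis by blast
qed

text \<open>In the matroid, edges inside blocks are deleted and all others except one per pair of
  blocks are contracted. A cut avoiding the inside edges contains each block or misses it, and this
  determines it on the chosen edges.\<close>

lemma K5_model_minor:
  assumes "K5_model V (gadj E) X"
  shows "\<exists>N. minor (cographic V E) N \<and> bmat_iso N (cographic K5_vertices K5_edges)"
proof -
  have X: "conn (gadj E) (X i)" "X i \<subseteq> V" if "i < 5" for i
    using assms that unfolding K5_model_def by blast+
  have T: "X i \<inter> X j = {}" "touch (gadj E) (X i) (X j)" if "i < 5" "j < 5" "i \<noteq> j" for i j
    using assms that unfolding K5_model_def by blast+
  obtain blk where blk: "\<And>u i. i < 5 \<Longrightarrow> blk u = i \<longleftrightarrow> u \<in> X i" and blk5: "\<And>u. blk u \<le> 5"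
    using block_index[of 5 X] T(1) by blast
  have "\<exists>e i j u v. e \<in> E \<and> k = {i, j} \<and> i < 5 \<and> j < 5 \<and> i \<noteq> j \<and> e = {u, v} \<and> u \<in> X i \<and> v \<in> X j" if k: "k \<in> K5_edges" for k
  proof -
    obtain i j where ij: "k = {i, j}" "i \<noteq> j" "gadj K5_edges i j" using sgraph.edge_ends[OF sgraph_K5 k] by blast
    then have l: "i < 5" "j < 5" using sgraph.gadjD[OF sgraph_K5 ij(3)] by (auto simp: K5_vertices_def)
    then obtain u v where "u \<in> X i" "v \<in> X j" "gadj E u v" using T(2)[OF l ij(2)] unfolding touch_def by blast
    then show ?thesis using ij l unfolding gadj_def by blast
  qed
  then obtain f where f: "\<And>k. k \<in> K5_edges \<Longrightarrow> \<exists>i j u v. f k \<in> E \<and> k = {i, j} \<and> i < 5 \<and> j < 5 \<and> i \<noteq> j \<and> f k = {u, v} \<and> u \<in> X i \<and> v \<in> X j"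
    by metis
  define \<psi> where "\<psi> e = blk ` e" for e
  have \<psi>f: "\<psi> (f k) = k" if k: "k \<in> K5_edges" for k
  proof -
    obtain i j u v where h: "k = {i, j}" "i < 5" "j < 5" "f k = {u, v}" "u \<in> X i" "v \<in> X j" using f[OF k] by blast
    have "blk u = i" "blk v = j" using blk h by blast+
    then show ?thesis using h(1,4) by (simp add: \<psi>_def)
  qed
  define F where "F = f ` K5_edges"
  have bij: "bij_betw \<psi> F K5_edges"
    unfolding F_def by (rule bij_betw_byWitness[where f' = f]) (use \<psi>f in auto)
  have FE: "F \<subseteq> E" using f unfolding F_def by blast
  define A where "A = {e \<in> E. \<exists>i<5. e \<subseteq> X i}"
  define B where "B = E - A - F"
  have FA: "F \<inter> A = {}"
  proof (rule ccontr)
    assume "F \<inter> A \<noteq> {}"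
    then obtain k l where k: "k \<in> K5_edges" "f k \<subseteq> X l" "l < 5" by (auto simp: F_def A_def)
    obtain i j u v where h: "i < 5" "j < 5" "i \<noteq> j" "f k = {u, v}" "u \<in> X i" "v \<in> X j" using f[OF k(1)] by blast
    have "u \<in> X l" "v \<in> X l" using k(2) h(4) by auto
    then show False using T(1)[OF k(3) h(1)] T(1)[OF k(3) h(2)] h(3,5,6) by blast
  qed
  have AE: "A \<subseteq> E" by (auto simp: A_def)
  have gr: "E - A - B = F" using FE FA by (auto simp: B_def)
  define N where "N = (F, (\<lambda>C. C - B) ` {C \<in> cut E ` Pow V. C \<inter> A = {}})"
  have "minor (cographic V E) (ground (cographic V E) - A - B, (\<lambda>C. C - B) ` {C \<in> cycles (cographic V E). C \<inter> A = {}})"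
    by (rule minor_of_sets) (use AE finite_sub in \<open>auto simp: B_def cycles_cographic\<close>)
  then have 1: "minor (cographic V E) N" unfolding N_def cycles_cographic gr .
  have key: "\<psi> ` (cut E S - B) = cut K5_edges {i. i < 5 \<and> X i \<subseteq> S}" if S: "S \<subseteq> V" "cut E S \<inter> A = {}" for S
  proof -
    let ?T = "{i. i < 5 \<and> X i \<subseteq> S}"
    have side: "u \<in> S \<longleftrightarrow> X i \<subseteq> S" if i: "i < 5" "u \<in> X i" for i u
    proof -
      have st: "\<not> gadj E x y" if xy: "x \<in> S \<inter> X i" "y \<in> X i - S" for x y
      proof
        assume a: "gadj E x y"
        have "{x, y} \<in> cut E S" using cut_iff[OF a, of S] xy by blast
        moreover have "{x, y} \<in> A" using a xy i(1) by (auto simp: A_def gadj_def)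
        ultimately show False using S(2) by blast
      qed
      show ?thesis using conn_closed[OF X(1)[OF i(1)], of S] st i(2) by blast
    qed
    have fk: "f k \<in> cut E S \<longleftrightarrow> k \<in> cut K5_edges ?T" if k: "k \<in> K5_edges" for k
    proof -
      obtain i j u v where h: "f k \<in> E" "k = {i, j}" "i < 5" "j < 5" "i \<noteq> j" "f k = {u, v}" "u \<in> X i" "v \<in> X j" using f[OF k] by blast
      have a: "gadj E u v" using h(1,6) by (simp add: gadj_def)
      show ?thesis unfolding h(6) cut_iff[OF a] unfolding h(2) K5_cut[OF h(3-5)]
        using side[OF h(3) h(7)] side[OF h(4) h(8)] h(3,4) by simp
    qed
    have sub: "cut E S - B = cut E S \<inter> F" using cut_subset[of S] S(2) FA FE unfolding B_def by blast
    show ?thesis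
    proof (intro subset_antisym subsetI)
      fix k assume "k \<in> \<psi> ` (cut E S - B)"
      then obtain l where l: "l \<in> K5_edges" "f l \<in> cut E S" "k = \<psi> (f l)" unfolding sub F_def by blast
      then show "k \<in> cut K5_edges ?T" using fk[OF l(1)] \<psi>f[OF l(1)] by simp
    next
      fix k assume k: "k \<in> cut K5_edges ?T"
      then have k5: "k \<in> K5_edges" by (simp add: cut_def)
      have "f k \<in> cut E S \<inter> F" using fk[OF k5] k k5 by (simp add: F_def)
      then show "k \<in> \<psi> ` (cut E S - B)" unfolding sub using \<psi>f[OF k5] by (intro rev_image_eqI) auto
    qed
  qed
  have 2: "(\<lambda>C. \<psi> ` C) ` cycles N = cut K5_edges ` Pow K5_vertices"
  proof
    show "(\<lambda>C. \<psi> ` C) ` cycles N \<subseteq> cut K5_edges ` Pow K5_vertices"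
    proof
      fix D assume "D \<in> (\<lambda>C. \<psi> ` C) ` cycles N"
      then obtain S where S: "S \<subseteq> V" "cut E S \<inter> A = {}" "D = \<psi> ` (cut E S - B)" by (auto simp: N_def)
      have "{i. i < 5 \<and> X i \<subseteq> S} \<in> Pow K5_vertices" by (auto simp: K5_vertices_def)
      then show "D \<in> cut K5_edges ` Pow K5_vertices" unfolding S(3) key[OF S(1,2)] by blast
    qed
    show "cut K5_edges ` Pow K5_vertices \<subseteq> (\<lambda>C. \<psi> ` C) ` cycles N"
    proof
      fix D assume "D \<in> cut K5_edges ` Pow K5_vertices"
      then obtain Q where Q: "Q \<subseteq> K5_vertices" "D = cut K5_edges Q" by blast
      define S where "S = (\<Union>i\<in>Q. X i)"
      have Q5: "i < 5" if "i \<in> Q" for i using Q(1) that by (auto simp: K5_vertices_def)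
      have SV: "S \<subseteq> V" using X(2) Q5 by (auto simp: S_def)
      have iff: "u \<in> S \<longleftrightarrow> i \<in> Q" if i: "i < 5" "u \<in> X i" for i u
      proof
        assume "u \<in> S"
        then obtain j where j: "j \<in> Q" "u \<in> X j" by (auto simp: S_def)
        then show "i \<in> Q" using T(1)[OF i(1) Q5[OF j(1)]] i(2) by (cases "i = j") auto
      qed (use i in \<open>auto simp: S_def\<close>)
      have eq: "{i. i < 5 \<and> X i \<subseteq> S} = Q"
      proof (rule set_eqI)
        fix i
        show "i \<in> {i. i < 5 \<and> X i \<subseteq> S} \<longleftrightarrow> i \<in> Q"
        proof (cases "i < 5")
          case True
          obtain u where "u \<in> X i" using conn_ne[OF X(1)[OF True]] by blast
          then have "X i \<subseteq> S \<longleftrightarrow> i \<in> Q" using iff[OF True] by blast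
          then show ?thesis using True by simp
        qed (use Q5 in auto)
      qed
      have cA: "cut E S \<inter> A = {}"
      proof (rule ccontr)
        assume "cut E S \<inter> A \<noteq> {}"
        then obtain e i where e: "e \<in> cut E S" "e \<in> E" "e \<subseteq> X i" "i < 5" by (auto simp: A_def)
        obtain u v where uv: "e = {u, v}" "gadj E u v" using edge_ends[OF e(2)] by blast
        have "(u \<in> S) \<noteq> (v \<in> S)" using e(1) cut_iff[OF uv(2)] uv(1) by blast
        then show False using iff[OF e(4), of u] iff[OF e(4), of v] e(3) uv(1) by blast
      qed
      have "D = \<psi> ` (cut E S - B)" unfolding key[OF SV cA] eq Q(2) ..
      moreover have "cut E S - B \<in> cycles N" unfolding N_def snd_conv using SV cA by blast
      ultimately show "D \<in> (\<lambda>C. \<psi> ` C) ` cycles N" by blast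
    qed
  qed
  have "bmat_iso N (cographic K5_vertices K5_edges)"
    unfolding bmat_iso_def by (intro exI[of _ \<psi>]) (use bij 2 in \<open>simp add: N_def cographic_def\<close>)
  then show ?thesis using 1 by blast
qed

end

section \<open>The metric inequalities\<close>

definition star :: "'v \<times> bool \<Rightarrow> 'v \<times> bool" where
  "star p = (fst p, \<not> snd p)"

lemma star_star [simp]: "star (star p) = p"
  by (simp add: star_def)

text \<open>A metric on a double cover of the vertices: the distance from \<open>u\<close> to the
  opposite copy of \<open>v\<close> stands for one minus the distance from \<open>u\<close> to
  \<open>v\<close>, but so far the two only sum to at least 1.\<close>

definition antipodal :: "('v \<times> bool \<Rightarrow> 'v \<times> bool \<Rightarrow> real) \<Rightarrow> bool" where
  "antipodal m \<longleftrightarrow> (\<forall>p. m p p = 0) \<and> (\<forall>p q. 0 \<le> m p q \<and> m p q \<le> 1) \<and> (\<forall>p q. m p q = m q p) \<and>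
     (\<forall>p q r. m p r \<le> m p q + m q r) \<and> (\<forall>p q. m (star p) (star q) = m p q) \<and> (\<forall>p. m p (star p) = 1)"

lemma antipodalD:
  assumes "antipodal m"
  shows "m p p = 0" "0 \<le> m p q" "m p q \<le> 1" "m p q = m q p" "m p r \<le> m p q + m q r"
    "m (star p) (star q) = m p q" "m p (star p) = 1" "m (star p) q = m p (star q)" "1 \<le> m p q + m p (star q)"
proof -
  have 1: "m p p = 0" "0 \<le> m p q" "m p q \<le> 1" "m p q = m q p" "m p r \<le> m p q + m q r"
    "m (star p) (star q) = m p q" "m p (star p) = 1" for p q r using assms unfolding antipodal_def by blast+
  then show "m p p = 0" "0 \<le> m p q" "m p q \<le> 1" "m p q = m q p" "m p r \<le> m p q + m q r"
    "m (star p) (star q) = m p q" "m p (star p) = 1" by blast+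
  show 2: "m (star p) q = m p (star q)" for p q using 1(6)[of p "star q"] by simp
  have "1 \<le> m p q + m q (star p)" using 1(5)[of p "star p" q] 1(7)[of p] by simp
  then show "1 \<le> m p q + m p (star q)" using 2[of p q] 1(4)[of q "star p"] by simp
qed

text \<open>Add a shortcut between \<open>p\<close> and \<open>q\<close> and one between their
  opposites, of the smallest length \<open>\<alpha>\<close> that the desired identity permits. Two
  shortcuts in a row are redundant or cost at least 1, so paths with at most one shortcut suffice,
  and opposite points stay at distance 1.\<close>

lemma antipodal_step:
  assumes m: "antipodal m"
  shows "\<exists>m'. antipodal m' \<and> (\<forall>x y. m' x y \<le> m x y) \<and> m' p q + m' p (star q) = 1"
proof -
  note A = antipodalD[OF m]
  define \<alpha> where "\<alpha> = 1 - m p (star q)"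
  have \<alpha>: "0 \<le> \<alpha>" using A(3)[of p "star q"] by (simp add: \<alpha>_def)
  define J where "J = {(p, q), (q, p), (star p, star q), (star q, star p)}"
  have Js: "(b, a) \<in> J" "(star a, star b) \<in> J" if "(a, b) \<in> J" for a b using that by (auto simp: J_def)
  have Ja: "m a (star b) = 1 - \<alpha>" if "(a, b) \<in> J" for a b
    using that A(4)[of q "star p"] A(4)[of "star q" p] A(8)[of p q] A(8)[of q p] by (auto simp: J_def \<alpha>_def)
  have JJ: "c = b \<and> d = a \<or> c = a \<and> d = b \<or> 1 \<le> m b c + 2 * \<alpha>" if ab: "(a, b) \<in> J" and cd: "(c, d) \<in> J" for a b c d
  proof -
    have "(c = b \<and> d = a \<or> c = a \<and> d = b) \<or> c = star a \<or> c = star b" using ab cd by (auto simp: J_def)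
    moreover have "m b (star a) = 1 - \<alpha>" using Ja[OF Js(1)[OF ab]] .
    moreover have "m b (star b) = 1" by (rule A(7))
    ultimately show ?thesis using \<alpha> by auto
  qed
  define m' where "m' x y = Min (insert (m x y) ((\<lambda>(a, b). m x a + \<alpha> + m b y) ` J))" for x y
  have fJ: "finite J" by (simp add: J_def)
  have le1: "m' x y \<le> m x y" for x y using fJ by (simp add: m'_def)
  have le2: "m' x y \<le> m x a + \<alpha> + m b y" if "(a, b) \<in> J" for x y a b
    unfolding m'_def by (rule Min_le) (use fJ that in force)+
  have in_m': "m' x y = m x y \<or> (\<exists>a b. (a, b) \<in> J \<and> m' x y = m x a + \<alpha> + m b y)" for x y
  proof -
    have "m' x y \<in> insert (m x y) ((\<lambda>(a, b). m x a + \<alpha> + m b y) ` J)"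
      unfolding m'_def by (rule Min_in) (use fJ in auto)
    then show ?thesis by auto
  qed
  have nonneg: "0 \<le> m' x y" for x y
    using in_m'[of x y] A(2) \<alpha> by (metis add_nonneg_nonneg)
  have sym1: "m' y x \<le> m' x y" for x y
    using in_m'[of x y]
  proof (elim disjE exE conjE)
    assume "m' x y = m x y"
    then show ?thesis using le1[of y x] A(4)[of x y] by simp
  next
    fix a b assume ab: "(a, b) \<in> J" "m' x y = m x a + \<alpha> + m b y"
    show ?thesis using le2[OF Js(1)[OF ab(1)], of y x] ab(2) A(4)[of x a] A(4)[of b y] by linarith
  qed
  have star1: "m' (star x) (star y) \<le> m' x y" for x y
    using in_m'[of x y]
  proof (elim disjE exE conjE)
    assume "m' x y = m x y"
    then show ?thesis using le1[of "star x" "star y"] A(6)[of x y] by simp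
  next
    fix a b assume ab: "(a, b) \<in> J" "m' x y = m x a + \<alpha> + m b y"
    show ?thesis using le2[OF Js(2)[OF ab(1)], of "star x" "star y"] ab(2) A(6)[of x a] A(6)[of b y] by linarith
  qed
  have star2: "m' x (star x) = 1" for x
  proof (rule antisym)
    show "m' x (star x) \<le> 1" using le1[of x "star x"] A(7)[of x] by simp
    show "1 \<le> m' x (star x)"
      using in_m'[of x "star x"]
    proof (elim disjE exE conjE)
      assume "m' x (star x) = m x (star x)"
      then show ?thesis using A(7)[of x] by simp
    next
      fix a b assume ab: "(a, b) \<in> J" "m' x (star x) = m x a + \<alpha> + m b (star x)"
      show ?thesis
        using ab(2) Ja[OF ab(1)] A(5)[of a "star b" x] A(4)[of a x] A(8)[of b x] A(4)[of "star b" x] by linarith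
    qed
  qed
  have tri: "m' x z \<le> m' x y + m' y z" for x y z
    using in_m'[of x y]
  proof (elim disjE exE conjE)
    assume xy: "m' x y = m x y"
    show ?thesis using in_m'[of y z]
    proof (elim disjE exE conjE)
      assume "m' y z = m y z"
      then show ?thesis using le1[of x z] A(5)[of x z y] xy by linarith
    next
      fix a b assume ab: "(a, b) \<in> J" "m' y z = m y a + \<alpha> + m b z"
      show ?thesis using le2[OF ab(1), of x z] ab(2) A(5)[of x a y] xy by linarith
    qed
  next
    fix a b assume ab: "(a, b) \<in> J" "m' x y = m x a + \<alpha> + m b y"
    show ?thesis using in_m'[of y z]
    proof (elim disjE exE conjE)
      assume "m' y z = m y z"
      then show ?thesis using le2[OF ab(1), of x z] ab(2) A(5)[of b z y] by linarith
    next
      fix c d assume cd: "(c, d) \<in> J" "m' y z = m y c + \<alpha> + m d z"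
      have s: "m' x y + m' y z \<ge> m x a + m b c + 2 * \<alpha> + m d z" using ab(2) cd(2) A(5)[of b c y] by linarith
      from JJ[OF ab(1) cd(1)] show ?thesis
      proof (elim disjE conjE)
        assume "c = b" "d = a"
        then show ?thesis using s \<alpha> A(5)[of x z a] A(2)[of b b] le1[of x z] by simp
      next
        assume "c = a" "d = b"
        then show ?thesis using s \<alpha> A(2)[of b a] le2[OF ab(1), of x z] by simp
      next
        assume "1 \<le> m b c + 2 * \<alpha>"
        then show ?thesis using s A(2)[of x a] A(2)[of d z] le1[of x z] A(3)[of x z] by linarith
      qed
    qed
  qed
  have an: "antipodal m'"
    unfolding antipodal_def
  proof (intro conjI allI)
    fix x y z
    show "m' x x = 0" using nonneg[of x x] le1[of x x] A(1)[of x] by simp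
    show "0 \<le> m' x y" by (rule nonneg)
    show "m' x y \<le> 1" using le1[of x y] A(3)[of x y] by simp
    show "m' x y = m' y x" using sym1[of x y] sym1[of y x] by simp
    show "m' x z \<le> m' x y + m' y z" by (rule tri)
    show "m' (star x) (star y) = m' x y" using star1[of x y] star1[of "star x" "star y"] by simp
    show "m' x (star x) = 1" by (rule star2)
  qed
  have "m' p q \<le> \<alpha>" using le2[of p q p q] A(1)[of p] A(1)[of q] by (simp add: J_def)
  moreover have "m' p (star q) \<le> 1 - \<alpha>" using le1[of p "star q"] by (simp add: \<alpha>_def)
  ultimately have "m' p q + m' p (star q) = 1" using antipodalD(9)[OF an, of p q] by simp
  then show ?thesis using an le1 by blast
qed

text \<open>Pairs are treated one at a time. A sum that has reached 1 stays there, because values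
  only decrease and the sum never falls below 1.\<close>

lemma antipodal_extend:
  assumes "antipodal m" "finite U"
  shows "\<exists>m'. antipodal m' \<and> (\<forall>x y. m' x y \<le> m x y) \<and> (\<forall>p\<in>U. \<forall>q\<in>U. m' p q + m' p (star q) = 1)"
  using assms(1)
proof (induction "card {(p, q) \<in> U \<times> U. m p q + m p (star q) \<noteq> 1}" arbitrary: m rule: less_induct)
  case less
  let ?S = "\<lambda>m. {(p, q) \<in> U \<times> U. m p q + m p (star q) \<noteq> (1 :: real)}"
  show ?case
  proof (cases "?S m = {}")
    case True
    then show ?thesis using less.prems by (intro exI[of _ m]) auto
  next
    case False
    then obtain p q where pq: "p \<in> U" "q \<in> U" "m p q + m p (star q) \<noteq> 1" by blast
    obtain m1 where m1: "antipodal m1" "\<And>x y. m1 x y \<le> m x y" "m1 p q + m1 p (star q) = 1"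
      using antipodal_step[OF less.prems] by blast
    have keep: "m1 x y + m1 x (star y) = 1" if "m x y + m x (star y) = 1" for x y
      using that m1(2)[of x y] m1(2)[of x "star y"] antipodalD(9)[OF m1(1), of x y] by linarith
    have "?S m1 \<subset> ?S m"
    proof (rule psubsetI)
      show "?S m1 \<subseteq> ?S m" using keep by auto
      show "?S m1 \<noteq> ?S m" using pq m1(3) by blast
    qed
    moreover have "finite (?S m)" by (rule finite_subset[of _ "U \<times> U"]) (use assms(2) in auto)
    ultimately have "card (?S m1) < card (?S m)" by (rule psubset_card_mono[rotated])
    then obtain m' where m': "antipodal m'" "\<forall>x y. m' x y \<le> m1 x y" "\<forall>p\<in>U. \<forall>q\<in>U. m' p q + m' p (star q) = 1"
      using less.hyps[OF _ m1(1)] by blast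
    then have "\<forall>x y. m' x y \<le> m x y" using m1(2) by (meson order_trans)
    then show ?thesis using m' by blast
  qed
qed

section \<open>Odd-set inequalities and signed paths\<close>

definition wgt :: "('e \<Rightarrow> real) \<Rightarrow> 'e set \<Rightarrow> 'e set \<Rightarrow> real" where
  "wgt d D F = (\<Sum>e\<in>D. if e \<in> F then 1 - d e else d e)"

lemma wgt_mono:
  assumes "finite D" "D' \<subseteq> D" "\<And>e. e \<in> D \<Longrightarrow> 0 \<le> d e \<and> d e \<le> 1"
  shows "wgt d D' F \<le> wgt d D F"
  unfolding wgt_def by (rule sum_mono2) (use assms in auto)

context sgraph begin

text \<open>A set that is no cocircuit splits into two smaller ones, one of which meets
  \<open>F\<close> oddly. A chord \<open>e\<close> closes two smaller sets and is counted as
  \<open>d e\<close> on the odd side and as \<open>1 - d e\<close> on the other: the two lower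
  bounds sum to 2 and the chord accounts for 1 of it.\<close>

lemma wgt_ge_1:
  assumes chl: "\<not> (\<exists>D. cocircuit (cographic V E) D \<and> chordless (cographic V E) D \<and> 5 \<le> card D)"
    and box: "\<And>e. e \<in> E \<Longrightarrow> 0 \<le> d e \<and> d e \<le> 1"
    and small: "\<And>D F. D \<subseteq> E \<Longrightarrow> bd D = {} \<Longrightarrow> odd (card (D \<inter> F)) \<Longrightarrow> card D \<le> 4 \<Longrightarrow> 1 \<le> wgt d D F"
    and D: "D \<subseteq> E" "bd D = {}" "odd (card (D \<inter> F))"
  shows "1 \<le> wgt d D F"
  using D
proof (induction "card D" arbitrary: D F rule: less_induct)
  case less
  have fD: "finite D" using less.prems(1) by (rule finite_sub)
  show ?case
  proof (cases "card D \<le> 4")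
    case True
    then show ?thesis using small less.prems by blast
  next
    case big: False
    have Dne: "D \<noteq> {}" using big by auto
    show ?thesis
    proof (cases "cocircuit (cographic V E) D")
      case False
      then obtain D' where D': "D' \<subseteq> D" "bd D' = {}" "D' \<noteq> {}" "D' \<noteq> D"
        unfolding cocircuit_def using less.prems Dne cocycles_iff by metis
      define D'' where "D'' = D - D'"
      have f: "finite D'" "finite D''" using D'(1) fD by (auto simp: D''_def finite_subset)
      have "D'' = sym_diff D D'" using D'(1) by (auto simp: D''_def)
      then have b: "bd D'' = {}" using bd_sym_diff[OF fD f(1)] less.prems(2) D'(2) by simp
      have "D \<inter> F = sym_diff (D' \<inter> F) (D'' \<inter> F)" using D'(1) by (auto simp: D''_def)
      then have "odd (card (D' \<inter> F)) \<or> odd (card (D'' \<inter> F))"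
        using less.prems(3) even_card_sym_diff[of "D' \<inter> F" "D'' \<inter> F"] f by auto
      moreover have "1 \<le> wgt d D F" if X: "X \<subset> D" "bd X = {}" "odd (card (X \<inter> F))" for X
      proof -
        have "1 \<le> wgt d X F" by (rule less.hyps) (use X fD less.prems(1) in \<open>auto intro: psubset_card_mono\<close>)
        also have "\<dots> \<le> wgt d D F" by (rule wgt_mono) (use X(1) fD box less.prems(1) in auto)
        finally show ?thesis .
      qed
      moreover have "D' \<subset> D" "D'' \<subset> D" using D' by (auto simp: D''_def)
      ultimately show ?thesis using D'(2) b by blast
    next
      case True
      then have "\<not> chordless (cographic V E) D" using chl big by auto
      then obtain e D1 D2 where e: "e \<in> E" "e \<notin> D" "D1 \<inter> D2 = {e}" "D = sym_diff D1 D2"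
        and c: "D1 \<subseteq> E" "bd D1 = {}" "D2 \<subseteq> E" "bd D2 = {}"
        unfolding chordless_def chord_def Bex_def cocycles_iff cycles_cographic by blast
      have main: "1 \<le> wgt d D F"
        if e': "D1 \<inter> D2 = {e}" "D = sym_diff D1 D2" and c': "D1 \<subseteq> E" "bd D1 = {}" "D2 \<subseteq> E" "bd D2 = {}"
          and odd: "odd (card ((D1 - {e}) \<inter> F))" for D1 D2
      proof -
        have f: "finite D1" "finite D2" using finite_sub c' by auto
        have eD: "e \<in> D1" "e \<in> D2" using e' by auto
        have card: "card D1 + card D2 = card D + 2"
        proof -
          have "card D1 = card (D1 - D2) + card (D1 \<inter> D2)" "card D2 = card (D2 - D1) + card (D1 \<inter> D2)"
            using card_Int_Diff[OF f(1), of D2] card_Int_Diff[OF f(2), of D1] by (simp_all add: Int_commute)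
          moreover have "card D = card (D1 - D2) + card (D2 - D1)" unfolding e'(2)
            using f by (intro card_Un_disjoint) auto
          ultimately show ?thesis using e'(1) by simp
        qed
        have "3 \<le> card D1" "3 \<le> card D2" using card_even_ge_3 c' eD by auto
        then have lt: "card D1 < card D" "card D2 < card D" using card by linarith+
        define D1' D2' where "D1' = D1 - {e}" and "D2' = D2 - {e}"
        have dec: "D1 = insert e D1'" "D2 = insert e D2'" "D = D1' \<union> D2'" "D1' \<inter> D2' = {}" "e \<notin> D1'" "e \<notin> D2'"
          "finite D1'" "finite D2'" using e' eD f by (auto simp: D1'_def D2'_def)
        have "D \<inter> F = sym_diff (D1' \<inter> F) (D2' \<inter> F)" using dec(3,4) by blast
        then have even: "even (card (D2' \<inter> F))"
          using less.prems(3) even_card_sym_diff[of "D1' \<inter> F" "D2' \<inter> F"] dec(7,8) odd unfolding D1'_def[symmetric] by auto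
        have "1 \<le> wgt d D1 (F - {e})"
        proof (rule less.hyps[OF lt(1) c'(1,2)])
          have "D1 \<inter> (F - {e}) = D1' \<inter> F" by (auto simp: D1'_def)
          then show "odd (card (D1 \<inter> (F - {e})))" using odd by (simp add: D1'_def)
        qed
        moreover have "wgt d D1 (F - {e}) = d e + wgt d D1' F"
          using dec(5,7) unfolding dec(1) wgt_def by (auto intro!: sum.cong)
        moreover have "1 \<le> wgt d D2 (insert e F)"
        proof (rule less.hyps[OF lt(2) c'(3,4)])
          have "D2 \<inter> insert e F = insert e (D2' \<inter> F)" using eD by (auto simp: D2'_def)
          then show "odd (card (D2 \<inter> insert e F))" using even dec(6,8) by simp
        qed
        moreover have "wgt d D2 (insert e F) = 1 - d e + wgt d D2' F"
          using dec(6,8) unfolding dec(2) wgt_def by (auto intro!: sum.cong)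
        moreover have "wgt d D F = wgt d D1' F + wgt d D2' F"
          unfolding dec(3) wgt_def by (rule sum.union_disjoint) (use dec in auto)
        ultimately show ?thesis by linarith
      qed
      have f: "finite D1" "finite D2" using finite_sub c by auto
      have "D \<inter> F = sym_diff ((D1 - {e}) \<inter> F) ((D2 - {e}) \<inter> F)" using e(3,4) by blast
      then have "odd (card ((D1 - {e}) \<inter> F)) \<or> odd (card ((D2 - {e}) \<inter> F))"
        using less.prems(3) even_card_sym_diff[of "(D1 - {e}) \<inter> F" "(D2 - {e}) \<inter> F"] f by auto
      then show ?thesis
      proof
        assume "odd (card ((D1 - {e}) \<inter> F))"
        then show ?thesis using main[OF e(3,4) c] by blast
      next
        assume o: "odd (card ((D2 - {e}) \<inter> F))"
        have "D2 \<inter> D1 = {e}" "D = sym_diff D2 D1" using e by auto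
        then show ?thesis using main[OF _ _ c(3,4,1,2) o] by blast
      qed
    qed
  qed
qed

text \<open>On the lift of the graph to signed vertices, \<open>D\<close> and \<open>F\<close> stand for a set of edges traversed
  and the ones among them at which the sign changes.\<close>

lemma antipodal_exists:
  assumes box: "\<And>e. e \<in> E \<Longrightarrow> 0 \<le> d e \<and> d e \<le> 1"
    and ge1: "\<And>D F. D \<subseteq> E \<Longrightarrow> bd D = {} \<Longrightarrow> odd (card (D \<inter> F)) \<Longrightarrow> 1 \<le> wgt d D F"
  shows "\<exists>m. antipodal m \<and> (\<forall>u v. {u, v} \<in> E \<longrightarrow> m (u, False) (v, False) \<le> d {u, v} \<and> m (u, False) (v, True) \<le> 1 - d {u, v})"
proof -
  define K where "K p q = {(D, F). D \<subseteq> E \<and> F \<subseteq> E \<and> bd D = sym_diff {fst p} {fst q} \<and> (odd (card (D \<inter> F)) \<longleftrightarrow> snd p \<noteq> snd q)}"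
    for p q :: "'v \<times> bool"
  \<comment> \<open>The cap 1 gives a value to pairs that no edge set joins, and it bounds all
    distances as required.\<close>
  define m where "m p q = Min (insert 1 ((\<lambda>(D, F). wgt d D F) ` K p q))" for p q
  have fK: "finite (K p q)" for p q
    by (rule finite_subset[of _ "Pow E \<times> Pow E"]) (use finE in \<open>auto simp: K_def\<close>)
  have le1: "m p q \<le> 1" for p q using fK by (simp add: m_def)
  have le2: "m p q \<le> wgt d D F" if "D \<subseteq> E" "bd D = sym_diff {fst p} {fst q}" "odd (card (D \<inter> F)) \<longleftrightarrow> snd p \<noteq> snd q" for p q D F
  proof -
    have "D \<inter> (F \<inter> E) = D \<inter> F" using that(1) by blast
    then have "(D, F \<inter> E) \<in> K p q" using that by (simp add: K_def)
    then have "wgt d D (F \<inter> E) \<in> (\<lambda>(D, F). wgt d D F) ` K p q" by (rule rev_image_eqI) simp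
    then have "m p q \<le> wgt d D (F \<inter> E)" unfolding m_def using fK by (intro Min_le) auto
    moreover have "wgt d D (F \<inter> E) = wgt d D F" unfolding wgt_def using that(1) by (intro sum.cong) auto
    ultimately show ?thesis by simp
  qed
  have in_m: "m p q = 1 \<or> (\<exists>D F. D \<subseteq> E \<and> bd D = sym_diff {fst p} {fst q} \<and> (odd (card (D \<inter> F)) \<longleftrightarrow> snd p \<noteq> snd q) \<and> m p q = wgt d D F)" for p q
  proof -
    have "m p q \<in> insert 1 ((\<lambda>(D, F). wgt d D F) ` K p q)"
      unfolding m_def by (rule Min_in) (use fK in auto)
    then show ?thesis unfolding K_def by auto
  qed
  have wnn: "0 \<le> wgt d D F" if "D \<subseteq> E" for D F
    unfolding wgt_def by (rule sum_nonneg) (use box that in auto)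
  have nn: "0 \<le> m p q" for p q using in_m[of p q] wnn by (metis zero_le_one)
  have wtri: "m p r \<le> wgt d D1 F1 + wgt d D2 F2"
    if 1: "D1 \<subseteq> E" "bd D1 = sym_diff {fst p} {fst q}" "odd (card (D1 \<inter> F1)) \<longleftrightarrow> snd p \<noteq> snd q"
      and 2: "D2 \<subseteq> E" "bd D2 = sym_diff {fst q} {fst r}" "odd (card (D2 \<inter> F2)) \<longleftrightarrow> snd q \<noteq> snd r" for p q r D1 F1 D2 F2
  \<comment> \<open>A common edge used with different signs already costs
    \<open>d e + (1 - d e) = 1\<close>, the cap. Otherwise common edges cancel in the symmetric
    difference together with their signs.\<close>
  proof (cases "D1 \<inter> D2 \<inter> F1 = D1 \<inter> D2 \<inter> F2")
    case False
    then obtain e where e: "e \<in> D1" "e \<in> D2" "(e \<in> F1) \<noteq> (e \<in> F2)" by blast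
    have "wgt d {e} F1 \<le> wgt d D1 F1" "wgt d {e} F2 \<le> wgt d D2 F2"
      by (rule wgt_mono; use e 1(1) 2(1) finite_sub box in auto)+
    moreover have "wgt d {e} F1 + wgt d {e} F2 = 1" using e(3) by (auto simp: wgt_def)
    ultimately show ?thesis using le1[of p r] by linarith
  next
    case True
    have f: "finite D1" "finite D2" using finite_sub 1(1) 2(1) by auto
    define D where "D = sym_diff D1 D2"
    define F where "F = (F1 \<inter> D1) \<union> (F2 \<inter> D2)"
    have DE: "D \<subseteq> E" using 1(1) 2(1) by (auto simp: D_def)
    have b: "bd D = sym_diff {fst p} {fst r}" unfolding D_def bd_sym_diff[OF f] 1(2) 2(2) by auto
    have "D \<inter> F = sym_diff (D1 \<inter> F1) (D2 \<inter> F2)" using True unfolding D_def F_def by blast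
    then have o: "odd (card (D \<inter> F)) \<longleftrightarrow> snd p \<noteq> snd r"
      using even_card_sym_diff[of "D1 \<inter> F1" "D2 \<inter> F2"] f 1(3) 2(3) by auto
    have "m p r \<le> wgt d D F" by (rule le2[OF DE b o])
    also have "wgt d D F = wgt d (D1 - D2) F + wgt d (D2 - D1) F"
      unfolding wgt_def D_def by (rule sum.union_disjoint) (use f in auto)
    also have "wgt d (D1 - D2) F = wgt d (D1 - D2) F1" unfolding wgt_def F_def by (intro sum.cong) auto
    also have "wgt d (D2 - D1) F = wgt d (D2 - D1) F2" unfolding wgt_def F_def by (intro sum.cong) auto
    also have "wgt d (D1 - D2) F1 + wgt d (D2 - D1) F2 \<le> wgt d D1 F1 + wgt d D2 F2"
      by (rule add_mono; rule wgt_mono) (use f box 1(1) 2(1) in auto)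
    finally show ?thesis .
  qed
  have an: "antipodal m"
    unfolding antipodal_def
  proof (intro conjI allI)
    fix p q r
    have "m p p \<le> wgt d {} {}" by (rule le2) auto
    then show "m p p = 0" using nn[of p p] by (simp add: wgt_def)
    show "0 \<le> m p q" by (rule nn)
    show "m p q \<le> 1" by (rule le1)
    have "K p q = K q p" unfolding K_def by (auto simp: Un_commute)
    then show "m p q = m q p" by (simp add: m_def)
    have "K (star p) (star q) = K p q" by (simp add: K_def star_def)
    then show "m (star p) (star q) = m p q" by (simp add: m_def)
    show "m p (star p) = 1"
      using in_m[of p "star p"]
    proof (elim disjE exE conjE)
      fix D F assume h: "D \<subseteq> E" "bd D = sym_diff {fst p} {fst (star p)}" "odd (card (D \<inter> F)) \<longleftrightarrow> snd p \<noteq> snd (star p)" "m p (star p) = wgt d D F"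
      have "1 \<le> wgt d D F" by (rule ge1) (use h in \<open>auto simp: star_def\<close>)
      then show ?thesis using h(4) le1[of p "star p"] by linarith
    qed
    show "m p r \<le> m p q + m q r"
      using in_m[of p q]
    proof (elim disjE exE conjE)
      assume "m p q = 1"
      then show ?thesis using le1[of p r] nn[of q r] by linarith
    next
      fix D1 F1 assume h1: "D1 \<subseteq> E" "bd D1 = sym_diff {fst p} {fst q}" "odd (card (D1 \<inter> F1)) \<longleftrightarrow> snd p \<noteq> snd q" "m p q = wgt d D1 F1"
      show ?thesis
        using in_m[of q r]
      proof (elim disjE exE conjE)
        assume "m q r = 1"
        then show ?thesis using le1[of p r] nn[of p q] by linarith
      next
        fix D2 F2 assume h2: "D2 \<subseteq> E" "bd D2 = sym_diff {fst q} {fst r}" "odd (card (D2 \<inter> F2)) \<longleftrightarrow> snd q \<noteq> snd r" "m q r = wgt d D2 F2"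
        show ?thesis using wtri[OF h1(1-3) h2(1-3)] h1(4) h2(4) by simp
      qed
    qed
  qed
  have edge: "m (u, False) (v, False) \<le> d {u, v} \<and> m (u, False) (v, True) \<le> 1 - d {u, v}" if uv: "{u, v} \<in> E" for u v
  proof
    have "u \<noteq> v" using gadjD[of u v] uv by (simp add: gadj_def)
    then have b: "bd {{u, v}} = sym_diff {u} {v}" by auto
    have "m (u, False) (v, False) \<le> wgt d {{u, v}} {}" by (rule le2) (use uv b in auto)
    then show "m (u, False) (v, False) \<le> d {u, v}" by (simp add: wgt_def)
    have "m (u, False) (v, True) \<le> wgt d {{u, v}} {{u, v}}" by (rule le2) (use uv b in auto)
    then show "m (u, False) (v, True) \<le> 1 - d {u, v}" by (simp add: wgt_def)
  qed
  show ?thesis using an edge by blast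
qed

lemma full_metric_exists:
  assumes box: "\<And>e. e \<in> E \<Longrightarrow> 0 \<le> d e \<and> d e \<le> 1"
    and ge1: "\<And>D F. D \<subseteq> E \<Longrightarrow> bd D = {} \<Longrightarrow> odd (card (D \<inter> F)) \<Longrightarrow> 1 \<le> wgt d D F"
  shows "\<exists>d'. full_metric V d' \<and> (\<forall>u v. {u, v} \<in> E \<longrightarrow> d' u v = d {u, v})"
proof -
  obtain m0 where m0: "antipodal m0"
    "\<And>u v. {u, v} \<in> E \<Longrightarrow> m0 (u, False) (v, False) \<le> d {u, v} \<and> m0 (u, False) (v, True) \<le> 1 - d {u, v}"
    using antipodal_exists[OF box ge1] by blast
  have "finite (V \<times> {False})" using finV by simp
  from antipodal_extend[OF m0(1) this] obtain m where m: "antipodal m" "\<And>x y. m x y \<le> m0 x y"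
    and one: "\<And>p q. p \<in> V \<times> {False} \<Longrightarrow> q \<in> V \<times> {False} \<Longrightarrow> m p q + m p (star q) = 1" by blast
  note A = antipodalD[OF m(1)]
  define d' where "d' u v = m (u, False) (v, False)" for u v
  have "full_metric V d'"
    unfolding full_metric_def
  proof (intro conjI ballI)
    fix u v w assume V: "u \<in> V" "v \<in> V" "w \<in> V"
    show "d' u u = 0" by (simp add: d'_def A(1))
    show "d' u v = d' v u" unfolding d'_def by (rule A(4))
    show "d' u w \<le> d' u v + d' v w" unfolding d'_def by (rule A(5))
    \<comment> \<open>The perimeter bound is the triangle inequality through the opposite copy of
      \<open>v\<close>.\<close>
    have "m (u, False) (w, False) \<le> m (u, False) (star (v, False)) + m (star (v, False)) (w, False)" by (rule A(5))
    then show "d' u v + d' v w + d' u w \<le> 2"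
      using one[of "(u, False)" "(v, False)"] one[of "(v, False)" "(w, False)"] A(8)[of "(v, False)" "(w, False)"] V
      unfolding d'_def by simp
  qed
  moreover have "d' u v = d {u, v}" if uv: "{u, v} \<in> E" for u v
  proof -
    have V: "u \<in> V" "v \<in> V" using gadjD[of u v] uv by (auto simp: gadj_def)
    have "m (u, False) (v, False) + m (u, False) (v, True) = 1"
      using one[of "(u, False)" "(v, False)"] V by (simp add: star_def)
    then show ?thesis
      using m0(2)[OF uv] m(2)[of "(u, False)" "(v, False)"] m(2)[of "(u, False)" "(v, True)"] unfolding d'_def by linarith
  qed
  ultimately show ?thesis by blast
qed

end

section \<open>From the theta body to cut mixtures\<close>

lemma sum_of_bool_mem: "finite D \<Longrightarrow> (\<Sum>e\<in>D. of_bool (e \<in> S)) = real (card (D \<inter> S))"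
  using sum.inter_restrict[of D "\<lambda>_. 1 :: real" S] by (simp add: of_bool_def)

context sgraph begin

text \<open>At a cut \<open>C\<close> the weight counts the elements of \<open>D\<close> in the
  symmetric difference of \<open>C\<close> and \<open>F\<close>. The count is odd, hence 1 or 3 when
  \<open>D\<close> has at most four elements, and an affine function with two values has a
  certificate by one square.\<close>

lemma theta_body_small:
  assumes x: "x \<in> theta_body E 1 (cycle_ideal (cographic V E))"
    and D: "D \<subseteq> E" "bd D = {}" "odd (card (D \<inter> F))" "card D \<le> 4"
  shows "1 \<le> wgt (\<lambda>e. (1 - lkp x e) / 2) D F"
proof -
  let ?c = "\<lambda>e. if e \<in> D then if e \<in> F then 1 / 2 else - 1 / 2 else 0 :: real"
  have fD: "finite D" by (rule finite_sub[OF D(1)])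
  have w: "wgt (\<lambda>e. (1 - lkp y e) / 2) D F - 1 = affine_eval E (card D / 2 - 1) ?c y" for y
  proof -
    have "(\<Sum>e\<in>E. ?c e * lkp y e) = (\<Sum>e\<in>D. ?c e * lkp y e)"
      by (rule sum.mono_neutral_right[OF finE D(1)]) auto
    moreover have "wgt (\<lambda>e. (1 - lkp y e) / 2) D F = (\<Sum>e\<in>D. 1 / 2 + ?c e * lkp y e)"
      unfolding wgt_def by (rule sum.cong) (auto simp: field_simps)
    ultimately show ?thesis by (simp add: affine_eval_def sum.distrib)
  qed
  have "0 \<le> affine_eval (ground (cographic V E)) (card D / 2 - 1) ?c x"
  proof (rule theta_body_two_level[where r = 2])
    show "finite (ground (cographic V E))" by (simp add: cycles_cographic finE)
    show "x \<in> theta_body (ground (cographic V E)) 1 (cycle_ideal (cographic V E))" using x by (simp add: cycles_cographic)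
    fix C assume "C \<in> cycles (cographic V E)"
    then obtain S where S: "C = cut E S" "S \<subseteq> V" by (auto simp: cycles_cographic)
    have "wgt (\<lambda>e. (1 - lkp (sign_vector E C) e) / 2) D F = (\<Sum>e\<in>D. of_bool (e \<in> sym_diff C F))"
      unfolding wgt_def S(1)
    proof (rule sum.cong[OF HOL.refl])
      fix e assume "e \<in> D"
      then have "e \<in> E" using D(1) by blast
      then show "(if e \<in> F then 1 - (1 - lkp (sign_vector E (cut E S)) e) / 2 else (1 - lkp (sign_vector E (cut E S)) e) / 2)
        = of_bool (e \<in> sym_diff (cut E S) F)"
        unfolding lookup_cut[OF \<open>e \<in> E\<close>] by (cases "e \<in> cut E S"; cases "e \<in> F") simp_all
    qed
    also have "\<dots> = real (card (D \<inter> sym_diff C F))" by (rule sum_of_bool_mem[OF fD])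
    finally have w1: "wgt (\<lambda>e. (1 - lkp (sign_vector E C) e) / 2) D F = real (card (D \<inter> sym_diff C F))" .
    have "D \<inter> sym_diff C F = sym_diff (D \<inter> C) (D \<inter> F)" by blast
    moreover have "even (card (D \<inter> C))" unfolding S(1) using parity_cut[OF D(1) S(2)] D(2) by simp
    ultimately have o: "odd (card (D \<inter> sym_diff C F))"
      using even_card_sym_diff[of "D \<inter> C" "D \<inter> F"] fD D(3) by simp
    have "card (D \<inter> sym_diff C F) \<le> 4" using card_mono[OF fD, of "D \<inter> sym_diff C F"] D(4) by auto
    then have "card (D \<inter> sym_diff C F) = 0 \<or> card (D \<inter> sym_diff C F) = 1 \<or> card (D \<inter> sym_diff C F) = 2
        \<or> card (D \<inter> sym_diff C F) = 3 \<or> card (D \<inter> sym_diff C F) = 4" by linarith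
    then have "card (D \<inter> sym_diff C F) = 1 \<or> card (D \<inter> sym_diff C F) = 3" using o by (elim disjE) simp_all
    then show "affine_eval (ground (cographic V E)) (card D / 2 - 1) ?c (sign_vector (ground (cographic V E)) C) \<in> {0, 2}"
      unfolding cycles_cographic w[symmetric] w1 by auto
  qed simp
  then show ?thesis unfolding cycles_cographic w[symmetric] by simp
qed

text \<open>One plus and one minus a coordinate both take only the values 0 and 2 on cuts.\<close>

lemma theta_body_box:
  assumes x: "x \<in> theta_body E 1 (cycle_ideal (cographic V E))" and e: "e \<in> E"
  shows "-1 \<le> lkp x e \<and> lkp x e \<le> 1"
proof -
  have *: "0 \<le> 1 + s * lkp x e" if s: "s = 1 \<or> s = -1" for s :: real
  proof -
    have a: "affine_eval E 1 (\<lambda>f. if f = e then s else 0) y = 1 + s * lkp y e" for y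
    proof -
      have "(\<Sum>f\<in>E. (if f = e then s else 0) * lkp y f) = (\<Sum>f\<in>E. if f = e then s * lkp y f else 0)"
        by (rule sum.cong) auto
      also have "\<dots> = s * lkp y e" using e finE by simp
      finally show ?thesis by (simp add: affine_eval_def)
    qed
    have "0 \<le> affine_eval (ground (cographic V E)) 1 (\<lambda>f. if f = e then s else 0) x"
    proof (rule theta_body_two_level[where r = 2])
      show "finite (ground (cographic V E))" by (simp add: cycles_cographic finE)
      show "x \<in> theta_body (ground (cographic V E)) 1 (cycle_ideal (cographic V E))" using x by (simp add: cycles_cographic)
      fix C assume "C \<in> cycles (cographic V E)"
      then obtain S where S: "C = cut E S" by (auto simp: cycles_cographic)
      show "affine_eval (ground (cographic V E)) 1 (\<lambda>f. if f = e then s else 0) (sign_vector (ground (cographic V E)) C) \<in> {0, 2}"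
        unfolding cycles_cographic a S lookup_cut[OF e] using s by auto
    qed simp
    then show ?thesis unfolding cycles_cographic a .
  qed
  show ?thesis using *[of 1] *[of "-1"] by simp
qed

lemma good_convex_hull:
  assumes good: "good V (gadj E)" and d': "full_metric V d'" "\<And>u v. {u, v} \<in> E \<Longrightarrow> d' u v = (1 - lkp x {u, v}) / 2"
    and x: "x \<in> real_space E"
  shows "x \<in> convex hull (sign_vector E ` cut E ` Pow V)"
proof -
  have "cut_repr V (gadj E) d'" using good d'(1) unfolding good_def by blast
  then obtain p0 where p0: "\<And>u v. u \<in> V \<Longrightarrow> v \<in> V \<Longrightarrow> gadj E u v \<Longrightarrow> measure_pmf.prob p0 (sep u v) = d' u v"
    unfolding cut_repr_def by blast
  \<comment> \<open>The random set ranges over the whole type; intersecting it with \<open>V\<close>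
    gives a finite mixture and separates the same edges.\<close>
  define p where "p = map_pmf (\<lambda>A. A \<inter> V) p0"
  have sp: "set_pmf p \<subseteq> Pow V" by (auto simp: p_def)
  have fP: "finite (Pow V)" using finV by simp
  have sum1: "(\<Sum>A\<in>Pow V. pmf p A) = 1" by (rule sum_pmf_eq_1[OF fP sp])
  have x_eq: "x = (\<Sum>A\<in>Pow V. pmf p A *\<^sub>R sign_vector E (cut E A))"
  proof (rule poly_mapping_eqI)
    fix e
    have lk: "lkp (\<Sum>A\<in>Pow V. pmf p A *\<^sub>R sign_vector E (cut E A)) e = (\<Sum>A\<in>Pow V. pmf p A * lkp (sign_vector E (cut E A)) e)"
      by (simp add: lookup_sum)
    show "lkp x e = lkp (\<Sum>A\<in>Pow V. pmf p A *\<^sub>R sign_vector E (cut E A)) e"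
    proof (cases "e \<in> E")
      case True
      then obtain u v where uv: "e = {u, v}" "u \<in> V" "v \<in> V" "gadj E u v" by (rule edgeE)
      have "(\<Sum>A\<in>Pow V. pmf p A * lkp (sign_vector E (cut E A)) e) = (\<Sum>A\<in>Pow V. pmf p A - 2 * (if A \<in> sep u v then pmf p A else 0))"
      proof (rule sum.cong[OF HOL.refl])
        fix A
        have "e \<in> cut E A \<longleftrightarrow> A \<in> sep u v" unfolding uv(1) cut_iff[OF uv(4)] by (simp add: sep_def)
        then show "pmf p A * lkp (sign_vector E (cut E A)) e = pmf p A - 2 * (if A \<in> sep u v then pmf p A else 0)"
          unfolding lookup_cut[OF True] by auto
      qed
      also have "\<dots> = 1 - 2 * (\<Sum>A\<in>Pow V. if A \<in> sep u v then pmf p A else 0)"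
        unfolding sum_subtractf sum1 sum_distrib_left ..
      also have "(\<Sum>A\<in>Pow V. if A \<in> sep u v then pmf p A else 0) = (\<Sum>A\<in>Pow V \<inter> sep u v. pmf p A)"
        using fP by (simp add: sum.inter_restrict)
      also have "\<dots> = measure_pmf.prob p (Pow V \<inter> sep u v)" using fP by (intro measure_measure_pmf_finite[symmetric]) auto
      also have "\<dots> = measure_pmf.prob p (sep u v)"
        by (rule measure_prob_cong_0) (use sp in \<open>auto simp: set_pmf_iff\<close>)
      also have "\<dots> = measure_pmf.prob p0 ((\<lambda>A. A \<inter> V) -` sep u v)" by (simp add: p_def)
      also have "(\<lambda>A. A \<inter> V) -` sep u v = sep u v" using uv(2,3) by (auto simp: sep_def)
      also have "measure_pmf.prob p0 (sep u v) = d' u v" by (rule p0[OF uv(2,3,4)])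
      also have "d' u v = (1 - lkp x e) / 2" using d'(2)[of u v] True uv(1) by simp
      finally have "(\<Sum>A\<in>Pow V. pmf p A * lkp (sign_vector E (cut E A)) e) = lkp x e" by (simp add: diff_divide_distrib)
      then show ?thesis unfolding lk by simp
    next
      case False
      then have "e \<notin> Poly_Mapping.keys x" using x by (auto simp: real_space_def)
      then have "lkp x e = 0" by (simp add: in_keys_iff)
      moreover have "lkp (sign_vector E (cut E A)) e = 0" for A using False by (simp add: lookup_sign_vector[OF finE])
      ultimately show ?thesis unfolding lk by simp
    qed
  qed
  show ?thesis
    unfolding x_eq
  proof (rule convex_sum[OF fP convex_convex_hull sum1])
    show "0 \<le> pmf p A" for A by simp
    show "sign_vector E (cut E A) \<in> convex hull (sign_vector E ` cut E ` Pow V)" if "A \<in> Pow V" for A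
      by (rule hull_inc) (use that in blast)
  qed
qed

lemma theta_exact_if:
  assumes no: "\<not> (\<exists>X. K5_model V (gadj E) X)"
    and chl: "\<not> (\<exists>D. cocircuit (cographic V E) D \<and> chordless (cographic V E) D \<and> 5 \<le> card D)"
  shows "theta_exact E 1 (cycle_ideal (cographic V E))"
proof -
  have "\<not> (\<exists>X. C5_model V (gadj E) X)" using C5_chordless_cocircuit chl by blast
  then have "cls V (gadj E)" using no by (simp add: cls_def no_K5_def no_C5_def)
  then have "cgraph V (gadj E)"
    by unfold_locales (use finV symp_gadj gadjD in auto)
  then have good: "good V (gadj E)" by (rule cgraph_good)
  have "theta_exact (ground (cographic V E)) 1 (cycle_ideal (cographic V E))"
  proof (rule theta_exactI)
    show "finite (ground (cographic V E))" by (simp add: cycles_cographic finE)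
    show "theta_body (ground (cographic V E)) 1 (cycle_ideal (cographic V E)) \<subseteq>
      convex hull (sign_vector (ground (cographic V E)) ` cycles (cographic V E))"
      unfolding cycles_cographic
    proof
      fix x assume x: "x \<in> theta_body E 1 (cycle_ideal (cographic V E))"
      let ?d = "\<lambda>e. (1 - lkp x e) / 2"
      have box: "0 \<le> ?d e \<and> ?d e \<le> 1" if "e \<in> E" for e using theta_body_box[OF x that] by simp
      have ge1: "1 \<le> wgt ?d D F" if "D \<subseteq> E" "bd D = {}" "odd (card (D \<inter> F))" for D F
        by (rule wgt_ge_1[OF chl box theta_body_small[OF x] that])
      obtain d' where d': "full_metric V d'" "\<And>u v. {u, v} \<in> E \<Longrightarrow> d' u v = ?d {u, v}"
        using full_metric_exists[OF box ge1] by blast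
      have "x \<in> real_space E" using x by (simp add: theta_body_def)
      then show "x \<in> convex hull (sign_vector E ` cut E ` Pow V)"
        by (intro good_convex_hull[OF good d'(1)]) (use d'(2) in simp_all)
    qed
  qed
  then show ?thesis by (simp add: cycles_cographic)
qed

end

theorem corollary4p11:
  fixes V :: "'v set" and E :: "'v set set"
  assumes "simple_graph V E"
  shows "theta_exact E 1 (cycle_ideal (cographic V E)) \<longleftrightarrow>
    \<not> (\<exists>N. minor (cographic V E) N \<and> bmat_iso N (cographic K5_vertices K5_edges)) \<and>
    \<not> (\<exists>D. cocircuit (cographic V E) D \<and> chordless (cographic V E) D \<and> card D \<ge> 5)"
proof -
  interpret sgraph V E by unfold_locales (rule assms)
  have "(\<exists>N. minor (cographic V E) N \<and> bmat_iso N (cographic K5_vertices K5_edges)) \<longleftrightarrow> (\<exists>X. K5_model V (gadj E) X)"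
    using K5_minor_model K5_model_minor by blast
  moreover have "(\<exists>X. C5_model V (gadj E) X) \<longleftrightarrow>
      (\<exists>D. cocircuit (cographic V E) D \<and> chordless (cographic V E) D \<and> 5 \<le> card D)"
    using C5_chordless_cocircuit chordless_cocircuit_C5 by blast
  ultimately show ?thesis
    using K5_not_exact C5_not_exact theta_exact_if by metis
qed

end
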